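(* Let $M>0$. (1) (Strong solution) Let $\epsilon_k>0$ with $\epsilon_k\to0$ as $k\to+\infty$, and let $Z_{1\epsilon_k}\in\Omega_M$ satisfy $Z_{1\epsilon_k}=T_{0\epsilon_k}(Z_{1\epsilon_k})$ for all $k\ge1$. Then there exist a subsequence $n_k$, $k\ge1$, and $Z_1^*\in H^{-m_1}(\Omega)$ such that $$\lim_{k\to+\infty}\|Z_{1\epsilon_{n_k}}-Z_1^*\|_{-m_1}=0\quad\text{and}\quad\lim_{k\to+\infty}\|Z_{1\epsilon_{n_k}}-T_0(Z_{1\epsilon_{n_k}})\|_{-m_1}=0 .$$ If $Z_1^*$ is locally integrable, then $\|Z_1^*\|_{L^\infty}\le M$. (2) ($L^\infty$ solution) If there exist $\epsilon_k>0$ and $Z_{1\epsilon_k}\in\Omega_M$ with $Z_{1\epsilon_k}=T_{0\epsilon_k}(Z_{1\epsilon_k})$, $k\ge1$, such that $\lim_{k\to+\infty}\epsilon_k=0$ and $\lim_{k\to+\infty}Z_{1\epsilon_k}$ exists almost everywhere on $\overline\Omega$, then there exists $Z_1^*\in L^\infty(\overline\Omega)$ with $\|Z_1^*\|_{L^\infty}\le M$ such that $Z_1^*=T_0(Z_1^* )$.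
   Context: **Setting.** $\Omega\subset\mathbb R^3$ is a bounded domain with $\partial\Omega\in C^{1,\alpha}$ ($0<\alpha\le1$) and $\overline\Omega$ convex; $m$ is a positive integer; $n=(n_1,n_2,n_3)$ is the unit exterior normal on $\partial\Omega$; $I_{\overline\Omega}$ is the characteristic function of $\overline\Omega$. A Dirichlet datum $A_1=u|_{\partial\Omega}\in C^2(\partial\Omega;\mathbb R^m)$ is given. For $u\in C^2(\overline\Omega;\mathbb R^m)$, $v_1,\dots,v_{10m}$ is a fixed permutation of the $10m$ scalar components of $u,u_x,u_y,u_z,u_{xx},u_{xy},u_{xz},u_{yy},u_{yz},u_{zz}$; the system is $v_j=f_j(v_{m+1},\dots,v_{10m},x,y,z)$, $1\le j\le m$, with $f=(f_1,\dots,f_m)^T$ continuous. **Matrices.** $C\in\mathbb R^{m\times 9m}$ is a constant matrix, $E$ the identity of order $m$, $\beta^T=(C,E)$, $e_k$ the $k$-th unit vector of $\mathbb R^{10m}$. The $m\times10m$ matrices $A_0,A_{01},A_{02},A_{03},A_{11},A_{12},A_{13},A_{22},A_{23},A_{33}$ correspond to $u,u_x,u_y,u_z,u_{xx},u_{xy},u_{xz},u_{yy},u_{yz},u_{zz}$: the row corresponding to the scalar component which is $v_j$ is the $j$-th row of $\beta^T$ if $j\le m$, and $e_{j-m}^T$ if $j>m$. $B(\xi)$ is the $9m\times10m$ matrix with block rows $i\xi_kA_0-A_{0k}$ ($k=1,2,3$) followed by $i\xi_ji\xi_kA_0-A_{jk}$ for $(j,k)=(1,1),(1,2),(1,3),(2,2),(2,3),(3,3)$;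 $B=(B_1,-B_2)$ with $B_1$ the first $9m$ columns. $C$ is chosen so that $\det B_1\not\equiv0$ and there is a polynomial $a_1$ in $i\xi_1,i\xi_2,i\xi_3$ with: $F^{-1}(a_1^{-1})\in\mathcal S'(\mathbb R^3)$ locally integrable; $a_1B_1^{-1}$ a polynomial matrix; $\varphi*F^{-1}(a_1^{-1})\in C(\mathbb R^3)$ for all Schwartz $\varphi$; and $(1+|\xi|^2)^{-a-3}B_1^{-1},\ (1+|\xi|^2)^{-a-3}B_1^{-1}B_2\in L^1(\mathbb R^3)$, where $a$ is the highest degree of the entries of $a_1B_1^{-1}$ and $a_1B_1^{-1}B_2$. $F(\phi)(\xi)=\int\phi(X)e^{-i\xi\cdot X}dX$. **$\psi,\psi_1$.** $\psi(Z_1)=f(Z_1,x,y,z)-CZ_1$. $\psi_1(Z_1)$ is the continuous function of $Z_1$ (and $x,y,z$) obtained from $-\Delta u=-(u_{xx}+u_{yy}+u_{zz})$ by replacing each scalar component that is $v_j$, $j\le m$, by $f_j(Z_1,x,y,z)$, and each that is $v_{m+k}$ by the $k$-th component of $Z_1$. **Boundary terms.** Let $h(X)=\frac1{4\pi|X|}$, and for $P_0\in\partial\Omega$ let $g_{02}(P_0)$ be the limit, as $M\to P_0$ along the normal line at $P_0$ from inside $\Omega$, of the derivative in direction $n_{P_0}$ of $M\mapsto\int_{\partial\Omega}[\nabla_Mh(M-P_1)\cdot n_{P_1}]A_1(P_1)dS_{P_1}$ (assumed to exist and belong to $C^1(\partial\Omega)$). $A_5=A_5(Z_1)$ is the unique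 solution on $\partial\Omega$ of $$\tfrac12A_5(P_0)=\int_{\partial\Omega}[\nabla h(P_0-P_1)\cdot n_{P_0}]A_5(P_1)dS_{P_1}+g_{02}(P_0)+\int_\Omega[\nabla h(P_0-Y)\cdot n_{P_0}]\psi_1(Z_1)(Y)dY .$$ Put $A_2=\partial_xA_1+(A_5-\partial_nA_1)n_1$, $A_3=\partial_yA_1+(A_5-\partial_nA_1)n_2$, $A_4=\partial_zA_1+(A_5-\partial_nA_1)n_3$ (with any $C^1$ extension of $A_1$ near $\partial\Omega$). Set $g_j=\int_{\partial\Omega}A_1n_je^{-i\xi\cdot X}dS$ ($j=1,2,3$), $g_{11},g_{21},g_{31}=\int_{\partial\Omega}A_kn_1e^{-i\xi\cdot X}dS$ with $k=2,3,4$ respectively, $g_{22},g_{32}=\int_{\partial\Omega}A_kn_2e^{-i\xi\cdot X}dS$ with $k=3,4$ respectively, $g_{33}=\int_{\partial\Omega}A_4n_3e^{-i\xi\cdot X}dS$, and $\beta_1=(-g_1^T,-g_2^T,-g_3^T,-g_{11}^T-i\xi_1g_1^T,-g_{21}^T-i\xi_1g_2^T,-g_{31}^T-i\xi_1g_3^T,-g_{22}^T-i\xi_2g_2^T,-g_{32}^T-i\xi_2g_3^T,-g_{33}^T-i\xi_3g_3^T)^T$. **Operators.** $T_0(Z_1)=F^{-1}(B_1^{-1}\beta_1)+F^{-1}(B_1^{-1}B_2)*(\psi(Z_1)I_{\overline\Omega})$ (a distribution, considered on $\Omega$); the same formula is used for $Z_1\in L^\infty(\overline\Omega)$, and then $Z_1=T_0(Z_1)$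 means equality in $H^{-m_1}(\Omega)$. For $\epsilon>0$ let $\delta_\epsilon(X)=(\pi\epsilon)^{-3/2}e^{-|X|^2/\epsilon}$ and $T_{0\epsilon}(Z_1)=F^{-1}(F(\delta_\epsilon)B_1^{-1}\beta_1)+F^{-1}(F(\delta_\epsilon)B_1^{-1}B_2)*(\psi(Z_1)I_{\overline\Omega})$, i.e. $T_{0\epsilon}(Z_1)=\delta_\epsilon*T_0(Z_1)$, regarded as an operator on $C(\overline\Omega;\mathbb R^{9m})$ by restriction to $\overline\Omega$. **Norms.** $\|Z_1\|_\infty=\max_{1\le i\le9m}\max_{X\in\overline\Omega}|Z_{1,i}(X)|$; $\Omega_M=\{Z_1\in C(\overline\Omega;\mathbb R^{9m}):\|Z_1\|_\infty<M\}$; $\|Z_1\|_{L^\infty}=\max_{1\le i\le 9m}\|Z_{1,i}\|_{L^\infty}$. With $m_1=6+2a$, for $Z_1$ with components in $H^{-m_1}(\Omega)$ (written $Z_1\in H^{-m_1}(\Omega)$): $\|Z_1\|_{-m_1}=\max_{1\le i\le9m}\sup_{0\ne\varphi\in C_0^\infty(\Omega)}|\langle Z_{1,i},\varphi\rangle|/\|\varphi\|_{m_1}$, where $\|\varphi\|_{m_1}=\big(\int_\Omega\sum_{|\alpha|\le m_1}|\partial^\alpha\varphi|^2dX\big)^{1/2}$. *)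

theory Defs
  imports "HOL-Analysis.Analysis" "HOL-Probability.Essential_Supremum" "HOL-Library.Poly_Mapping"
begin

type_synonym R3 = "real^3"

section \<open>Derivatives and function spaces\<close>

definition pd :: "'n::finite \<Rightarrow> (real^'n \<Rightarrow> 'b::real_normed_vector) \<Rightarrow> real^'n \<Rightarrow> 'b" where
  "pd i F X = frechet_derivative F (at X) (axis i 1)"

definition grad :: "(R3 \<Rightarrow> real) \<Rightarrow> R3 \<Rightarrow> R3" where
  "grad F X = (\<chi> i. pd i F X)"

primrec Ck :: "nat \<Rightarrow> (real^'n::finite) set \<Rightarrow> (real^'n \<Rightarrow> 'b::real_normed_vector) \<Rightarrow> bool" where
  "Ck 0 U F \<longleftrightarrow> continuous_on U F"
| "Ck (Suc k) U F \<longleftrightarrow> (\<forall>X\<in>U. F differentiable (at X)) \<and> (\<forall>i. Ck k U (pd i F))"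

definition smooth :: "(R3 \<Rightarrow> complex) \<Rightarrow> bool" where
  "smooth \<phi> \<longleftrightarrow> (\<forall>k. Ck k UNIV \<phi>)"

type_synonym mindex = "nat \<times> nat \<times> nat"

fun mabs :: "mindex \<Rightarrow> nat" where
  "mabs (p, q, r) = p + q + r"

fun pdm :: "mindex \<Rightarrow> (R3 \<Rightarrow> complex) \<Rightarrow> R3 \<Rightarrow> complex" where
  "pdm (p, q, r) \<phi> = (pd 1 ^^ p) ((pd 2 ^^ q) ((pd 3 ^^ r) \<phi>))"

definition test_fun :: "R3 set \<Rightarrow> (R3 \<Rightarrow> complex) \<Rightarrow> bool" where
  "test_fun U \<phi> \<longleftrightarrow> smooth \<phi> \<and> compact (closure {X. \<phi> X \<noteq> 0}) \<and> closure {X. \<phi> X \<noteq> 0} \<subseteq> U"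

definition loc_integrable :: "R3 set \<Rightarrow> (R3 \<Rightarrow> 'b::euclidean_space) \<Rightarrow> bool" where
  "loc_integrable U g \<longleftrightarrow> (\<forall>K. compact K \<and> K \<subseteq> U \<longrightarrow> set_integrable lborel K g)"

section \<open>The domain, its boundary and the surface measure\<close>

text \<open>The boundary is locally, in suitable orthonormal coordinates centred at \<open>P\<close>, the graph of a
  function \<open>\<gamma>\<close> with Hoelder continuous gradient \<open>G\<close>, and the set lies on one side of it.\<close>

definition C1_alpha_boundary :: "real \<Rightarrow> R3 set \<Rightarrow> bool" where
  "C1_alpha_boundary \<alpha> \<Omega> \<longleftrightarrow>
     (\<forall>P\<in>frontier \<Omega>. \<exists>r>0. \<exists>Q :: R3 \<Rightarrow> R3. \<exists>\<gamma> :: real^2 \<Rightarrow> real. \<exists>G :: real^2 \<Rightarrow> real^2. \<exists>L.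
        orthogonal_transformation Q \<and>
        (\<forall>s. (\<gamma> has_derivative (\<lambda>t. G s \<bullet> t)) (at s)) \<and>
        (\<forall>s t. norm (G s - G t) \<le> L * norm (s - t) powr \<alpha>) \<and>
        (\<forall>y\<in>ball 0 r. P + Q y \<in> \<Omega> \<longleftrightarrow> \<gamma> (vector [y$1, y$2]) < y$3))"

text \<open>Unit vector orthogonal to the tangent plane of the boundary at \<open>P\<close> and pointing outwards.\<close>

definition outer_normal :: "R3 set \<Rightarrow> R3 \<Rightarrow> R3" where
  "outer_normal \<Omega> P = (THE \<nu>. norm \<nu> = 1 \<and>
     ((\<lambda>X. ((X - P) \<bullet> \<nu>) / norm (X - P)) \<longlongrightarrow> 0) (at P within frontier \<Omega>) \<and>
     (\<forall>\<^sub>F t in at_right 0. P - t *\<^sub>R \<nu> \<in> \<Omega> \<and> P + t *\<^sub>R \<nu> \<notin> closure \<Omega>))"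

text \<open>Two-dimensional Hausdorff measure; with the factor \<open>\<pi>/4\<close> it is the usual area on \<open>C\<^sup>1\<close>
  surfaces. By Caratheodory's criterion the outer measure is a measure on the Borel sets.\<close>

definition hausdorff2_outer :: "R3 set \<Rightarrow> ennreal" where
  "hausdorff2_outer A = (SUP \<delta>\<in>{0<..}. INF U\<in>{U :: nat \<Rightarrow> R3 set.
      A \<subseteq> (\<Union>i. U i) \<and> (\<forall>i. bounded (U i) \<and> diameter (U i) \<le> \<delta>)}.
      suminf (\<lambda>i. ennreal (pi / 4 * (diameter (U i))\<^sup>2)))"

definition hausdorff2 :: "R3 measure" where
  "hausdorff2 = measure_of UNIV (sets borel) hausdorff2_outer"

definition surf :: "R3 set \<Rightarrow> R3 measure" where
  "surf \<Omega> = restrict_space hausdorff2 (frontier \<Omega>)"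

text \<open>Differentiability classes on the boundary are understood by extension: \<open>g \<in> C\<^sup>k(\<partial>\<Omega>)\<close> if
  \<open>g\<close> is on \<open>\<partial>\<Omega>\<close> the restriction of a \<open>C\<^sup>k\<close> function on a neighbourhood of \<open>\<partial>\<Omega>\<close>.\<close>

definition Ck_extension :: "nat \<Rightarrow> R3 set \<Rightarrow> (R3 \<Rightarrow> 'b::real_normed_vector) \<Rightarrow> (R3 \<Rightarrow> 'b) \<Rightarrow> bool" where
  "Ck_extension k \<Omega> g F \<longleftrightarrow>
     (\<exists>U. open U \<and> frontier \<Omega> \<subseteq> U \<and> Ck k U F) \<and> (\<forall>P\<in>frontier \<Omega>. F P = g P)"

definition Ck_boundary :: "nat \<Rightarrow> R3 set \<Rightarrow> (R3 \<Rightarrow> 'b::real_normed_vector) \<Rightarrow> bool" where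
  "Ck_boundary k \<Omega> g \<longleftrightarrow> (\<exists>F. Ck_extension k \<Omega> g F)"

section \<open>Fourier transform and distributions\<close>

definition fourier :: "(R3 \<Rightarrow> complex) \<Rightarrow> R3 \<Rightarrow> complex" where
  "fourier \<phi> \<xi> = (LINT X|lborel. \<phi> X * exp (- \<i> * of_real (\<xi> \<bullet> X)))"

definition inv_fourier :: "(R3 \<Rightarrow> complex) \<Rightarrow> R3 \<Rightarrow> complex" where
  "inv_fourier \<phi> X = of_real (1 / (2 * pi) ^ 3) * (LINT \<xi>|lborel. \<phi> \<xi> * exp (\<i> * of_real (\<xi> \<bullet> X)))"

text \<open>A (scalar) distribution is a functional on functions, evaluated only on test functions or,
  if tempered, on Schwartz functions.\<close>

type_synonym dist = "(R3 \<Rightarrow> complex) \<Rightarrow> complex"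

definition schwartz :: "(R3 \<Rightarrow> complex) \<Rightarrow> bool" where
  "schwartz \<phi> \<longleftrightarrow> smooth \<phi> \<and>
     (\<forall>N \<mu>. bounded (range (\<lambda>X. of_real ((1 + norm X) ^ N) * pdm \<mu> \<phi> X)))"

definition schwartz_norm :: "nat \<Rightarrow> (R3 \<Rightarrow> complex) \<Rightarrow> real" where
  "schwartz_norm N \<phi> = (SUP X. \<Sum>\<mu> | mabs \<mu> \<le> N. (1 + norm X) ^ N * cmod (pdm \<mu> \<phi> X))"

definition tempered :: "dist \<Rightarrow> bool" where
  "tempered T \<longleftrightarrow>
     (\<forall>\<phi> \<eta>. schwartz \<phi> \<and> schwartz \<eta> \<longrightarrow> T (\<lambda>X. \<phi> X + \<eta> X) = T \<phi> + T \<eta>) \<and>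
     (\<forall>c \<phi>. schwartz \<phi> \<longrightarrow> T (\<lambda>X. c * \<phi> X) = c * T \<phi>) \<and>
     (\<exists>K N. \<forall>\<phi>. schwartz \<phi> \<longrightarrow> cmod (T \<phi>) \<le> K * schwartz_norm N \<phi>)"

definition fun_dist :: "(R3 \<Rightarrow> complex) \<Rightarrow> dist" where
  "fun_dist g \<phi> = (LINT X|lborel. g X * \<phi> X)"

definition inv_fourier_dist :: "dist \<Rightarrow> dist" where
  "inv_fourier_dist T \<phi> = T (inv_fourier \<phi>)"

text \<open>\<open>T * w\<close> for a bounded function \<open>w\<close> of compact support.\<close>

definition conv_dist :: "dist \<Rightarrow> (R3 \<Rightarrow> complex) \<Rightarrow> dist" where
  "conv_dist T w \<phi> = T (\<lambda>X. LINT Y|lborel. w Y * \<phi> (X + Y))"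

text \<open>\<open>\<phi> * T\<close> for a Schwartz function \<open>\<phi>\<close> and a tempered distribution \<open>T\<close>.\<close>

definition conv_schwartz :: "(R3 \<Rightarrow> complex) \<Rightarrow> dist \<Rightarrow> R3 \<Rightarrow> complex" where
  "conv_schwartz \<phi> T X = T (\<lambda>Y. \<phi> (X - Y))"

section \<open>Norms\<close>

text \<open>Vector-valued distributions map a scalar test function to the vector of the pairings.\<close>

type_synonym 'k vdist = "(R3 \<Rightarrow> complex) \<Rightarrow> complex^'k"

definition vfun_dist :: "R3 set \<Rightarrow> (R3 \<Rightarrow> real^'k::finite) \<Rightarrow> 'k vdist" where
  "vfun_dist \<Omega> Z \<phi> = (\<chi> i. LINT X:\<Omega>|lborel. of_real (Z X $ i) * \<phi> X)"

definition sobolev_norm :: "nat \<Rightarrow> R3 set \<Rightarrow> (R3 \<Rightarrow> complex) \<Rightarrow> real" where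
  "sobolev_norm k \<Omega> \<phi> = sqrt (LINT X:\<Omega>|lborel. \<Sum>\<mu> | mabs \<mu> \<le> k. (cmod (pdm \<mu> \<phi> X))\<^sup>2)"

text \<open>The value is \<open>\<infinity>\<close> on distributions outside \<open>H\<^sup>-\<^sup>k(\<Omega>)\<close>.\<close>

definition neg_norm :: "nat \<Rightarrow> R3 set \<Rightarrow> 'k::finite vdist \<Rightarrow> ennreal" where
  "neg_norm k \<Omega> T = (MAX i. SUP \<phi>\<in>{\<phi>. test_fun \<Omega> \<phi> \<and> \<phi> \<noteq> (\<lambda>_. 0)}.
      ennreal (cmod (T \<phi> $ i) / sobolev_norm k \<Omega> \<phi>))"

definition in_neg_sobolev :: "nat \<Rightarrow> R3 set \<Rightarrow> 'k::finite vdist \<Rightarrow> bool" where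
  "in_neg_sobolev k \<Omega> T \<longleftrightarrow>
     (\<forall>\<phi> \<eta>. test_fun \<Omega> \<phi> \<and> test_fun \<Omega> \<eta> \<longrightarrow> T (\<lambda>X. \<phi> X + \<eta> X) = T \<phi> + T \<eta>) \<and>
     (\<forall>c \<phi>. test_fun \<Omega> \<phi> \<longrightarrow> T (\<lambda>X. c * \<phi> X) = c *s T \<phi>) \<and>
     neg_norm k \<Omega> T < \<infinity>"

definition max_norm :: "R3 set \<Rightarrow> (R3 \<Rightarrow> real^'k::finite) \<Rightarrow> real" where
  "max_norm \<Omega> Z = (MAX i. SUP X\<in>closure \<Omega>. \<bar>Z X $ i\<bar>)"

definition Omega_ball :: "R3 set \<Rightarrow> real \<Rightarrow> (R3 \<Rightarrow> real^'k::finite) set" where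
  "Omega_ball \<Omega> M = {Z. continuous_on (closure \<Omega>) Z \<and> max_norm \<Omega> Z < M}"

definition Linf_norm :: "R3 set \<Rightarrow> (R3 \<Rightarrow> real^'k::finite) \<Rightarrow> ereal" where
  "Linf_norm S Z = (MAX i. esssup (restrict_space lborel S) (\<lambda>X. ereal \<bar>Z X $ i\<bar>))"

definition Linf_fun :: "R3 set \<Rightarrow> (R3 \<Rightarrow> real^'k::finite) \<Rightarrow> bool" where
  "Linf_fun S Z \<longleftrightarrow> Z \<in> borel_measurable (restrict_space lborel S) \<and> Linf_norm S Z < \<infinity>"

section \<open>Polynomials in three variables\<close>

type_synonym poly3 = "mindex \<Rightarrow>\<^sub>0 complex"

fun monom3 :: "mindex \<Rightarrow> complex^3 \<Rightarrow> complex" where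
  "monom3 (p, q, r) z = z$1 ^ p * z$2 ^ q * z$3 ^ r"

definition eval3 :: "poly3 \<Rightarrow> complex^3 \<Rightarrow> complex" where
  "eval3 p z = (\<Sum>\<mu>\<in>Poly_Mapping.keys p. Poly_Mapping.lookup p \<mu> * monom3 \<mu> z)"

definition degree3 :: "poly3 \<Rightarrow> nat" where
  "degree3 p = Max (insert 0 (mabs ` Poly_Mapping.keys p))"

definition i_xi :: "R3 \<Rightarrow> complex^3" where
  "i_xi \<xi> = (\<chi> j. \<i> * of_real (\<xi> $ j))"

section \<open>Unknowns and matrices\<close>

datatype pder = Dx | Dy | Dz | Dxx | Dxy | Dxz | Dyy | Dyz | Dzz

instance pder :: finite
proof
  have "(UNIV :: pder set) = {Dx, Dy, Dz, Dxx, Dxy, Dxz, Dyy, Dyz, Dzz}"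
    using pder.exhaust by auto
  then show "finite (UNIV :: pder set)" by (metis finite.simps)
qed

text \<open>The type \<open>'m\<close> plays the role of \<open>{1..m}\<close> and \<open>'m idx\<close> that of \<open>{1..9m}\<close>; the columns of the
  \<open>m \<times> 10m\<close> matrices are indexed by \<open>'m idx + 'm\<close> (first \<open>9m\<close>, last \<open>m\<close>). As an index of a
  component of \<open>Z\<^sub>1\<close> an element of \<open>'m idx\<close> is only a label: which derivative that component stands
  for is determined by the enumeration below.

  A scalar component of \<open>u, u\<^sub>x, \<dots>, u\<^sub>z\<^sub>z\<close> is a pair \<open>(d, i)\<close>, with \<open>d = None\<close> for \<open>u\<close> itself.
  The enumeration \<open>v :: 'm + 'm idx \<Rightarrow> pder option \<times> 'm\<close> is a bijection, \<open>v (Inl j)\<close> being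
  \<open>v\<^sub>j\<close> for \<open>j \<le> m\<close> and \<open>v (Inr k)\<close> being \<open>v\<^sub>m\<^sub>+\<^sub>k\<close>.\<close>

type_synonym 'm idx = "pder \<times> 'm"
type_synonym 'm enum10 = "'m + 'm idx \<Rightarrow> pder option \<times> 'm"
type_synonym 'm Zfun = "R3 \<Rightarrow> real^('m idx)"
type_synonym 'm rhs = "real^('m idx) \<Rightarrow> R3 \<Rightarrow> real^'m"

definition betaT :: "real^('m::finite idx)^'m \<Rightarrow> real^('m idx + 'm)^'m" where
  "betaT C = (\<chi> j c. case c of Inl k \<Rightarrow> C $ j $ k | Inr l \<Rightarrow> if j = l then 1 else 0)"

definition A_mat :: "'m::finite enum10 \<Rightarrow> real^('m idx)^'m \<Rightarrow> pder option \<Rightarrow> real^('m idx + 'm)^'m" where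
  "A_mat v C d = (\<chi> i. case inv v (d, i) of Inl j \<Rightarrow> betaT C $ j | Inr k \<Rightarrow> axis (Inl k) 1)"

primrec symbol :: "pder \<Rightarrow> complex^3 \<Rightarrow> complex" where
  "symbol Dx z = z$1"
| "symbol Dy z = z$2"
| "symbol Dz z = z$3"
| "symbol Dxx z = z$1 * z$1"
| "symbol Dxy z = z$1 * z$2"
| "symbol Dxz z = z$1 * z$3"
| "symbol Dyy z = z$2 * z$2"
| "symbol Dyz z = z$2 * z$3"
| "symbol Dzz z = z$3 * z$3"

definition B_mat :: "'m::finite enum10 \<Rightarrow> real^('m idx)^'m \<Rightarrow> R3 \<Rightarrow> complex^('m idx + 'm)^('m idx)" where
  "B_mat v C \<xi> = (\<chi> r c. case r of (d, i) \<Rightarrow>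
      symbol d (i_xi \<xi>) * of_real (A_mat v C None $ i $ c) - of_real (A_mat v C (Some d) $ i $ c))"

definition B1 :: "'m::finite enum10 \<Rightarrow> real^('m idx)^'m \<Rightarrow> R3 \<Rightarrow> complex^('m idx)^('m idx)" where
  "B1 v C \<xi> = (\<chi> r k. B_mat v C \<xi> $ r $ Inl k)"

definition B2 :: "'m::finite enum10 \<Rightarrow> real^('m idx)^'m \<Rightarrow> R3 \<Rightarrow> complex^'m^('m idx)" where
  "B2 v C \<xi> = (\<chi> r l. - B_mat v C \<xi> $ r $ Inr l)"

definition B1inv :: "'m::finite enum10 \<Rightarrow> real^('m idx)^'m \<Rightarrow> R3 \<Rightarrow> complex^('m idx)^('m idx)" where
  "B1inv v C \<xi> = matrix_inv (B1 v C \<xi>)"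

definition B1invB2 :: "'m::finite enum10 \<Rightarrow> real^('m idx)^'m \<Rightarrow> R3 \<Rightarrow> complex^'m^('m idx)" where
  "B1invB2 v C \<xi> = B1inv v C \<xi> ** B2 v C \<xi>"

text \<open>\<open>Np\<close> and \<open>Lp\<close> are the polynomial matrices \<open>a\<^sub>1 B\<^sub>1\<^sup>-\<^sup>1\<close> and \<open>a\<^sub>1 B\<^sub>1\<^sup>-\<^sup>1 B\<^sub>2\<close>.\<close>

definition max_degree :: "poly3^('m::finite idx)^('m idx) \<Rightarrow> poly3^'m^('m idx) \<Rightarrow> nat" where
  "max_degree Np Lp =
     Max (range (\<lambda>(r, k). degree3 (Np $ r $ k)) \<union> range (\<lambda>(r, l). degree3 (Lp $ r $ l)))"

definition admissible ::
  "'m::finite enum10 \<Rightarrow> real^('m idx)^'m \<Rightarrow> poly3 \<Rightarrow> poly3^('m idx)^('m idx) \<Rightarrow> poly3^'m^('m idx) \<Rightarrow> bool" where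
  "admissible v C a1 Np Lp \<longleftrightarrow>
     (\<exists>\<xi>. det (B1 v C \<xi>) \<noteq> 0) \<and> a1 \<noteq> 0 \<and>
     (let inv_a1 = (\<lambda>\<xi>. 1 / eval3 a1 (i_xi \<xi>)); a = max_degree Np Lp in
       (\<forall>\<phi>. schwartz \<phi> \<longrightarrow> integrable lborel (\<lambda>\<xi>. inv_a1 \<xi> * \<phi> \<xi>)) \<and>
       tempered (inv_fourier_dist (fun_dist inv_a1)) \<and>
       (\<exists>K. loc_integrable UNIV K \<and>
            (\<forall>\<phi>. test_fun UNIV \<phi> \<longrightarrow> inv_fourier_dist (fun_dist inv_a1) \<phi> = fun_dist K \<phi>)) \<and>
       (\<forall>\<phi>. schwartz \<phi> \<longrightarrow>
            continuous_on UNIV (conv_schwartz \<phi> (inv_fourier_dist (fun_dist inv_a1)))) \<and>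
       (\<forall>\<xi> r k. det (B1 v C \<xi>) \<noteq> 0 \<longrightarrow>
            eval3 (Np $ r $ k) (i_xi \<xi>) = eval3 a1 (i_xi \<xi>) * B1inv v C \<xi> $ r $ k) \<and>
       (\<forall>\<xi> r l. det (B1 v C \<xi>) \<noteq> 0 \<longrightarrow>
            eval3 (Lp $ r $ l) (i_xi \<xi>) = eval3 a1 (i_xi \<xi>) * B1invB2 v C \<xi> $ r $ l) \<and>
       (\<forall>r k. integrable lborel (\<lambda>\<xi>. B1inv v C \<xi> $ r $ k / of_real ((1 + (norm \<xi>)\<^sup>2) ^ (a + 3)))) \<and>
       (\<forall>r l. integrable lborel (\<lambda>\<xi>. B1invB2 v C \<xi> $ r $ l / of_real ((1 + (norm \<xi>)\<^sup>2) ^ (a + 3)))))"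

section \<open>Nonlinear terms and boundary terms\<close>

definition psi :: "'m::finite rhs \<Rightarrow> real^('m idx)^'m \<Rightarrow> 'm Zfun \<Rightarrow> R3 \<Rightarrow> real^'m" where
  "psi f C Z Y = f (Z Y) Y - C *v Z Y"

definition comp_val :: "'m::finite enum10 \<Rightarrow> 'm rhs \<Rightarrow> 'm Zfun \<Rightarrow> R3 \<Rightarrow> pder option \<times> 'm \<Rightarrow> real" where
  "comp_val v f Z Y c = (case inv v c of Inl j \<Rightarrow> f (Z Y) Y $ j | Inr k \<Rightarrow> Z Y $ k)"

definition psi1 :: "'m::finite enum10 \<Rightarrow> 'm rhs \<Rightarrow> 'm Zfun \<Rightarrow> R3 \<Rightarrow> real^'m" where
  "psi1 v f Z Y = (\<chi> i. - (comp_val v f Z Y (Some Dxx, i) + comp_val v f Z Y (Some Dyy, i)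
                            + comp_val v f Z Y (Some Dzz, i)))"

definition newton :: "R3 \<Rightarrow> real" where
  "newton X = 1 / (4 * pi * norm X)"

definition double_layer :: "R3 set \<Rightarrow> (R3 \<Rightarrow> real^'m::finite) \<Rightarrow> R3 \<Rightarrow> real^'m" where
  "double_layer \<Omega> A1 M = (LINT P|surf \<Omega>. (grad newton (M - P) \<bullet> outer_normal \<Omega> P) *\<^sub>R A1 P)"

definition is_g02 :: "R3 set \<Rightarrow> (R3 \<Rightarrow> real^'m::finite) \<Rightarrow> (R3 \<Rightarrow> real^'m) \<Rightarrow> bool" where
  "is_g02 \<Omega> A1 g02 \<longleftrightarrow> (\<forall>P\<in>frontier \<Omega>.
     ((\<lambda>t. frechet_derivative (double_layer \<Omega> A1) (at (P - t *\<^sub>R outer_normal \<Omega> P)) (outer_normal \<Omega> P))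
        \<longlongrightarrow> g02 P) (at_right 0))"

definition solves_A5 ::
  "R3 set \<Rightarrow> 'm::finite enum10 \<Rightarrow> 'm rhs \<Rightarrow> (R3 \<Rightarrow> real^'m) \<Rightarrow> 'm Zfun \<Rightarrow> (R3 \<Rightarrow> real^'m) \<Rightarrow> bool" where
  "solves_A5 \<Omega> v f g02 Z A \<longleftrightarrow> continuous_on (frontier \<Omega>) A \<and>
     (\<forall>P\<in>frontier \<Omega>. (1/2) *\<^sub>R A P =
        (LINT P1|surf \<Omega>. (grad newton (P - P1) \<bullet> outer_normal \<Omega> P) *\<^sub>R A P1) + g02 P
        + (LINT Y:\<Omega>|lborel. (grad newton (P - Y) \<bullet> outer_normal \<Omega> P) *\<^sub>R psi1 v f Z Y))"

text \<open>\<open>A\<^sub>2, A\<^sub>3, A\<^sub>4\<close> are \<open>bgrad \<dots> 1, 2, 3\<close>; the argument \<open>F\<close> is a \<open>C\<^sup>1\<close> extension of \<open>A\<^sub>1\<close> and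
  \<open>A5\<close> is the function \<open>A\<^sub>5(Z\<^sub>1)\<close>.\<close>

definition bgrad :: "R3 set \<Rightarrow> (R3 \<Rightarrow> real^'m::finite) \<Rightarrow> (R3 \<Rightarrow> real^'m) \<Rightarrow> 3 \<Rightarrow> R3 \<Rightarrow> real^'m" where
  "bgrad \<Omega> F A5 j P = pd j F P
     + (outer_normal \<Omega> P $ j) *\<^sub>R (A5 P - frechet_derivative F (at P) (outer_normal \<Omega> P))"

definition bfourier :: "R3 set \<Rightarrow> (R3 \<Rightarrow> real^'m::finite) \<Rightarrow> 3 \<Rightarrow> R3 \<Rightarrow> complex^'m" where
  "bfourier \<Omega> A k \<xi> =
     (\<chi> i. LINT P|surf \<Omega>. of_real (A P $ i * outer_normal \<Omega> P $ k) * exp (- \<i> * of_real (\<xi> \<bullet> P)))"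

definition beta1 ::
  "R3 set \<Rightarrow> (R3 \<Rightarrow> real^'m::finite) \<Rightarrow> (R3 \<Rightarrow> real^'m) \<Rightarrow> (R3 \<Rightarrow> real^'m) \<Rightarrow> R3 \<Rightarrow> complex^('m idx)" where
  "beta1 \<Omega> A1 F A5 \<xi> =
     (let g = (\<lambda>j. bfourier \<Omega> A1 j \<xi>);
          gg = (\<lambda>j k. bfourier \<Omega> (bgrad \<Omega> F A5 j) k \<xi>);
          z = i_xi \<xi>
      in \<chi> r. case r of (d, i) \<Rightarrow> (case d of
           Dx \<Rightarrow> - g 1
         | Dy \<Rightarrow> - g 2
         | Dz \<Rightarrow> - g 3
         | Dxx \<Rightarrow> - gg 1 1 - z$1 *s g 1
         | Dxy \<Rightarrow> - gg 2 1 - z$1 *s g 2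
         | Dxz \<Rightarrow> - gg 3 1 - z$1 *s g 3
         | Dyy \<Rightarrow> - gg 2 2 - z$2 *s g 2
         | Dyz \<Rightarrow> - gg 3 2 - z$2 *s g 3
         | Dzz \<Rightarrow> - gg 3 3 - z$3 *s g 3) $ i)"

section \<open>The operators\<close>

definition psi_cut ::
  "R3 set \<Rightarrow> 'm::finite rhs \<Rightarrow> real^('m idx)^'m \<Rightarrow> 'm Zfun \<Rightarrow> 'm \<Rightarrow> R3 \<Rightarrow> complex" where
  "psi_cut \<Omega> f C Z l Y = indicator (closure \<Omega>) Y * of_real (psi f C Z Y $ l)"

definition T0 ::
  "R3 set \<Rightarrow> 'm::finite enum10 \<Rightarrow> real^('m idx)^'m \<Rightarrow> 'm rhs \<Rightarrow> (R3 \<Rightarrow> real^'m) \<Rightarrow> (R3 \<Rightarrow> real^'m) \<Rightarrow>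
   ('m Zfun \<Rightarrow> R3 \<Rightarrow> real^'m) \<Rightarrow> 'm Zfun \<Rightarrow> 'm idx vdist" where
  "T0 \<Omega> v C f A1 F A5 Z \<phi> = (\<chi> r.
      inv_fourier_dist (fun_dist (\<lambda>\<xi>. (B1inv v C \<xi> *v beta1 \<Omega> A1 F (A5 Z) \<xi>) $ r)) \<phi>
      + (\<Sum>l\<in>UNIV. conv_dist (inv_fourier_dist (fun_dist (\<lambda>\<xi>. B1invB2 v C \<xi> $ r $ l)))
                     (psi_cut \<Omega> f C Z l) \<phi>))"

definition gauss :: "real \<Rightarrow> R3 \<Rightarrow> complex" where
  "gauss \<epsilon> X = of_real ((pi * \<epsilon>) powr (-3/2) * exp (- (norm X)\<^sup>2 / \<epsilon>))"

text \<open>The factor \<open>F(\<delta>\<^sub>\<epsilon>)\<close> makes the symbols integrable, so that the inverse Fourier transforms and the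
  convolution are those of functions.\<close>

definition T0_eps ::
  "R3 set \<Rightarrow> 'm::finite enum10 \<Rightarrow> real^('m idx)^'m \<Rightarrow> 'm rhs \<Rightarrow> (R3 \<Rightarrow> real^'m) \<Rightarrow> (R3 \<Rightarrow> real^'m) \<Rightarrow>
   ('m Zfun \<Rightarrow> R3 \<Rightarrow> real^'m) \<Rightarrow> real \<Rightarrow> 'm Zfun \<Rightarrow> R3 \<Rightarrow> complex^('m idx)" where
  "T0_eps \<Omega> v C f A1 F A5 \<epsilon> Z X = (\<chi> r.
      inv_fourier (\<lambda>\<xi>. fourier (gauss \<epsilon>) \<xi> * (B1inv v C \<xi> *v beta1 \<Omega> A1 F (A5 Z) \<xi>) $ r) X
      + (\<Sum>l\<in>UNIV. LINT Y|lborel.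
           inv_fourier (\<lambda>\<xi>. fourier (gauss \<epsilon>) \<xi> * B1invB2 v C \<xi> $ r $ l) (X - Y) * psi_cut \<Omega> f C Z l Y))"

definition fixed_T0_eps ::
  "R3 set \<Rightarrow> 'm::finite enum10 \<Rightarrow> real^('m idx)^'m \<Rightarrow> 'm rhs \<Rightarrow> (R3 \<Rightarrow> real^'m) \<Rightarrow> (R3 \<Rightarrow> real^'m) \<Rightarrow>
   ('m Zfun \<Rightarrow> R3 \<Rightarrow> real^'m) \<Rightarrow> real \<Rightarrow> 'm Zfun \<Rightarrow> bool" where
  "fixed_T0_eps \<Omega> v C f A1 F A5 \<epsilon> Z \<longleftrightarrow>
     (\<forall>X\<in>closure \<Omega>. \<forall>r. of_real (Z X $ r) = T0_eps \<Omega> v C f A1 F A5 \<epsilon> Z X $ r)"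

end

theory Submission
  imports Defs "HOL-Complex_Analysis.Great_Picard" "HOL-Probability.Characteristic_Functions" "HOL-Probability.Sinc_Integral"
begin

text \<open>On the Fourier side a fixed point of \<open>T\<^sub>0\<^sub>\<epsilon>\<close> satisfies
  \<open>\<integral> F(Z) F\<^sup>-\<^sup>1\<phi> = \<integral> e\<^bsup>-\<epsilon>|\<xi>|\<^sup>2/4\<^esup> (p + q(Z)) F\<^sup>-\<^sup>1\<phi>\<close> for test functions \<open>\<phi>\<close> of \<open>\<Omega>\<close>, where \<open>p\<close> is fixed and
  \<open>q(Z)\<close> depends on \<open>Z\<close> only through \<open>A\<^sub>5(Z)\<close> and \<open>F(\<psi>(Z))\<close>. For \<open>Z\<close> bounded by \<open>M\<close> on a bounded set, the
  transforms \<open>F(Z)\<close> and \<open>F(\<psi>(Z))\<close> are uniformly bounded and Lipschitz, so they converge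
  pointwise along a subsequence. The boundary equation for \<open>A\<^sub>5\<close> has weakly singular kernels, because a
  convex \<open>C\<^sup>1\<^sup>,\<^sup>\<alpha>\<close> boundary has a surface measure of quadratic growth and
  \<open>|(P - Q) \<bullet> n| \<le> c |P - Q|\<^sup>1\<^sup>+\<^sup>\<alpha>\<close> on it; by the assumed uniqueness its solution operator is bounded and compact, and
  \<open>A\<^sub>5(Z)\<close> converges uniformly along a subsequence. Dominated convergence in the weighted
  space \<open>L\<^sup>1((1 + |\<xi>|\<^sup>2)\<^bsup>-a-3\<^esup>)\<close> then gives convergence in \<open>H\<^sup>-\<^sup>m\<^sup>1\<close>. If the \<open>Z\<close>
  converge almost everywhere, all limits are identified and the limit equation is \<open>Z = T\<^sub>0(Z)\<close>.\<close>

section \<open>Test functions and essential bounds\<close>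

text \<open>The nonlinearity shapes the two assertions. Bounded fixed points converge only weakly in
  general, and f does not commute with weak limits. So the transforms of Z and of \<psi>(Z) receive
  separate limits, and the strong solution compares Z with its image under the operator along the
  sequence. With convergence almost everywhere the second limit becomes the transform of \<psi> of
  the first, and a genuine equation results. The order m_1 = 6 + 2a is 2(a + 3): on test functions
  each factor |\<xi>|^2 of the weight (1 + |\<xi>|^2)^(a+3) is paid for with two derivatives. All
  convergence in the negative norm is thus reduced to convergence of symbols in a weighted L^1
  space, uniformly in the test function. The uniqueness hypothesis speaks of the full boundary
  equation; applied at Z = 0 it gives injectivity of 1/2 - K. Together with compactness of K this
  yields the a priori bound on A_5(Z) by Riesz's normalisation argument.\<close>

lemma pd_eq: "(F has_derivative F') (at X) \<Longrightarrow> pd i F X = F' (axis i 1)"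
  unfolding pd_def by (metis frechet_derivative_at)

lemma smooth_differentiable: "smooth \<phi> \<Longrightarrow> \<phi> differentiable (at X)"
  unfolding smooth_def by (metis Ck.simps(2) UNIV_I)

lemma smooth_pd: "smooth \<phi> \<Longrightarrow> smooth (pd i \<phi>)"
  unfolding smooth_def by (metis Ck.simps(2))

lemma smooth_continuous_on: "smooth \<phi> \<Longrightarrow> continuous_on S \<phi>"
  by (meson continuous_at_imp_continuous_on differentiable_imp_continuous_within smooth_differentiable)

section \<open>Smooth bump functions built from exp(-1/t)\<close>

definition flat :: "real poly \<Rightarrow> real \<Rightarrow> real" where
  "flat p t = (if t > 0 then poly p (1 / t) * exp (- (1 / t)) else 0)"

text \<open>With s = 1/t the derivative of p(s) exp(-s) in t is s^2 (p(s) - p'(s)) exp(-s). The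
  polynomial parameter keeps the family closed under differentiation.\<close>

definition flat_deriv :: "real poly \<Rightarrow> real poly" where
  "flat_deriv p = [:0, 0, 1:] * (p - pderiv p)"

lemma poly_exp_tendsto_0: "((\<lambda>s. poly p s * exp (- s)) \<longlongrightarrow> 0) at_top" for p :: "real poly"
proof (induction p)
  case 0
  then show ?case by simp
next
  case (pCons a p)
  have "((\<lambda>s. (s * poly p s) * exp (- s)) \<longlongrightarrow> 0) at_top"
  proof -
    have "((\<lambda>s. \<Sum>i\<le>degree p. coeff p i * (s ^ Suc i / exp s)) \<longlongrightarrow> (\<Sum>i\<le>degree p. coeff p i * 0)) at_top"
      by (intro tendsto_intros tendsto_power_div_exp_0)
    moreover have "(\<Sum>i\<le>degree p. coeff p i * (s ^ Suc i / exp s)) = (s * poly p s) * exp (- s)" for s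
      by (simp add: poly_altdef sum_distrib_left sum_distrib_right exp_minus field_simps sum_divide_distrib)
    ultimately show ?thesis by simp
  qed
  moreover have "((\<lambda>s. a * exp (- s)) \<longlongrightarrow> 0) at_top"
    using tendsto_mult_right_zero[OF filterlim_compose[OF exp_at_bot filterlim_uminus_at_bot_at_top]] by simp
  ultimately have "((\<lambda>s. a * exp (- s) + (s * poly p s) * exp (- s)) \<longlongrightarrow> 0 + 0) at_top"
    by (intro tendsto_add)
  then show ?case by (simp add: algebra_simps)
qed

text \<open>Away from 0 this is the chain rule. At 0 the left difference quotient vanishes, and the
  right one tends to 0 because exp(-1/h) beats every power of 1/h.\<close>

lemma flat_has_derivative: "(flat p has_real_derivative flat (flat_deriv p) t) (at t)"
proof -
  consider "t < 0" | "t = 0" | "t > 0" by linarith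
  then show ?thesis
  proof cases
    case 1
    have "((\<lambda>_. 0) has_real_derivative 0) (at t)" by simp
    then have "(flat p has_real_derivative 0) (at t)"
      by (rule DERIV_cong_ev[THEN iffD1, rotated -1])
         (use 1 in \<open>auto simp: flat_def eventually_nhds intro!: exI[of _ "{..<0}"]\<close>)
    then show ?thesis using 1 by (simp add: flat_def)
  next
    case 3
    have "((\<lambda>t. poly p (1 / t) * exp (- (1 / t))) has_real_derivative
        (poly (pderiv p) (1/t) * (- 1 / t^2)) * exp (- (1 / t)) + exp (- (1/t)) * (1 / t^2) * poly p (1 / t)) (at t)"
      by (rule derivative_eq_intros DERIV_chain2[where f="poly p"] poly_DERIV refl | use 3 in \<open>simp add: power2_eq_square field_simps\<close>)+
    then have "(flat p has_real_derivative
        (poly (pderiv p) (1/t) * (- 1 / t^2)) * exp (- (1 / t)) + exp (- (1/t)) * (1 / t^2) * poly p (1 / t)) (at t)"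
      by (rule DERIV_cong_ev[THEN iffD1, rotated -1])
         (use 3 in \<open>auto simp: flat_def eventually_nhds intro!: exI[of _ "{0<..}"]\<close>)
    then show ?thesis using 3 by (simp add: flat_def flat_deriv_def power2_eq_square field_simps)
  next
    case 2
    have "((\<lambda>h. flat p h / h) \<longlongrightarrow> 0) (at_right 0)"
    proof -
      \<comment> \<open>With s = 1/h the quotient \<open>flat p h / h\<close> is s p(s) exp(-s), and
        \<open>pCons 0 p\<close> is the polynomial s p(s).\<close>
      have "((\<lambda>s. poly (pCons 0 p) s * exp (- s)) \<longlongrightarrow> 0) at_top" by (rule poly_exp_tendsto_0)
      then have "((\<lambda>h. poly (pCons 0 p) (inverse h) * exp (- inverse h)) \<longlongrightarrow> 0) (at_right 0)"
        using filterlim_compose filterlim_inverse_at_top_right by blast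
      then show ?thesis
        by (rule Lim_transform_eventually)
           (auto simp: flat_def eventually_at_right_field divide_simps intro!: exI[of _ 1])
    qed
    moreover have "((\<lambda>h. flat p h / h) \<longlongrightarrow> 0) (at_left 0)"
      by (rule Lim_transform_eventually[OF tendsto_const])
         (auto simp: flat_def eventually_at_left_field intro!: exI[of _ "-1"])
    ultimately have "((\<lambda>h. flat p h / h) \<longlongrightarrow> 0) (at 0)"
      by (simp add: filterlim_split_at)
    then show ?thesis using 2 by (simp add: DERIV_def flat_def)
  qed
qed

text \<open>A class of expressions closed under partial derivatives, so that one induction on the
  order gives smoothness. Affine arguments in a single coordinate suffice to build bumps adapted to
  boxes.\<close>

inductive flat_expr :: "(R3 \<Rightarrow> complex) \<Rightarrow> bool" where
  const: "flat_expr (\<lambda>X. c)"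
| flat: "flat_expr (\<lambda>X. of_real (flat p (s * X $ j + b)))"
| add: "flat_expr f \<Longrightarrow> flat_expr g \<Longrightarrow> flat_expr (\<lambda>X. f X + g X)"
| mult: "flat_expr f \<Longrightarrow> flat_expr g \<Longrightarrow> flat_expr (\<lambda>X. f X * g X)"

lemma flat_expr_deriv:
  assumes "flat_expr f"
  shows "(\<forall>X. f differentiable (at X)) \<and> (\<forall>i. flat_expr (pd i f))"
  using assms
proof induction
  case (const c)
  have "pd i (\<lambda>X::R3. c) = (\<lambda>X. 0)" for i
    by (intro ext) (subst pd_eq[OF has_derivative_const], simp)
  then show ?case by (simp add: flat_expr.const)
next
  case (flat p s j b)
  have d: "((\<lambda>X::R3. complex_of_real (flat p (s * X $ j + b))) has_derivative
      (\<lambda>h. of_real (flat (flat_deriv p) (s * X $ j + b) * (s * h $ j)))) (at X)" for X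
  proof -
    have "((\<lambda>X::R3. s * X $ j + b) has_derivative (\<lambda>h. s * h $ j)) (at X)"
      by (auto intro!: derivative_eq_intros bounded_linear.has_derivative[OF bounded_linear_vec_nth])
    from has_derivative_compose[OF this flat_has_derivative[THEN has_field_derivative_imp_has_derivative]]
    have "((\<lambda>X::R3. flat p (s * X $ j + b)) has_derivative (\<lambda>h. flat (flat_deriv p) (s * X $ j + b) * (s * h $ j))) (at X)" .
    from has_derivative_of_real[OF this] show ?thesis .
  qed
  have "pd i (\<lambda>X. complex_of_real (flat p (s * X $ j + b))) =
     (\<lambda>X. (if i = j then of_real s else 0) * of_real (flat (flat_deriv p) (s * X $ j + b)))" for i
    by (intro ext) (auto simp: pd_eq[OF d] axis_def)
  then show ?case using d by (auto simp: differentiable_def intro!: flat_expr.intros)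
next
  case (add f g)
  have "pd i (\<lambda>X. f X + g X) = (\<lambda>X. pd i f X + pd i g X)" for i
    using add.IH by (auto simp: fun_eq_iff pd_def intro!: pd_eq[unfolded pd_def] has_derivative_add frechet_derivative_works[THEN iffD1])
  then show ?case using add.IH by (auto intro!: flat_expr.add)
next
  case (mult f g)
  have "pd i (\<lambda>X. f X * g X) = (\<lambda>X. f X * pd i g X + pd i f X * g X)" for i
    using mult.IH by (auto simp: fun_eq_iff pd_def intro!: pd_eq[unfolded pd_def] has_derivative_mult frechet_derivative_works[THEN iffD1])
  then show ?case using mult.IH mult.hyps by (auto intro!: flat_expr.intros)
qed

lemma flat_expr_Ck: "flat_expr f \<Longrightarrow> Ck k UNIV f"
proof (induction k arbitrary: f)
  case 0
  then show ?case using flat_expr_deriv[OF 0]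
    by (simp add: continuous_at_imp_continuous_on differentiable_imp_continuous_within)
next
  case (Suc k)
  then show ?case using flat_expr_deriv[OF Suc.prems] by auto
qed

lemma flat_expr_smooth: "flat_expr f \<Longrightarrow> smooth f"
  by (simp add: smooth_def flat_expr_Ck)

text \<open>As \<open>n\<close> grows, these functions tend pointwise to the indicator of the open box.\<close>

definition box_bump :: "nat \<Rightarrow> R3 \<Rightarrow> R3 \<Rightarrow> R3 \<Rightarrow> real" where
  "box_bump n a b X = (\<Prod>j\<in>UNIV. flat 1 (real (Suc n) * (X $ j - a $ j)) * flat 1 (real (Suc n) * (b $ j - X $ j)))"

lemma flat_1_bounds: "0 \<le> flat 1 t" "flat 1 t \<le> 1"
  by (auto simp: flat_def)

lemma box_bump_bounds: "0 \<le> box_bump n a b X" "box_bump n a b X \<le> 1"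
  unfolding box_bump_def
  by (intro prod_nonneg ballI mult_nonneg_nonneg flat_1_bounds)
     (intro prod_le_1 ballI conjI mult_nonneg_nonneg mult_le_one flat_1_bounds)

lemma box_bump_eq_0: "X \<notin> box a b \<Longrightarrow> box_bump n a b X = 0"
proof -
  assume "X \<notin> box a b"
  then obtain j where "X $ j - a $ j \<le> 0 \<or> b $ j - X $ j \<le> 0" by (auto simp: mem_box_cart not_less)
  then have "flat 1 (real (Suc n) * (X $ j - a $ j)) = 0 \<or> flat 1 (real (Suc n) * (b $ j - X $ j)) = 0"
    by (auto simp: flat_def mult_le_0_iff zero_less_mult_iff not_less)
  then show ?thesis unfolding box_bump_def by (intro prod_zero bexI[of _ j]) auto
qed

text \<open>Inside the box every factor has the form exp(-1/((n+1)c)) with c > 0 and tends to 1;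
  outside, some factor is 0 for every n.\<close>

lemma box_bump_tendsto: "(\<lambda>n. box_bump n a b X) \<longlonglongrightarrow> indicator (box a b) X"
proof (cases "X \<in> box a b")
  case False
  then show ?thesis by (simp add: box_bump_eq_0)
next
  case True
  have l: "(\<lambda>n. flat 1 (real (Suc n) * c)) \<longlonglongrightarrow> 1" if "c > 0" for c
  proof -
    have "(\<lambda>n. exp (- (1 / c * (1 / real (Suc n))))) \<longlonglongrightarrow> exp (- (1 / c * 0))"
      by (intro tendsto_intros LIMSEQ_Suc[OF lim_1_over_n])
    then show ?thesis using that by (simp add: flat_def mult.commute)
  qed
  have "(\<lambda>n. box_bump n a b X) \<longlonglongrightarrow> (\<Prod>j\<in>(UNIV :: 3 set). 1 * 1)"
    unfolding box_bump_def
    by (intro tendsto_prod tendsto_mult l) (use True in \<open>auto simp: mem_box_cart\<close>)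
  then show ?thesis using True by simp
qed

lemma test_fun_box_bump:
  assumes "cbox a b \<subseteq> U"
  shows "test_fun U (\<lambda>X. of_real (box_bump n a b X))"
proof -
  have "{X. complex_of_real (box_bump n a b X) \<noteq> 0} \<subseteq> cbox a b"
    using box_bump_eq_0 box_subset_cbox by force
  then have s: "closure {X. complex_of_real (box_bump n a b X) \<noteq> 0} \<subseteq> cbox a b"
    by (intro closure_minimal closed_cbox)
  have "flat_expr (\<lambda>X. of_real (flat 1 (real (Suc n) * (X $ j - a $ j))) * of_real (flat 1 (real (Suc n) * (b $ j - X $ j))))" for j
    using flat_expr.mult[OF flat_expr.flat[of 1 "real (Suc n)" j "- real (Suc n) * a $ j"]
        flat_expr.flat[of 1 "- real (Suc n)" j "real (Suc n) * b $ j"]]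
    by (simp add: algebra_simps)
  then have "flat_expr (\<lambda>X. of_real (box_bump n a b X))"
    unfolding box_bump_def of_real_prod of_real_mult
    by (induction rule: finite_induct[OF finite[of "UNIV :: 3 set"]])
       (simp_all add: flat_expr.intros)
  then show ?thesis using s assms
    using closure_subset by (auto simp: test_fun_def flat_expr_smooth compact_eq_bounded_closed intro: bounded_subset[OF bounded_cbox])
qed

lemma box_bump_measurable [measurable]: "box_bump n a b \<in> borel_measurable borel"
proof -
  have "continuous_on UNIV (\<lambda>X. complex_of_real (box_bump n a b X))"
    using test_fun_box_bump[of a b UNIV n] smooth_continuous_on[of "\<lambda>X. complex_of_real (box_bump n a b X)"]
    unfolding test_fun_def by blast
  then have "continuous_on UNIV (\<lambda>X. Re (complex_of_real (box_bump n a b X)))"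
    by (rule continuous_on_Re)
  then show ?thesis by (simp add: borel_measurable_continuous_onI)
qed

text \<open>The bumps are admissible test functions. Dominated convergence turns the test inequality
  into one for the indicator of the open box, and the faces of the box are null.\<close>

lemma box_integral_bound_of_tests:
  fixes u :: "R3 \<Rightarrow> real"
  assumes u: "loc_integrable \<Omega> u" and ab: "cbox a b \<subseteq> \<Omega>"
    and bd: "\<And>\<phi>. test_fun \<Omega> \<phi> \<Longrightarrow> cmod (LINT X:\<Omega>|lborel. of_real (u X) * \<phi> X) \<le> M * (LINT X:\<Omega>|lborel. cmod (\<phi> X))"
  shows "\<bar>LINT X:cbox a b|lborel. u X\<bar> \<le> M * measure lborel (cbox a b)"
proof -
  let ?b = "\<lambda>n. box_bump n a b"
  have ui: "set_integrable lborel (cbox a b) u"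
    using u ab by (auto simp: loc_integrable_def)
  have AEb: "AE X in lborel. indicator (cbox a b) X = (indicator (box a b) X :: real)"
  proof -
    have "cbox a b - box a b \<in> null_sets lborel"
      using negligible_frontier_interval[of a b] by (simp add: negligible_iff_null_sets null_sets_completion_iff)
    then show ?thesis
      by (rule AE_I') (use box_subset_cbox in \<open>auto split: split_indicator\<close>)
  qed
  have eq0: "?b n X = 0" if "X \<notin> cbox a b" for n X
    using that box_bump_eq_0 box_subset_cbox by blast
  have 1: "(\<lambda>n. LINT X|lborel. ?b n X * (indicator (cbox a b) X * u X)) \<longlonglongrightarrow> (LINT X|lborel. indicator (box a b) X * (indicator (cbox a b) X * u X))"
  proof (rule integral_dominated_convergence[where w="\<lambda>X. \<bar>indicator (cbox a b) X * u X\<bar>"])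
    show "(\<lambda>X. indicator (box a b) X * (indicator (cbox a b) X * u X)) \<in> borel_measurable lborel"
      using ui by (auto simp: set_integrable_def intro!: borel_measurable_times)
    show "(\<lambda>X. ?b n X * (indicator (cbox a b) X * u X)) \<in> borel_measurable lborel" for n
      using ui by (auto simp: set_integrable_def intro!: borel_measurable_times)
    show "integrable lborel (\<lambda>X. \<bar>indicator (cbox a b) X * u X\<bar>)"
      using ui by (auto simp: set_integrable_def)
    show "AE X in lborel. (\<lambda>n. ?b n X * (indicator (cbox a b) X * u X)) \<longlonglongrightarrow> indicator (box a b) X * (indicator (cbox a b) X * u X)"
      by (intro AE_I2 tendsto_intros box_bump_tendsto)
    show "AE X in lborel. norm (?b n X * (indicator (cbox a b) X * u X)) \<le> \<bar>indicator (cbox a b) X * u X\<bar>" for n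
      by (intro AE_I2) (simp add: abs_mult box_bump_bounds mult_left_le_one_le)
  qed
  have 2: "(\<lambda>n. LINT X|lborel. ?b n X * indicator (cbox a b) X) \<longlonglongrightarrow> (LINT X|lborel. indicator (box a b) X * indicator (cbox a b) X)"
  proof (rule integral_dominated_convergence[where w="indicator (cbox a b)"])
    show "AE X in lborel. (\<lambda>n. ?b n X * indicator (cbox a b) X) \<longlonglongrightarrow> indicator (box a b) X * indicator (cbox a b) X"
      by (intro AE_I2 tendsto_intros box_bump_tendsto)
    show "AE X in lborel. norm (?b n X * indicator (cbox a b) X) \<le> indicator (cbox a b) X" for n
      by (intro AE_I2) (simp add: abs_mult box_bump_bounds mult_left_le_one_le)
    show "integrable lborel (indicator (cbox a b) :: R3 \<Rightarrow> real)"
      by (intro integrable_real_indicator) (auto simp: emeasure_lborel_cbox_eq)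
  qed auto
  have i1: "(LINT X:\<Omega>|lborel. of_real (u X) * of_real (?b n X)) = complex_of_real (LINT X|lborel. ?b n X * (indicator (cbox a b) X * u X))" for n
    unfolding set_lebesgue_integral_def integral_complex_of_real[symmetric]
    by (rule Bochner_Integration.integral_cong) (use ab eq0 in \<open>auto split: split_indicator\<close>)
  have i2: "(LINT X:\<Omega>|lborel. cmod (of_real (?b n X))) = (LINT X|lborel. ?b n X * indicator (cbox a b) X)" for n
    unfolding set_lebesgue_integral_def
    by (rule Bochner_Integration.integral_cong) (use ab eq0 in \<open>auto simp: box_bump_bounds split: split_indicator\<close>)
  have "\<bar>LINT X|lborel. ?b n X * (indicator (cbox a b) X * u X)\<bar> \<le> M * (LINT X|lborel. ?b n X * indicator (cbox a b) X)" for n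
    using bd[OF test_fun_box_bump[OF ab, of n]] unfolding i1 i2 by simp
  then have "\<bar>LINT X|lborel. indicator (box a b) X * (indicator (cbox a b) X * u X)\<bar>
      \<le> M * (LINT X|lborel. indicator (box a b) X * indicator (cbox a b) X)"
    by (intro LIMSEQ_le[OF tendsto_rabs[OF 1] tendsto_mult[OF tendsto_const 2]]) auto
  also have "(LINT X|lborel. indicator (box a b) X * (indicator (cbox a b) X * u X)) = (LINT X:cbox a b|lborel. u X)"
    unfolding set_lebesgue_integral_def
  proof (rule integral_cong_AE)
    show "AE X in lborel. indicator (box a b) X * (indicator (cbox a b) X * u X) = indicator (cbox a b) X *\<^sub>R u X"
      using AEb by (rule eventually_mono) (auto split: split_indicator_asm)
  qed (use ui in \<open>auto simp: set_integrable_def intro!: borel_measurable_times\<close>)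
  also have "(LINT X|lborel. indicator (box a b) X * indicator (cbox a b) X) = (LINT X|lborel. indicator (cbox a b) X :: real)"
  proof (rule integral_cong_AE)
    show "AE X in lborel. indicator (box a b) X * indicator (cbox a b) X = (indicator (cbox a b) X :: real)"
      using AEb by (rule eventually_mono) (auto split: split_indicator_asm)
  qed auto
  finally show ?thesis by simp
qed

text \<open>By Lebesgue differentiation, averages of u over small cubes with lower corner x converge
  to u(x) for almost every x, and each average is bounded by M through the box inequality. Countably
  many closed boxes exhaust the open set.\<close>

lemma AE_bound_of_tests:
  fixes u :: "R3 \<Rightarrow> real"
  assumes op: "open \<Omega>" and u: "loc_integrable \<Omega> u"
    and bd: "\<And>\<phi>. test_fun \<Omega> \<phi> \<Longrightarrow> cmod (LINT X:\<Omega>|lborel. of_real (u X) * \<phi> X) \<le> M * (LINT X:\<Omega>|lborel. cmod (\<phi> X))"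
  shows "AE X in lborel. X \<in> \<Omega> \<longrightarrow> \<bar>u X\<bar> \<le> M"
proof -
  obtain D where D: "countable D" "D \<subseteq> Pow \<Omega>" "\<And>K. K \<in> D \<Longrightarrow> \<exists>a b. K = cbox a b" "\<Union>D = \<Omega>"
    by (rule open_countable_Union_open_cbox[OF op]) blast
  have "AE X in lborel. X \<in> K \<longrightarrow> \<bar>u X\<bar> \<le> M" if KD: "K \<in> D" for K
  proof -
    obtain c d where K: "K = cbox c d" using D(3)[OF KD] by blast
    have sub: "cbox c d \<subseteq> \<Omega>" using D(2) KD K by auto
    \<comment> \<open>The differentiation theorem asks for integrability on every box, while u is
      only locally integrable in \<Omega>. Cutting u off outside one compact box of \<Omega>
      provides it.\<close>
    let ?h = "\<lambda>X. indicator (cbox c d) X *\<^sub>R u X"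
    have hi: "integrable lborel ?h"
      using u sub by (auto simp: loc_integrable_def set_integrable_def)
    have "?h integrable_on cbox a b" for a b
      using integrable_on_lborel[OF hi] integrable_on_subcbox by blast
    then obtain N where N: "negligible N"
      and Nh: "\<And>x e. \<lbrakk>x \<notin> N; 0 < e\<rbrakk> \<Longrightarrow> \<exists>d>0. \<forall>h. 0 < h \<and> h < d \<longrightarrow>
                         norm (integral (cbox x (x + h *\<^sub>R One)) ?h /\<^sub>R h ^ DIM(R3) - ?h x) < e"
      using integrable_ccontinuous_explicit[of ?h] by blast
    have key: "\<bar>u x\<bar> \<le> M" if x: "x \<in> box c d" "x \<notin> N" for x
    proof (rule field_le_epsilon)
      fix e :: real assume "e > 0"
      then obtain d1 where d1: "d1 > 0" "\<And>h. 0 < h \<and> h < d1 \<Longrightarrow>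
          norm (integral (cbox x (x + h *\<^sub>R One)) ?h /\<^sub>R h ^ DIM(R3) - ?h x) < e"
        using Nh x by blast
      obtain d2 where d2: "d2 > 0" "ball x d2 \<subseteq> box c d"
        using x open_box by (meson openE)
      \<comment> \<open>Small enough for the differentiation estimate and for the cube with corner x
        and side h to stay in the box; the summand 1 keeps the denominator positive.\<close>
      define h where "h = min d1 (d2 / (2 * norm (One::R3) + 1)) / 2"
      have np: "2 * norm (One::R3) + 1 > 0" by (simp add: add_nonneg_pos)
      have h: "0 < h" "h < d1"
        using d1(1) d2(1) np unfolding h_def by (simp_all add: min_less_iff_disj)
      have "h \<le> d2 / (2 * norm (One::R3) + 1) / 2"
        unfolding h_def by (intro divide_right_mono min.cobounded2) simp
      then have "h * (2 * norm (One::R3) + 1) \<le> d2 / 2" using np by (simp add: field_simps)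
      moreover have "h * norm (One::R3) \<le> h * (2 * norm (One::R3) + 1)" using h by (intro mult_left_mono) auto
      moreover have "norm (h *\<^sub>R (One::R3)) = h * norm (One::R3)" using h(1) by simp
      ultimately have "norm (h *\<^sub>R (One::R3)) < d2" using d2(1) by linarith
      then have "x + h *\<^sub>R One \<in> ball x d2" by (simp add: dist_norm)
      then have xh: "x + h *\<^sub>R One \<in> box c d" using d2 by blast
      have cs: "cbox x (x + h *\<^sub>R One) \<subseteq> cbox c d"
        using x xh by (auto simp: subset_box mem_box less_imp_le)
      have iu: "set_integrable lborel (cbox x (x + h *\<^sub>R One)) u"
        using u cs sub by (auto simp: loc_integrable_def)
      have "integral (cbox x (x + h *\<^sub>R One)) ?h = integral (cbox x (x + h *\<^sub>R One)) u"
        using cs by (intro integral_cong) (auto split: split_indicator)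
      also have "\<dots> = (LINT X:cbox x (x + h *\<^sub>R One)|lborel. u X)"
        using set_borel_integral_eq_integral(2)[OF iu] by simp
      finally have "\<bar>integral (cbox x (x + h *\<^sub>R One)) ?h\<bar> \<le> M * measure lborel (cbox x (x + h *\<^sub>R One))"
        using box_integral_bound_of_tests[OF u _ bd, of x "x + h *\<^sub>R One"] cs sub by auto
      also have "measure lborel (cbox x (x + h *\<^sub>R One)) = h ^ DIM(R3)"
        using h by (subst measure_lborel_cbox_eq) (auto simp: inner_simps)
      finally have "\<bar>integral (cbox x (x + h *\<^sub>R One)) ?h /\<^sub>R h ^ DIM(R3)\<bar> \<le> M"
        using h by (simp add: abs_mult field_simps)
      moreover have "?h x = u x" using x box_subset_cbox by (auto split: split_indicator)
      moreover have "norm (integral (cbox x (x + h *\<^sub>R One)) ?h /\<^sub>R h ^ DIM(R3) - ?h x) < e"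
        using d1(2) h by blast
      ultimately show "\<bar>u x\<bar> \<le> M + e" unfolding real_norm_def by linarith
    qed
    have "negligible (N \<union> (cbox c d - box c d))" using N negligible_frontier_interval by auto
    then have "N \<union> (cbox c d - box c d) \<in> null_sets lebesgue" by (simp add: negligible_iff_null_sets)
    then have "AE X in lebesgue. X \<notin> N \<union> (cbox c d - box c d)" by (rule AE_not_in)
    then have "AE X in lebesgue. X \<in> K \<longrightarrow> \<bar>u X\<bar> \<le> M"
      by (rule eventually_mono) (use key K in auto)
    then show ?thesis by (simp add: AE_completion_iff)
  qed
  then have "AE X in lborel. \<forall>K\<in>D. X \<in> K \<longrightarrow> \<bar>u X\<bar> \<le> M"
    unfolding AE_ball_countable[OF D(1)] by blast
  then show ?thesis by (rule eventually_mono) (use D(4) in auto)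
qed

text \<open>Local integrability gives measurability on compact boxes, and countably many of them
  cover \<Omega>.\<close>

lemma loc_integrable_measurable:
  fixes g :: "R3 \<Rightarrow> 'b::euclidean_space"
  assumes op: "open \<Omega>" and g: "loc_integrable \<Omega> g"
  shows "g \<in> borel_measurable (restrict_space lborel \<Omega>)"
proof -
  obtain D where D: "countable D" "D \<subseteq> Pow \<Omega>" "\<And>K. K \<in> D \<Longrightarrow> \<exists>a b. K = cbox a b" "\<Union>D = \<Omega>"
    by (rule open_countable_Union_open_cbox[OF op]) blast
  show ?thesis
  proof (rule measurable_piecewise_restrict[of D])
    show "countable D" by fact
    show "space (restrict_space lborel \<Omega>) \<subseteq> \<Union>D" using D(4) by (simp add: space_restrict_space)
    fix K assume K: "K \<in> D"
    then obtain a b where ab: "K = cbox a b" using D(3)[OF K] by blast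
    have sub: "K \<subseteq> \<Omega>" using K D(2) by auto
    show "K \<inter> space (restrict_space lborel \<Omega>) \<in> sets (restrict_space lborel \<Omega>)"
      using op ab by (auto simp: sets_restrict_space space_restrict_space)
    have "set_integrable lborel K g" using g sub ab by (auto simp: loc_integrable_def)
    then have "g \<in> borel_measurable (restrict_space lborel K)"
      using ab by (subst borel_measurable_restrict_space_iff) (auto simp: set_integrable_def)
    moreover have "restrict_space (restrict_space lborel \<Omega>) K = restrict_space lborel K"
      by (subst restrict_restrict_space) (use op ab sub in \<open>auto simp: inf_absorb2\<close>)
    ultimately show "g \<in> borel_measurable (restrict_space (restrict_space lborel \<Omega>) K)" by simp
  qed
qed

lemma Linf_norm_le:
  fixes g :: "R3 \<Rightarrow> real^'k::finite"
  assumes "S \<in> sets lborel" "g \<in> borel_measurable (restrict_space lborel S)"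
    and "\<And>i. AE X in lborel. X \<in> S \<longrightarrow> \<bar>g X $ i\<bar> \<le> M"
  shows "Linf_norm S g \<le> ereal M"
proof -
  have [measurable]: "(\<lambda>X. g X $ i) \<in> borel_measurable (restrict_space lborel S)" for i
    by (rule measurable_compose[OF assms(2)]) (intro borel_measurable_continuous_onI continuous_intros)
  have "esssup (restrict_space lborel S) (\<lambda>X. ereal \<bar>g X $ i\<bar>) \<le> ereal M" for i
  proof (rule esssup_I)
    show "(\<lambda>X. ereal \<bar>g X $ i\<bar>) \<in> borel_measurable (restrict_space lborel S)"
      by measurable
    show "AE X in restrict_space lborel S. ereal \<bar>g X $ i\<bar> \<le> ereal M"
      using assms by (subst AE_restrict_space_iff) auto
  qed
  then show ?thesis unfolding Linf_norm_def by (subst Max_le_iff) auto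
qed

text \<open>The hypothesis speaks of pairings only, which is the form in which a bound by M survives
  a limit of distributions. It is applied to a function representing the weak limit of the fixed
  points.\<close>

lemma Linf_norm_le_of_tests:
  fixes g :: "R3 \<Rightarrow> real^'k::finite"
  assumes op: "open \<Omega>" and g: "loc_integrable \<Omega> g"
    and bd: "\<And>\<phi> i. test_fun \<Omega> \<phi> \<Longrightarrow> cmod (vfun_dist \<Omega> g \<phi> $ i) \<le> M * (LINT X:\<Omega>|lborel. cmod (\<phi> X))"
  shows "Linf_norm \<Omega> g \<le> ereal M"
proof (rule Linf_norm_le)
  show "\<Omega> \<in> sets lborel" using op by simp
  show "g \<in> borel_measurable (restrict_space lborel \<Omega>)" by (rule loc_integrable_measurable[OF op g])
  fix i
  have "loc_integrable \<Omega> (\<lambda>X. g X $ i)"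
    unfolding loc_integrable_def set_integrable_def
  proof (intro allI impI)
    fix K assume "compact K \<and> K \<subseteq> \<Omega>"
    then have "integrable lborel (\<lambda>X. indicat_real K X *\<^sub>R g X)"
      using g by (auto simp: loc_integrable_def set_integrable_def)
    from integrable_bounded_linear[OF bounded_linear_vec_nth this, of i]
    show "integrable lborel (\<lambda>X. indicat_real K X *\<^sub>R g X $ i)" by simp
  qed
  then show "AE X in lborel. X \<in> \<Omega> \<longrightarrow> \<bar>g X $ i\<bar> \<le> M"
    by (rule AE_bound_of_tests[OF op]) (use bd[of _ i] in \<open>simp add: vfun_dist_def\<close>)
qed

section \<open>The Fourier transform\<close>

lemma test_fun_mono: "test_fun U \<phi> \<Longrightarrow> U \<subseteq> V \<Longrightarrow> test_fun V \<phi>"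
  by (auto simp: test_fun_def)

lemma test_fun_eq_0: "test_fun U \<phi> \<Longrightarrow> X \<notin> U \<Longrightarrow> \<phi> X = 0"
  using closure_subset[of "{X. \<phi> X \<noteq> 0}"] unfolding test_fun_def by blast

lemma test_fun_continuous_on: "test_fun U \<phi> \<Longrightarrow> continuous_on S \<phi>"
  by (simp add: test_fun_def smooth_continuous_on)

lemma test_fun_measurable: "test_fun U \<phi> \<Longrightarrow> \<phi> \<in> borel_measurable borel"
  by (simp add: borel_measurable_continuous_onI test_fun_continuous_on)

lemma test_fun_support:
  assumes "test_fun U \<phi>" shows "\<exists>S. compact S \<and> S \<subseteq> U \<and> (\<forall>X. X \<notin> S \<longrightarrow> \<phi> X = 0)"
  using assms closure_subset[of "{X. \<phi> X \<noteq> 0}"]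
  unfolding test_fun_def by (intro exI[of _ "closure {X. \<phi> X \<noteq> 0}"]) blast

lemma test_fun_integrable:
  assumes "test_fun U \<phi>" shows "integrable lborel \<phi>"
proof -
  obtain S where S: "compact S" "\<forall>X. X \<notin> S \<longrightarrow> \<phi> X = 0" using test_fun_support[OF assms] by blast
  have "integrable lborel (\<lambda>X. indicator S X *\<^sub>R \<phi> X)"
    by (rule borel_integrable_compact[OF S(1) test_fun_continuous_on[OF assms]])
  moreover have "(\<lambda>X. indicator S X *\<^sub>R \<phi> X) = \<phi>" using S(2) by (auto split: split_indicator)
  ultimately show ?thesis by simp
qed

lemma test_fun_bounded:
  assumes "test_fun U \<phi>" shows "\<exists>K\<ge>0. \<forall>X. cmod (\<phi> X) \<le> K"
proof -
  obtain S where S: "compact S" "\<forall>X. X \<notin> S \<longrightarrow> \<phi> X = 0" using test_fun_support[OF assms] by blast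
  have "bounded (\<phi> ` S)"
    by (intro compact_imp_bounded compact_continuous_image S test_fun_continuous_on[OF assms])
  then obtain K where K: "\<forall>x\<in>S. cmod (\<phi> x) \<le> K" by (auto simp: bounded_iff)
  have "cmod (\<phi> X) \<le> max K 0" for X
    using K S(2) by (cases "X \<in> S") auto
  then show ?thesis by (intro exI[of _ "max K 0"]) simp
qed

lemma test_fun_pd: assumes "test_fun U \<phi>" shows "test_fun U (pd i \<phi>)"
proof -
  let ?S = "closure {X. \<phi> X \<noteq> 0}"
  have "pd i \<phi> X = 0" if "X \<notin> ?S" for X
  proof -
    have "((\<lambda>_. 0) has_derivative (\<lambda>_. 0)) (at X)" by simp
    moreover have "open (- ?S)" "X \<in> - ?S" using that by auto
    moreover have "\<And>Y. Y \<in> - ?S \<Longrightarrow> 0 = \<phi> Y" using closure_subset[of "{X. \<phi> X \<noteq> 0}"] by auto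
    ultimately have "(\<phi> has_derivative (\<lambda>_. 0)) (at X)"
      by (rule has_derivative_transform_within_open)
    from pd_eq[OF this] show ?thesis by simp
  qed
  then have sub: "closure {X. pd i \<phi> X \<noteq> 0} \<subseteq> ?S" by (intro closure_minimal) auto
  have S: "compact ?S" "?S \<subseteq> U" "smooth \<phi>" using assms unfolding test_fun_def by blast+
  have "compact (closure {X. pd i \<phi> X \<noteq> 0})"
    using bounded_subset[OF compact_imp_bounded[OF S(1)] sub] by (simp add: compact_eq_bounded_closed)
  moreover have "closure {X. pd i \<phi> X \<noteq> 0} \<subseteq> U" using sub S(2) by (rule subset_trans)
  ultimately show ?thesis unfolding test_fun_def by (intro conjI smooth_pd[OF S(3)])
qed

lemma test_fun_pd_pow: "test_fun U \<phi> \<Longrightarrow> test_fun U ((pd i ^^ n) \<phi>)"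
  by (induction n) (auto intro: test_fun_pd)

section \<open>Derivatives and decay of the inverse transform\<close>

lemma lborel_integral_shift:
  fixes f :: "'a::euclidean_space \<Rightarrow> 'b::{banach, second_countable_topology}"
  assumes [measurable]: "f \<in> borel_measurable borel"
  shows "(LINT x|lborel. f (c + x)) = (LINT x|lborel. f x)"
  using integral_distr[of "\<lambda>x. c + x" lborel borel f] by (simp add: lborel_distr_plus)

text \<open>The mean value inequality along a coordinate line. It supplies the majorant for
  difference quotients under the integral sign.\<close>

lemma test_fun_difference_bound:
  assumes "test_fun U \<phi>" and B: "\<And>X. cmod (pd j \<phi> X) \<le> B"
  shows "cmod (\<phi> (X + h *\<^sub>R axis j 1) - \<phi> X) \<le> B * \<bar>h\<bar>"
proof -
  have *: "cmod (\<phi> (X + h *\<^sub>R axis j 1) - \<phi> X) \<le> B * h" if "h > 0" for X h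
  proof -
    have d: "((\<lambda>t. \<phi> (X + t *\<^sub>R axis j 1)) has_derivative (\<lambda>s. s *\<^sub>R pd j \<phi> (X + t *\<^sub>R axis j 1))) (at t)" for t
    proof -
      have "(\<phi> has_derivative frechet_derivative \<phi> (at (X + t *\<^sub>R axis j 1))) (at (X + t *\<^sub>R axis j 1))"
        using assms by (simp add: test_fun_def smooth_differentiable frechet_derivative_works[symmetric])
      then have "((\<lambda>t. \<phi> (X + t *\<^sub>R axis j 1)) has_derivative
          (\<lambda>s. frechet_derivative \<phi> (at (X + t *\<^sub>R axis j 1)) (s *\<^sub>R axis j 1))) (at t)"
        by (rule has_derivative_compose[rotated]) (auto intro!: derivative_eq_intros)
      moreover have "linear (frechet_derivative \<phi> (at (X + t *\<^sub>R axis j 1)))"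
        using assms by (simp add: test_fun_def smooth_differentiable linear_frechet_derivative)
      ultimately show ?thesis by (simp add: pd_def linear_cmul)
    qed
    have "\<exists>x\<in>{0<..<h}. cmod (\<phi> (X + h *\<^sub>R axis j 1) - \<phi> (X + 0 *\<^sub>R axis j 1)) \<le> norm ((h - 0) *\<^sub>R pd j \<phi> (X + x *\<^sub>R axis j 1))"
      by (rule mvt_general[OF that _ d])
         (intro continuous_at_imp_continuous_on ballI has_derivative_continuous[OF d])
    then obtain x where "cmod (\<phi> (X + h *\<^sub>R axis j 1) - \<phi> X) \<le> h * cmod (pd j \<phi> (X + x *\<^sub>R axis j 1))"
      using that by auto
    also have "\<dots> \<le> h * B" using that B by (intro mult_left_mono) auto
    finally show ?thesis by (simp add: mult.commute)
  qed
  consider "h > 0" | "h = 0" | "h < 0" by linarith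
  then show ?thesis
  proof cases
    case 3
    then show ?thesis using *[of "- h" "X + h *\<^sub>R axis j 1"] by (simp add: norm_minus_commute)
  qed (use * in auto)
qed

lemma has_derivative_directional:
  assumes "(f has_derivative D) (at x)"
  shows "((\<lambda>t. (f (x + t *\<^sub>R v) - f x) /\<^sub>R t) \<longlongrightarrow> D v) (at 0)"
proof -
  have lin: "linear D" using assms has_derivative_linear by blast
  have "((\<lambda>t. f (x + t *\<^sub>R v)) has_derivative (\<lambda>s. D (s *\<^sub>R v))) (at 0)"
    by (rule has_derivative_compose[where f="\<lambda>t. x + t *\<^sub>R v" and g=f])
       (use assms in \<open>auto intro!: derivative_eq_intros\<close>)
  then have "(\<lambda>h. norm (f (x + (0 + h) *\<^sub>R v) - f (x + 0 *\<^sub>R v) - D (h *\<^sub>R v)) / norm h) \<midarrow>0\<rightarrow> 0"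
    unfolding has_derivative_at by blast
  then have "(\<lambda>h. norm ((f (x + h *\<^sub>R v) - f x) /\<^sub>R h - D v)) \<midarrow>0\<rightarrow> 0"
  proof (rule Lim_transform_eventually)
    show "\<forall>\<^sub>F h in at 0. norm (f (x + (0 + h) *\<^sub>R v) - f (x + 0 *\<^sub>R v) - D (h *\<^sub>R v)) / norm h
        = norm ((f (x + h *\<^sub>R v) - f x) /\<^sub>R h - D v)"
    proof (rule eventually_mono[OF eventually_neq_at_within[of 0]])
      fix h :: real assume "h \<noteq> 0"
      then have "(f (x + h *\<^sub>R v) - f x) /\<^sub>R h - D v = (f (x + h *\<^sub>R v) - f x - D (h *\<^sub>R v)) /\<^sub>R h"
        by (simp add: linear_cmul[OF lin] scaleR_diff_right)
      then show "norm (f (x + (0 + h) *\<^sub>R v) - f (x + 0 *\<^sub>R v) - D (h *\<^sub>R v)) / norm h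
        = norm ((f (x + h *\<^sub>R v) - f x) /\<^sub>R h - D v)" by (simp add: divide_inverse_commute)
    qed
  qed
  then show ?thesis by (rule LIM_zero_cancel[OF tendsto_norm_zero_cancel])
qed

text \<open>Instead of integrating by parts, \<phi> is translated: a shift by \<tau> along axis j
  multiplies the integral by exp(-i \<tau> \<xi>_j), and the difference quotient of this factor
  tends to -i \<xi>_j.\<close>

lemma inv_fourier_pd:
  assumes t: "test_fun UNIV \<phi>"
  shows "inv_fourier (pd j \<phi>) \<xi> = - \<i> * of_real (\<xi> $ j) * inv_fourier \<phi> \<xi>"
proof -
  let ?e = "\<lambda>X. exp (\<i> * of_real (X \<bullet> \<xi>))"
  let ?v = "axis j 1 :: R3"
  define \<tau> where "\<tau> n = 1 / real (Suc n)" for n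
  have \<tau>: "\<tau> n > 0" "\<tau> n \<le> 1" for n unfolding \<tau>_def by auto
  have \<tau>0: "\<tau> \<longlonglongrightarrow> 0" unfolding \<tau>_def by (rule LIMSEQ_Suc[OF lim_1_over_n])
  let ?I = "LINT X|lborel. \<phi> X * ?e X"
  have [measurable]: "\<phi> \<in> borel_measurable borel" "pd j \<phi> \<in> borel_measurable borel"
    using test_fun_measurable[OF t] test_fun_measurable[OF test_fun_pd[OF t]] by auto
  have ne: "norm (?e X) = 1" for X by simp
  have int: "integrable lborel (\<lambda>X. \<phi> (h *\<^sub>R ?v + X) * ?e X)" for h
  proof -
    have "integrable (distr lborel borel ((+) (h *\<^sub>R ?v))) \<phi>"
      unfolding lborel_distr_plus by (rule test_fun_integrable[OF t])
    then have "integrable lborel (\<lambda>X. \<phi> (h *\<^sub>R ?v + X))"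
      by (subst (asm) integrable_distr_eq) auto
    then show ?thesis by (rule Bochner_Integration.integrable_bound) (auto simp: norm_mult)
  qed
  have shift: "(LINT X|lborel. \<phi> (h *\<^sub>R ?v + X) * ?e X) = exp (- \<i> * of_real (h * \<xi> $ j)) * ?I" for h
  proof -
    have "(LINT X|lborel. \<phi> (h *\<^sub>R ?v + X) * ?e X) = (LINT X|lborel. \<phi> (h *\<^sub>R ?v + X) * (?e (h *\<^sub>R ?v + X) * exp (- \<i> * of_real (h * \<xi> $ j))))"
      by (intro Bochner_Integration.integral_cong refl)
         (simp add: mult_exp_exp inner_add_left inner_axis' algebra_simps)
    also have "\<dots> = (LINT X|lborel. \<phi> X * (?e X * exp (- \<i> * of_real (h * \<xi> $ j))))"
      by (rule lborel_integral_shift[of "\<lambda>X. \<phi> X * (?e X * exp (- \<i> * of_real (h * \<xi> $ j)))"]) simp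
    also have "\<dots> = exp (- \<i> * of_real (h * \<xi> $ j)) * ?I"
      unfolding mult.assoc[symmetric] by (simp add: mult.commute)
    finally show ?thesis .
  qed
  obtain S where S: "compact S" "\<forall>X. X \<notin> S \<longrightarrow> \<phi> X = 0" using test_fun_support[OF t] by blast
  obtain R where R: "\<forall>x\<in>S. norm x \<le> R" using compact_imp_bounded[OF S(1)] by (auto simp: bounded_iff)
  obtain B where B: "\<forall>X. cmod (pd j \<phi> X) \<le> B" "B \<ge> 0" using test_fun_bounded[OF test_fun_pd[OF t]] by blast
  have "(\<lambda>n. LINT X|lborel. ((\<phi> (X + \<tau> n *\<^sub>R ?v) - \<phi> X) /\<^sub>R \<tau> n) * ?e X) \<longlonglongrightarrow> (LINT X|lborel. pd j \<phi> X * ?e X)"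
  \<comment> \<open>The shifts have length at most 1, so all difference quotients vanish outside the
    ball of radius R + 1.\<close>
  proof (rule integral_dominated_convergence[where w="\<lambda>X. B * indicator (cball 0 (R + 1)) X"])
    show "integrable lborel (\<lambda>X::R3. B * indicator (cball 0 (R + 1)) X)"
      by (intro integrable_mult_right integrable_real_indicator emeasure_bounded_finite) auto
    show "AE X in lborel. (\<lambda>n. ((\<phi> (X + \<tau> n *\<^sub>R ?v) - \<phi> X) /\<^sub>R \<tau> n) * ?e X) \<longlonglongrightarrow> pd j \<phi> X * ?e X"
    proof (intro AE_I2 tendsto_mult tendsto_const)
      fix X
      have "(\<phi> has_derivative frechet_derivative \<phi> (at X)) (at X)"
        using t by (simp add: test_fun_def smooth_differentiable frechet_derivative_works[symmetric])
      then have "((\<lambda>t. (\<phi> (X + t *\<^sub>R ?v) - \<phi> X) /\<^sub>R t) \<longlongrightarrow> pd j \<phi> X) (at 0)"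
        unfolding pd_def by (rule has_derivative_directional)
      moreover have "filterlim \<tau> (at 0) sequentially"
        using \<tau>0 \<tau>(1) by (simp add: filterlim_at less_imp_neq[symmetric])
      ultimately show "(\<lambda>n. (\<phi> (X + \<tau> n *\<^sub>R ?v) - \<phi> X) /\<^sub>R \<tau> n) \<longlonglongrightarrow> pd j \<phi> X"
        by (rule filterlim_compose)
    qed
    fix n
    show "AE X in lborel. norm (((\<phi> (X + \<tau> n *\<^sub>R ?v) - \<phi> X) /\<^sub>R \<tau> n) * ?e X) \<le> B * indicator (cball 0 (R + 1)) X"
    proof (intro AE_I2)
      fix X
      show "norm (((\<phi> (X + \<tau> n *\<^sub>R ?v) - \<phi> X) /\<^sub>R \<tau> n) * ?e X) \<le> B * indicator (cball 0 (R + 1)) X"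
      proof (cases "X \<in> cball 0 (R + 1)")
        case True
        have "cmod (\<phi> (X + \<tau> n *\<^sub>R ?v) - \<phi> X) \<le> B * \<bar>\<tau> n\<bar>"
          by (rule test_fun_difference_bound[OF t B(1)[rule_format]])
        then have "cmod (\<phi> (X + \<tau> n *\<^sub>R ?v) - \<phi> X) / \<tau> n \<le> B" using \<tau>(1)[of n] by (simp add: pos_divide_le_eq)
        moreover have "norm (((\<phi> (X + \<tau> n *\<^sub>R ?v) - \<phi> X) /\<^sub>R \<tau> n) * ?e X) = cmod (\<phi> (X + \<tau> n *\<^sub>R ?v) - \<phi> X) / \<tau> n"
          using \<tau>(1)[of n] unfolding norm_mult norm_scaleR ne by (simp add: divide_inverse mult.commute)
        ultimately show ?thesis using True by simp
      next
        case False
        have "norm (\<tau> n *\<^sub>R ?v) \<le> 1" using \<tau>[of n] by simp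
        moreover have "norm X \<le> norm (X + \<tau> n *\<^sub>R ?v) + norm (\<tau> n *\<^sub>R ?v)"
          using norm_triangle_ineq4[of "X + \<tau> n *\<^sub>R ?v" "\<tau> n *\<^sub>R ?v"] by simp
        moreover have "norm X > R + 1" using False by simp
        ultimately have "\<not> norm X \<le> R" "\<not> norm (X + \<tau> n *\<^sub>R ?v) \<le> R" by linarith+
        then have "X \<notin> S" "X + \<tau> n *\<^sub>R ?v \<notin> S" using R by blast+
        then have "\<phi> X = 0" "\<phi> (X + \<tau> n *\<^sub>R ?v) = 0" using S(2) by blast+
        then show ?thesis using False by simp
      qed
    qed
  qed auto
  moreover have "(LINT X|lborel. ((\<phi> (X + \<tau> n *\<^sub>R ?v) - \<phi> X) /\<^sub>R \<tau> n) * ?e X)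
      = ((exp (- \<i> * of_real (\<tau> n * \<xi> $ j)) - 1) / of_real (\<tau> n)) * ?I" for n
  proof -
    have "(LINT X|lborel. ((\<phi> (X + \<tau> n *\<^sub>R ?v) - \<phi> X) /\<^sub>R \<tau> n) * ?e X)
       = (LINT X|lborel. (\<phi> (\<tau> n *\<^sub>R ?v + X) * ?e X - \<phi> (0 *\<^sub>R ?v + X) * ?e X) / of_real (\<tau> n))"
      by (intro Bochner_Integration.integral_cong refl) (use \<tau>(1)[of n] in \<open>simp add: scaleR_conv_of_real divide_inverse algebra_simps\<close>)
    also have "\<dots> = ((LINT X|lborel. \<phi> (\<tau> n *\<^sub>R ?v + X) * ?e X) - (LINT X|lborel. \<phi> (0 *\<^sub>R ?v + X) * ?e X)) / of_real (\<tau> n)"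
      by (subst Bochner_Integration.integral_diff[OF int int, symmetric]) simp
    finally show ?thesis unfolding shift by (simp add: divide_inverse algebra_simps)
  qed
  moreover have "(\<lambda>n. ((exp (- \<i> * of_real (\<tau> n * \<xi> $ j)) - 1) / of_real (\<tau> n)) * ?I) \<longlonglongrightarrow> (- \<i> * of_real (\<xi> $ j)) * ?I"
  proof (intro tendsto_mult tendsto_const)
    have "((\<lambda>z. exp (- \<i> * of_real (\<xi> $ j) * z)) has_field_derivative (- \<i> * of_real (\<xi> $ j))) (at 0)"
      by (auto intro!: derivative_eq_intros)
    then have "((\<lambda>z. (exp (- \<i> * of_real (\<xi> $ j) * z) - 1) / z) \<longlongrightarrow> - \<i> * of_real (\<xi> $ j)) (at 0)"
      by (simp add: DERIV_def)
    moreover have "filterlim (\<lambda>n. complex_of_real (\<tau> n)) (at 0) sequentially"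
      using tendsto_of_real[OF \<tau>0, where 'a=complex] \<tau>(1) by (simp add: filterlim_at less_imp_neq[symmetric])
    ultimately have "(\<lambda>n. (exp (- \<i> * of_real (\<xi> $ j) * of_real (\<tau> n)) - 1) / of_real (\<tau> n)) \<longlonglongrightarrow> - \<i> * of_real (\<xi> $ j)"
      by (rule filterlim_compose)
    then show "(\<lambda>n. (exp (- \<i> * of_real (\<tau> n * \<xi> $ j)) - 1) / of_real (\<tau> n)) \<longlonglongrightarrow> - \<i> * of_real (\<xi> $ j)"
      by (simp add: mult.assoc mult.commute mult.left_commute)
  qed
  ultimately have "(LINT X|lborel. pd j \<phi> X * ?e X) = (- \<i> * of_real (\<xi> $ j)) * ?I"
    by (simp add: LIMSEQ_unique)
  then show ?thesis unfolding inv_fourier_def by (simp only: mult.left_commute[of "complex_of_real (1 / (2 * pi) ^ 3)"])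
qed

lemma inv_fourier_pd_pow:
  assumes "test_fun UNIV \<phi>"
  shows "inv_fourier ((pd j ^^ n) \<phi>) \<xi> = (- \<i> * of_real (\<xi> $ j)) ^ n * inv_fourier \<phi> \<xi>"
  using assms by (induction n) (simp_all add: inv_fourier_pd test_fun_pd_pow)

lemma cmod_inv_fourier_le:
  "cmod (inv_fourier \<phi> \<xi>) \<le> (LINT X|lborel. cmod (\<phi> X))"
proof -
  have "cmod (LINT X|lborel. \<phi> X * exp (\<i> * of_real (X \<bullet> \<xi>))) \<le> (LINT X|lborel. cmod (\<phi> X * exp (\<i> * of_real (X \<bullet> \<xi>))))"
    by (rule integral_norm_bound)
  also have "\<dots> = (LINT X|lborel. cmod (\<phi> X))" by (simp add: norm_mult)
  finally have "cmod (LINT X|lborel. \<phi> X * exp (\<i> * of_real (X \<bullet> \<xi>))) \<le> (LINT X|lborel. cmod (\<phi> X))" .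
  moreover have "1 / (2 * pi) ^ 3 \<le> 1"
    using one_le_power[of "2 * pi" 3] pi_ge_two by (simp add: divide_le_eq)
  ultimately have "1 / (2 * pi) ^ 3 * cmod (LINT X|lborel. \<phi> X * exp (\<i> * of_real (X \<bullet> \<xi>))) \<le> 1 * (LINT X|lborel. cmod (\<phi> X))"
    by (intro mult_mono) auto
  then show ?thesis unfolding inv_fourier_def norm_mult norm_of_real by simp
qed

lemma cmod_fourier_le: "cmod (fourier \<phi> \<xi>) \<le> (LINT X|lborel. cmod (\<phi> X))"
proof -
  have "cmod (fourier \<phi> \<xi>) \<le> (LINT X|lborel. cmod (\<phi> X * exp (- \<i> * of_real (\<xi> \<bullet> X))))"
    unfolding fourier_def by (rule integral_norm_bound)
  also have "\<dots> = (LINT X|lborel. cmod (\<phi> X))" by (simp add: norm_mult)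
  finally show ?thesis .
qed

lemma finite_mindex: "finite {\<mu>. mabs \<mu> \<le> N}"
proof (rule finite_subset)
  show "{\<mu>. mabs \<mu> \<le> N} \<subseteq> {..N} \<times> {..N} \<times> {..N}" by auto
qed auto

text \<open>Cauchy-Schwarz from nonnegativity of the integral of (g - c)^2 at c = I/m, where m is
  the measure of S plus 1. The extra 1 avoids a division by zero on null sets.\<close>

lemma set_integral_L1_le_L2:
  fixes g :: "'a::euclidean_space \<Rightarrow> real"
  assumes S: "S \<in> sets lborel" "emeasure lborel S < \<infinity>" and g: "set_integrable lborel S g" "set_integrable lborel S (\<lambda>X. (g X)\<^sup>2)"
  shows "(LINT X:S|lborel. g X) \<le> sqrt (measure lborel S + 1) * sqrt (LINT X:S|lborel. (g X)\<^sup>2)"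
proof -
  let ?I = "LINT X:S|lborel. g X" and ?J = "LINT X:S|lborel. (g X)\<^sup>2"
  define m where "m = measure lborel S + 1"
  have m: "m > 0" unfolding m_def by (simp add: add_nonneg_pos)
  define c where "c = ?I / m"
  have si: "set_integrable lborel S (\<lambda>X. c\<^sup>2)"
    using S by (auto simp: set_integrable_def)
  have "0 \<le> (LINT X:S|lborel. (g X - c)\<^sup>2)"
    unfolding set_lebesgue_integral_def by (intro integral_nonneg_AE AE_I2) simp
  also have "(LINT X:S|lborel. (g X - c)\<^sup>2) = (LINT X:S|lborel. (g X)\<^sup>2 + c\<^sup>2 - 2 * c * g X)"
    by (intro set_lebesgue_integral_cong) (use S in \<open>auto simp: power2_eq_square algebra_simps\<close>)
  also have "\<dots> = ?J + c\<^sup>2 * measure lborel S - 2 * c * ?I"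
    using S g si by (subst set_integral_diff set_integral_add, (auto simp: set_integral_add)[2])+ (auto simp: set_lebesgue_integral_def)
  also have "\<dots> \<le> ?J + c\<^sup>2 * m - 2 * c * ?I" unfolding m_def by (simp add: algebra_simps)
  also have "\<dots> = ?J - ?I\<^sup>2 / m" unfolding c_def using m by (simp add: field_simps power2_eq_square)
  finally have "?I\<^sup>2 \<le> m * ?J" using m by (simp add: field_simps)
  then have "\<bar>?I\<bar> \<le> sqrt (m * ?J)" using real_le_rsqrt by (metis power2_abs)
  then show ?thesis unfolding m_def by (simp add: real_sqrt_mult)
qed

text \<open>The derivatives are supported in \<Omega>, which has finite measure, so their L^1 norms
  are controlled by the L^2 norms collected in \<open>sobolev_norm\<close>.\<close>

lemma sobolev_dominates:
  assumes \<Omega>: "open \<Omega>" "bounded \<Omega>" and t: "test_fun \<Omega> \<phi>"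
    and \<mu>: "mabs \<mu> \<le> N" and ts: "\<And>\<mu>. test_fun \<Omega> (pdm \<mu> \<phi>)"
  shows "(LINT X|lborel. cmod (pdm \<mu> \<phi> X)) \<le> sqrt (measure lborel \<Omega> + 1) * sobolev_norm N \<Omega> \<phi>"
proof -
  have S: "\<Omega> \<in> sets lborel" "emeasure lborel \<Omega> < \<infinity>"
    using \<Omega> emeasure_bounded_finite by auto
  have i1: "integrable lborel (\<lambda>X. cmod (pdm \<mu> \<phi> X))" for \<mu>
    using test_fun_integrable[OF ts] by simp
  have i2: "integrable lborel (\<lambda>X. (cmod (pdm \<mu> \<phi> X))\<^sup>2)" for \<mu>
  proof -
    obtain K where K: "\<forall>X. cmod (pdm \<mu> \<phi> X) \<le> K" "K \<ge> 0" using test_fun_bounded[OF ts] by blast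
    have [measurable]: "pdm \<mu> \<phi> \<in> borel_measurable borel" by (rule test_fun_measurable[OF ts])
    show ?thesis
    proof (rule Bochner_Integration.integrable_bound[OF integrable_mult_right[OF i1[of \<mu>], of K]])
      show "AE X in lborel. norm ((cmod (pdm \<mu> \<phi> X))\<^sup>2) \<le> norm (K * cmod (pdm \<mu> \<phi> X))"
        using K by (intro AE_I2) (auto simp: power2_eq_square abs_mult intro!: mult_right_mono)
    qed simp
  qed
  have s1: "set_integrable lborel \<Omega> (\<lambda>X. cmod (pdm \<mu> \<phi> X))" and s2: "set_integrable lborel \<Omega> (\<lambda>X. (cmod (pdm \<mu> \<phi> X))\<^sup>2)" for \<mu>
    using integrable_mult_indicator[OF S(1) i1] integrable_mult_indicator[OF S(1) i2] by (auto simp: set_integrable_def)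
  have "(LINT X|lborel. cmod (pdm \<mu> \<phi> X)) = (LINT X:\<Omega>|lborel. cmod (pdm \<mu> \<phi> X))"
    unfolding set_lebesgue_integral_def
    by (intro Bochner_Integration.integral_cong refl) (use test_fun_eq_0[OF ts] in \<open>auto split: split_indicator\<close>)
  also have "\<dots> \<le> sqrt (measure lborel \<Omega> + 1) * sqrt (LINT X:\<Omega>|lborel. (cmod (pdm \<mu> \<phi> X))\<^sup>2)"
    by (rule set_integral_L1_le_L2[OF S s1 s2])
  also have "\<dots> \<le> sqrt (measure lborel \<Omega> + 1) * sobolev_norm N \<Omega> \<phi>"
    unfolding sobolev_norm_def
  proof (intro mult_left_mono real_sqrt_le_mono set_integral_mono s2)
    show "set_integrable lborel \<Omega> (\<lambda>X. \<Sum>\<mu> | mabs \<mu> \<le> N. (cmod (pdm \<mu> \<phi> X))\<^sup>2)"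
      using s2 finite_mindex unfolding set_integrable_def scaleR_sum_right by (intro Bochner_Integration.integrable_sum)
    show "(cmod (pdm \<mu> \<phi> X))\<^sup>2 \<le> (\<Sum>\<mu> | mabs \<mu> \<le> N. (cmod (pdm \<mu> \<phi> X))\<^sup>2)" for X
      using \<mu> finite_mindex by (intro member_le_sum) auto
  qed (simp add: )
  finally show ?thesis .
qed

lemma test_fun_pdm: "test_fun U \<phi> \<Longrightarrow> test_fun U (pdm \<mu> \<phi>)"
  by (cases \<mu>) (simp add: test_fun_pd_pow)

text \<open>1 + |\<xi>|^2 is at most 4 times the maximum of 1 and the squared coordinates, and the
  N-th power of this maximum is one of the summands on the right. The decay estimate can then work
  with pure derivatives in a single direction.\<close>

lemma one_plus_norm_power_le:
  fixes \<xi> :: R3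
  shows "(1 + (norm \<xi>)\<^sup>2) ^ N \<le> 4 ^ N * (1 + (\<Sum>j\<in>UNIV. \<bar>\<xi> $ j\<bar> ^ (2 * N)))"
proof -
  define s where "s j = \<bar>\<xi> $ j\<bar>" for j
  have n: "(norm \<xi>)\<^sup>2 = (s 1)\<^sup>2 + (s 2)\<^sup>2 + (s 3)\<^sup>2"
    unfolding s_def by (simp add: norm_vec_def L2_set_def sum_3)
  define M where "M = Max {1, (s 1)\<^sup>2, (s 2)\<^sup>2, (s 3)\<^sup>2}"
  have le: "1 \<le> M" "(s 1)\<^sup>2 \<le> M" "(s 2)\<^sup>2 \<le> M" "(s 3)\<^sup>2 \<le> M" unfolding M_def by (auto intro!: Max_ge)
  have "M \<in> {1, (s 1)\<^sup>2, (s 2)\<^sup>2, (s 3)\<^sup>2}" unfolding M_def by (intro Max_in) auto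
  then have "M ^ N \<in> {1 ^ N, s 1 ^ (2 * N), s 2 ^ (2 * N), s 3 ^ (2 * N)}"
    by (auto simp: power_mult)
  then have "M ^ N \<le> 1 + (\<Sum>j\<in>UNIV. s j ^ (2 * N))"
    by (auto simp: sum_3 s_def)
  moreover have "(1 + (norm \<xi>)\<^sup>2) ^ N \<le> (4 * M) ^ N"
    using le by (intro power_mono) (auto simp: n)
  ultimately show ?thesis unfolding power_mult_distrib s_def
    by (meson mult_left_mono order_trans zero_le_numeral zero_le_power)
qed

text \<open>Each factor \<xi>_j^(2N) is absorbed by 2N derivatives of \<phi> in direction j. A
  weight of power N therefore costs Sobolev order 2N, which for N = a + 3 is exactly m_1 = 6 +
  2a.\<close>

lemma inv_fourier_decay:
  assumes \<Omega>: "open \<Omega>" "bounded \<Omega>"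
  shows "\<exists>K\<ge>0. \<forall>\<phi> \<xi>. test_fun \<Omega> \<phi> \<longrightarrow>
    (1 + (norm \<xi>)\<^sup>2) ^ N * cmod (inv_fourier \<phi> \<xi>) \<le> K * sobolev_norm (2 * N) \<Omega> \<phi>"
proof (intro exI conjI allI impI)
  \<comment> \<open>The factor \<open>4 ^ N\<close> comes from the comparison of weights; the inner
    4 counts the undifferentiated term and the three directions.\<close>
  let ?K = "4 ^ N * (4 * sqrt (measure lborel \<Omega> + 1))"
  show "0 \<le> ?K" by simp
  fix \<phi> \<xi> assume t: "test_fun \<Omega> \<phi>"
  have tU: "test_fun UNIV \<phi>" by (rule test_fun_mono[OF t]) simp
  let ?s = "sqrt (measure lborel \<Omega> + 1) * sobolev_norm (2 * N) \<Omega> \<phi>"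
  have dom: "(LINT X|lborel. cmod (pdm \<mu> \<phi> X)) \<le> ?s" if "mabs \<mu> \<le> 2 * N" for \<mu>
    by (rule sobolev_dominates[OF \<Omega> t that test_fun_pdm[OF t]])
  have 0: "cmod (inv_fourier \<phi> \<xi>) \<le> ?s"
    using dom[of "(0,0,0)"] cmod_inv_fourier_le[of \<phi> \<xi>] by simp
  have j: "\<bar>\<xi> $ j\<bar> ^ (2 * N) * cmod (inv_fourier \<phi> \<xi>) \<le> ?s" for j
  proof -
    have "\<bar>\<xi> $ j\<bar> ^ (2 * N) * cmod (inv_fourier \<phi> \<xi>) = cmod (inv_fourier ((pd j ^^ (2 * N)) \<phi>) \<xi>)"
      by (simp add: inv_fourier_pd_pow[OF tU] norm_mult norm_power)
    also have "\<dots> \<le> (LINT X|lborel. cmod ((pd j ^^ (2 * N)) \<phi> X))" by (rule cmod_inv_fourier_le)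
    also have "\<dots> \<le> ?s"
      using dom[of "(2*N,0,0)"] dom[of "(0,2*N,0)"] dom[of "(0,0,2*N)"] exhaust_3[of j] by auto
    finally show ?thesis .
  qed
  have "(1 + (norm \<xi>)\<^sup>2) ^ N * cmod (inv_fourier \<phi> \<xi>)
      \<le> (4 ^ N * (1 + (\<Sum>j\<in>UNIV. \<bar>\<xi> $ j\<bar> ^ (2 * N)))) * cmod (inv_fourier \<phi> \<xi>)"
    by (intro mult_right_mono one_plus_norm_power_le) simp
  also have "\<dots> = 4 ^ N * (cmod (inv_fourier \<phi> \<xi>) + (\<Sum>j\<in>UNIV. \<bar>\<xi> $ j\<bar> ^ (2 * N) * cmod (inv_fourier \<phi> \<xi>)))"
    by (simp add: algebra_simps sum_distrib_left sum_distrib_right)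
  also have "\<dots> \<le> 4 ^ N * (?s + (\<Sum>j\<in>(UNIV :: 3 set). ?s))"
    by (intro mult_left_mono add_mono 0 sum_mono j) simp
  also have "\<dots> = ?K * sobolev_norm (2 * N) \<Omega> \<phi>" by simp
  finally show "(1 + (norm \<xi>)\<^sup>2) ^ N * cmod (inv_fourier \<phi> \<xi>) \<le> ?K * sobolev_norm (2 * N) \<Omega> \<phi>" .
qed

section \<open>Exchange of integrals, pairings and convolutions\<close>

lemma fourier_measurable:
  assumes [measurable]: "w \<in> borel_measurable borel"
  shows "fourier w \<in> borel_measurable borel"
proof -
  have "(\<lambda>\<xi>. LINT X|lborel. w X * exp (- \<i> * of_real (\<xi> \<bullet> X))) \<in> borel_measurable borel"
    by measurable
  then show ?thesis unfolding fourier_def[abs_def] .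
qed

lemma inv_fourier_measurable:
  assumes [measurable]: "w \<in> borel_measurable borel"
  shows "inv_fourier w \<in> borel_measurable borel"
proof -
  have "(\<lambda>\<xi>. of_real (1 / (2 * pi) ^ 3) * (LINT X|lborel. w X * exp (\<i> * of_real (X \<bullet> \<xi>)))) \<in> borel_measurable borel"
    by measurable
  then show ?thesis unfolding inv_fourier_def[abs_def] .
qed

text \<open>For a kernel of modulus at most 1 the product |u(x)| |w(y)| is an integrable majorant.
  The pairing, convolution and inversion formulas use this with exponential kernels.\<close>

lemma Fubini_kernel:
  fixes u :: "'a::euclidean_space \<Rightarrow> complex" and w :: "'b::euclidean_space \<Rightarrow> complex"
  assumes u: "integrable lborel u" and w: "integrable lborel w"
    and k: "case_prod k \<in> borel_measurable borel" and k1: "\<And>x y. cmod (k x y) \<le> 1"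
  shows "(LINT x|lborel. u x * (LINT y|lborel. w y * k x y)) = (LINT y|lborel. w y * (LINT x|lborel. u x * k x y))"
proof -
  have [measurable]: "u \<in> borel_measurable borel" "w \<in> borel_measurable borel"
    "case_prod k \<in> borel_measurable (borel \<Otimes>\<^sub>M borel)"
    using borel_measurable_integrable[OF u] borel_measurable_integrable[OF w] k by (simp_all add: borel_prod)
  have m[measurable]: "(\<lambda>p. u (fst p) * w (snd p) * k (fst p) (snd p)) \<in> borel_measurable (lborel \<Otimes>\<^sub>M lborel)"
    by measurable
  have yi: "integrable lborel (\<lambda>y. u x * w y * k x y)" for x
  proof (rule Bochner_Integration.integrable_bound[OF integrable_mult_right[OF w, of "u x"]])
    show "AE y in lborel. norm (u x * w y * k x y) \<le> norm (u x * w y)"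
      using k1 by (intro AE_I2) (simp add: norm_mult mult_left_le)
  qed measurable
  have int: "integrable (lborel \<Otimes>\<^sub>M lborel) (\<lambda>(x, y). u x * w y * k x y)"
  proof (rule lborel_pair.Fubini_integrable)
    show "(\<lambda>(x, y). u x * w y * k x y) \<in> borel_measurable (lborel \<Otimes>\<^sub>M lborel)"
      using m by (simp add: case_prod_beta')
    show "AE x in lborel. integrable lborel (\<lambda>y. case (x, y) of (x, y) \<Rightarrow> u x * w y * k x y)"
      using yi by simp
    show "integrable lborel (\<lambda>x. LINT y|lborel. norm (case (x, y) of (x, y) \<Rightarrow> u x * w y * k x y))"
    proof (rule Bochner_Integration.integrable_bound[OF integrable_mult_left[OF integrable_norm[OF u], of "LINT y|lborel. cmod (w y)"]])
      show "(\<lambda>x. LINT y|lborel. norm (case (x, y) of (x, y) \<Rightarrow> u x * w y * k x y)) \<in> borel_measurable lborel"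
        by measurable
      show "AE x in lborel. norm (LINT y|lborel. norm (case (x, y) of (x, y) \<Rightarrow> u x * w y * k x y))
          \<le> norm (cmod (u x) * (LINT y|lborel. cmod (w y)))"
      proof (intro AE_I2)
        fix x
        have "(LINT y|lborel. norm (u x * w y * k x y)) \<le> (LINT y|lborel. cmod (u x) * cmod (w y))"
          using k1 by (intro integral_mono integrable_norm yi integrable_mult_right w) (simp add: norm_mult mult_left_le)
        then show "norm (LINT y|lborel. norm (case (x, y) of (x, y) \<Rightarrow> u x * w y * k x y))
          \<le> norm (cmod (u x) * (LINT y|lborel. cmod (w y)))"
          by simp
      qed
    qed
  qed
  have "(LINT y|lborel. LINT x|lborel. u x * w y * k x y) = (LINT x|lborel. LINT y|lborel. u x * w y * k x y)"
    by (rule lborel_pair.Fubini_integral[OF int])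
  moreover have "(LINT x|lborel. u x * w y * k x y) = w y * (LINT x|lborel. u x * k x y)" for y
    by (subst integral_mult_right_zero[symmetric]) (simp add: mult_ac)
  moreover have "(LINT y|lborel. u x * w y * k x y) = u x * (LINT y|lborel. w y * k x y)" for x
    by (subst integral_mult_right_zero[symmetric]) (simp add: mult_ac)
  ultimately show ?thesis by simp
qed

text \<open>Moves the inverse transform from the symbol to the test function. This is how the
  mollified operator, given by integrals, is compared with the distributional definition of
  \<open>T0\<close>.\<close>

lemma inv_fourier_pairing:
  assumes G: "integrable lborel G" and \<phi>: "integrable lborel \<phi>"
  shows "(LINT X|lborel. inv_fourier G X * \<phi> X) = (LINT \<xi>|lborel. G \<xi> * inv_fourier \<phi> \<xi>)"
proof -
  have "(LINT X|lborel. \<phi> X * (LINT \<xi>|lborel. G \<xi> * exp (\<i> * of_real (\<xi> \<bullet> X))))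
      = (LINT \<xi>|lborel. G \<xi> * (LINT X|lborel. \<phi> X * exp (\<i> * of_real (\<xi> \<bullet> X))))"
    by (rule Fubini_kernel[OF \<phi> G])
       (auto simp: case_prod_beta' intro!: borel_measurable_continuous_onI continuous_intros)
  then have "of_real (1 / (2 * pi) ^ 3) * (LINT X|lborel. \<phi> X * (LINT \<xi>|lborel. G \<xi> * exp (\<i> * of_real (\<xi> \<bullet> X))))
      = complex_of_real (1 / (2 * pi) ^ 3) * (LINT \<xi>|lborel. G \<xi> * (LINT X|lborel. \<phi> X * exp (\<i> * of_real (X \<bullet> \<xi>))))"
    by (simp add: inner_commute)
  moreover have "(LINT X|lborel. inv_fourier G X * \<phi> X)
      = of_real (1 / (2 * pi) ^ 3) * (LINT X|lborel. \<phi> X * (LINT \<xi>|lborel. G \<xi> * exp (\<i> * of_real (\<xi> \<bullet> X))))"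
    unfolding inv_fourier_def by (subst integral_mult_right_zero[symmetric]) (simp only: mult_ac)
  moreover have "(LINT \<xi>|lborel. G \<xi> * inv_fourier \<phi> \<xi>)
      = of_real (1 / (2 * pi) ^ 3) * (LINT \<xi>|lborel. G \<xi> * (LINT X|lborel. \<phi> X * exp (\<i> * of_real (X \<bullet> \<xi>))))"
    unfolding inv_fourier_def by (subst integral_mult_right_zero[symmetric]) (simp only: mult_ac)
  ultimately show ?thesis by simp
qed

lemma conv_inv_fourier:
  assumes H: "integrable lborel H" and w: "integrable lborel w"
  shows "(LINT Y|lborel. inv_fourier H (X - Y) * w Y) = inv_fourier (\<lambda>\<xi>. H \<xi> * fourier w \<xi>) X"
proof -
  have Hi: "integrable lborel (\<lambda>\<xi>. H \<xi> * exp (\<i> * of_real (\<xi> \<bullet> X)))"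
    by (rule Bochner_Integration.integrable_bound[OF H]) (use H in \<open>auto simp: norm_mult\<close>)
  have "(LINT Y|lborel. w Y * (LINT \<xi>|lborel. (H \<xi> * exp (\<i> * of_real (\<xi> \<bullet> X))) * exp (- \<i> * of_real (\<xi> \<bullet> Y))))
      = (LINT \<xi>|lborel. (H \<xi> * exp (\<i> * of_real (\<xi> \<bullet> X))) * (LINT Y|lborel. w Y * exp (- \<i> * of_real (\<xi> \<bullet> Y))))"
    by (rule Fubini_kernel[OF w Hi])
       (auto simp: case_prod_beta' intro!: borel_measurable_continuous_onI continuous_intros)
  moreover have "exp (\<i> * of_real (\<xi> \<bullet> X)) * exp (- \<i> * of_real (\<xi> \<bullet> Y)) = exp (\<i> * of_real (\<xi> \<bullet> (X - Y)))" for \<xi> Y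
    by (simp add: mult_exp_exp inner_diff_right algebra_simps)
  ultimately have "(LINT Y|lborel. w Y * (LINT \<xi>|lborel. H \<xi> * exp (\<i> * of_real (\<xi> \<bullet> (X - Y)))))
      = (LINT \<xi>|lborel. (H \<xi> * exp (\<i> * of_real (\<xi> \<bullet> X))) * fourier w \<xi>)"
    by (simp add: mult.assoc fourier_def)
  then have "complex_of_real (1 / (2 * pi) ^ 3) * (LINT Y|lborel. w Y * (LINT \<xi>|lborel. H \<xi> * exp (\<i> * of_real (\<xi> \<bullet> (X - Y)))))
      = of_real (1 / (2 * pi) ^ 3) * (LINT \<xi>|lborel. (H \<xi> * fourier w \<xi>) * exp (\<i> * of_real (\<xi> \<bullet> X)))"
    by (simp add: mult_ac)
  moreover have "(LINT Y|lborel. inv_fourier H (X - Y) * w Y)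
      = of_real (1 / (2 * pi) ^ 3) * (LINT Y|lborel. w Y * (LINT \<xi>|lborel. H \<xi> * exp (\<i> * of_real (\<xi> \<bullet> (X - Y)))))"
    unfolding inv_fourier_def by (subst integral_mult_right_zero[symmetric]) (simp only: mult_ac)
  ultimately show ?thesis unfolding inv_fourier_def by simp
qed

text \<open>\<open>conv_dist\<close> evaluates a distribution at the correlation of w with \<phi>.
  The identity turns the convolution term of \<open>T0\<close> into multiplication of its symbol by
  the transform of w.\<close>

lemma inv_fourier_correlation:
  assumes w: "integrable lborel w" and \<phi>: "test_fun UNIV \<phi>"
  shows "inv_fourier (\<lambda>X. LINT Y|lborel. w Y * \<phi> (X + Y)) \<xi> = fourier w \<xi> * inv_fourier \<phi> \<xi>"
proof -
  let ?e = "\<lambda>X. exp (\<i> * of_real (X \<bullet> \<xi>))"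
  have [measurable]: "w \<in> borel_measurable borel" "\<phi> \<in> borel_measurable borel"
    using borel_measurable_integrable[OF w] test_fun_measurable[OF \<phi>] by auto
  have \<phi>i: "integrable lborel (\<lambda>X. \<phi> (Y + X))" for Y
  proof -
    have "integrable (distr lborel borel ((+) Y)) \<phi>"
      unfolding lborel_distr_plus by (rule test_fun_integrable[OF \<phi>])
    then show ?thesis by (subst (asm) integrable_distr_eq) auto
  qed
  have \<phi>n: "(LINT X|lborel. cmod (\<phi> (Y + X))) = (LINT X|lborel. cmod (\<phi> X))" for Y
    by (rule lborel_integral_shift) simp
  have xi: "integrable lborel (\<lambda>X. w Y * \<phi> (Y + X) * ?e X)" for Y
    by (rule Bochner_Integration.integrable_bound[OF integrable_mult_right[OF \<phi>i, of "w Y"]]) (auto simp: norm_mult)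
  have int: "integrable (lborel \<Otimes>\<^sub>M lborel) (\<lambda>(Y, X). w Y * \<phi> (Y + X) * ?e X)"
  proof (rule lborel_pair.Fubini_integrable)
    show "(\<lambda>(Y, X). w Y * \<phi> (Y + X) * ?e X) \<in> borel_measurable (lborel \<Otimes>\<^sub>M lborel)"
      by (simp add: case_prod_beta')
    show "AE Y in lborel. integrable lborel (\<lambda>X. case (Y, X) of (Y, X) \<Rightarrow> w Y * \<phi> (Y + X) * ?e X)"
      using xi by simp
    show "integrable lborel (\<lambda>Y. LINT X|lborel. norm (case (Y, X) of (Y, X) \<Rightarrow> w Y * \<phi> (Y + X) * ?e X))"
      using w by (simp add: norm_mult \<phi>n)
  qed
  have "(LINT X|lborel. LINT Y|lborel. w Y * \<phi> (Y + X) * ?e X) = (LINT Y|lborel. LINT X|lborel. w Y * \<phi> (Y + X) * ?e X)"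
    by (rule lborel_pair.Fubini_integral[OF int])
  also have "\<dots> = (LINT Y|lborel. w Y * exp (- \<i> * of_real (\<xi> \<bullet> Y)) * (LINT X|lborel. \<phi> X * ?e X))"
  proof (intro Bochner_Integration.integral_cong refl)
    fix Y
    have "(LINT X|lborel. w Y * \<phi> (Y + X) * ?e X)
        = (LINT X|lborel. w Y * exp (- \<i> * of_real (\<xi> \<bullet> Y)) * (\<phi> (Y + X) * ?e (Y + X)))"
    proof (intro Bochner_Integration.integral_cong refl)
      fix X
      have "?e X = exp (- \<i> * of_real (\<xi> \<bullet> Y)) * ?e (Y + X)"
        by (simp add: mult_exp_exp inner_add_left inner_commute algebra_simps)
      then show "w Y * \<phi> (Y + X) * ?e X = w Y * exp (- \<i> * of_real (\<xi> \<bullet> Y)) * (\<phi> (Y + X) * ?e (Y + X))"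
        by (simp only: mult_ac)
    qed
    also have "\<dots> = w Y * exp (- \<i> * of_real (\<xi> \<bullet> Y)) * (LINT X|lborel. \<phi> (Y + X) * ?e (Y + X))"
      by (rule integral_mult_right_zero)
    also have "(LINT X|lborel. \<phi> (Y + X) * ?e (Y + X)) = (LINT X|lborel. \<phi> X * ?e X)"
      by (rule lborel_integral_shift[of "\<lambda>X. \<phi> X * ?e X"]) simp
    finally show "(LINT X|lborel. w Y * \<phi> (Y + X) * ?e X) = w Y * exp (- \<i> * of_real (\<xi> \<bullet> Y)) * (LINT X|lborel. \<phi> X * ?e X)" .
  qed
  also have "\<dots> = fourier w \<xi> * (LINT X|lborel. \<phi> X * ?e X)"
    unfolding fourier_def by (rule integral_mult_left_zero)
  finally have "(LINT X|lborel. (LINT Y|lborel. w Y * \<phi> (X + Y)) * ?e X) = fourier w \<xi> * (LINT X|lborel. \<phi> X * ?e X)"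
    by (simp add: add.commute)
  then show ?thesis unfolding inv_fourier_def by (simp only: mult_ac)
qed

section \<open>Product integrals, Gaussians and integrable weights\<close>

lemma
  fixes f :: "'a::euclidean_space \<Rightarrow> real \<Rightarrow> complex"
  assumes f: "\<And>b. b \<in> Basis \<Longrightarrow> integrable lborel (f b)"
  shows lborel_integrable_prod: "integrable lborel (\<lambda>x. \<Prod>b\<in>Basis. f b (x \<bullet> b))"
    and lborel_integral_prod: "(LINT x|lborel. (\<Prod>b\<in>Basis. f b (x \<bullet> b))) = (\<Prod>b\<in>Basis. (LINT x|lborel. f b x))"
proof -
  interpret product_sigma_finite "\<lambda>_. lborel :: real measure" by standard
  have T[measurable]: "(\<lambda>x. \<Sum>b\<in>Basis. x b *\<^sub>R b) \<in> measurable (\<Pi>\<^sub>M b\<in>(Basis :: 'a set). lborel) borel"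
    by measurable
  have m: "(\<lambda>x::'a. \<Prod>b\<in>Basis. f b (x \<bullet> b)) \<in> borel_measurable borel"
  proof (intro borel_measurable_prod)
    fix b :: 'a assume "b \<in> Basis"
    then have "f b \<in> borel_measurable borel" using borel_measurable_integrable[OF f] by simp
    then show "(\<lambda>x::'a. f b (x \<bullet> b)) \<in> borel_measurable borel"
      by (rule measurable_compose[rotated]) simp
  qed
  have e: "(\<Prod>b\<in>Basis. f b ((\<Sum>b\<in>Basis. x b *\<^sub>R b) \<bullet> b)) = (\<Prod>b\<in>Basis. f b (x b))" for x
    by (intro prod.cong) auto
  show "integrable lborel (\<lambda>x. \<Prod>b\<in>Basis. f b (x \<bullet> b))"
    unfolding lborel_eq[where 'a='a] integrable_distr_eq[OF T m] e by (intro product_integrable_prod f) auto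
  show "(LINT x|lborel. (\<Prod>b\<in>Basis. f b (x \<bullet> b))) = (\<Prod>b\<in>Basis. (LINT x|lborel. f b x))"
    unfolding lborel_eq[where 'a='a] integral_distr[OF T m] e by (intro product_integral_prod f) auto
qed

text \<open>The kernel is the normal density of variance \<epsilon>/2. After scaling by its standard
  deviation c, the integral is the characteristic function of the standard normal law at
  -tc.\<close>

lemma
  assumes \<epsilon>: "\<epsilon> > 0"
  shows fourier_gauss_1d: "(LINT x|lborel. of_real ((pi * \<epsilon>) powr (-1/2) * exp (- x\<^sup>2 / \<epsilon>)) * exp (- \<i> * of_real (t * x)))
      = complex_of_real (exp (- \<epsilon> * t\<^sup>2 / 4))"
    and integrable_gauss_1d: "integrable lborel (\<lambda>x. of_real ((pi * \<epsilon>) powr (-1/2) * exp (- x\<^sup>2 / \<epsilon>)) * exp (- \<i> * of_real (t * x)))"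
proof -
  define c where "c = sqrt (\<epsilon> / 2)"
  have c: "c > 0" "c\<^sup>2 = \<epsilon> / 2" unfolding c_def using \<epsilon> by simp_all
  let ?g = "\<lambda>x. (pi * \<epsilon>) powr (-1/2) * exp (- x\<^sup>2 / \<epsilon>)"
  have pw: "(pi * \<epsilon>) powr (-1/2) = 1 / sqrt (pi * \<epsilon>)"
  proof -
    have "(pi * \<epsilon>) powr (-1/2) = (pi * \<epsilon>) powr (- (1/2))" by simp
    also have "\<dots> = inverse (sqrt (pi * \<epsilon>))" unfolding powr_minus using \<epsilon> by (subst powr_half_sqrt) simp_all
    finally show ?thesis by (simp only: inverse_eq_divide)
  qed
  have nd: "?g x = normal_density 0 c x" for x
  proof -
    have "(pi * \<epsilon>) powr (-1/2) = 1 / sqrt (2 * pi * c\<^sup>2)"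
      unfolding pw c by simp
    then show "?g x = normal_density 0 c x" by (simp add: normal_density_def c)
  qed
  show i: "integrable lborel (\<lambda>x. of_real (?g x) * exp (- \<i> * of_real (t * x)))"
    unfolding nd
    by (rule Bochner_Integration.integrable_bound[OF integrable_normal_density[OF c(1), of 0]])
       (auto simp: norm_mult)
  have gc: "?g (c * y) = std_normal_density y / c" for y
  proof -
    have "(pi * \<epsilon>) powr (-1/2) = 1 / (sqrt (2 * pi) * c)"
      unfolding pw c_def real_sqrt_mult[symmetric] by simp
    moreover have "(c * y)\<^sup>2 / \<epsilon> = y\<^sup>2 / 2" using \<epsilon> by (simp add: power_mult_distrib c)
    ultimately show ?thesis by (simp add: std_normal_density_def)
  qed
  have "(LINT x|lborel. of_real (?g x) * exp (- \<i> * of_real (t * x)))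
     = \<bar>c\<bar> *\<^sub>R (LINT x|lborel. of_real (?g (0 + c * x)) * exp (- \<i> * of_real (t * (0 + c * x))))"
    by (rule lborel_integral_real_affine) (use c in simp)
  also have "\<dots> = (LINT x|lborel. \<bar>c\<bar> *\<^sub>R (of_real (?g (0 + c * x)) * exp (- \<i> * of_real (t * (0 + c * x)))))"
    by (rule Bochner_Integration.integral_scaleR_right[symmetric])
  also have "\<dots> = (LINT x|lborel. std_normal_density x *\<^sub>R exp (\<i> * of_real (- (t * c) * x)))"
  proof (intro Bochner_Integration.integral_cong refl)
    fix x
    have "\<bar>c\<bar> *\<^sub>R (complex_of_real (?g (0 + c * x)) * exp (- \<i> * of_real (t * (0 + c * x))))
       = (\<bar>c\<bar> * ?g (c * x)) *\<^sub>R exp (- \<i> * of_real (t * (c * x)))"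
      by (simp only: add_0_left scaleR_conv_of_real of_real_mult mult.assoc)
    also have "\<bar>c\<bar> * ?g (c * x) = std_normal_density x" unfolding gc using c by simp
    finally show "\<bar>c\<bar> *\<^sub>R (complex_of_real (?g (0 + c * x)) * exp (- \<i> * of_real (t * (0 + c * x))))
       = std_normal_density x *\<^sub>R exp (\<i> * of_real (- (t * c) * x))"
      by (simp add: mult.assoc)
  qed
  also have "\<dots> = char std_normal_distribution (- (t * c))"
    unfolding char_def by (rule integral_density[symmetric]) auto
  also have "\<dots> = of_real (exp (- \<epsilon> * t\<^sup>2 / 4))"
    using c by (simp add: char_std_normal_distribution power_mult_distrib)
  finally show "(LINT x|lborel. of_real (?g x) * exp (- \<i> * of_real (t * x))) = complex_of_real (exp (- \<epsilon> * t\<^sup>2 / 4))" .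
qed

lemma gauss_prod:
  assumes \<epsilon>: "\<epsilon> > 0"
  shows "gauss \<epsilon> X * exp (- \<i> * of_real (\<xi> \<bullet> X))
    = (\<Prod>b\<in>Basis. of_real ((pi * \<epsilon>) powr (-1/2) * exp (- (X \<bullet> b)\<^sup>2 / \<epsilon>)) * exp (- \<i> * of_real ((\<xi> \<bullet> b) * (X \<bullet> b))))"
proof -
  have 1: "\<xi> \<bullet> X = (\<Sum>b\<in>Basis. (\<xi> \<bullet> b) * (X \<bullet> b))" by (rule euclidean_inner)
  have 2: "(norm X)\<^sup>2 = (\<Sum>b\<in>Basis. (X \<bullet> b)\<^sup>2)"
    unfolding power2_norm_eq_inner unfolding power2_eq_square by (rule euclidean_inner)
  have 3: "(pi * \<epsilon>) powr (-3/2) = ((pi * \<epsilon>) powr (-1/2)) ^ card (Basis :: R3 set)"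
    using \<epsilon> by (simp add: powr_power)
  have "exp (- (norm X)\<^sup>2 / \<epsilon>) = (\<Prod>b\<in>Basis. exp (- (X \<bullet> b)\<^sup>2 / \<epsilon>))"
    unfolding 2 by (simp add: exp_sum[symmetric] sum_negf sum_divide_distrib)
  moreover have "exp (- \<i> * of_real (\<xi> \<bullet> X)) = (\<Prod>b\<in>Basis. exp (- \<i> * of_real ((\<xi> \<bullet> b) * (X \<bullet> b))))"
    unfolding 1 by (simp add: exp_sum[symmetric] sum_negf sum_distrib_left)
  ultimately show ?thesis unfolding gauss_def 3
    by (simp only: of_real_mult prod.distrib of_real_prod prod_constant of_real_power)
qed

lemma
  assumes \<epsilon>: "\<epsilon> > 0"
  shows fourier_gauss: "fourier (gauss \<epsilon>) \<xi> = of_real (exp (- \<epsilon> * (norm \<xi>)\<^sup>2 / 4))"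
    and integrable_gauss: "integrable lborel (gauss \<epsilon>)"
proof -
  have 2: "(norm \<xi>)\<^sup>2 = (\<Sum>b\<in>Basis. (\<xi> \<bullet> b)\<^sup>2)"
    unfolding power2_norm_eq_inner unfolding power2_eq_square by (rule euclidean_inner)
  have "fourier (gauss \<epsilon>) \<xi> = (\<Prod>b\<in>(Basis :: R3 set). of_real (exp (- \<epsilon> * (\<xi> \<bullet> b)\<^sup>2 / 4)))"
    unfolding fourier_def gauss_prod[OF \<epsilon>]
    by (subst lborel_integral_prod) (simp_all only: integrable_gauss_1d[OF \<epsilon>] fourier_gauss_1d[OF \<epsilon>])
  also have "\<dots> = of_real (exp (\<Sum>b\<in>(Basis :: R3 set). - \<epsilon> * (\<xi> \<bullet> b)\<^sup>2 / 4))"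
    by (simp only: of_real_prod[symmetric] exp_sum[OF finite_Basis])
  also have "(\<Sum>b\<in>(Basis :: R3 set). - \<epsilon> * (\<xi> \<bullet> b)\<^sup>2 / 4) = - \<epsilon> * (norm \<xi>)\<^sup>2 / 4"
    unfolding 2 by (simp only: sum_distrib_left sum_divide_distrib)
  finally show "fourier (gauss \<epsilon>) \<xi> = of_real (exp (- \<epsilon> * (norm \<xi>)\<^sup>2 / 4))" .
  \<comment> \<open>Frequency 0 makes the product formula available for the Gaussian itself.\<close>
  have "integrable lborel (\<lambda>X. gauss \<epsilon> X * exp (- \<i> * of_real (0 \<bullet> X)))"
    unfolding gauss_prod[OF \<epsilon>] by (rule lborel_integrable_prod) (rule integrable_gauss_1d[OF \<epsilon>])
  then show "integrable lborel (gauss \<epsilon>)" by simp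
qed

text \<open>The product of the three factors 1 + \<xi>_j^2 is at most (1 + |\<xi>|^2)^3, and the
  reciprocal of each factor is integrable on the line; hence the exponent 3.\<close>

lemma integrable_weight:
  assumes "N \<ge> 3" shows "integrable lborel (\<lambda>\<xi>::R3. 1 / (1 + (norm \<xi>)\<^sup>2) ^ N)"
proof -
  have "set_integrable lborel (einterval (-\<infinity>) \<infinity>) (\<lambda>x. inverse (1 + x^2))"
    by (rule integrable_inverse_1_plus_square)
  then have "integrable lborel (\<lambda>x::real. inverse (1 + x\<^sup>2))"
    by (simp add: set_integrable_def)
  then have c: "integrable lborel (\<lambda>x::real. complex_of_real (inverse (1 + x\<^sup>2)))"
    by (rule integrable_of_real)
  have "integrable lborel (\<lambda>\<xi>::R3. \<Prod>b\<in>Basis. complex_of_real (inverse (1 + (\<xi> \<bullet> b)\<^sup>2)))"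
    by (rule lborel_integrable_prod[OF c])
  then have i: "integrable lborel (\<lambda>\<xi>::R3. complex_of_real (\<Prod>b\<in>Basis. inverse (1 + (\<xi> \<bullet> b)\<^sup>2)))"
    by simp
  show ?thesis
  proof (rule Bochner_Integration.integrable_bound[OF i])
    show "AE \<xi>::R3 in lborel. norm (1 / (1 + (norm \<xi>)\<^sup>2) ^ N) \<le> norm (complex_of_real (\<Prod>b\<in>Basis. inverse (1 + (\<xi> \<bullet> b)\<^sup>2)))"
    proof (intro AE_I2)
      fix \<xi> :: R3
      have p: "0 < 1 + (\<xi> \<bullet> b)\<^sup>2" for b by (rule add_pos_nonneg) simp_all
      have "(\<Prod>b\<in>(Basis :: R3 set). 1 + (\<xi> \<bullet> b)\<^sup>2) \<le> (\<Prod>b\<in>(Basis :: R3 set). 1 + (norm \<xi>)\<^sup>2)"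
      proof (intro prod_mono conjI)
        fix b :: R3 assume "b \<in> Basis"
        then have "\<bar>\<xi> \<bullet> b\<bar> \<le> norm \<xi>" by (rule Basis_le_norm)
        then have "(\<xi> \<bullet> b)\<^sup>2 \<le> (norm \<xi>)\<^sup>2" using power_mono[of "\<bar>\<xi> \<bullet> b\<bar>" "norm \<xi>" 2] by simp
        then show "1 + (\<xi> \<bullet> b)\<^sup>2 \<le> 1 + (norm \<xi>)\<^sup>2" by simp
      qed (use p less_imp_le in blast)
      also have "\<dots> = (1 + (norm \<xi>)\<^sup>2) ^ 3" by simp
      also have "\<dots> \<le> (1 + (norm \<xi>)\<^sup>2) ^ N" using assms by (intro power_increasing) auto
      finally have "1 / (1 + (norm \<xi>)\<^sup>2) ^ N \<le> 1 / (\<Prod>b\<in>(Basis :: R3 set). 1 + (\<xi> \<bullet> b)\<^sup>2)"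
        by (rule divide_left_mono) (intro mult_pos_pos prod_pos zero_less_power add_pos_nonneg ballI p zero_less_one zero_le_power2 zero_le_one)+
      also have "\<dots> = (\<Prod>b\<in>(Basis :: R3 set). inverse (1 + (\<xi> \<bullet> b)\<^sup>2))"
        by (simp only: inverse_eq_divide prod_dividef prod.neutral_const)
      finally show "norm (1 / (1 + (norm \<xi>)\<^sup>2) ^ N) \<le> norm (complex_of_real (\<Prod>b\<in>Basis. inverse (1 + (\<xi> \<bullet> b)\<^sup>2)))"
        unfolding norm_of_real real_norm_def
        by (subst abs_of_nonneg) (auto intro: order_trans[OF _ abs_ge_self])
    qed
  qed simp
qed

text \<open>Duality between the weighted L^1 space of the symbols and functions of matching decay: g
  h = (g/w)(w h) with w the weight.\<close>

lemma integrable_mult_decay: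
  fixes g h :: "R3 \<Rightarrow> complex"
  assumes g: "integrable lborel (\<lambda>\<xi>. g \<xi> / of_real ((1 + (norm \<xi>)\<^sup>2) ^ N))"
    and h: "h \<in> borel_measurable borel" "\<And>\<xi>. (1 + (norm \<xi>)\<^sup>2) ^ N * cmod (h \<xi>) \<le> K"
  shows "integrable lborel (\<lambda>\<xi>. g \<xi> * h \<xi>)"
    "(LINT \<xi>|lborel. cmod (g \<xi> * h \<xi>)) \<le> K * (LINT \<xi>|lborel. cmod (g \<xi> / of_real ((1 + (norm \<xi>)\<^sup>2) ^ N)))"
proof -
  have pos: "0 < (1 + (norm \<xi>)\<^sup>2) ^ N" for \<xi> :: R3
    by (intro zero_less_power add_pos_nonneg) simp_all
  have aux: "x * y = (x / w) * (w * y)" if "w > 0" for x y w :: real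
    using that by simp
  have pw: "norm (g \<xi> * h \<xi>) \<le> K * cmod (g \<xi> / of_real ((1 + (norm \<xi>)\<^sup>2) ^ N))" for \<xi>
  proof -
    have "norm (g \<xi> * h \<xi>) = cmod (g \<xi> / of_real ((1 + (norm \<xi>)\<^sup>2) ^ N)) * ((1 + (norm \<xi>)\<^sup>2) ^ N * cmod (h \<xi>))"
      unfolding norm_mult norm_divide norm_of_real abs_of_pos[OF pos] by (rule aux[OF pos])
    also have "\<dots> \<le> cmod (g \<xi> / of_real ((1 + (norm \<xi>)\<^sup>2) ^ N)) * K"
      by (intro mult_left_mono h) simp
    finally show ?thesis by (simp only: mult.commute)
  qed
  have m: "(\<lambda>\<xi>. g \<xi> * h \<xi>) \<in> borel_measurable lborel"
  proof -
    have "(\<lambda>\<xi>. (g \<xi> / of_real ((1 + (norm \<xi>)\<^sup>2) ^ N)) * of_real ((1 + (norm \<xi>)\<^sup>2) ^ N) * h \<xi>) \<in> borel_measurable lborel"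
      using h(1) by (intro borel_measurable_times borel_measurable_integrable[OF g]) auto
    moreover have "(g \<xi> / of_real ((1 + (norm \<xi>)\<^sup>2) ^ N)) * of_real ((1 + (norm \<xi>)\<^sup>2) ^ N) = g \<xi>" for \<xi>
      using pos[of \<xi>] by (metis less_irrefl nonzero_eq_divide_eq of_real_eq_0_iff)
    ultimately show ?thesis by simp
  qed
  have iK: "integrable lborel (\<lambda>\<xi>. K * cmod (g \<xi> / of_real ((1 + (norm \<xi>)\<^sup>2) ^ N)))"
    by (intro integrable_mult_right integrable_norm g)
  show i: "integrable lborel (\<lambda>\<xi>. g \<xi> * h \<xi>)"
  proof (rule Bochner_Integration.integrable_bound[OF iK m])
    show "AE \<xi> in lborel. norm (g \<xi> * h \<xi>) \<le> norm (K * cmod (g \<xi> / of_real ((1 + (norm \<xi>)\<^sup>2) ^ N)))"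
      using pw by (intro AE_I2) (metis abs_ge_self order_trans real_norm_def)
  qed
  have "(LINT \<xi>|lborel. cmod (g \<xi> * h \<xi>)) \<le> (LINT \<xi>|lborel. K * cmod (g \<xi> / of_real ((1 + (norm \<xi>)\<^sup>2) ^ N)))"
    by (intro integral_mono integrable_norm i iK pw)
  then show "(LINT \<xi>|lborel. cmod (g \<xi> * h \<xi>)) \<le> K * (LINT \<xi>|lborel. cmod (g \<xi> / of_real ((1 + (norm \<xi>)\<^sup>2) ^ N)))"
    by simp
qed

text \<open>A single \<phi> is supported in some ball, and the Sobolev estimate on that ball yields
  a constant depending on \<phi>.\<close>

lemma test_fun_inv_fourier_decay:
  assumes "test_fun U \<phi>"
  shows "\<exists>K. \<forall>\<xi>. (1 + (norm \<xi>)\<^sup>2) ^ N * cmod (inv_fourier \<phi> \<xi>) \<le> K"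
proof -
  obtain S where S: "compact S" "\<forall>X. X \<notin> S \<longrightarrow> \<phi> X = 0" using test_fun_support[OF assms] by blast
  obtain R where R: "S \<subseteq> ball 0 R"
    using compact_imp_bounded[OF S(1)] bounded_subset_ballD by blast
  have "compact (closure {X. \<phi> X \<noteq> 0})" "smooth \<phi>" using assms unfolding test_fun_def by blast+
  moreover have "closure {X. \<phi> X \<noteq> 0} \<subseteq> S"
    using S compact_imp_closed by (intro closure_minimal) blast+
  ultimately have t: "test_fun (ball 0 R) \<phi>" using R unfolding test_fun_def by blast
  show ?thesis using inv_fourier_decay[OF open_ball bounded_ball, of 0 R N] t by blast
qed

lemma integrable_inv_fourier:
  assumes "test_fun U \<phi>" shows "integrable lborel (inv_fourier \<phi>)"
proof -
  obtain K where "\<forall>\<xi>. (1 + (norm \<xi>)\<^sup>2) ^ 3 * cmod (inv_fourier \<phi> \<xi>) \<le> K"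
    using test_fun_inv_fourier_decay[OF assms] by blast
  moreover have "integrable lborel (\<lambda>\<xi>::R3. 1 / complex_of_real ((1 + (norm \<xi>)\<^sup>2) ^ 3))"
    using integrable_of_real[OF integrable_weight[of 3], where 'a=complex] by simp
  ultimately have "integrable lborel (\<lambda>\<xi>. 1 * inv_fourier \<phi> \<xi>)"
    by (intro integrable_mult_decay(1)[of "\<lambda>_. 1" 3]) (auto intro: inv_fourier_measurable test_fun_measurable[OF assms])
  then show ?thesis by simp
qed

text \<open>The parameter is a square because \<open>gauss (d\<^sup>2)\<close> is the normalised
  dilation by d of \<open>gauss 1\<close>. Substituting dY for Y freezes the kernel and leaves a
  dominated limit in \<phi>.\<close>

lemma gauss_approximation:
  assumes \<phi>: "continuous_on UNIV \<phi>" and K: "\<And>X. cmod (\<phi> X) \<le> K"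
    and \<delta>: "\<And>n. \<delta> n > 0" "\<delta> \<longlonglongrightarrow> 0"
  shows "(\<lambda>n. LINT Y|lborel. \<phi> (X + Y) * gauss ((\<delta> n)\<^sup>2) Y) \<longlonglongrightarrow> \<phi> X"
proof -
  have [measurable]: "\<phi> \<in> borel_measurable borel" "\<And>\<epsilon>. gauss \<epsilon> \<in> borel_measurable borel"
    using \<phi> by (simp_all add: borel_measurable_continuous_onI gauss_def[abs_def])
  have g1: "integrable lborel (gauss 1)" by (rule integrable_gauss) simp
  have eq: "(LINT Y|lborel. \<phi> (X + Y) * gauss (d\<^sup>2) Y) = (LINT Y|lborel. \<phi> (X + d *\<^sub>R Y) * gauss 1 Y)" if d: "d > 0" for d
  proof -
    let ?f = "\<lambda>Y. \<phi> (X + Y) * gauss (d\<^sup>2) Y"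
    have "(LINT Y|lborel. ?f Y) = (LINT Y|density (distr lborel borel (\<lambda>x. 0 + d *\<^sub>R x)) (\<lambda>_. \<bar>d\<bar> ^ DIM(R3)). ?f Y)"
      using lborel_affine[of d "0 :: R3"] d by simp
    also have "\<dots> = (LINT Y|distr lborel borel (\<lambda>x. 0 + d *\<^sub>R x). (\<bar>d\<bar> ^ DIM(R3)) *\<^sub>R ?f Y)"
      by (rule integral_density) auto
    also have "\<dots> = (LINT Y|lborel. (\<bar>d\<bar> ^ DIM(R3)) *\<^sub>R ?f (0 + d *\<^sub>R Y))"
      by (rule integral_distr) auto
    also have "\<dots> = (LINT Y|lborel. \<phi> (X + d *\<^sub>R Y) * gauss 1 Y)"
    proof (intro Bochner_Integration.integral_cong refl)
      fix Y :: R3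
      have "(pi * d\<^sup>2) powr (-3/2) = pi powr (-3/2) * (d\<^sup>2) powr (-3/2)" using d by (simp add: powr_mult)
      also have "(d\<^sup>2) powr (-3/2) = d powr (-3)" using d by (simp add: powr_powr flip: powr_numeral)
      also have "\<dots> = inverse (d ^ 3)" using d by (simp add: powr_minus)
      finally have "d ^ 3 * (pi * d\<^sup>2) powr (-3/2) = pi powr (-3/2)" using d by simp
      moreover have "(norm (d *\<^sub>R Y))\<^sup>2 / d\<^sup>2 = (norm Y)\<^sup>2" using d by (simp add: power_mult_distrib)
      ultimately have "\<bar>d\<bar> ^ 3 * ((pi * d\<^sup>2) powr (-3/2) * exp (- (norm (d *\<^sub>R Y))\<^sup>2 / d\<^sup>2)) = pi powr (-3/2) * exp (- (norm Y)\<^sup>2)"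
        using d by (simp add: mult.assoc[symmetric])
      then have "complex_of_real (\<bar>d\<bar> ^ 3) * gauss (d\<^sup>2) (d *\<^sub>R Y) = gauss 1 Y"
        unfolding gauss_def of_real_mult[symmetric] by simp
      then show "(\<bar>d\<bar> ^ DIM(R3)) *\<^sub>R ?f (0 + d *\<^sub>R Y) = \<phi> (X + d *\<^sub>R Y) * gauss 1 Y"
        by (simp add: scaleR_conv_of_real mult.left_commute)
    qed
    finally show ?thesis .
  qed
  have "(\<lambda>n. LINT Y|lborel. \<phi> (X + \<delta> n *\<^sub>R Y) * gauss 1 Y) \<longlonglongrightarrow> (LINT Y|lborel. \<phi> X * gauss 1 Y)"
  proof (rule integral_dominated_convergence[where w="\<lambda>Y. K * cmod (gauss 1 Y)"])
    show "integrable lborel (\<lambda>Y. K * cmod (gauss 1 Y))"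
      by (intro integrable_mult_right integrable_norm g1)
    show "AE Y in lborel. (\<lambda>n. \<phi> (X + \<delta> n *\<^sub>R Y) * gauss 1 Y) \<longlonglongrightarrow> \<phi> X * gauss 1 Y"
    proof (intro AE_I2 tendsto_mult tendsto_const)
      fix Y
      have "(\<lambda>n. X + \<delta> n *\<^sub>R Y) \<longlonglongrightarrow> X + 0 *\<^sub>R Y" by (intro tendsto_intros \<delta>)
      then show "(\<lambda>n. \<phi> (X + \<delta> n *\<^sub>R Y)) \<longlonglongrightarrow> \<phi> X"
        using continuous_on_tendsto_compose[OF \<phi>] by simp
    qed
    show "AE Y in lborel. norm (\<phi> (X + \<delta> n *\<^sub>R Y) * gauss 1 Y) \<le> K * cmod (gauss 1 Y)" for n
      using K by (intro AE_I2) (simp add: norm_mult mult_right_mono)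
  qed auto
  moreover have "(LINT Y|lborel. gauss 1 Y) = 1"
    using fourier_gauss[of 1 0] by (simp add: fourier_def)
  ultimately show ?thesis using \<delta> by (simp add: eq)
qed

text \<open>Gaussian summation: damping the integrand by exp(-\<delta>^2 |\<xi>|^2 / 4) turns the
  integral into an average of \<phi> against a narrow Gaussian centred at X, which tends to
  \<phi>(X). The damped integrals also tend to the undamped one.\<close>

lemma fourier_inversion:
  assumes t: "test_fun UNIV \<phi>"
  shows "(LINT \<xi>|lborel. inv_fourier \<phi> \<xi> * exp (- \<i> * of_real (\<xi> \<bullet> X))) = \<phi> X"
proof -
  define \<delta> where "\<delta> n = 1 / real (Suc n)" for n
  have \<delta>: "\<delta> n > 0" "\<delta> \<longlonglongrightarrow> 0" for n
    unfolding \<delta>_def using LIMSEQ_Suc[OF lim_1_over_n] by auto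
  define G where "G n \<xi> = complex_of_real (exp (- (\<delta> n)\<^sup>2 * (norm \<xi>)\<^sup>2 / 4)) * exp (- \<i> * of_real (\<xi> \<bullet> X))" for n and \<xi> :: R3
  have Gm[measurable]: "G n \<in> borel_measurable borel" for n unfolding G_def by measurable
  have [measurable]: "\<phi> \<in> borel_measurable borel" by (rule test_fun_measurable[OF t])
  \<comment> \<open>Up to normalisation the damping factor is the Gaussian with parameter
    4/\<delta>^2, so its transform is already known.\<close>
  have Geq: "G n \<xi> = of_real ((pi * (4 / (\<delta> n)\<^sup>2)) powr (3/2)) * (gauss (4 / (\<delta> n)\<^sup>2) \<xi> * exp (- \<i> * of_real (\<xi> \<bullet> X)))" for n \<xi>
  proof -
    have "(pi * (4 / (\<delta> n)\<^sup>2)) powr (3/2) * (pi * (4 / (\<delta> n)\<^sup>2)) powr (-3/2) = 1"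
      using \<delta>(1)[of n] by (simp add: powr_add[symmetric])
    then have "complex_of_real ((pi * (4 / (\<delta> n)\<^sup>2)) powr (3/2)) * gauss (4 / (\<delta> n)\<^sup>2) \<xi> = of_real (exp (- (\<delta> n)\<^sup>2 * (norm \<xi>)\<^sup>2 / 4))"
      unfolding gauss_def of_real_mult[symmetric] mult.assoc[symmetric] by (simp add: mult.commute)
    then show ?thesis unfolding G_def by (simp only: mult.assoc[symmetric])
  qed
  have Gi: "integrable lborel (G n)" for n
  proof -
    have "integrable lborel (gauss (4 / (\<delta> n)\<^sup>2))" using \<delta>(1)[of n] by (intro integrable_gauss) simp
    then have "integrable lborel (\<lambda>\<xi>. of_real ((pi * (4 / (\<delta> n)\<^sup>2)) powr (3/2)) * gauss (4 / (\<delta> n)\<^sup>2) \<xi>)"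
      by (rule integrable_mult_right)
    then show ?thesis
      by (rule Bochner_Integration.integrable_bound) (simp_all add: Geq norm_mult)
  qed
  have Ginv: "inv_fourier (G n) Y = gauss ((\<delta> n)\<^sup>2) (Y - X)" for n Y
  proof -
    let ?c = "(pi * (4 / (\<delta> n)\<^sup>2)) powr (3/2)"
    have "(LINT \<xi>|lborel. G n \<xi> * exp (\<i> * of_real (\<xi> \<bullet> Y))) = of_real ?c * fourier (gauss (4 / (\<delta> n)\<^sup>2)) (X - Y)"
      unfolding fourier_def
    proof (subst integral_mult_right_zero[symmetric], intro Bochner_Integration.integral_cong refl)
      fix \<xi>
      have "exp (- \<i> * of_real (\<xi> \<bullet> X)) * exp (\<i> * of_real (\<xi> \<bullet> Y)) = exp (- \<i> * of_real ((X - Y) \<bullet> \<xi>))"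
        by (simp add: mult_exp_exp inner_diff_left inner_commute algebra_simps)
      then show "G n \<xi> * exp (\<i> * of_real (\<xi> \<bullet> Y)) = of_real ?c * (gauss (4 / (\<delta> n)\<^sup>2) \<xi> * exp (- \<i> * of_real ((X - Y) \<bullet> \<xi>)))"
        unfolding Geq by (simp only: mult.assoc)
    qed
    also have "\<dots> = of_real (?c * exp (- (norm (Y - X))\<^sup>2 / (\<delta> n)\<^sup>2))"
      using \<delta>(1)[of n] by (subst fourier_gauss) (simp_all add: norm_minus_commute)
    finally have "inv_fourier (G n) Y = of_real (1 / (2 * pi) ^ 3 * ?c * exp (- (norm (Y - X))\<^sup>2 / (\<delta> n)\<^sup>2))"
      unfolding inv_fourier_def by simp
    moreover have "1 / (2 * pi) ^ 3 * ?c = (pi * (\<delta> n)\<^sup>2) powr (-3/2)"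
    proof -
      have "y ^ 3 = (y\<^sup>2) powr (3/2)" if "y > 0" for y :: real
        using that by (simp add: powr_powr flip: powr_numeral)
      from this[of "2 * pi"] have p: "(2 * pi) ^ 3 = ((2 * pi)\<^sup>2) powr (3/2)" by simp
      have "1 / (2 * pi) ^ 3 * ?c = ((pi * (4 / (\<delta> n)\<^sup>2)) / (2 * pi)\<^sup>2) powr (3/2)"
        unfolding p using \<delta>(1)[of n] by (subst powr_divide) simp_all
      also have "(pi * (4 / (\<delta> n)\<^sup>2)) / (2 * pi)\<^sup>2 = inverse (pi * (\<delta> n)\<^sup>2)"
        using \<delta>(1)[of n] by (simp add: field_simps power2_eq_square)
      also have "\<dots> powr (3/2) = (pi * (\<delta> n)\<^sup>2) powr (- (3/2))"
        using \<delta>(1)[of n] by (simp only: powr_minus) (subst powr_divide[of 1, simplified, folded inverse_eq_divide], simp_all)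
      finally show ?thesis by simp
    qed
    ultimately show ?thesis unfolding gauss_def by (simp only:)
  qed
  have 1: "(\<lambda>n. LINT \<xi>|lborel. inv_fourier \<phi> \<xi> * G n \<xi>) \<longlonglongrightarrow> (LINT \<xi>|lborel. inv_fourier \<phi> \<xi> * exp (- \<i> * of_real (\<xi> \<bullet> X)))"
  proof (rule integral_dominated_convergence[where w="\<lambda>\<xi>. cmod (inv_fourier \<phi> \<xi>)"])
    show "integrable lborel (\<lambda>\<xi>. cmod (inv_fourier \<phi> \<xi>))"
      by (intro integrable_norm integrable_inv_fourier[OF t])
    have [measurable]: "inv_fourier \<phi> \<in> borel_measurable borel" by (rule inv_fourier_measurable) measurable
    show "(\<lambda>\<xi>. inv_fourier \<phi> \<xi> * exp (- \<i> * of_real (\<xi> \<bullet> X))) \<in> borel_measurable lborel" by measurable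
    show "(\<lambda>\<xi>. inv_fourier \<phi> \<xi> * G n \<xi>) \<in> borel_measurable lborel" for n by measurable
    show "AE \<xi> in lborel. (\<lambda>n. inv_fourier \<phi> \<xi> * G n \<xi>) \<longlonglongrightarrow> inv_fourier \<phi> \<xi> * exp (- \<i> * of_real (\<xi> \<bullet> X))"
    proof (intro AE_I2 tendsto_mult tendsto_const)
      fix \<xi> :: R3
      have "(\<lambda>n. G n \<xi>) \<longlonglongrightarrow> of_real (exp (- 0\<^sup>2 * (norm \<xi>)\<^sup>2 / 4)) * exp (- \<i> * of_real (\<xi> \<bullet> X))"
        unfolding G_def by (intro tendsto_intros \<delta>) simp
      then show "(\<lambda>n. G n \<xi>) \<longlonglongrightarrow> exp (- \<i> * of_real (\<xi> \<bullet> X))" by simp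
    qed
    show "AE \<xi> in lborel. norm (inv_fourier \<phi> \<xi> * G n \<xi>) \<le> cmod (inv_fourier \<phi> \<xi>)" for n
      by (intro AE_I2) (simp add: G_def norm_mult mult_left_le)
  qed
  have 2: "(LINT \<xi>|lborel. inv_fourier \<phi> \<xi> * G n \<xi>) = (LINT Y|lborel. \<phi> (X + Y) * gauss ((\<delta> n)\<^sup>2) Y)" for n
  proof -
    have "(LINT \<xi>|lborel. inv_fourier \<phi> \<xi> * G n \<xi>) = (LINT Y|lborel. \<phi> Y * inv_fourier (G n) Y)"
      by (rule inv_fourier_pairing[OF test_fun_integrable[OF t] Gi])
    also have "\<dots> = (LINT Y|lborel. \<phi> (X + Y) * inv_fourier (G n) (X + Y))"
      by (rule lborel_integral_shift[symmetric, of "\<lambda>Y. \<phi> Y * inv_fourier (G n) Y"])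
         (intro borel_measurable_times inv_fourier_measurable Gm test_fun_measurable[OF t])
    finally show ?thesis by (simp add: Ginv)
  qed
  obtain K where K: "\<forall>X. cmod (\<phi> X) \<le> K" using test_fun_bounded[OF t] by blast
  have "(\<lambda>n. LINT Y|lborel. \<phi> (X + Y) * gauss ((\<delta> n)\<^sup>2) Y) \<longlonglongrightarrow> \<phi> X"
    by (rule gauss_approximation[OF test_fun_continuous_on[OF t] K[rule_format] \<delta>])
  then show ?thesis using 1 LIMSEQ_unique unfolding 2 by blast
qed

lemma test_fun_pairing_fourier:
  assumes w: "integrable lborel w" and t: "test_fun UNIV \<phi>"
  shows "(LINT X|lborel. w X * \<phi> X) = (LINT \<xi>|lborel. fourier w \<xi> * inv_fourier \<phi> \<xi>)"
proof -
  have "(LINT X|lborel. w X * \<phi> X) = (LINT X|lborel. w X * (LINT \<xi>|lborel. inv_fourier \<phi> \<xi> * exp (- \<i> * of_real (\<xi> \<bullet> X))))"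
    by (simp only: fourier_inversion[OF t])
  also have "\<dots> = (LINT \<xi>|lborel. inv_fourier \<phi> \<xi> * (LINT X|lborel. w X * exp (- \<i> * of_real (\<xi> \<bullet> X))))"
    by (rule Fubini_kernel[OF w integrable_inv_fourier[OF t]])
       (auto simp: case_prod_beta' intro!: borel_measurable_continuous_onI continuous_intros)
  finally show ?thesis by (simp add: fourier_def mult.commute)
qed

text \<open>A diagonal argument on a countable dense set, extended to all points by the common
  Lipschitz constant. The limits are pointwise, as dominated convergence requires.\<close>

lemma equi_Lipschitz_subsequence:
  fixes F :: "nat \<Rightarrow> R3 \<Rightarrow> 'b::euclidean_space"
  assumes M: "\<And>n \<xi>. norm (F n \<xi>) \<le> M" and L: "\<And>n \<xi> \<eta>. norm (F n \<xi> - F n \<eta>) \<le> L * norm (\<xi> - \<eta>)"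
  shows "\<exists>r :: nat \<Rightarrow> nat. strict_mono r \<and> (\<forall>\<xi>. convergent (\<lambda>n. F (r n) \<xi>))"
proof -
  obtain D :: "R3 set" where D: "countable D" "UNIV \<subseteq> closure D" using separable[of UNIV] by metis
  obtain r where r: "strict_mono r" "\<And>\<xi>. \<xi> \<in> D \<Longrightarrow> \<exists>l. (\<lambda>n. F (r n) \<xi>) \<longlonglongrightarrow> l"
    using function_convergent_subsequence[OF D(1), of F M] M by metis
  have "Cauchy (\<lambda>n. F (r n) \<xi>)" for \<xi>
  proof (rule metric_CauchyI)
    fix e :: real assume e: "e > 0"
    \<comment> \<open>Enlarged to be positive, since it is divided by.\<close>
    define L' where "L' = \<bar>L\<bar> + 1"
    have L': "L' > 0" "L \<le> L'" unfolding L'_def by linarith+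
    have "\<xi> \<in> closure D" using D(2) by blast
    then obtain d where d: "d \<in> D" "dist d \<xi> < e / (3 * L')"
      using e L' by (meson closure_approachable divide_pos_pos mult_pos_pos zero_less_numeral)
    have close: "dist (F n \<xi>) (F n d) < e / 3" for n
    proof -
      have "dist (F n \<xi>) (F n d) \<le> L' * dist d \<xi>"
        using L[of n \<xi> d] L' mult_right_mono[OF L'(2), of "norm (\<xi> - d)"] by (simp add: dist_norm norm_minus_commute)
      also have "\<dots> < L' * (e / (3 * L'))" using d L' by (intro mult_strict_left_mono) auto
      finally show ?thesis using L' by simp
    qed
    obtain l where "(\<lambda>n. F (r n) d) \<longlonglongrightarrow> l" using r(2)[OF d(1)] by blast
    then have "Cauchy (\<lambda>n. F (r n) d)" by (rule LIMSEQ_imp_Cauchy)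
    then obtain N where N: "\<forall>m\<ge>N. \<forall>n\<ge>N. dist (F (r m) d) (F (r n) d) < e / 3"
      using e unfolding Cauchy_def by (meson divide_pos_pos zero_less_numeral)
    show "\<exists>M. \<forall>m\<ge>M. \<forall>n\<ge>M. dist (F (r m) \<xi>) (F (r n) \<xi>) < e"
    proof (intro exI[of _ N] allI impI)
      fix m n assume "m \<ge> N" "n \<ge> N"
      then have "dist (F (r m) d) (F (r n) d) < e / 3" using N by blast
      moreover have "dist (F (r m) \<xi>) (F (r n) \<xi>) \<le> dist (F (r m) \<xi>) (F (r m) d) + dist (F (r m) d) (F (r n) d) + dist (F (r n) d) (F (r n) \<xi>)"
        using dist_triangle[of "F (r m) \<xi>" "F (r n) \<xi>" "F (r m) d"] dist_triangle[of "F (r m) d" "F (r n) \<xi>" "F (r n) d"] by linarith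
      ultimately show "dist (F (r m) \<xi>) (F (r n) \<xi>) < e"
        using close[of "r m"] close[of "r n"] by (simp add: dist_commute)
    qed
  qed
  then show ?thesis using r(1) Cauchy_convergent by blast
qed

lemma cmod_exp_diff_le: "cmod (exp (- \<i> * of_real a) - exp (- \<i> * of_real b)) \<le> \<bar>a - b\<bar>"
proof -
  have "exp (- \<i> * of_real a) - exp (- \<i> * of_real b) = exp (- \<i> * of_real a) * (1 - exp (\<i> * of_real (a - b)))"
    by (simp add: right_diff_distrib mult_exp_exp algebra_simps)
  then have "cmod (exp (- \<i> * of_real a) - exp (- \<i> * of_real b)) = cmod (exp (\<i> * of_real (a - b)) - 1)"
    by (simp add: norm_mult norm_minus_commute)
  also have "\<dots> \<le> \<bar>a - b\<bar>" using iexp_approx1[of "a - b" 0] by simp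
  finally show ?thesis .
qed

text \<open>On a support of radius R the phases exp(-i \<xi> . X) are R-Lipschitz in \<xi>.\<close>

lemma fourier_Lipschitz:
  assumes u: "integrable lborel u" and R: "\<And>X. u X \<noteq> 0 \<Longrightarrow> norm X \<le> R"
  shows "cmod (fourier u \<xi> - fourier u \<eta>) \<le> R * (LINT X|lborel. cmod (u X)) * norm (\<xi> - \<eta>)"
proof -
  have i: "integrable lborel (\<lambda>X. u X * exp (- \<i> * of_real (\<xi> \<bullet> X)))" for \<xi>
    by (rule Bochner_Integration.integrable_bound[OF u]) (use u in \<open>auto simp: norm_mult\<close>)
  have "fourier u \<xi> - fourier u \<eta> = (LINT X|lborel. u X * exp (- \<i> * of_real (\<xi> \<bullet> X)) - u X * exp (- \<i> * of_real (\<eta> \<bullet> X)))"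
    unfolding fourier_def by (rule Bochner_Integration.integral_diff[OF i i, symmetric])
  also have "cmod \<dots> \<le> (LINT X|lborel. cmod (u X) * (R * norm (\<xi> - \<eta>)))"
  proof (rule Bochner_Integration.integral_norm_bound_integral)
    show "integrable lborel (\<lambda>X. u X * exp (- \<i> * of_real (\<xi> \<bullet> X)) - u X * exp (- \<i> * of_real (\<eta> \<bullet> X)))"
      by (intro Bochner_Integration.integrable_diff i)
    show "integrable lborel (\<lambda>X. cmod (u X) * (R * norm (\<xi> - \<eta>)))"
      by (intro integrable_mult_left integrable_norm u)
    fix X
    show "cmod (u X * exp (- \<i> * of_real (\<xi> \<bullet> X)) - u X * exp (- \<i> * of_real (\<eta> \<bullet> X))) \<le> cmod (u X) * (R * norm (\<xi> - \<eta>))"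
    proof (cases "u X = 0")
      case False
      have "cmod (exp (- \<i> * of_real (\<xi> \<bullet> X)) - exp (- \<i> * of_real (\<eta> \<bullet> X))) \<le> \<bar>(\<xi> - \<eta>) \<bullet> X\<bar>"
        using cmod_exp_diff_le[of "\<xi> \<bullet> X" "\<eta> \<bullet> X"] by (simp add: inner_diff_left)
      also have "\<dots> \<le> norm (\<xi> - \<eta>) * norm X" by (rule Cauchy_Schwarz_ineq2)
      also have "\<dots> \<le> norm (\<xi> - \<eta>) * R" by (intro mult_left_mono R False) simp
      finally show ?thesis
        unfolding right_diff_distrib[symmetric] norm_mult by (simp add: mult.commute mult_left_mono)
    qed simp
  qed
  also have "\<dots> = R * (LINT X|lborel. cmod (u X)) * norm (\<xi> - \<eta>)" by simp
  finally show ?thesis .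
qed

section \<open>Local charts and the outer normal of a convex domain\<close>

text \<open>A chart in level-set form: D is the gradient of \<Phi>, and \<Phi> is positive exactly
  on the part of \<Omega> near P0. For a graph, \<Phi> is the height above it in rotated
  coordinates. It lives on all of space, so only the sign condition is local.\<close>

definition level_chart :: "R3 set \<Rightarrow> real \<Rightarrow> R3 \<Rightarrow> real \<Rightarrow> (R3 \<Rightarrow> real) \<Rightarrow> (R3 \<Rightarrow> R3) \<Rightarrow> real \<Rightarrow> bool" where
  "level_chart \<Omega> \<alpha> P0 r \<Phi> D L \<longleftrightarrow> r > 0 \<and> L \<ge> 0 \<and>
     (\<forall>X. (\<Phi> has_derivative (\<lambda>h. D X \<bullet> h)) (at X)) \<and>
     (\<forall>X Y. norm (D X - D Y) \<le> L * norm (X - Y) powr \<alpha>) \<and>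
     (\<forall>X. norm (D X) \<ge> 1) \<and>
     (\<forall>X\<in>ball P0 r. X \<in> \<Omega> \<longleftrightarrow> \<Phi> X > 0)"

lemma inner_R3: "x \<bullet> y = x$1 * y$1 + x$2 * y$2 + x$3 * y$3" for x y :: R3
  by (simp add: inner_vec_def sum_3)

lemma inner_R2: "x \<bullet> y = x$1 * y$1 + x$2 * y$2" for x y :: "real^2"
  by (simp add: inner_vec_def sum_2)

lemma level_chart_exists:
  assumes b: "C1_alpha_boundary \<alpha> \<Omega>" and P0: "P0 \<in> frontier \<Omega>" and \<alpha>: "0 < \<alpha>"
  shows "\<exists>r \<Phi> D L. level_chart \<Omega> \<alpha> P0 r \<Phi> D L"
proof -
  obtain r Q \<gamma> G L where r: "r > 0" and Q: "orthogonal_transformation (Q :: R3 \<Rightarrow> R3)"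
    and \<gamma>: "\<forall>s :: real^2. (\<gamma> has_derivative (\<lambda>t. G s \<bullet> t)) (at s)"
    and G: "\<forall>s t. norm (G s - G t) \<le> L * norm (s - t) powr \<alpha>"
    and iff: "\<forall>y\<in>ball 0 r. P0 + Q y \<in> \<Omega> \<longleftrightarrow> \<gamma> (vector [y$1, y$2]) < y$3"
    using b[unfolded C1_alpha_boundary_def, rule_format, OF P0] by (elim exE conjE) (rule that; assumption)
  have Qlin: "linear Q" and Qinner: "\<And>x y. Q x \<bullet> Q y = x \<bullet> y"
    using Q unfolding orthogonal_transformation_def by auto
  have Qn: "norm (Q x) = norm x" for x using Q by (simp add: orthogonal_transformation_norm)
  have Qi: "orthogonal_transformation (inv Q)" using Q by (rule orthogonal_transformation_inv)
  have Qilin: "linear (inv Q)" using Qi unfolding orthogonal_transformation_def by auto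
  have Qin: "norm (inv Q x) = norm x" for x using Qi by (simp add: orthogonal_transformation_norm)
  have QQ: "Q (inv Q x) = x" for x
    using Q by (simp add: orthogonal_transformation_surj surj_f_inv_f)
  define p where "p y = (vector [y$1, y$2] :: real^2)" for y :: R3
  have pl: "linear p" unfolding p_def by (intro linearI) (simp_all add: vec_eq_iff forall_2 vector_2)
  have pn: "norm (p y) \<le> norm y" for y
    unfolding p_def norm_eq_sqrt_inner inner_R3 inner_R2 by (simp add: vector_2)
  \<comment> \<open>The gradient of y_3 - \<gamma>(y_1, y_2) in chart coordinates, g being the
    gradient of \<gamma>. Its last entry 1 gives the lower bound on the norm.\<close>
  define W where "W g = (vector [- g$1, - g$2, 1] :: R3)" for g :: "real^2"
  have Wi: "W g \<bullet> y = y$3 - g \<bullet> p y" for g y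
    unfolding W_def p_def inner_R3 inner_R2 by (simp add: vector_2 vector_3)
  have Wd: "norm (W g - W g') = norm (g - g')" for g g'
    unfolding W_def norm_eq_sqrt_inner inner_R3 inner_R2 by (simp add: vector_2 vector_3 power2_eq_square[symmetric] power2_commute)
  have Wn: "norm (W g) \<ge> 1" for g
    unfolding W_def norm_eq_sqrt_inner inner_R3 by (simp add: vector_3)
  define Y where "Y X = inv Q (X - P0)" for X
  define \<Phi> where "\<Phi> X = Y X $ 3 - \<gamma> (p (Y X))" for X
  define D where "D X = Q (W (G (p (Y X))))" for X
  have Yd: "(Y has_derivative inv Q) (at X)" for X
    unfolding Y_def
    by (rule has_derivative_compose[where g="inv Q" and f="\<lambda>X. X - P0" and f'="\<lambda>h. h" , simplified])
       (auto intro!: derivative_eq_intros bounded_linear_imp_has_derivative linear_conv_bounded_linear[THEN iffD1] Qilin)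
  have Dh: "D X \<bullet> h = W (G (p (Y X))) \<bullet> inv Q h" for X h
    unfolding D_def by (subst (1) QQ[of h, symmetric]) (rule Qinner)
  have "(\<Phi> has_derivative (\<lambda>h. D X \<bullet> h)) (at X)" for X
  proof -
    have "((\<lambda>X. p (Y X)) has_derivative (\<lambda>h. p (inv Q h))) (at X)"
      by (rule bounded_linear.has_derivative[OF _ Yd]) (use pl in \<open>simp add: linear_conv_bounded_linear\<close>)
    then have "((\<lambda>X. \<gamma> (p (Y X))) has_derivative (\<lambda>h. G (p (Y X)) \<bullet> p (inv Q h))) (at X)"
      by (rule has_derivative_compose) (use \<gamma> in blast)
    moreover have "((\<lambda>X. Y X $ 3) has_derivative (\<lambda>h. inv Q h $ 3)) (at X)"
      by (rule bounded_linear.has_derivative[OF bounded_linear_vec_nth Yd])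
    ultimately have "((\<lambda>X. Y X $ 3 - \<gamma> (p (Y X))) has_derivative (\<lambda>h. inv Q h $ 3 - G (p (Y X)) \<bullet> p (inv Q h))) (at X)"
      by (intro has_derivative_diff)
    then show ?thesis unfolding Dh Wi \<Phi>_def .
  qed
  moreover have "norm (D X - D X') \<le> \<bar>L\<bar> * norm (X - X') powr \<alpha>" for X X'
  proof -
    have "norm (D X - D X') = norm (W (G (p (Y X))) - W (G (p (Y X'))))"
      unfolding D_def linear_diff[OF Qlin, symmetric] Qn ..
    also have "\<dots> \<le> L * norm (p (Y X) - p (Y X')) powr \<alpha>" unfolding Wd using G by blast
    also have "\<dots> \<le> \<bar>L\<bar> * norm (p (Y X) - p (Y X')) powr \<alpha>" by (intro mult_right_mono) auto
    also have "\<dots> \<le> \<bar>L\<bar> * norm (X - X') powr \<alpha>"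
    proof (intro mult_left_mono powr_mono2)
      have "norm (p (Y X) - p (Y X')) \<le> norm (Y X - Y X')"
        unfolding linear_diff[OF pl, symmetric] by (rule pn)
      also have "\<dots> = norm (X - X')"
        unfolding Y_def linear_diff[OF Qilin, symmetric] Qin by simp
      finally show "norm (p (Y X) - p (Y X')) \<le> norm (X - X')" .
    qed (use \<alpha> in auto)
    finally show ?thesis .
  qed
  moreover have "norm (D X) \<ge> 1" for X unfolding D_def Qn by (rule Wn)
  moreover have "X \<in> \<Omega> \<longleftrightarrow> \<Phi> X > 0" if "X \<in> ball P0 r" for X
  proof -
    have "norm (Y X) < r" using that unfolding Y_def Qin by (simp add: dist_norm norm_minus_commute)
    then have "P0 + Q (Y X) \<in> \<Omega> \<longleftrightarrow> \<gamma> (p (Y X)) < Y X $ 3" using iff unfolding p_def by simp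
    moreover have "P0 + Q (Y X) = X" unfolding Y_def QQ by simp
    ultimately show ?thesis unfolding \<Phi>_def by simp
  qed
  ultimately have "level_chart \<Omega> \<alpha> P0 r \<Phi> D \<bar>L\<bar>" using r unfolding level_chart_def by simp
  then show ?thesis by blast
qed

lemma eventually_pos_direction:
  fixes \<Phi> :: "R3 \<Rightarrow> real"
  assumes "(\<Phi> has_derivative (\<lambda>h. D \<bullet> h)) (at P)" "\<Phi> P = 0" "D \<bullet> v > 0"
  shows "\<forall>\<^sub>F t in at_right 0. \<Phi> (P + t *\<^sub>R v) > 0"
proof -
  have "((\<lambda>t. (\<Phi> (P + t *\<^sub>R v) - \<Phi> P) /\<^sub>R t) \<longlongrightarrow> D \<bullet> v) (at 0)"
    by (rule has_derivative_directional[OF assms(1)])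
  then have "((\<lambda>t. (\<Phi> (P + t *\<^sub>R v) - \<Phi> P) /\<^sub>R t) \<longlongrightarrow> D \<bullet> v) (at_right 0)"
    by (rule filterlim_mono) (simp_all add: at_le)
  then have "\<forall>\<^sub>F t in at_right 0. (\<Phi> (P + t *\<^sub>R v) - \<Phi> P) /\<^sub>R t > 0"
    using assms(3) order_tendstoD(1) by blast
  moreover have "\<forall>\<^sub>F t :: real in at_right 0. t > 0" by (rule eventually_at_right_less)
  ultimately show ?thesis
    by eventually_elim (use assms(2) in \<open>simp add: zero_less_mult_iff\<close>)
qed

lemma eventually_neg_direction:
  fixes \<Phi> :: "R3 \<Rightarrow> real"
  assumes "(\<Phi> has_derivative (\<lambda>h. D \<bullet> h)) (at P)" "\<Phi> P = 0" "D \<bullet> v < 0"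
  shows "\<forall>\<^sub>F t in at_right 0. \<Phi> (P + t *\<^sub>R v) < 0"
proof -
  have "((\<lambda>X. - \<Phi> X) has_derivative (\<lambda>h. (- D) \<bullet> h)) (at P)"
    using has_derivative_minus[OF assms(1)] by simp
  from eventually_pos_direction[OF this] show ?thesis using assms by simp
qed

lemma eventually_in_ball_direction:
  fixes P v :: R3
  assumes "P \<in> ball P0 r" shows "\<forall>\<^sub>F t in at_right 0. P + t *\<^sub>R v \<in> ball P0 r"
proof -
  have "((\<lambda>t. P + t *\<^sub>R v) \<longlongrightarrow> P + 0 *\<^sub>R v) (at_right 0)"
    by (intro tendsto_intros)
  then show ?thesis using topological_tendstoD[OF _ open_ball, of _ P] assms by simp
qed

context
  fixes \<Omega> \<alpha> P0 r \<Phi> D L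
  assumes ch: "level_chart \<Omega> \<alpha> P0 r \<Phi> D L" and op: "open \<Omega>" and \<alpha>0: "0 < \<alpha>"
begin

lemma chart_deriv: "(\<Phi> has_derivative (\<lambda>h. D X \<bullet> h)) (at X)"
  and chart_Hoelder: "norm (D X - D Y) \<le> L * norm (X - Y) powr \<alpha>"
  and chart_norm: "norm (D X) \<ge> 1"
  and chart_iff: "X \<in> ball P0 r \<Longrightarrow> X \<in> \<Omega> \<longleftrightarrow> \<Phi> X > 0"
  and chart_L: "L \<ge> 0"
  using ch unfolding level_chart_def by auto

lemma chart_continuous_on: "continuous_on S \<Phi>"
  by (intro continuous_at_imp_continuous_on ballI has_derivative_continuous[OF chart_deriv])

lemma chart_nz: "D X \<noteq> 0" "D X \<bullet> D X > 0" "norm (D X) > 0"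
  using chart_norm[of X] by auto

lemma chart_neg_not_closure:
  assumes "X \<in> ball P0 r" "\<Phi> X < 0" shows "X \<notin> closure \<Omega>"
proof -
  let ?N = "ball P0 r \<inter> \<Phi> -` {..<0}"
  have o: "open ?N"
    by (rule continuous_open_preimage[OF chart_continuous_on]) simp_all
  have "?N \<inter> \<Omega> = {}"
  proof -
    have "Y \<notin> \<Omega>" if "Y \<in> ?N" for Y
      using that chart_iff[of Y] by simp
    then show ?thesis by blast
  qed
  then have "?N \<inter> closure \<Omega> = {}" using open_Int_closure_eq_empty[OF o] by blast
  then show ?thesis using assms by blast
qed

text \<open>A zero of \<Phi> lies outside \<Omega> but is reached from inside along the gradient;
  where \<Phi> is negative, a whole neighbourhood misses \<Omega>.\<close>

lemma chart_frontier_iff: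
  assumes X: "X \<in> ball P0 r" shows "X \<in> frontier \<Omega> \<longleftrightarrow> \<Phi> X = 0"
proof
  assume "X \<in> frontier \<Omega>"
  then have "X \<in> closure \<Omega>" "X \<notin> \<Omega>" using op by (auto simp: frontier_def interior_open)
  then show "\<Phi> X = 0" using chart_neg_not_closure[OF X] chart_iff[OF X] by linarith
next
  assume 0: "\<Phi> X = 0"
  have "\<forall>\<^sub>F t in at_right 0. \<Phi> (X + t *\<^sub>R D X) > 0"
    by (rule eventually_pos_direction[OF chart_deriv 0 chart_nz(2)])
  then have ev: "\<forall>\<^sub>F t in at_right 0. X + t *\<^sub>R D X \<in> \<Omega>"
    using eventually_in_ball_direction[OF X, of "D X"] by eventually_elim (simp add: chart_iff)
  have "((\<lambda>t. X + t *\<^sub>R D X) \<longlongrightarrow> X + 0 *\<^sub>R D X) (at_right 0)" by (intro tendsto_intros)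
  then have "X \<in> closure \<Omega>"
    by (intro Lim_in_closed_set[OF closed_closure, of "\<lambda>t. X + t *\<^sub>R D X" \<Omega> "at_right 0" X] eventually_mono[OF ev])
       (use closure_subset in simp_all, blast)
  moreover have "X \<notin> \<Omega>" using chart_iff[OF X] 0 by simp
  ultimately show "X \<in> frontier \<Omega>" using op by (simp add: frontier_def interior_open)
qed

text \<open>Tangent directions are limits of chords of the boundary: \<Phi> has opposite signs in
  the directions w + cD and w - cD, and the intermediate value theorem finds a zero between them. It
  does the work of an implicit function theorem.\<close>

lemma chart_tangent_approach:
  assumes P: "P \<in> ball P0 r" "\<Phi> P = 0" and w: "D P \<bullet> w = 0" "w \<noteq> 0" and c: "c > 0"
  shows "\<exists>t s. 0 < t \<and> t < c \<and> \<bar>s\<bar> \<le> c \<and> P + t *\<^sub>R (w + s *\<^sub>R D P) \<in> frontier \<Omega>"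
proof -
  have "\<forall>\<^sub>F t in at_right 0. \<Phi> (P + t *\<^sub>R (w + c *\<^sub>R D P)) > 0"
    by (rule eventually_pos_direction[OF chart_deriv P(2)]) (simp add: inner_add_right w c chart_nz)
  moreover have "\<forall>\<^sub>F t in at_right 0. \<Phi> (P + t *\<^sub>R (w + (-c) *\<^sub>R D P)) < 0"
    by (rule eventually_neg_direction[OF chart_deriv P(2)]) (use c chart_nz(2)[of P] in \<open>simp add: inner_add_right inner_diff_right w(1)\<close>)
  moreover have "\<forall>\<^sub>F t in at_right 0. P + t *\<^sub>R (w + c *\<^sub>R D P) \<in> ball P0 r" "\<forall>\<^sub>F t in at_right 0. P + t *\<^sub>R (w + (-c) *\<^sub>R D P) \<in> ball P0 r"
    by (intro eventually_in_ball_direction P(1))+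
  moreover have "\<forall>\<^sub>F t in at_right 0. 0 < t \<and> t < c"
    using c by (simp add: eventually_at_right_field) blast
  ultimately have "\<forall>\<^sub>F t in at_right 0. \<Phi> (P + t *\<^sub>R (w + c *\<^sub>R D P)) > 0 \<and> \<Phi> (P + t *\<^sub>R (w + (-c) *\<^sub>R D P)) < 0
      \<and> P + t *\<^sub>R (w + c *\<^sub>R D P) \<in> ball P0 r \<and> P + t *\<^sub>R (w + (-c) *\<^sub>R D P) \<in> ball P0 r \<and> 0 < t \<and> t < c"
    by eventually_elim blast
  then obtain t where t: "\<Phi> (P + t *\<^sub>R (w + c *\<^sub>R D P)) > 0" "\<Phi> (P + t *\<^sub>R (w + (-c) *\<^sub>R D P)) < 0"
     "P + t *\<^sub>R (w + c *\<^sub>R D P) \<in> ball P0 r" "P + t *\<^sub>R (w + (-c) *\<^sub>R D P) \<in> ball P0 r" "0 < t" "t < c"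
    using eventually_happens[of _ "at_right (0::real)"] trivial_limit_at_right_real by blast
  have "\<exists>s. -c \<le> s \<and> s \<le> c \<and> \<Phi> (P + t *\<^sub>R (w + s *\<^sub>R D P)) = 0"
    by (rule IVT') (use t c in \<open>auto intro!: continuous_intros continuous_on_compose2[OF chart_continuous_on[of UNIV]]\<close>)
  then obtain s where s: "-c \<le> s" "s \<le> c" "\<Phi> (P + t *\<^sub>R (w + s *\<^sub>R D P)) = 0" by blast
  have "P + t *\<^sub>R (w + s *\<^sub>R D P) \<in> ball P0 r"
  proof -
    define u where "u = (s + c) / (2 * c)"
    have u: "0 \<le> u" "u \<le> 1" unfolding u_def using s c by simp_all
    have su: "s = u * c + (1 - u) * (-c)" unfolding u_def using c by (simp add: field_simps)
    have "u *\<^sub>R (P + t *\<^sub>R (w + c *\<^sub>R D P)) + (1 - u) *\<^sub>R (P + t *\<^sub>R (w + (-c) *\<^sub>R D P)) \<in> ball P0 r"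
      using convexD[OF convex_ball t(3) t(4), of u "1 - u"] u by simp
    also have "u *\<^sub>R (P + t *\<^sub>R (w + c *\<^sub>R D P)) + (1 - u) *\<^sub>R (P + t *\<^sub>R (w + (-c) *\<^sub>R D P)) = P + t *\<^sub>R (w + s *\<^sub>R D P)"
      unfolding su by (simp add: vec_eq_iff algebra_simps)
    finally show ?thesis .
  qed
  then have "P + t *\<^sub>R (w + s *\<^sub>R D P) \<in> frontier \<Omega>" using chart_frontier_iff s(3) by blast
  then show ?thesis using t(5,6) s(1,2) by (intro exI[of _ t] exI[of _ s]) auto
qed

text \<open>\<open>outer_normal\<close> is a definite description, so existence and uniqueness are
  both shown. A candidate is orthogonal to every tangent vector, because these are limits of chord
  directions; hence it is a multiple of D(P), and the side condition fixes the sign.\<close>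

lemma outer_normal_chart:
  assumes P: "P \<in> frontier \<Omega>" "P \<in> ball P0 r"
  shows "outer_normal \<Omega> P = - (D P /\<^sub>R norm (D P))"
proof -
  let ?\<nu> = "- (D P /\<^sub>R norm (D P))"
  have P0: "\<Phi> P = 0" using chart_frontier_iff[OF P(2)] P(1) by blast
  have n1: "norm ?\<nu> = 1" using chart_nz[of P] by simp
  have D\<nu>: "D P \<bullet> ?\<nu> = - norm (D P)"
    using chart_nz(3)[of P] by (simp add: power2_norm_eq_inner[symmetric] power2_eq_square)
  have t2: "((\<lambda>X. ((X - P) \<bullet> ?\<nu>) / norm (X - P)) \<longlongrightarrow> 0) (at P within frontier \<Omega>)"
  proof -
    have "(\<Phi> has_derivative (\<lambda>h. D P \<bullet> h)) (at P within frontier \<Omega>)"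
      by (rule has_derivative_at_withinI[OF chart_deriv])
    then have "((\<lambda>X. norm ((\<Phi> X - \<Phi> P) - D P \<bullet> (X - P)) / norm (X - P)) \<longlongrightarrow> 0) (at P within frontier \<Omega>)"
      unfolding has_derivative_iff_norm by blast
    then have "((\<lambda>X. (norm ((\<Phi> X - \<Phi> P) - D P \<bullet> (X - P)) / norm (X - P)) / norm (D P)) \<longlongrightarrow> 0 / norm (D P)) (at P within frontier \<Omega>)"
      by (intro tendsto_divide tendsto_const) (use chart_nz(3)[of P] in auto)
    moreover have "\<forall>\<^sub>F X in at P within frontier \<Omega>.
        (norm ((\<Phi> X - \<Phi> P) - D P \<bullet> (X - P)) / norm (X - P)) / norm (D P) = norm (((X - P) \<bullet> ?\<nu>) / norm (X - P))"
    proof -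
      have "\<forall>\<^sub>F X in at P within frontier \<Omega>. X \<in> ball P0 r \<and> X \<in> frontier \<Omega>"
        using P(2) open_ball by (auto simp: eventually_at_topological)
      then show ?thesis
      proof (rule eventually_mono)
        fix X assume X: "X \<in> ball P0 r \<and> X \<in> frontier \<Omega>"
        then have "\<Phi> X = 0" using chart_frontier_iff by blast
        then show "(norm ((\<Phi> X - \<Phi> P) - D P \<bullet> (X - P)) / norm (X - P)) / norm (D P) = norm (((X - P) \<bullet> ?\<nu>) / norm (X - P))"
          by (simp add: P0 abs_mult inner_commute divide_inverse mult_ac)
      qed
    qed
    ultimately have "((\<lambda>X. norm (((X - P) \<bullet> ?\<nu>) / norm (X - P))) \<longlongrightarrow> 0) (at P within frontier \<Omega>)"
      using Lim_transform_eventually by force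
    then show ?thesis by (rule tendsto_norm_zero_cancel)
  qed
  have t3a: "\<forall>\<^sub>F t in at_right 0. P - t *\<^sub>R ?\<nu> \<in> \<Omega>"
  proof -
    have "\<forall>\<^sub>F t in at_right 0. \<Phi> (P + t *\<^sub>R (- ?\<nu>)) > 0"
      by (rule eventually_pos_direction[OF chart_deriv P0]) (use D\<nu> chart_nz(3)[of P] in simp)
    then show ?thesis using eventually_in_ball_direction[OF P(2), of "- ?\<nu>"]
      by eventually_elim (use chart_iff in auto)
  qed
  have t3b: "\<forall>\<^sub>F t in at_right 0. P + t *\<^sub>R ?\<nu> \<notin> closure \<Omega>"
  proof -
    have "\<forall>\<^sub>F t in at_right 0. \<Phi> (P + t *\<^sub>R ?\<nu>) < 0"
      by (rule eventually_neg_direction[OF chart_deriv P0]) (use D\<nu> chart_nz(3)[of P] in simp)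
    then show ?thesis using eventually_in_ball_direction[OF P(2), of "?\<nu>"]
      by eventually_elim (use chart_neg_not_closure in auto)
  qed
  show ?thesis unfolding outer_normal_def
  proof (rule the_equality)
    show "norm ?\<nu> = 1 \<and> ((\<lambda>X. ((X - P) \<bullet> ?\<nu>) / norm (X - P)) \<longlongrightarrow> 0) (at P within frontier \<Omega>) \<and>
      (\<forall>\<^sub>F t in at_right 0. P - t *\<^sub>R ?\<nu> \<in> \<Omega> \<and> P + t *\<^sub>R ?\<nu> \<notin> closure \<Omega>)"
      using n1 t2 eventually_conj[OF t3a t3b] by blast
  next
    fix \<nu> assume \<nu>: "norm \<nu> = 1 \<and> ((\<lambda>X. ((X - P) \<bullet> \<nu>) / norm (X - P)) \<longlongrightarrow> 0) (at P within frontier \<Omega>) \<and>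
      (\<forall>\<^sub>F t in at_right 0. P - t *\<^sub>R \<nu> \<in> \<Omega> \<and> P + t *\<^sub>R \<nu> \<notin> closure \<Omega>)"
    have tang: "w \<bullet> \<nu> = 0" if w: "D P \<bullet> w = 0" "w \<noteq> 0" for w
    proof -
      define c where "c n = 1 / real (Suc n)" for n
      have c: "c n > 0" for n unfolding c_def by simp
      have c0: "c \<longlonglongrightarrow> 0" unfolding c_def by (rule LIMSEQ_Suc[OF lim_1_over_n])
      have "\<forall>n. \<exists>t s. 0 < t \<and> t < c n \<and> \<bar>s\<bar> \<le> c n \<and> P + t *\<^sub>R (w + s *\<^sub>R D P) \<in> frontier \<Omega>"
        using chart_tangent_approach[OF P(2) P0 w c] by blast
      then obtain t s where ts: "\<And>n. 0 < t n" "\<And>n. t n < c n" "\<And>n. \<bar>s n\<bar> \<le> c n"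
          "\<And>n. P + t n *\<^sub>R (w + s n *\<^sub>R D P) \<in> frontier \<Omega>" by metis
      have t0: "t \<longlonglongrightarrow> 0"
        by (rule tendsto_sandwich[OF _ _ tendsto_const c0]) (intro always_eventually allI less_imp_le ts)+
      have s0: "s \<longlonglongrightarrow> 0"
        by (rule Lim_null_comparison[OF _ c0]) (use ts(3) in auto)
      let ?X = "\<lambda>n. P + t n *\<^sub>R (w + s n *\<^sub>R D P)"
      have nz: "w + a *\<^sub>R D P \<noteq> 0" for a
      proof
        assume "w + a *\<^sub>R D P = 0"
        then have "w \<bullet> (w + a *\<^sub>R D P) = 0" by simp
        then have "w \<bullet> w = 0" using w(1) by (simp add: inner_add_right inner_commute)
        then show False using w(2) by simp
      qed
      have "?X \<longlonglongrightarrow> P + 0 *\<^sub>R (w + 0 *\<^sub>R D P)" by (intro tendsto_intros t0 s0)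
      then have "filterlim ?X (at P within frontier \<Omega>) sequentially"
        unfolding filterlim_at using ts(1,4) nz by (auto intro!: always_eventually simp: less_imp_neq[symmetric])
      then have "(\<lambda>n. ((?X n - P) \<bullet> \<nu>) / norm (?X n - P)) \<longlonglongrightarrow> 0"
        using \<nu> filterlim_compose[of "\<lambda>X. ((X - P) \<bullet> \<nu>) / norm (X - P)"] by blast
      moreover have "((?X n - P) \<bullet> \<nu>) / norm (?X n - P) = ((w + s n *\<^sub>R D P) \<bullet> \<nu>) / norm (w + s n *\<^sub>R D P)" for n
        using ts(1)[of n] by simp
      ultimately have "(\<lambda>n. ((w + s n *\<^sub>R D P) \<bullet> \<nu>) / norm (w + s n *\<^sub>R D P)) \<longlonglongrightarrow> 0" by simp
      moreover have "(\<lambda>n. ((w + s n *\<^sub>R D P) \<bullet> \<nu>) / norm (w + s n *\<^sub>R D P)) \<longlonglongrightarrow> ((w + 0 *\<^sub>R D P) \<bullet> \<nu>) / norm (w + 0 *\<^sub>R D P)"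
        by (intro tendsto_intros s0) (use w in simp)
      ultimately have "(w \<bullet> \<nu>) / norm w = 0" using LIMSEQ_unique by force
      then show ?thesis using w(2) by simp
    qed
    \<comment> \<open>After removal of its component along the gradient, the rest of \<nu> is
      tangent, hence orthogonal both to \<nu> and to the gradient, and therefore 0.\<close>
    define k where "k = (\<nu> \<bullet> D P) / (D P \<bullet> D P)"
    have "D P \<bullet> (\<nu> - k *\<^sub>R D P) = 0"
      unfolding k_def using chart_nz[of P] by (simp add: inner_diff_right inner_commute)
    moreover have "(\<nu> - k *\<^sub>R D P) \<bullet> (\<nu> - k *\<^sub>R D P) = (\<nu> - k *\<^sub>R D P) \<bullet> \<nu> - k * (D P \<bullet> (\<nu> - k *\<^sub>R D P))"
      by (simp add: inner_diff_right inner_diff_left inner_commute algebra_simps)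
    ultimately have "\<nu> - k *\<^sub>R D P = 0" using tang[of "\<nu> - k *\<^sub>R D P"] by fastforce
    then have \<nu>k: "\<nu> = k *\<^sub>R D P" by simp
    then have "\<bar>k\<bar> * norm (D P) = 1" using \<nu> by simp
    then have "k = 1 / norm (D P) \<or> k = - (1 / norm (D P))" using chart_nz(3)[of P] by (auto simp: field_simps abs_if split: if_splits)
    then show "\<nu> = ?\<nu>"
    proof
      \<comment> \<open>The wrong sign would put small outward steps inside \<Omega>, against
        \<open>t3b\<close>.\<close>
      assume "k = 1 / norm (D P)"
      then have "\<nu> = - ?\<nu>" using \<nu>k by (simp add: inverse_eq_divide)
      then have "\<forall>\<^sub>F t in at_right 0. P + t *\<^sub>R ?\<nu> \<in> \<Omega>" using \<nu> by (auto elim!: eventually_mono)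
      then have "\<forall>\<^sub>F t :: real in at_right 0. False"
        using t3b by eventually_elim (use closure_subset in blast)
      then show ?thesis by simp
    next
      assume "k = - (1 / norm (D P))"
      then show ?thesis using \<nu>k by (simp add: inverse_eq_divide)
    qed
  qed
qed

lemma inner_outer_normal_chart:
  assumes "P \<in> frontier \<Omega>" "P \<in> ball P0 r"
  shows "Y \<bullet> outer_normal \<Omega> P = - ((D P \<bullet> Y) / norm (D P))"
  unfolding outer_normal_chart[OF assms] inner_minus_right inner_scaleR_right
  unfolding inner_commute[of Y "D P"] divide_inverse mult.commute[of "D P \<bullet> Y"] ..

text \<open>Both points lie on the zero level, so by the mean value theorem the gradient at some
  point of the chord is orthogonal to the chord. Hoelder continuity compares it with the gradient at
  P and gains the factor |P - X|^\<alpha>.\<close>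

lemma chart_normal_estimate:
  assumes P: "P \<in> frontier \<Omega>" "P \<in> ball P0 r" and X: "X \<in> frontier \<Omega>" "X \<in> ball P0 r"
  shows "\<bar>(P - X) \<bullet> outer_normal \<Omega> P\<bar> \<le> L * norm (P - X) powr (1 + \<alpha>)"
proof -
  have 0: "\<Phi> P = 0" "\<Phi> X = 0" using chart_frontier_iff[OF P(2)] chart_frontier_iff[OF X(2)] P(1) X(1) by blast+
  have d: "((\<lambda>t. \<Phi> (P + t *\<^sub>R (X - P))) has_derivative (\<lambda>s. D (P + t *\<^sub>R (X - P)) \<bullet> (s *\<^sub>R (X - P)))) (at t within {0..1})" for t
    by (rule has_derivative_compose[where f="\<lambda>t. P + t *\<^sub>R (X - P)" and g=\<Phi>, OF _ chart_deriv])
       (auto intro!: derivative_eq_intros)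
  have "\<exists>t\<in>{0..1}. \<Phi> (P + 1 *\<^sub>R (X - P)) - \<Phi> (P + 0 *\<^sub>R (X - P)) = D (P + t *\<^sub>R (X - P)) \<bullet> ((1 - 0) *\<^sub>R (X - P))"
    by (rule mvt_very_simple[of 0 1 "\<lambda>t. \<Phi> (P + t *\<^sub>R (X - P))", OF zero_le_one d])
  then obtain t where t: "0 \<le> t" "t \<le> 1" "D (P + t *\<^sub>R (X - P)) \<bullet> (X - P) = 0"
    using 0 by (auto simp del: inner_diff_right)
  have "\<bar>D P \<bullet> (X - P)\<bar> = \<bar>(D (P + t *\<^sub>R (X - P)) - D P) \<bullet> (X - P)\<bar>"
    using t(3) by (simp add: inner_diff_left)
  also have "\<dots> \<le> norm (D (P + t *\<^sub>R (X - P)) - D P) * norm (X - P)" by (rule Cauchy_Schwarz_ineq2)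
  also have "\<dots> \<le> (L * norm (X - P) powr \<alpha>) * norm (X - P)"
  proof (rule mult_right_mono)
    have "norm (D (P + t *\<^sub>R (X - P)) - D P) \<le> L * norm (P + t *\<^sub>R (X - P) - P) powr \<alpha>" by (rule chart_Hoelder)
    also have "\<dots> \<le> L * norm (X - P) powr \<alpha>"
    proof (intro mult_left_mono powr_mono2 chart_L)
      show "norm (P + t *\<^sub>R (X - P) - P) \<le> norm (X - P)"
        using t(1,2) mult_right_mono[OF t(2), of "norm (X - P)"] by simp
    qed (use \<alpha>0 in simp_all)
    finally show "norm (D (P + t *\<^sub>R (X - P)) - D P) \<le> L * norm (X - P) powr \<alpha>" .
  qed simp
  also have "\<dots> = L * norm (P - X) powr (1 + \<alpha>)"
    by (cases "X = P") (simp_all add: powr_add norm_minus_commute)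
  finally have e: "\<bar>D P \<bullet> (X - P)\<bar> \<le> L * norm (P - X) powr (1 + \<alpha>)" .
  have "\<bar>(P - X) \<bullet> outer_normal \<Omega> P\<bar> = \<bar>D P \<bullet> (X - P)\<bar> / norm (D P)"
  proof -
    have "D P \<bullet> (P - X) = - (D P \<bullet> (X - P))" unfolding inner_diff_right by linarith
    then have "(P - X) \<bullet> outer_normal \<Omega> P = (D P \<bullet> (X - P)) / norm (D P)"
      unfolding inner_outer_normal_chart[OF P] by (simp only: minus_divide_left minus_minus)
    then show ?thesis by (simp only: abs_divide abs_norm_cancel)
  qed
  also have "\<dots> \<le> \<bar>D P \<bullet> (X - P)\<bar> / 1"
    using chart_norm[of P] by (intro divide_left_mono) auto
  finally show ?thesis using e by linarith
qed

text \<open>If X lay beyond the tangent plane, the segment from P to X would start in the region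
  where \<Phi> is negative, outside the closure, although convexity keeps it inside.\<close>

lemma chart_support:
  assumes P: "P \<in> frontier \<Omega>" "P \<in> ball P0 r" and cv: "convex (closure \<Omega>)" and X: "X \<in> closure \<Omega>"
  shows "(X - P) \<bullet> outer_normal \<Omega> P \<le> 0"
proof (rule ccontr)
  assume "\<not> ?thesis"
  then have "0 < - ((D P \<bullet> (X - P)) / norm (D P))"
    unfolding inner_outer_normal_chart[OF P] by linarith
  then have neg: "D P \<bullet> (X - P) < 0"
    using chart_nz(3)[of P] divide_nonneg_pos[of "D P \<bullet> (X - P)" "norm (D P)"] by linarith
  have "\<Phi> P = 0" using chart_frontier_iff[OF P(2)] P(1) by blast
  from eventually_neg_direction[OF chart_deriv this neg]
  have "\<forall>\<^sub>F t in at_right 0. \<Phi> (P + t *\<^sub>R (X - P)) < 0" .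
  moreover have "\<forall>\<^sub>F t in at_right 0. P + t *\<^sub>R (X - P) \<in> ball P0 r" by (rule eventually_in_ball_direction[OF P(2)])
  moreover have "\<forall>\<^sub>F t :: real in at_right 0. 0 < t \<and> t < 1"
    using eventually_at_right_real[of 0 "1 :: real"] by (simp only: greaterThanLessThan_iff zero_less_one simp_thms)
  ultimately have "\<forall>\<^sub>F t :: real in at_right 0. False"
  proof eventually_elim
    case (elim t)
    have "(1 - t) *\<^sub>R P + t *\<^sub>R X \<in> closure \<Omega>"
      using elim(3) P(1) X by (intro convexD[OF cv]) (simp_all add: frontier_def)
    moreover have "(1 - t) *\<^sub>R P + t *\<^sub>R X = P + t *\<^sub>R (X - P)" by (simp add: algebra_simps)
    ultimately show ?case using chart_neg_not_closure[OF elim(2,1)] by simp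
  qed
  then show False by simp
qed

lemma chart_normal_continuous:
  assumes P: "P \<in> frontier \<Omega>" "P \<in> ball P0 r"
  shows "continuous (at P within frontier \<Omega>) (outer_normal \<Omega>)"
proof -
  have "(D \<longlongrightarrow> D P) (at P within frontier \<Omega>)"
  proof (rule Lim_null[THEN iffD2], rule Lim_null_comparison)
    show "\<forall>\<^sub>F X in at P within frontier \<Omega>. norm (D X - D P) \<le> L * norm (X - P) powr \<alpha>"
      by (intro always_eventually allI chart_Hoelder)
    have "((\<lambda>X. norm (X - P)) \<longlongrightarrow> norm (P - P)) (at P within frontier \<Omega>)" by (intro tendsto_intros)
    then have "((\<lambda>X. L * norm (X - P) powr \<alpha>) \<longlongrightarrow> L * 0 powr \<alpha>) (at P within frontier \<Omega>)"
      using \<alpha>0 by (intro tendsto_mult tendsto_const tendsto_powr2) (auto intro!: always_eventually)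
    then show "((\<lambda>X. L * norm (X - P) powr \<alpha>) \<longlongrightarrow> 0) (at P within frontier \<Omega>)" by simp
  qed
  then have "((\<lambda>X. - (D X /\<^sub>R norm (D X))) \<longlongrightarrow> - (D P /\<^sub>R norm (D P))) (at P within frontier \<Omega>)"
    by (intro tendsto_intros) (use chart_nz[of P] in auto)
  moreover have "\<forall>\<^sub>F X in at P within frontier \<Omega>. - (D X /\<^sub>R norm (D X)) = outer_normal \<Omega> X"
    using P(2) open_ball outer_normal_chart by (auto simp: eventually_at_topological intro!: exI[of _ "ball P0 r"])
  ultimately have "(outer_normal \<Omega> \<longlongrightarrow> - (D P /\<^sub>R norm (D P))) (at P within frontier \<Omega>)"
    by (rule Lim_transform_eventually)
  then show ?thesis unfolding continuous_within outer_normal_chart[OF P] .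
qed

lemma chart_normal_unit:
  assumes "P \<in> frontier \<Omega>" "P \<in> ball P0 r" shows "norm (outer_normal \<Omega> P) = 1"
  unfolding outer_normal_chart[OF assms] using chart_nz(3)[of P] by simp

end

section \<open>The surface measure of a convex domain\<close>

context
  fixes \<Omega> :: "R3 set" and \<alpha> :: real
  assumes op: "open \<Omega>" and bdd: "bounded \<Omega>" and bnd: "C1_alpha_boundary \<alpha> \<Omega>" and \<alpha>: "0 < \<alpha>"
begin

lemma outer_normal_unit:
  assumes "P \<in> frontier \<Omega>" shows "norm (outer_normal \<Omega> P) = 1"
proof -
  obtain r \<Phi> D L where ch: "level_chart \<Omega> \<alpha> P r \<Phi> D L" using level_chart_exists[OF bnd assms \<alpha>] by blast
  show ?thesis by (rule chart_normal_unit[OF ch op \<alpha> assms]) (use ch in \<open>simp add: level_chart_def\<close>)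
qed

lemma outer_normal_continuous_on: "continuous_on (frontier \<Omega>) (outer_normal \<Omega>)"
  unfolding continuous_on_eq_continuous_within
proof
  fix P assume P: "P \<in> frontier \<Omega>"
  obtain r \<Phi> D L where ch: "level_chart \<Omega> \<alpha> P r \<Phi> D L" using level_chart_exists[OF bnd P \<alpha>] by blast
  show "continuous (at P within frontier \<Omega>) (outer_normal \<Omega>)"
    by (rule chart_normal_continuous[OF ch op \<alpha> P]) (use ch in \<open>simp add: level_chart_def\<close>)
qed

lemma outer_normal_support:
  assumes P: "P \<in> frontier \<Omega>" and cv: "convex (closure \<Omega>)" and X: "X \<in> closure \<Omega>"
  shows "(X - P) \<bullet> outer_normal \<Omega> P \<le> 0"
proof -
  obtain r \<Phi> D L where ch: "level_chart \<Omega> \<alpha> P r \<Phi> D L" using level_chart_exists[OF bnd P \<alpha>] by blast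
  show ?thesis by (rule chart_support[OF ch op \<alpha> P _ cv X]) (use ch in \<open>simp add: level_chart_def\<close>)
qed

lemma compact_frontier_Omega: "compact (frontier \<Omega>)"
  using bdd by (simp add: compact_frontier_bounded)

text \<open>In a finite cover by charts of half radius, two points closer than d lie in one chart,
  where the local estimate holds. For distant points Cauchy-Schwarz suffices, because (|P -
  X|/d)^\<alpha> is at least 1.\<close>

lemma outer_normal_estimate:
  "\<exists>K\<ge>0. \<forall>P\<in>frontier \<Omega>. \<forall>X\<in>frontier \<Omega>. \<bar>(P - X) \<bullet> outer_normal \<Omega> P\<bar> \<le> K * norm (P - X) powr (1 + \<alpha>)"
proof -
  have "\<forall>P\<in>frontier \<Omega>. \<exists>r L. r > 0 \<and> L \<ge> 0 \<and> (\<forall>X\<in>frontier \<Omega> \<inter> ball P r. \<forall>Y\<in>frontier \<Omega> \<inter> ball P r.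
      \<bar>(X - Y) \<bullet> outer_normal \<Omega> X\<bar> \<le> L * norm (X - Y) powr (1 + \<alpha>))"
  proof
    fix P assume P: "P \<in> frontier \<Omega>"
    obtain r \<Phi> D L where ch: "level_chart \<Omega> \<alpha> P r \<Phi> D L" using level_chart_exists[OF bnd P \<alpha>] by blast
    then have "r > 0" "L \<ge> 0" unfolding level_chart_def by auto
    moreover have "\<forall>X\<in>frontier \<Omega> \<inter> ball P r. \<forall>Y\<in>frontier \<Omega> \<inter> ball P r.
      \<bar>(X - Y) \<bullet> outer_normal \<Omega> X\<bar> \<le> L * norm (X - Y) powr (1 + \<alpha>)"
      using chart_normal_estimate[OF ch op \<alpha>] by blast
    ultimately show "\<exists>r L. r > 0 \<and> L \<ge> 0 \<and> (\<forall>X\<in>frontier \<Omega> \<inter> ball P r. \<forall>Y\<in>frontier \<Omega> \<inter> ball P r.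
      \<bar>(X - Y) \<bullet> outer_normal \<Omega> X\<bar> \<le> L * norm (X - Y) powr (1 + \<alpha>))" by blast
  qed
  then obtain r L where rL: "\<And>P. P \<in> frontier \<Omega> \<Longrightarrow> r P > 0" "\<And>P. P \<in> frontier \<Omega> \<Longrightarrow> L P \<ge> 0"
    "\<And>P X Y. \<lbrakk>P \<in> frontier \<Omega>; X \<in> frontier \<Omega> \<inter> ball P (r P); Y \<in> frontier \<Omega> \<inter> ball P (r P)\<rbrakk> \<Longrightarrow>
      \<bar>(X - Y) \<bullet> outer_normal \<Omega> X\<bar> \<le> L P * norm (X - Y) powr (1 + \<alpha>)"
    by metis
  obtain C where C: "C \<subseteq> frontier \<Omega>" "finite C" "frontier \<Omega> \<subseteq> (\<Union>P\<in>C. ball P (r P / 2))"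
  proof (rule compactE_image[OF compact_frontier_Omega, of "frontier \<Omega>" "\<lambda>P. ball P (r P / 2)"])
    show "frontier \<Omega> \<subseteq> (\<Union>P\<in>frontier \<Omega>. ball P (r P / 2))" using rL(1) by auto
  qed auto
  define d where "d = Min (insert 1 ((\<lambda>P. r P / 2) ` C))"
  have d: "d > 0"
    unfolding d_def using C(2) rL(1) C(1) by (subst Min_gr_iff) auto
  have d2: "d \<le> r P / 2" if "P \<in> C" for P
    unfolding d_def using C(2) that by (intro Min_le) auto
  define K where "K = (\<Sum>P\<in>C. L P) + d powr (- \<alpha>)"
  have sL: "L P \<le> K" if "P \<in> C" for P
  proof -
    have "L P \<le> (\<Sum>P\<in>C. L P)" using C rL(2) that by (intro member_le_sum) auto
    moreover have "0 \<le> d powr (- \<alpha>)" by simp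
    ultimately show ?thesis unfolding K_def by linarith
  qed
  have sd: "d powr (- \<alpha>) \<le> K" unfolding K_def using C(1) rL(2) by (simp add: subset_iff sum_nonneg)
  have K0: "K \<ge> 0" by (rule order_trans[OF _ sd]) simp
  show ?thesis
  proof (intro exI[of _ K] conjI K0 ballI)
    fix P X assume P: "P \<in> frontier \<Omega>" and X: "X \<in> frontier \<Omega>"
    show "\<bar>(P - X) \<bullet> outer_normal \<Omega> P\<bar> \<le> K * norm (P - X) powr (1 + \<alpha>)"
    proof (cases "dist P X < d")
      case True
      obtain Q where Q: "Q \<in> C" "P \<in> ball Q (r Q / 2)" using C(3) P by blast
      have "dist Q X \<le> dist Q P + dist P X" by (rule dist_triangle)
      moreover have "dist Q P < r Q / 2" using Q(2) by simp
      ultimately have "P \<in> frontier \<Omega> \<inter> ball Q (r Q)" "X \<in> frontier \<Omega> \<inter> ball Q (r Q)"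
        using True d2[OF Q(1)] d P X by auto
      then have "\<bar>(P - X) \<bullet> outer_normal \<Omega> P\<bar> \<le> L Q * norm (P - X) powr (1 + \<alpha>)"
        using rL(3) C(1) Q(1) by blast
      also have "\<dots> \<le> K * norm (P - X) powr (1 + \<alpha>)" by (intro mult_right_mono sL Q(1)) simp
      finally show ?thesis .
    next
      case False
      then have n: "norm (P - X) \<ge> d" by (simp add: dist_norm)
      then have n0: "norm (P - X) > 0" using d by linarith
      have "\<bar>(P - X) \<bullet> outer_normal \<Omega> P\<bar> \<le> norm (P - X) * norm (outer_normal \<Omega> P)" by (rule Cauchy_Schwarz_ineq2)
      also have "\<dots> = norm (P - X) * 1" by (simp add: outer_normal_unit[OF P])
      also have "\<dots> \<le> norm (P - X) * (norm (P - X) / d) powr \<alpha>"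
        using n d \<alpha> by (intro mult_left_mono ge_one_powr_ge_zero) auto
      also have "\<dots> = d powr (- \<alpha>) * norm (P - X) powr (1 + \<alpha>)"
      proof -
        have "(norm (P - X) / d) powr \<alpha> = norm (P - X) powr \<alpha> / d powr \<alpha>"
          using n0 d by (simp only: powr_divide)
        moreover have "norm (P - X) powr (1 + \<alpha>) = norm (P - X) * norm (P - X) powr \<alpha>"
          using n0 by (simp add: powr_add)
        ultimately show ?thesis by (simp only: powr_minus divide_inverse mult_ac)
      qed
      also have "\<dots> \<le> K * norm (P - X) powr (1 + \<alpha>)" by (intro mult_right_mono sd) simp
      finally show ?thesis .
    qed
  qed
qed

end

section \<open>Upper bounds for the two-dimensional Hausdorff measure\<close>

lemma emeasure_hausdorff2_le: "emeasure hausdorff2 A \<le> hausdorff2_outer A"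
  \<comment> \<open>\<open>measure_of\<close> takes either the value of the given set function or 0;
    the inequality holds in both cases.\<close>
  unfolding hausdorff2_def by (subst emeasure_measure_of_conv) auto

text \<open>A finite cover is enumerated and padded with empty sets, of diameter 0, to fit the
  sequences in the definition.\<close>

lemma hausdorff2_outer_le_finite_cover:
  assumes cov: "\<And>\<delta>. \<delta> > 0 \<Longrightarrow> \<exists>(I :: 'i set) V. finite I \<and> A \<subseteq> (\<Union>i\<in>I. V i) \<and>
      (\<forall>i\<in>I. bounded (V i) \<and> diameter (V i) \<le> \<delta>) \<and> (\<Sum>i\<in>I. pi / 4 * (diameter (V i))\<^sup>2) \<le> B"
  shows "hausdorff2_outer A \<le> ennreal B"
  unfolding hausdorff2_outer_def
proof (rule SUP_least)
  fix \<delta> :: real assume "\<delta> \<in> {0<..}"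
  then obtain I :: "'i set" and V where I: "finite I" "A \<subseteq> (\<Union>i\<in>I. V i)"
      "\<And>i. i \<in> I \<Longrightarrow> bounded (V i)" "\<And>i. i \<in> I \<Longrightarrow> diameter (V i) \<le> \<delta>"
      "(\<Sum>i\<in>I. pi / 4 * (diameter (V i))\<^sup>2) \<le> B" and \<delta>: "\<delta> > 0" using cov[of \<delta>] by auto
  obtain h where h: "bij_betw h {0..<card I} I" using ex_bij_betw_nat_finite[OF I(1)] by blast
  define U where "U n = (if n < card I then V (h n) else {})" for n
  have hI: "h n \<in> I" if "n < card I" for n using h that by (auto simp: bij_betw_def)
  have cover: "A \<subseteq> (\<Union>n. U n)"
  proof
    fix x assume "x \<in> A"
    then obtain i where i: "i \<in> I" "x \<in> V i" using I(2) by blast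
    then obtain n where "n < card I" "h n = i"
      using h unfolding bij_betw_def by (metis atLeastLessThan_iff image_iff)
    then show "x \<in> (\<Union>n. U n)" using i by (auto simp: U_def)
  qed
  have UP: "bounded (U n) \<and> diameter (U n) \<le> \<delta>" for n
    using I(3,4) hI \<delta> by (auto simp: U_def)
  have "(INF U\<in>{U :: nat \<Rightarrow> R3 set. A \<subseteq> (\<Union>i. U i) \<and> (\<forall>i. bounded (U i) \<and> diameter (U i) \<le> \<delta>)}.
      suminf (\<lambda>i. ennreal (pi / 4 * (diameter (U i))\<^sup>2))) \<le> suminf (\<lambda>n. ennreal (pi / 4 * (diameter (U n))\<^sup>2))"
    by (rule INF_lower) (use cover UP in blast)
  also have "\<dots> = (\<Sum>n<card I. ennreal (pi / 4 * (diameter (U n))\<^sup>2))"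
    by (rule suminf_finite) (auto simp: U_def)
  also have "\<dots> = ennreal (\<Sum>n<card I. pi / 4 * (diameter (U n))\<^sup>2)" by (rule sum_ennreal) simp
  also have "(\<Sum>n<card I. pi / 4 * (diameter (U n))\<^sup>2) = (\<Sum>n\<in>{0..<card I}. pi / 4 * (diameter (V (h n)))\<^sup>2)"
    by (intro sum.cong) (auto simp: U_def)
  also have "\<dots> = (\<Sum>i\<in>I. pi / 4 * (diameter (V i))\<^sup>2)" by (rule sum.reindex_bij_betw[OF h])
  also have "ennreal \<dots> \<le> ennreal B" by (intro ennreal_leI I(5))
  finally show "(INF U\<in>{U :: nat \<Rightarrow> R3 set. A \<subseteq> (\<Union>i. U i) \<and> (\<forall>i. bounded (U i) \<and> diameter (U i) \<le> \<delta>)}.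
      suminf (\<lambda>i. ennreal (pi / 4 * (diameter (U i))\<^sup>2))) \<le> ennreal B" .
qed

text \<open>N^2 cells of side h = s/N have images of diameter at most 2h. Per patch the sum of
  \<pi>/4 (2h)^2 over the cells is \<pi> s^2, independent of N, so N can be taken as large as the
  mesh \<delta> demands.\<close>

lemma hausdorff2_outer_le_Lipschitz_patches:
  fixes g :: "'i \<Rightarrow> real \<Rightarrow> real \<Rightarrow> R3"
  assumes J: "finite J" and s: "s > 0"
    and A: "A \<subseteq> (\<Union>j\<in>J. \<Union>x\<in>{0..s}. \<Union>y\<in>{0..s}. {g j x y})"
    and lip: "\<And>j x y x' y'. dist (g j x y) (g j x' y') \<le> \<bar>x - x'\<bar> + \<bar>y - y'\<bar>"
  shows "hausdorff2_outer A \<le> ennreal (real (card J) * pi * s\<^sup>2)"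
proof (rule hausdorff2_outer_le_finite_cover)
  fix \<delta> :: real assume \<delta>: "\<delta> > 0"
  obtain N :: nat where N: "2 * s / \<delta> < real N" using reals_Archimedean2 by blast
  then have N0: "real N > 0" using s \<delta> by (meson divide_pos_pos less_trans mult_pos_pos zero_less_numeral)
  have N\<delta>: "2 * s / real N \<le> \<delta>" using N N0 \<delta> by (simp add: field_simps)
  define h where "h = s / real N"
  have h: "h > 0" unfolding h_def using s N0 by simp
  define V where "V p = (case p of (j, a, b) \<Rightarrow>
     {g j x y | x y. x \<in> {real a * h..real (Suc a) * h} \<and> y \<in> {real b * h..real (Suc b) * h}})" for p :: "'i \<times> nat \<times> nat"
  let ?I = "J \<times> {..<N} \<times> {..<N}"
  have dist: "dist u w \<le> 2 * h" if "u \<in> V p" "w \<in> V p" for u w p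
  proof -
    obtain j a b where p: "p = (j, a, b)" by (cases p)
    obtain x y x' y' where "u = g j x y" "w = g j x' y'"
      and r: "x \<in> {real a * h..real (Suc a) * h}" "y \<in> {real b * h..real (Suc b) * h}"
        "x' \<in> {real a * h..real (Suc a) * h}" "y' \<in> {real b * h..real (Suc b) * h}"
      using \<open>u \<in> V p\<close> \<open>w \<in> V p\<close> unfolding V_def p by auto
    then have "dist u w \<le> \<bar>x - x'\<bar> + \<bar>y - y'\<bar>" using lip by simp
    moreover have "\<bar>x - x'\<bar> \<le> h" "\<bar>y - y'\<bar> \<le> h" using r by (auto simp: algebra_simps abs_le_iff)
    ultimately show ?thesis by linarith
  qed
  have bV: "bounded (V p)" for p
    unfolding bounded_two_points using dist by blast
  have dV: "diameter (V p) \<le> 2 * h" for p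
    using dist h by (intro diameter_le) (auto simp: dist_norm)
  have cover: "A \<subseteq> (\<Union>p\<in>?I. V p)"
  proof
    fix u assume "u \<in> A"
    then obtain j x y where j: "j \<in> J" and x: "0 \<le> x" "x \<le> s" and y: "0 \<le> y" "y \<le> s" and u: "u = g j x y"
      using A by fastforce
    \<comment> \<open>The endpoint t = s is put into the last cell; the floor of t/h would give the
      index N there.\<close>
    have cell: "\<exists>a<N. t \<in> {real a * h..real (Suc a) * h}" if t: "0 \<le> t" "t \<le> s" for t
    proof (cases "t = s")
      case True
      have "N \<noteq> 0" using N0 by auto
      then have "s = real (Suc (N - 1)) * h" using N0 by (simp add: h_def)
      moreover have "real (N - 1) * h \<le> real (Suc (N - 1)) * h" using h by (intro mult_right_mono) auto
      ultimately show ?thesis using True \<open>N \<noteq> 0\<close> by (intro exI[of _ "N - 1"]) auto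
    next
      case False
      define a where "a = nat \<lfloor>t / h\<rfloor>"
      have th: "t / h \<ge> 0" using t h by simp
      have a: "real a \<le> t / h" "t / h < real (Suc a)"
        unfolding a_def using th by (simp_all add: of_nat_nat floor_less_cancel)
      have "t / h < s / h" using False t h by (intro divide_strict_right_mono) auto
      also have "s / h = real N" using s N0 by (simp add: h_def)
      finally have "a < N" using a(1) by linarith
      moreover have "real a * h \<le> t" "t \<le> real (Suc a) * h"
        using a h by (simp_all add: le_divide_eq divide_less_eq less_imp_le)
      ultimately show ?thesis by auto
    qed
    obtain a where "a < N" "x \<in> {real a * h..real (Suc a) * h}" using cell[OF x] by blast
    moreover obtain b where "b < N" "y \<in> {real b * h..real (Suc b) * h}" using cell[OF y] by blast
    ultimately have "u \<in> V (j, a, b)" "(j, a, b) \<in> ?I" using j u unfolding V_def by auto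
    then show "u \<in> (\<Union>p\<in>?I. V p)" by blast
  qed
  have "(\<Sum>p\<in>?I. pi / 4 * (diameter (V p))\<^sup>2) \<le> (\<Sum>p\<in>?I. pi / 4 * (2 * h)\<^sup>2)"
    using dV bV by (intro sum_mono mult_left_mono power_mono diameter_ge_0) auto
  also have "\<dots> = real (card J) * (real N * real N) * (pi * h\<^sup>2)"
    by (simp add: power_mult_distrib card_cartesian_product)
  also have "\<dots> = real (card J) * pi * s\<^sup>2" using N0 by (simp add: h_def power_divide power2_eq_square)
  finally have sum: "(\<Sum>p\<in>?I. pi / 4 * (diameter (V p))\<^sup>2) \<le> real (card J) * pi * s\<^sup>2" .
  show "\<exists>(I :: ('i \<times> nat \<times> nat) set) V. finite I \<and> A \<subseteq> (\<Union>i\<in>I. V i) \<and>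
      (\<forall>i\<in>I. bounded (V i) \<and> diameter (V i) \<le> \<delta>) \<and> (\<Sum>i\<in>I. pi / 4 * (diameter (V i))\<^sup>2) \<le> real (card J) * pi * s\<^sup>2"
  proof (intro exI[of _ ?I] exI[of _ V] conjI ballI)
    show "finite ?I" using J by simp
    show "diameter (V p) \<le> \<delta>" for p using dV[of p] N\<delta> by (simp add: h_def)
  qed (use cover bV sum in auto)
qed

text \<open>The pair selects the axis and the side of the face. The free coordinates are measured
  from the lower edge, so that on every face both parameters run through [0, 2r].\<close>

definition cube_face :: "R3 \<Rightarrow> real \<Rightarrow> nat \<times> bool \<Rightarrow> real \<Rightarrow> real \<Rightarrow> R3" where
  "cube_face P r q x y = (case q of (j, \<sigma>) \<Rightarrow> let e = (if \<sigma> then r else - r) in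
     if j = 0 then vector [P$1 + e, P$2 - r + x, P$3 - r + y]
     else if j = 1 then vector [P$1 - r + x, P$2 + e, P$3 - r + y]
     else vector [P$1 - r + x, P$2 - r + y, P$3 + e])"

lemma cube_face_Lipschitz: "dist (cube_face P r q x y) (cube_face P r q x' y') \<le> \<bar>x - x'\<bar> + \<bar>y - y'\<bar>"
proof -
  have "dist (cube_face P r q x y) (cube_face P r q x' y') \<le> (\<Sum>i\<in>UNIV. \<bar>(cube_face P r q x y - cube_face P r q x' y') $ i\<bar>)"
    unfolding dist_norm by (rule norm_le_l1_cart)
  also have "\<dots> \<le> \<bar>x - x'\<bar> + \<bar>y - y'\<bar>"
    by (cases q) (auto simp: cube_face_def sum_3 vector_3 Let_def)
  finally show ?thesis .
qed

lemma cube_frontier_subset_faces: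
  assumes X: "X \<in> frontier (cbox (P - (\<chi> i. r)) (P + (\<chi> i. r)))"
  shows "\<exists>q\<in>{..<3} \<times> UNIV. \<exists>x\<in>{0..2 * r}. \<exists>y\<in>{0..2 * r}. X = cube_face P r q x y"
proof -
  have c: "X \<in> cbox (P - (\<chi> i. r)) (P + (\<chi> i. r))" "X \<notin> box (P - (\<chi> i. r)) (P + (\<chi> i. r))"
    using X by (auto simp: frontier_def interior_cbox)
  have b: "P$i - r \<le> X$i" "X$i \<le> P$i + r" for i
    using c(1) by (auto simp: mem_box_cart)
  define p where "p i = X$i - P$i + r" for i
  have p: "p i \<in> {0..2*r}" for i using b[of i] by (simp add: p_def)
  obtain i where "X$i = P$i - r \<or> X$i = P$i + r"
    using c(2) b by (auto simp: mem_box_cart not_less) (metis order_antisym)+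
  then obtain \<sigma> where \<sigma>: "X$i = P$i + (if \<sigma> then r else - r)" by (metis add_uminus_conv_diff)
  consider "i = 1" | "i = 2" | "i = 3" using exhaust_3[of i] by blast
  then show ?thesis
  proof cases
    case 1
    then have "X = cube_face P r (0, \<sigma>) (p 2) (p 3)"
      using \<sigma> by (simp add: cube_face_def vec_eq_iff forall_3 vector_3 p_def)
    then show ?thesis using p by (intro bexI[of _ "(0, \<sigma>)"] bexI[of _ "p 2"] bexI[of _ "p 3"]) auto
  next
    case 2
    then have "X = cube_face P r (1, \<sigma>) (p 1) (p 3)"
      using \<sigma> by (simp add: cube_face_def vec_eq_iff forall_3 vector_3 p_def)
    then show ?thesis using p by (intro bexI[of _ "(1, \<sigma>)"] bexI[of _ "p 1"] bexI[of _ "p 3"]) auto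
  next
    case 3
    then have "X = cube_face P r (2, \<sigma>) (p 1) (p 2)"
      using \<sigma> by (simp add: cube_face_def vec_eq_iff forall_3 vector_3 p_def)
    then show ?thesis using p by (intro bexI[of _ "(2, \<sigma>)"] bexI[of _ "p 1"] bexI[of _ "p 2"]) auto
  qed
qed

text \<open>From a boundary point in the ball, the ray along the supporting normal leaves the cube around
  the ball; the nearest-point projection, which is 1-Lipschitz, maps its exit point back. So the
  boundary inside the ball is covered by the projections of the six faces.\<close>

lemma hausdorff2_outer_convex_frontier:
  assumes cl: "closed K" "convex K" "K \<noteq> {}"
    and sup: "\<And>Q. Q \<in> S \<Longrightarrow> Q \<in> K \<and> (\<exists>\<nu>. norm \<nu> = 1 \<and> (\<forall>Z\<in>K. (Z - Q) \<bullet> \<nu> \<le> 0))" and r: "r > 0"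
  shows "hausdorff2_outer (S \<inter> ball P r) \<le> ennreal (24 * pi * r\<^sup>2)"
proof -
  let ?C = "cbox (P - (\<chi> i. r)) (P + (\<chi> i. r))"
  let ?g = "\<lambda>q x y. closest_point K (cube_face P r q x y)"
  have "hausdorff2_outer (S \<inter> ball P r) \<le> ennreal (real (card ({..<3::nat} \<times> (UNIV :: bool set))) * pi * (2 * r)\<^sup>2)"
  proof (rule hausdorff2_outer_le_Lipschitz_patches[of _ _ _ ?g])
    show "S \<inter> ball P r \<subseteq> (\<Union>q\<in>{..<3} \<times> UNIV. \<Union>x\<in>{0..2 * r}. \<Union>y\<in>{0..2 * r}. {?g q x y})"
    proof
      fix Q assume Q: "Q \<in> S \<inter> ball P r"
      then obtain \<nu> where \<nu>: "norm \<nu> = 1" "\<And>Z. Z \<in> K \<Longrightarrow> (Z - Q) \<bullet> \<nu> \<le> 0" and QK: "Q \<in> K" using sup by blast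
      have Qi: "Q \<in> interior ?C"
      proof -
        have "\<bar>(Q - P) $ i\<bar> < r" for i
          using component_le_norm_cart[of "Q - P" i] Q by (simp add: dist_norm norm_minus_commute)
        then have c: "\<bar>Q $ i - P $ i\<bar> < r" for i by simp
        have "P $ i - r < Q $ i" "Q $ i < P $ i + r" for i
          using c[of i] by linarith+
        then show ?thesis unfolding interior_cbox mem_box_cart by simp
      qed
      have \<nu>0: "\<nu> \<noteq> 0" using \<nu>(1) by auto
      obtain d where d: "d > 0" "Q + d *\<^sub>R \<nu> \<in> frontier ?C"
        by (rule ray_to_frontier[OF bounded_cbox Qi \<nu>0])
      obtain q x y where q: "q \<in> {..<3} \<times> UNIV" "x \<in> {0..2 * r}" "y \<in> {0..2 * r}" "Q + d *\<^sub>R \<nu> = cube_face P r q x y"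
        using cube_frontier_subset_faces[OF d(2)] by blast
      have "Q = closest_point K (Q + d *\<^sub>R \<nu>)"
      proof (rule closest_point_unique[OF cl(2,1) QK], intro ballI)
        \<comment> \<open>Expanding the squared distance from Q + d\<nu> to Z, the cross term is
          nonpositive by the support inequality, so Z is at distance at least d.\<close>
        fix Z assume Z: "Z \<in> K"
        have "d\<^sup>2 \<le> d\<^sup>2 * (\<nu> \<bullet> \<nu>) - 2 * d * ((Z - Q) \<bullet> \<nu>) + (Z - Q) \<bullet> (Z - Q)"
        proof -
          have n: "\<nu> \<bullet> \<nu> = 1" using \<nu>(1) by (simp add: norm_eq_1)
          have "2 * d * ((Z - Q) \<bullet> \<nu>) \<le> 0"
            using d(1) \<nu>(2)[OF Z] by (intro mult_nonneg_nonpos) auto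
          moreover have "0 \<le> (Z - Q) \<bullet> (Z - Q)" by (rule inner_ge_zero)
          ultimately show ?thesis unfolding n mult_1_right by linarith
        qed
        also have "\<dots> = (d *\<^sub>R \<nu> - (Z - Q)) \<bullet> (d *\<^sub>R \<nu> - (Z - Q))"
          unfolding inner_diff_left[of "d *\<^sub>R \<nu>"] inner_diff_right[of _ "d *\<^sub>R \<nu>"] inner_scaleR_left inner_scaleR_right
            inner_commute[of \<nu> "Z - Q"] by (simp only: power2_eq_square) algebra
        also have "\<dots> = (norm (d *\<^sub>R \<nu> - (Z - Q)))\<^sup>2" by (simp add: power2_norm_eq_inner)
        finally have "\<bar>d\<bar> \<le> norm (d *\<^sub>R \<nu> - (Z - Q))" by (metis abs_norm_cancel abs_le_square_iff)
        moreover have "dist (Q + d *\<^sub>R \<nu>) Q = \<bar>d\<bar>" using \<nu>(1) by (simp add: dist_norm)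
        moreover have "dist (Q + d *\<^sub>R \<nu>) Z = norm (d *\<^sub>R \<nu> - (Z - Q))" by (simp add: dist_norm algebra_simps)
        ultimately show "dist (Q + d *\<^sub>R \<nu>) Q \<le> dist (Q + d *\<^sub>R \<nu>) Z" by linarith
      qed
      then have "Q \<in> {?g q x y}" unfolding q(4) by (simp only: singleton_iff)
      then show "Q \<in> (\<Union>q\<in>{..<3} \<times> UNIV. \<Union>x\<in>{0..2 * r}. \<Union>y\<in>{0..2 * r}. {?g q x y})"
        by (rule UN_I[OF q(1) UN_I[OF q(2) UN_I[OF q(3)]]])
    qed
    show "dist (?g q x y) (?g q x' y') \<le> \<bar>x - x'\<bar> + \<bar>y - y'\<bar>" for q x y x' y'
      by (rule order_trans[OF closest_point_lipschitz[OF cl(2,1,3)] cube_face_Lipschitz])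
  qed (use r in auto)
  \<comment> \<open>Six faces, each with a parameter square of side 2r.\<close>
  also have "real (card ({..<3::nat} \<times> (UNIV :: bool set))) * pi * (2 * r)\<^sup>2 = 24 * pi * r\<^sup>2"
    by (simp add: card_cartesian_product power_mult_distrib)
  finally show ?thesis .
qed

lemma space_surf [simp]: "space (surf \<Omega>) = frontier \<Omega>"
  and sets_surf: "sets (surf \<Omega>) = sets (restrict_space borel (frontier \<Omega>))"
proof -
  have "sets hausdorff2 = sets borel" "space hausdorff2 = UNIV"
    unfolding hausdorff2_def by (simp_all add: sets_measure_of_conv space_measure_of_conv sets.sigma_sets_eq[of borel, simplified])
  then show "space (surf \<Omega>) = frontier \<Omega>" "sets (surf \<Omega>) = sets (restrict_space borel (frontier \<Omega>))"
    unfolding surf_def by (simp_all add: space_restrict_space sets_restrict_space)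
qed

lemma emeasure_surf_ball_le:
  assumes "open \<Omega>" "bounded \<Omega>" "C1_alpha_boundary \<alpha> \<Omega>" "0 < \<alpha>" "convex (closure \<Omega>)" "\<Omega> \<noteq> {}" and r: "r > 0"
  shows "emeasure (surf \<Omega>) (frontier \<Omega> \<inter> ball P r) \<le> ennreal (24 * pi * r\<^sup>2)"
proof -
  have sh: "sets hausdorff2 = sets borel" "space hausdorff2 = UNIV"
    unfolding hausdorff2_def by (simp_all add: sets_measure_of_conv space_measure_of_conv sets.sigma_sets_eq[of borel, simplified])
  have "emeasure (surf \<Omega>) (frontier \<Omega> \<inter> ball P r) = emeasure hausdorff2 (frontier \<Omega> \<inter> ball P r)"
    unfolding surf_def by (rule emeasure_restrict_space) (auto simp: sh)
  also have "\<dots> \<le> hausdorff2_outer (frontier \<Omega> \<inter> ball P r)" by (rule emeasure_hausdorff2_le)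
  also have "\<dots> \<le> ennreal (24 * pi * r\<^sup>2)"
  proof (rule hausdorff2_outer_convex_frontier[of "closure \<Omega>"])
    fix Q assume Q: "Q \<in> frontier \<Omega>"
    then show "Q \<in> closure \<Omega> \<and> (\<exists>\<nu>. norm \<nu> = 1 \<and> (\<forall>Z\<in>closure \<Omega>. (Z - Q) \<bullet> \<nu> \<le> 0))"
      using outer_normal_unit[OF assms(1-4) Q] outer_normal_support[OF assms(1-4) Q assms(5)]
      by (auto simp: frontier_def)
  qed (use assms in auto)
  finally show ?thesis .
qed

lemma finite_measure_surf:
  assumes "open \<Omega>" "bounded \<Omega>" "C1_alpha_boundary \<alpha> \<Omega>" "0 < \<alpha>" "convex (closure \<Omega>)" "\<Omega> \<noteq> {}"
  shows "finite_measure (surf \<Omega>)"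
proof
  obtain R where R: "R > 0" "frontier \<Omega> \<subseteq> ball 0 R"
  proof -
    have "bounded (frontier \<Omega>)" by (rule compact_imp_bounded[OF compact_frontier_Omega[OF assms(1-4)]])
    then obtain R where "frontier \<Omega> \<subseteq> ball 0 R" using bounded_subset_ballD by blast
    moreover have "ball (0::R3) R \<subseteq> ball 0 (max R 1)" by (rule subset_ball) simp
    ultimately show ?thesis by (intro that[of "max R 1"]) auto
  qed
  have "emeasure (surf \<Omega>) (frontier \<Omega> \<inter> ball 0 R) \<le> ennreal (24 * pi * R\<^sup>2)"
    by (rule emeasure_surf_ball_le[OF assms R(1)])
  moreover have "frontier \<Omega> \<inter> ball 0 R = space (surf \<Omega>)" using R(2) by auto
  ultimately show "emeasure (surf \<Omega>) (space (surf \<Omega>)) \<noteq> \<infinity>" by (auto simp: top_unique)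
qed

section \<open>Weakly singular integral equations\<close>

text \<open>A weakly singular kernel \<open>k\<close> of order \<open>t\<close> on points of \<open>T\<close> against a measure of dimension
  \<open>s > t\<close>: the integral over a small ball around the singularity is small, by a dyadic
  decomposition into annuli.\<close>

locale weakly_singular = finite_measure M
  for M :: "R3 measure" +
  fixes T S :: "R3 set" and k :: "R3 \<Rightarrow> R3 \<Rightarrow> real" and C L s t :: real
  assumes sets_M: "sets M = sets (restrict_space borel S)"
    and growth: "\<And>P r. P \<in> T \<Longrightarrow> r > 0 \<Longrightarrow> emeasure M (S \<inter> ball P r) \<le> ennreal (C * r powr s)"
    and CL: "C \<ge> 0" "L \<ge> 0" and st: "0 \<le> t" "t < s"
    and k_measurable: "\<And>P. P \<in> T \<Longrightarrow> k P \<in> borel_measurable M"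
    and k_bound: "\<And>P Y. P \<in> T \<Longrightarrow> Y \<in> S \<Longrightarrow> Y \<noteq> P \<Longrightarrow> \<bar>k P Y\<bar> \<le> L * norm (P - Y) powr (- t)"
    and k_continuous: "\<And>P Y. P \<in> T \<Longrightarrow> Y \<in> S \<Longrightarrow> Y \<noteq> P \<Longrightarrow> ((\<lambda>P'. k P' Y) \<longlongrightarrow> k P Y) (at P within T)"
begin

lemma space_M: "space M = S"
  using sets_eq_imp_space_eq[OF sets_M] by (simp add: space_restrict_space)

lemma ball_sets: "S \<inter> ball P r \<in> sets M"
  unfolding sets_M by (auto simp: sets_restrict_space)

text \<open>The kernel bound says nothing at the singularity itself; the growth condition with s > 0
  makes that point null.\<close>

lemma point_null:
  assumes "P \<in> T" shows "AE Y in M. Y \<noteq> P"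
proof -
  have le: "emeasure M (S \<inter> {P}) \<le> ennreal (C * r powr s)" if "r > 0" for r
  proof -
    have "emeasure M (S \<inter> {P}) \<le> emeasure M (S \<inter> ball P r)"
      using that by (intro emeasure_mono ball_sets) auto
    then show ?thesis using growth[OF assms that] by (rule order_trans)
  qed
  have "((\<lambda>r. C * r powr s) \<longlongrightarrow> C * 0 powr s) (at_right 0)"
    using st by (intro tendsto_mult tendsto_const tendsto_powr2 tendsto_ident_at eventually_at_rightI[of 0 1]) auto
  then have "((\<lambda>r. ennreal (C * r powr s)) \<longlongrightarrow> ennreal (C * 0 powr s)) (at_right 0)"
    by (rule tendsto_ennrealI)
  then have "emeasure M (S \<inter> {P}) \<le> ennreal (C * 0 powr s)"
    by (rule tendsto_lowerbound) (auto intro!: eventually_at_rightI[of 0 1] le)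
  then have "emeasure M (S \<inter> {P}) = 0" by simp
  moreover have "S \<inter> {P} \<in> sets M" unfolding sets_M by (auto simp: sets_restrict_space)
  ultimately have "S \<inter> {P} \<in> null_sets M" by auto
  then show ?thesis by (rule AE_I') (auto simp: space_M)
qed

text \<open>A geometric series: on the annulus between \<rho>/2 and \<rho> the kernel is at most L
  (\<rho>/2)^(-t) and the measure at most C \<rho>^s, and halving \<rho> multiplies the product by
  2^(t-s).\<close>

definition near_const :: real where
  "near_const = L * C * 2 powr t / (1 - 2 powr (t - s))"

lemma near_const_nonneg: "near_const \<ge> 0"
  unfolding near_const_def using CL st powr_mono[of "t - s" 0 2] by (intro divide_nonneg_nonneg mult_nonneg_nonneg) simp_all

lemma near_nn_integral:
  assumes P: "P \<in> T" and r: "r > 0"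
  shows "(\<integral>\<^sup>+Y. ennreal \<bar>k P Y\<bar> * indicator (ball P r) Y \<partial>M) \<le> ennreal (near_const * r powr (s - t))"
proof -
  define \<rho> where "\<rho> j = r * (1/2) ^ j" for j :: nat
  have \<rho>: "\<rho> j > 0" for j unfolding \<rho>_def using r by simp
  have \<rho>S: "\<rho> (Suc j) = \<rho> j / 2" for j unfolding \<rho>_def by simp
  have \<rho>_half: "\<rho> (Suc j) powr a = \<rho> j powr a * 2 powr (- a)" for j a
  proof -
    have "\<rho> (Suc j) powr a = \<rho> j powr a / 2 powr a" unfolding \<rho>S by (rule powr_divide)
    then show ?thesis by (simp only: powr_minus divide_inverse)
  qed
  let ?g = "\<lambda>j Y. ennreal (L * \<rho> (Suc j) powr (- t)) * indicator (S \<inter> ball P (\<rho> j)) Y"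
  have pt: "ennreal \<bar>k P Y\<bar> * indicator (ball P r) Y \<le> suminf (\<lambda>j. ?g j Y)" if Y: "Y \<in> S" "Y \<noteq> P" for Y
  proof (cases "Y \<in> ball P r")
    case True
    define d where "d = norm (P - Y)"
    have d: "0 < d" "d < r" unfolding d_def using Y True by (auto simp: dist_norm)
    have ex: "\<exists>j. \<rho> (Suc j) \<le> d"
    proof -
      have "(\<lambda>j. r * (1/2) ^ j) \<longlonglongrightarrow> r * 0" by (intro tendsto_mult tendsto_const LIMSEQ_power_zero) simp
      then have "\<forall>\<^sub>F j in sequentially. r * (1/2) ^ j < d" using d(1) by (intro order_tendstoD) auto
      then obtain j where "\<rho> j < d" unfolding \<rho>_def eventually_sequentially by blast
      then show ?thesis using \<rho>S[of j] \<rho>[of j] by (intro exI[of _ j]) linarith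
    qed
    \<comment> \<open>The annulus containing Y: d lies between \<rho>(j+1) and \<rho>(j). Minimality
      gives the upper bound, and for j = 0 it is d < r.\<close>
    define j where "j = (LEAST j. \<rho> (Suc j) \<le> d)"
    have j1: "\<rho> (Suc j) \<le> d" unfolding j_def by (rule LeastI_ex[OF ex])
    have j2: "d < \<rho> j"
    proof (cases j)
      case 0
      then show ?thesis using d(2) by (simp add: \<rho>_def)
    next
      case (Suc i)
      then have "\<not> \<rho> (Suc i) \<le> d" using not_less_Least[of i "\<lambda>j. \<rho> (Suc j) \<le> d"] unfolding j_def by simp
      then show ?thesis using Suc by simp
    qed
    have "\<bar>k P Y\<bar> \<le> L * d powr (- t)" unfolding d_def by (rule k_bound[OF P Y])
    also have "\<dots> \<le> L * \<rho> (Suc j) powr (- t)"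
      using j1 \<rho> st CL by (intro mult_left_mono powr_mono2') auto
    finally have "ennreal \<bar>k P Y\<bar> * indicator (ball P r) Y \<le> ?g j Y"
      using True Y j2 by (simp add: d_def dist_norm ennreal_leI)
    also have "\<dots> \<le> suminf (\<lambda>j. ?g j Y)"
    proof -
      define G where "G i = ?g i Y" for i
      have "sum G {j} \<le> suminf G" by (rule sum_le_suminf) auto
      then have "G j \<le> suminf G" by simp
      then show ?thesis unfolding G_def .
    qed
    finally show ?thesis .
  qed simp
  have "(\<integral>\<^sup>+Y. ennreal \<bar>k P Y\<bar> * indicator (ball P r) Y \<partial>M) \<le> (\<integral>\<^sup>+Y. suminf (\<lambda>j. ?g j Y) \<partial>M)"
  proof (rule nn_integral_mono_AE)
    show "AE Y in M. ennreal \<bar>k P Y\<bar> * indicator (ball P r) Y \<le> suminf (\<lambda>j. ?g j Y)"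
      using point_null[OF P] AE_space[of M]
    proof eventually_elim
      case (elim Y)
      then show ?case by (intro pt) (simp_all add: space_M)
    qed
  qed
  also have "\<dots> = suminf (\<lambda>j. \<integral>\<^sup>+Y. ?g j Y \<partial>M)"
  proof (rule nn_integral_suminf)
    fix j
    have [measurable]: "S \<inter> ball P (\<rho> j) \<in> sets M" by (rule ball_sets)
    show "?g j \<in> borel_measurable M" by measurable
  qed
  also have "\<dots> \<le> suminf (\<lambda>j. ennreal (L * C * 2 powr t * r powr (s - t) * (2 powr (t - s)) ^ j))"
  proof (rule suminf_le[OF _ summableI summableI])
    fix j
    have "(\<integral>\<^sup>+Y. ?g j Y \<partial>M) = ennreal (L * \<rho> (Suc j) powr (- t)) * emeasure M (S \<inter> ball P (\<rho> j))"
      by (rule nn_integral_cmult_indicator[OF ball_sets])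
    also have "\<dots> \<le> ennreal (L * \<rho> (Suc j) powr (- t)) * ennreal (C * \<rho> j powr s)"
      by (intro mult_left_mono growth P \<rho>) simp
    also have "\<dots> = ennreal (L * \<rho> (Suc j) powr (- t) * (C * \<rho> j powr s))"
      using CL by (simp add: ennreal_mult)
    also have "L * \<rho> (Suc j) powr (- t) * (C * \<rho> j powr s) = L * C * 2 powr t * r powr (s - t) * (2 powr (t - s)) ^ j"
    proof -
      have 1: "\<rho> (Suc j) powr (- t) = \<rho> j powr (- t) * 2 powr t"
        unfolding \<rho>_half minus_minus ..
      have 2: "\<rho> j powr (- t) * \<rho> j powr s = \<rho> j powr (s - t)"
        using \<rho>[of j] by (simp add: powr_add[symmetric])
      have 3: "\<rho> j powr (s - t) = r powr (s - t) * (2 powr (t - s)) ^ j"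
      proof (induction j)
        case 0
        show ?case by (simp add: \<rho>_def)
      next
        case (Suc j)
        show ?case unfolding \<rho>_half Suc.IH minus_diff_eq power_Suc by (simp only: mult_ac)
      qed
      have "L * \<rho> (Suc j) powr (- t) * (C * \<rho> j powr s) = L * C * 2 powr t * (\<rho> j powr (- t) * \<rho> j powr s)"
        unfolding 1 by (simp only: mult_ac)
      then show ?thesis unfolding 2 3 by (simp only: mult_ac)
    qed
    finally show "(\<integral>\<^sup>+Y. ?g j Y \<partial>M) \<le> ennreal (L * C * 2 powr t * r powr (s - t) * (2 powr (t - s)) ^ j)" .
  qed
  also have "\<dots> = ennreal (near_const * r powr (s - t))"
  proof (rule suminf_ennreal_eq)
    have q: "2 powr (t - s) < 1" using st powr_less_mono[of "t - s" 0 2] by simp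
    have "(\<lambda>j. (2 powr (t - s)) ^ j) sums (1 / (1 - 2 powr (t - s)))"
      by (rule geometric_sums) (use q in simp)
    then have "(\<lambda>j. L * C * 2 powr t * r powr (s - t) * (2 powr (t - s)) ^ j) sums (L * C * 2 powr t * r powr (s - t) * (1 / (1 - 2 powr (t - s))))"
      by (rule sums_mult)
    then show "(\<lambda>j. L * C * 2 powr t * r powr (s - t) * (2 powr (t - s)) ^ j) sums (near_const * r powr (s - t))"
      by (simp add: near_const_def mult_ac)
  qed (use CL in simp)
  finally show ?thesis .
qed

lemma near_small:
  assumes "e > 0" shows "\<exists>r>0. near_const * r powr (s - t) < e"
proof -
  have "((\<lambda>r. near_const * r powr (s - t)) \<longlongrightarrow> near_const * 0 powr (s - t)) (at_right 0)"
    using st by (intro tendsto_mult tendsto_const tendsto_powr2 tendsto_ident_at eventually_at_rightI[of 0 1]) auto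
  then have "\<forall>\<^sub>F r in at_right 0. near_const * r powr (s - t) < e" using assms by (intro order_tendstoD) auto
  then have "\<forall>\<^sub>F r in at_right 0. r > 0 \<and> near_const * r powr (s - t) < e"
    using eventually_at_right_less by eventually_elim simp
  then show ?thesis using eventually_happens[of _ "at_right (0::real)"] trivial_limit_at_right_real by blast
qed

lemma far_bound:
  assumes "P \<in> T" "Y \<in> S" "r > 0" "Y \<notin> ball P r" shows "\<bar>k P Y\<bar> \<le> L * r powr (- t)"
proof -
  have "Y \<noteq> P" using assms by auto
  then have "\<bar>k P Y\<bar> \<le> L * norm (P - Y) powr (- t)" by (rule k_bound[OF assms(1,2)])
  also have "\<dots> \<le> L * r powr (- t)"
    using assms st CL by (intro mult_left_mono powr_mono2') (auto simp: dist_norm)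
  finally show ?thesis .
qed

text \<open>The integral is split at distance 1: the near bound with r = 1, and |k| at most L
  beyond.\<close>

definition total_const :: real where
  "total_const = near_const + L * measure M S"

lemma total_nn_integral:
  assumes P: "P \<in> T" shows "(\<integral>\<^sup>+Y. ennreal \<bar>k P Y\<bar> \<partial>M) \<le> ennreal total_const"
proof -
  have [measurable]: "k P \<in> borel_measurable M" by (rule k_measurable[OF P])
  have [measurable]: "S \<inter> ball P 1 \<in> sets M" by (rule ball_sets)
  have "(\<integral>\<^sup>+Y. ennreal \<bar>k P Y\<bar> \<partial>M) \<le> (\<integral>\<^sup>+Y. ennreal \<bar>k P Y\<bar> * indicator (S \<inter> ball P 1) Y + ennreal L \<partial>M)"
  proof (rule nn_integral_mono)
    fix Y assume "Y \<in> space M"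
    then have Y: "Y \<in> S" by (simp add: space_M)
    show "ennreal \<bar>k P Y\<bar> \<le> ennreal \<bar>k P Y\<bar> * indicator (S \<inter> ball P 1) Y + ennreal L"
    proof (cases "Y \<in> ball P 1")
      case False
      then show ?thesis using far_bound[OF P Y _ False] Y by (simp add: ennreal_leI)
    qed (use Y in simp)
  qed
  also have "\<dots> = (\<integral>\<^sup>+Y. ennreal \<bar>k P Y\<bar> * indicator (S \<inter> ball P 1) Y \<partial>M) + (\<integral>\<^sup>+Y. ennreal L \<partial>M)"
    by (rule nn_integral_add) measurable
  also have "(\<integral>\<^sup>+Y. ennreal \<bar>k P Y\<bar> * indicator (S \<inter> ball P 1) Y \<partial>M) = (\<integral>\<^sup>+Y. ennreal \<bar>k P Y\<bar> * indicator (ball P 1) Y \<partial>M)"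
    by (rule nn_integral_cong) (auto simp: space_M split: split_indicator)
  also have "(\<integral>\<^sup>+Y. ennreal \<bar>k P Y\<bar> * indicator (ball P 1) Y \<partial>M) + (\<integral>\<^sup>+Y. ennreal L \<partial>M) \<le> ennreal (near_const * 1 powr (s - t)) + ennreal (L * measure M S)"
    using CL by (intro add_mono near_nn_integral[OF P]) (simp_all add: space_M emeasure_eq_measure ennreal_mult)
  also have "\<dots> = ennreal total_const" unfolding total_const_def using near_const_nonneg CL by (simp add: ennreal_plus)
  finally show ?thesis .
qed

lemma kernel_integrable: "P \<in> T \<Longrightarrow> integrable M (k P)"
  using total_nn_integral[of P] k_measurable[of P]
  by (intro integrableI_bounded) (auto simp: less_top[symmetric] top_unique intro: order_le_less_trans)

lemma total_const_nonneg: "total_const \<ge> 0"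
  unfolding total_const_def using near_const_nonneg CL by simp

lemma kernel_L1_bound:
  assumes P: "P \<in> T" shows "(LINT Y|M. \<bar>k P Y\<bar>) \<le> total_const"
proof -
  have "ennreal (LINT Y|M. \<bar>k P Y\<bar>) = (\<integral>\<^sup>+Y. ennreal \<bar>k P Y\<bar> \<partial>M)"
    by (rule nn_integral_eq_integral[symmetric]) (use kernel_integrable[OF P] in auto)
  also have "\<dots> \<le> ennreal total_const" by (rule total_nn_integral[OF P])
  finally show ?thesis unfolding ennreal_le_iff[OF total_const_nonneg] .
qed

lemma near_integral:
  assumes P: "P \<in> T" and r: "r > 0"
  shows "(LINT Y|M. \<bar>k P Y\<bar> * indicator (ball P r) Y) \<le> near_const * r powr (s - t)"
proof -
  have i: "integrable M (\<lambda>Y. \<bar>k P Y\<bar> * indicator (S \<inter> ball P r) Y)"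
    using integrable_mult_indicator[OF ball_sets integrable_abs[OF kernel_integrable[OF P]], of P r]
    by (simp add: mult.commute)
  have c: "\<bar>k P Y\<bar> * indicator (S \<inter> ball P r) Y = \<bar>k P Y\<bar> * indicator (ball P r) Y" if "Y \<in> space M" for Y
    using that by (auto simp: space_M split: split_indicator)
  have "integrable M (\<lambda>Y. \<bar>k P Y\<bar> * indicator (ball P r) Y)"
    using i by (subst (asm) Bochner_Integration.integrable_cong[OF refl c]) auto
  then have "ennreal (LINT Y|M. \<bar>k P Y\<bar> * indicator (ball P r) Y) = (\<integral>\<^sup>+Y. ennreal (\<bar>k P Y\<bar> * indicator (ball P r) Y) \<partial>M)"
    by (intro nn_integral_eq_integral[symmetric]) auto
  also have "\<dots> = (\<integral>\<^sup>+Y. ennreal \<bar>k P Y\<bar> * indicator (ball P r) Y \<partial>M)"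
    by (intro nn_integral_cong) (auto split: split_indicator)
  also have "\<dots> \<le> ennreal (near_const * r powr (s - t))" by (rule near_nn_integral[OF P r])
  finally show ?thesis using near_const_nonneg by simp
qed

text \<open>Near P each kernel has a small integral over a ball about its own singularity. Away from
  P both are uniformly bounded, and pointwise continuity combines with dominated
  convergence.\<close>

lemma kernel_L1_continuous:
  assumes p: "\<And>n. p n \<in> T" and P: "P \<in> T" and lim: "p \<longlonglongrightarrow> P"
  shows "(\<lambda>n. LINT Y|M. \<bar>k (p n) Y - k P Y\<bar>) \<longlonglongrightarrow> 0"
proof (rule LIMSEQ_I)
  fix e :: real assume e: "e > 0"
  obtain r where r: "r > 0" "near_const * r powr (s - t) < e / 4" using near_small[of "e / 4"] e by auto
  let ?N = "S \<inter> ball P (r / 2)"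
  let ?far = "\<lambda>n Y. \<bar>k (p n) Y - k P Y\<bar> * indicator (- ball P (r / 2)) Y"
  have ki: "integrable M (\<lambda>Y. \<bar>k (p n) Y - k P Y\<bar>)" for n
    by (intro integrable_abs Bochner_Integration.integrable_diff kernel_integrable p P)
  \<comment> \<open>For p_n within r/4 of P, the ball of radius r/2 about P lies in the ball of
    radius r about p_n, and points outside the former keep distance r/4 from both
    singularities.\<close>
  obtain N1 where N1: "\<And>n. n \<ge> N1 \<Longrightarrow> dist (p n) P < r / 4"
    using metric_LIMSEQ_D[OF lim, of "r / 4"] r(1) by auto
  have kt: "(\<lambda>n. k (p n) Y) \<longlonglongrightarrow> k P Y" if Y: "Y \<in> S" "Y \<noteq> P" for Y
  proof -
    have "((\<lambda>P'. k P' Y) \<longlongrightarrow> k P Y) (at P within T)" by (rule k_continuous[OF P Y])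
    then have "continuous (at P within T) (\<lambda>P'. k P' Y)" by (simp add: continuous_within)
    then show ?thesis using continuous_within_tendsto_compose'[of P T "\<lambda>P'. k P' Y" p sequentially] p lim by blast
  qed
  have mind: "(\<lambda>Y. indicator (- ball P (r / 2)) Y :: real) \<in> borel_measurable M"
    unfolding measurable_cong_sets[OF sets_M refl] by (intro measurable_restrict_space1) measurable
  have farlim: "(\<lambda>n. LINT Y|M. ?far (n + N1) Y) \<longlonglongrightarrow> (LINT Y|M. 0)"
  proof (rule integral_dominated_convergence[where w="\<lambda>_. 2 * (L * (r / 4) powr (- t))"])
    show "integrable M (\<lambda>_. 2 * (L * (r / 4) powr (- t)))" by simp
    show "AE Y in M. (\<lambda>n. ?far (n + N1) Y) \<longlonglongrightarrow> 0"
    proof (rule AE_I2)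
      fix Y assume "Y \<in> space M"
      then have Y: "Y \<in> S" by (simp add: space_M)
      show "(\<lambda>n. ?far (n + N1) Y) \<longlonglongrightarrow> 0"
      proof (cases "Y \<in> ball P (r / 2)")
        case False
        then have "Y \<noteq> P" using r by auto
        then have "(\<lambda>n. k (p (n + N1)) Y) \<longlonglongrightarrow> k P Y" using LIMSEQ_ignore_initial_segment[OF kt[OF Y]] by blast
        then have "(\<lambda>n. \<bar>k (p (n + N1)) Y - k P Y\<bar> * indicator (- ball P (r / 2)) Y) \<longlonglongrightarrow> \<bar>k P Y - k P Y\<bar> * indicator (- ball P (r / 2)) Y"
          by (intro tendsto_intros)
        then show ?thesis by simp
      qed simp
    qed
    fix n
    show "AE Y in M. norm (?far (n + N1) Y) \<le> 2 * (L * (r / 4) powr (- t))"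
    proof (rule AE_I2)
      fix Y assume "Y \<in> space M"
      then have Y: "Y \<in> S" by (simp add: space_M)
      show "norm (?far (n + N1) Y) \<le> 2 * (L * (r / 4) powr (- t))"
      proof (cases "Y \<in> ball P (r / 2)")
        case False
        have d: "dist (p (n + N1)) P < r / 4" by (rule N1) simp
        have "dist P Y \<le> dist (p (n + N1)) P + dist (p (n + N1)) Y" using dist_triangle[of P Y "p (n + N1)"] by (simp add: dist_commute)
        then have f1: "Y \<notin> ball (p (n + N1)) (r / 4)" and f2: "Y \<notin> ball P (r / 4)" using d False r by auto
        have "\<bar>k (p (n + N1)) Y\<bar> \<le> L * (r / 4) powr (- t)" by (rule far_bound[OF p Y _ f1]) (use r in simp)
        moreover have "\<bar>k P Y\<bar> \<le> L * (r / 4) powr (- t)" by (rule far_bound[OF P Y _ f2]) (use r in simp)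
        ultimately have "\<bar>k (p (n + N1)) Y - k P Y\<bar> \<le> 2 * (L * (r / 4) powr (- t))" by linarith
        then show ?thesis using False by simp
      qed (use CL in simp)
    qed
    show "?far (n + N1) \<in> borel_measurable M"
      using k_measurable[OF p] k_measurable[OF P] mind by (intro borel_measurable_times) measurable
  qed simp
  then obtain N2 where N2: "\<And>n. n \<ge> N2 \<Longrightarrow> \<bar>LINT Y|M. ?far (n + N1) Y\<bar> < e / 4"
    using LIMSEQ_D[OF farlim, of "e / 4"] e by auto
  show "\<exists>no. \<forall>n\<ge>no. norm ((LINT Y|M. \<bar>k (p n) Y - k P Y\<bar>) - 0) < e"
  proof (intro exI[of _ "N1 + N2"] allI impI)
    fix n assume n: "n \<ge> N1 + N2"
    then have d: "dist (p n) P < r / 4" using N1 by simp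
    have bi: "integrable M (\<lambda>Y. \<bar>k Q Y\<bar> * indicator (ball Q r) Y)" if Q: "Q \<in> T" for Q
    proof (rule Bochner_Integration.integrable_bound[OF kernel_integrable[OF Q]])
      show "(\<lambda>Y. \<bar>k Q Y\<bar> * indicator (ball Q r) Y) \<in> borel_measurable M"
        unfolding measurable_cong_sets[OF sets_M refl]
        by (intro borel_measurable_times borel_measurable_abs k_measurable[OF Q, unfolded measurable_cong_sets[OF sets_M refl]] measurable_restrict_space1 borel_measurable_indicator) auto
    qed (auto split: split_indicator)
    have fi: "integrable M (?far n)"
    proof (rule Bochner_Integration.integrable_bound[OF ki[of n]])
      show "?far n \<in> borel_measurable M"
        using k_measurable[OF p] k_measurable[OF P] mind by (intro borel_measurable_times) measurable
    qed (auto split: split_indicator)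
    have "(LINT Y|M. \<bar>k (p n) Y - k P Y\<bar>) \<le> (LINT Y|M. \<bar>k (p n) Y\<bar> * indicator (ball (p n) r) Y + \<bar>k P Y\<bar> * indicator (ball P r) Y + ?far n Y)"
    proof (rule integral_mono[OF ki])
      show "integrable M (\<lambda>Y. \<bar>k (p n) Y\<bar> * indicator (ball (p n) r) Y + \<bar>k P Y\<bar> * indicator (ball P r) Y + ?far n Y)"
        by (intro Bochner_Integration.integrable_add bi p P fi)
      fix Y
      show "\<bar>k (p n) Y - k P Y\<bar> \<le> \<bar>k (p n) Y\<bar> * indicator (ball (p n) r) Y + \<bar>k P Y\<bar> * indicator (ball P r) Y + ?far n Y"
      proof (cases "Y \<in> ball P (r / 2)")
        case True
        have "dist (p n) Y \<le> dist (p n) P + dist P Y" by (rule dist_triangle)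
        then have "Y \<in> ball (p n) r" "Y \<in> ball P r" using True d r by auto
        then show ?thesis using True by simp
      qed (simp add: add_nonneg_nonneg)
    qed
    also have "\<dots> = (LINT Y|M. \<bar>k (p n) Y\<bar> * indicator (ball (p n) r) Y) + (LINT Y|M. \<bar>k P Y\<bar> * indicator (ball P r) Y) + (LINT Y|M. ?far n Y)"
      by (simp add: Bochner_Integration.integral_add bi p P fi Bochner_Integration.integrable_add)
    also have "\<dots> \<le> near_const * r powr (s - t) + near_const * r powr (s - t) + (LINT Y|M. ?far n Y)"
      by (intro add_mono near_integral p P r order_refl)
    also have "\<dots> < e"
    proof -
      have "\<bar>LINT Y|M. ?far ((n - N1) + N1) Y\<bar> < e / 4" by (rule N2) (use n in simp)
      then have "(LINT Y|M. ?far n Y) < e / 4" using n by simp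
      then show ?thesis using r(2) e by linarith
    qed
    finally have "(LINT Y|M. \<bar>k (p n) Y - k P Y\<bar>) < e" .
    moreover have "(LINT Y|M. \<bar>k (p n) Y - k P Y\<bar>) \<ge> 0" by (rule integral_nonneg_AE) simp
    ultimately show "norm ((LINT Y|M. \<bar>k (p n) Y - k P Y\<bar>) - 0) < e" by simp
  qed
qed

end

section \<open>Integral operators with a weakly singular kernel\<close>

context weakly_singular
begin

lemma op_integrable:
  fixes A :: "R3 \<Rightarrow> 'b::euclidean_space"
  assumes P: "P \<in> T" and A: "A \<in> borel_measurable M" "\<And>Y. Y \<in> S \<Longrightarrow> norm (A Y) \<le> B"
  shows "integrable M (\<lambda>Y. k P Y *\<^sub>R A Y)"
proof (rule Bochner_Integration.integrable_bound[OF integrable_mult_right[OF kernel_integrable[OF P], of B]])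
  show "(\<lambda>Y. k P Y *\<^sub>R A Y) \<in> borel_measurable M"
    by (intro borel_measurable_scaleR k_measurable[OF P] A(1))
  show "AE Y in M. norm (k P Y *\<^sub>R A Y) \<le> norm (B * k P Y)"
  proof (rule AE_I2)
    fix Y assume "Y \<in> space M"
    then have "norm (A Y) \<le> \<bar>B\<bar>" using A(2)[of Y] by (simp add: space_M)
    then show "norm (k P Y *\<^sub>R A Y) \<le> norm (B * k P Y)"
      using mult_left_mono[of "norm (A Y)" "\<bar>B\<bar>" "\<bar>k P Y\<bar>"] by (simp add: abs_mult mult.commute)
  qed
qed

lemma op_bound:
  fixes A :: "R3 \<Rightarrow> 'b::euclidean_space"
  assumes P: "P \<in> T" and A: "\<And>Y. Y \<in> S \<Longrightarrow> norm (A Y) \<le> B" and B: "B \<ge> 0"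
  shows "norm (LINT Y|M. k P Y *\<^sub>R A Y) \<le> B * total_const"
proof (cases "integrable M (\<lambda>Y. k P Y *\<^sub>R A Y)")
  case True
  have "norm (LINT Y|M. k P Y *\<^sub>R A Y) \<le> (LINT Y|M. B * \<bar>k P Y\<bar>)"
  proof (rule Bochner_Integration.integral_norm_bound_integral[OF True])
    show "integrable M (\<lambda>Y. B * \<bar>k P Y\<bar>)" by (intro integrable_mult_right integrable_abs kernel_integrable P)
    fix Y assume "Y \<in> space M"
    then show "norm (k P Y *\<^sub>R A Y) \<le> B * \<bar>k P Y\<bar>"
      using mult_left_mono[OF A, of Y "\<bar>k P Y\<bar>"] by (simp add: space_M mult.commute)
  qed
  also have "\<dots> = B * (LINT Y|M. \<bar>k P Y\<bar>)" by simp
  also have "\<dots> \<le> B * total_const" by (intro mult_left_mono kernel_L1_bound P B)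
  finally show ?thesis .
next
  \<comment> \<open>A non-integrable integrand has integral 0 by convention, so the bound holds for
    every bounded density.\<close>
  case False
  then show ?thesis using B total_const_nonneg by (simp add: not_integrable_integral_eq)
qed

text \<open>At a given P the modulus d is common to all densities bounded by B, since it comes from
  the L^1 continuity of the kernel alone. This is the equicontinuity for Arzela-Ascoli.\<close>

lemma op_equicontinuous:
  assumes P: "P \<in> T" and e: "e > 0" and B: "B \<ge> 0"
  shows "\<exists>d>0. \<forall>A :: R3 \<Rightarrow> 'b::euclidean_space. \<forall>P'\<in>T. A \<in> borel_measurable M \<longrightarrow> (\<forall>Y\<in>S. norm (A Y) \<le> B) \<longrightarrow>
      norm (P - P') < d \<longrightarrow> norm ((LINT Y|M. k P Y *\<^sub>R A Y) - (LINT Y|M. k P' Y *\<^sub>R A Y)) < e"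
proof -
  define f where "f P' = (LINT Y|M. \<bar>k P' Y - k P Y\<bar>)" for P'
  have "continuous (at P within T) f"
    unfolding continuous_within_sequentially
  proof (intro allI impI)
    fix x assume x: "(\<forall>n. x n \<in> T) \<and> x \<longlonglongrightarrow> P"
    then have "(\<lambda>n. LINT Y|M. \<bar>k (x n) Y - k P Y\<bar>) \<longlonglongrightarrow> 0" by (intro kernel_L1_continuous P) auto
    then show "(f \<circ> x) \<longlonglongrightarrow> f P" by (simp add: f_def o_def)
  qed
  moreover have "f P = 0" by (simp add: f_def)
  moreover have "e / (B + 1) > 0" using e B by simp
  ultimately obtain d where d: "d > 0" "\<And>P'. P' \<in> T \<Longrightarrow> dist P' P < d \<Longrightarrow> dist (f P') 0 < e / (B + 1)"
    unfolding continuous_within_eps_delta by metis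
  show ?thesis
  proof (intro exI[of _ d] conjI d(1) allI ballI impI)
    fix A :: "R3 \<Rightarrow> 'b" and P'
    assume P': "P' \<in> T" and A: "A \<in> borel_measurable M" "\<forall>Y\<in>S. norm (A Y) \<le> B" and lt: "norm (P - P') < d"
    have ip: "integrable M (\<lambda>Y. k P Y *\<^sub>R A Y)" by (rule op_integrable[OF P A(1)]) (use A(2) in blast)
    have ip': "integrable M (\<lambda>Y. k P' Y *\<^sub>R A Y)" by (rule op_integrable[OF P' A(1)]) (use A(2) in blast)
    have "norm ((LINT Y|M. k P' Y *\<^sub>R A Y) - (LINT Y|M. k P Y *\<^sub>R A Y)) = norm (LINT Y|M. k P' Y *\<^sub>R A Y - k P Y *\<^sub>R A Y)"
      by (simp only: Bochner_Integration.integral_diff[OF ip' ip])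
    also have "\<dots> \<le> (LINT Y|M. B * \<bar>k P' Y - k P Y\<bar>)"
    proof (rule Bochner_Integration.integral_norm_bound_integral)
      show "integrable M (\<lambda>Y. k P' Y *\<^sub>R A Y - k P Y *\<^sub>R A Y)" by (intro Bochner_Integration.integrable_diff ip ip')
      show "integrable M (\<lambda>Y. B * \<bar>k P' Y - k P Y\<bar>)"
        by (intro integrable_mult_right integrable_abs Bochner_Integration.integrable_diff kernel_integrable P P')
      fix Y assume "Y \<in> space M"
      then have "norm (A Y) \<le> B" using A(2) by (simp add: space_M)
      then show "norm (k P' Y *\<^sub>R A Y - k P Y *\<^sub>R A Y) \<le> B * \<bar>k P' Y - k P Y\<bar>"
        unfolding scaleR_diff_left[symmetric] norm_scaleR using mult_right_mono[of "norm (A Y)" B "\<bar>k P' Y - k P Y\<bar>"] by (simp add: mult.commute)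
    qed
    also have "\<dots> = B * f P'" by (simp add: f_def)
    also have "\<dots> < e"
    proof -
      have f: "f P' < e / (B + 1)" "f P' \<ge> 0"
        using d(2)[OF P'] lt by (auto simp: dist_norm norm_minus_commute f_def intro!: integral_nonneg_AE)
      have "B * f P' \<le> (B + 1) * f P'" using f(2) by (simp add: algebra_simps)
      also have "\<dots> < e" using f(1) B by (simp add: field_simps)
      finally show ?thesis .
    qed
    finally show "norm ((LINT Y|M. k P Y *\<^sub>R A Y) - (LINT Y|M. k P' Y *\<^sub>R A Y)) < e"
      by (simp only: norm_minus_commute)
  qed
qed

lemma op_diff_bound:
  fixes A :: "R3 \<Rightarrow> 'b::euclidean_space"
  assumes P: "P \<in> T" and A: "A \<in> borel_measurable M" "\<And>Y. Y \<in> S \<Longrightarrow> norm (A Y) \<le> B"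
    and A': "A' \<in> borel_measurable M" "\<And>Y. Y \<in> S \<Longrightarrow> norm (A' Y) \<le> B'"
    and d: "\<And>Y. Y \<in> S \<Longrightarrow> norm (A Y - A' Y) \<le> D" "D \<ge> 0"
  shows "norm ((LINT Y|M. k P Y *\<^sub>R A Y) - (LINT Y|M. k P Y *\<^sub>R A' Y)) \<le> D * total_const"
proof -
  have "(LINT Y|M. k P Y *\<^sub>R A Y) - (LINT Y|M. k P Y *\<^sub>R A' Y) = (LINT Y|M. k P Y *\<^sub>R (A Y - A' Y))"
    unfolding scaleR_diff_right
    by (rule Bochner_Integration.integral_diff[OF op_integrable[OF P A] op_integrable[OF P A'], symmetric])
  then show ?thesis using op_bound[OF P d] by simp
qed

end

text \<open>The abstract equation A/2 = K A + g + V \<rho>, with one kernel integrated over the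
  boundary and over the domain; \<open>homogeneous\<close> is injectivity of 1/2 - K. The parameter
  \<open>dummy\<close> brings the value type \<open>'b\<close> into the locale.\<close>

locale boundary_equation =
  K: weakly_singular MK T T k CK LK sK tK + V: weakly_singular MV T SV k CV LV sV tV
  for MK MV :: "R3 measure" and T SV :: "R3 set" and k :: "R3 \<Rightarrow> R3 \<Rightarrow> real" and CK LK sK tK CV LV sV tV :: real +
  fixes dummy :: "'b::euclidean_space"
  assumes T: "compact T" "T \<noteq> {}"
    and homogeneous: "\<And>a :: R3 \<Rightarrow> 'b. continuous_on T a \<Longrightarrow>
        (\<And>P. P \<in> T \<Longrightarrow> (1/2) *\<^sub>R a P = (LINT Y|MK. k P Y *\<^sub>R a Y)) \<Longrightarrow> (\<And>P. P \<in> T \<Longrightarrow> a P = 0)"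
begin

lemma continuous_measurable:
  fixes a :: "R3 \<Rightarrow> 'c::euclidean_space"
  assumes "continuous_on T a" shows "a \<in> borel_measurable MK"
proof -
  have "a \<in> borel_measurable (restrict_space borel T)"
    by (rule borel_measurable_continuous_on_restrict[OF assms])
  then show ?thesis by (simp add: measurable_cong_sets[OF K.sets_M refl])
qed

text \<open>Compactness of K A + V \<rho> over bounded families: both operators are bounded and
  equicontinuous, so Arzela-Ascoli applies even if the densities themselves do not converge.\<close>

lemma op_subsequence:
  fixes A \<rho> :: "nat \<Rightarrow> R3 \<Rightarrow> 'b"
  assumes A: "\<And>n. continuous_on T (A n)" "\<And>n P. P \<in> T \<Longrightarrow> norm (A n P) \<le> B" and B: "B \<ge> 0"
    and \<rho>: "\<And>n. \<rho> n \<in> borel_measurable MV" "\<And>n Y. Y \<in> SV \<Longrightarrow> norm (\<rho> n Y) \<le> R" and R: "R \<ge> 0"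
  shows "\<exists>g r. continuous_on T g \<and> strict_mono (r :: nat \<Rightarrow> nat) \<and>
    (\<forall>e>0. \<exists>N. \<forall>n P. n \<ge> N \<and> P \<in> T \<longrightarrow>
       norm ((LINT Y|MK. k P Y *\<^sub>R A (r n) Y) + (LINT Y|MV. k P Y *\<^sub>R \<rho> (r n) Y) - g P) < e)"
proof -
  let ?F = "\<lambda>n P. (LINT Y|MK. k P Y *\<^sub>R A n Y) + (LINT Y|MV. k P Y *\<^sub>R \<rho> n Y)"
  have bd: "norm (?F n P) \<le> B * K.total_const + R * V.total_const" if "P \<in> T" for n P
    by (rule norm_triangle_mono[OF K.op_bound[OF that A(2) B] V.op_bound[OF that \<rho>(2) R]])
  have eq: "\<exists>d>0. \<forall>n P'. P' \<in> T \<and> norm (P - P') < d \<longrightarrow> norm (?F n P - ?F n P') < e" if P: "P \<in> T" and e: "e > 0" for P e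
  proof -
    have e2: "e / 2 > 0" using e by simp
    obtain d1 where d1: "d1 > 0" "\<forall>A :: R3 \<Rightarrow> 'b. \<forall>P'\<in>T. A \<in> borel_measurable MK \<longrightarrow> (\<forall>Y\<in>T. norm (A Y) \<le> B) \<longrightarrow>
      norm (P - P') < d1 \<longrightarrow> norm ((LINT Y|MK. k P Y *\<^sub>R A Y) - (LINT Y|MK. k P' Y *\<^sub>R A Y)) < e / 2"
      using K.op_equicontinuous[OF P e2 B] by blast
    obtain d2 where d2: "d2 > 0" "\<forall>A :: R3 \<Rightarrow> 'b. \<forall>P'\<in>T. A \<in> borel_measurable MV \<longrightarrow> (\<forall>Y\<in>SV. norm (A Y) \<le> R) \<longrightarrow>
      norm (P - P') < d2 \<longrightarrow> norm ((LINT Y|MV. k P Y *\<^sub>R A Y) - (LINT Y|MV. k P' Y *\<^sub>R A Y)) < e / 2"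
      using V.op_equicontinuous[OF P e2 R] by blast
    show ?thesis
    proof (intro exI[of _ "min d1 d2"] conjI allI impI)
      fix n P' assume P': "P' \<in> T \<and> norm (P - P') < min d1 d2"
      have "norm ((LINT Y|MK. k P Y *\<^sub>R A n Y) - (LINT Y|MK. k P' Y *\<^sub>R A n Y)) < e / 2"
        using d1(2) P' continuous_measurable[OF A(1)] A(2) by simp
      moreover have "norm ((LINT Y|MV. k P Y *\<^sub>R \<rho> n Y) - (LINT Y|MV. k P' Y *\<^sub>R \<rho> n Y)) < e / 2"
        using d2(2) P' \<rho> by simp
      ultimately show "norm (?F n P - ?F n P') < e"
        by (simp only: add_diff_add) (rule norm_triangle_lt, linarith)
    qed (use d1 d2 in simp)
  qed
  show ?thesis
  proof (rule Arzela_Ascoli[OF T(1) bd eq])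
    fix g r assume h: "continuous_on T g" "strict_mono (r :: nat \<Rightarrow> nat)"
      "\<And>e. 0 < e \<Longrightarrow> \<exists>N. \<forall>n P. n \<ge> N \<and> P \<in> T \<longrightarrow> norm (?F (r n) P - g P) < e"
    show ?thesis by (intro exI[of _ g] exI[of _ r] conjI h allI impI)
  qed
qed

lemma op_uniform_limit:
  fixes A :: "nat \<Rightarrow> R3 \<Rightarrow> 'b"
  assumes A: "\<And>n. continuous_on T (A n)" and a: "continuous_on T a"
    and lim: "\<forall>e>0. \<exists>N. \<forall>n P. n \<ge> N \<and> P \<in> T \<longrightarrow> norm (A n P - a P) < e" and P: "P \<in> T"
  shows "(\<lambda>n. LINT Y|MK. k P Y *\<^sub>R A n Y) \<longlonglongrightarrow> (LINT Y|MK. k P Y *\<^sub>R a Y)"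
proof (rule LIMSEQ_I)
  have bound: "\<exists>B. \<forall>Y\<in>T. norm (f Y) \<le> B" if "continuous_on T f" for f :: "R3 \<Rightarrow> 'b"
    using compact_imp_bounded[OF compact_continuous_image[OF that T(1)]] by (auto simp: bounded_iff)
  fix e :: real assume e: "e > 0"
  define D where "D = e / (K.total_const + 1)"
  have D: "D > 0" unfolding D_def using e K.total_const_nonneg by simp
  obtain N where N: "\<And>n P. n \<ge> N \<Longrightarrow> P \<in> T \<Longrightarrow> norm (A n P - a P) < D" using lim D by blast
  show "\<exists>no. \<forall>n\<ge>no. norm ((LINT Y|MK. k P Y *\<^sub>R A n Y) - (LINT Y|MK. k P Y *\<^sub>R a Y)) < e"
  proof (intro exI[of _ N] allI impI)
    fix n assume n: "n \<ge> N"
    obtain B where B: "\<forall>Y\<in>T. norm (A n Y) \<le> B" using bound[OF A] by blast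
    obtain B' where B': "\<forall>Y\<in>T. norm (a Y) \<le> B'" using bound[OF a] by blast
    have "norm ((LINT Y|MK. k P Y *\<^sub>R A n Y) - (LINT Y|MK. k P Y *\<^sub>R a Y)) \<le> D * K.total_const"
      by (rule K.op_diff_bound[OF P continuous_measurable[OF A] _ continuous_measurable[OF a]])
         (use B B' N[OF n] D less_imp_le in blast)+
    also have "\<dots> < e"
    proof -
      have "D * K.total_const < D * (K.total_const + 1)" using D by (intro mult_strict_left_mono) auto
      also have "\<dots> = e" unfolding D_def using K.total_const_nonneg by simp
      finally show ?thesis .
    qed
    finally show "norm ((LINT Y|MK. k P Y *\<^sub>R A n Y) - (LINT Y|MK. k P Y *\<^sub>R a Y)) < e" .
  qed
qed

text \<open>Riesz's argument by contradiction: unbounded solutions are divided by their maxima, the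
  sources then disappear in the limit, and compactness yields a nonzero continuous solution of the
  homogeneous equation.\<close>

lemma solutions_bounded:
  fixes A \<rho> :: "nat \<Rightarrow> R3 \<Rightarrow> 'b" and g :: "R3 \<Rightarrow> 'b"
  assumes A: "\<And>n. continuous_on T (A n)"
    and eq: "\<And>n P. P \<in> T \<Longrightarrow> (1/2) *\<^sub>R A n P = (LINT Y|MK. k P Y *\<^sub>R A n Y) + g P + (LINT Y|MV. k P Y *\<^sub>R \<rho> n Y)"
    and g: "\<And>P. P \<in> T \<Longrightarrow> norm (g P) \<le> G"
    and \<rho>: "\<And>n Y. Y \<in> SV \<Longrightarrow> norm (\<rho> n Y) \<le> R" and R: "R \<ge> 0"
  shows "\<exists>B\<ge>0. \<forall>n. \<forall>P\<in>T. norm (A n P) \<le> B"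
proof (rule ccontr)
  assume unb: "\<not> ?thesis"
  have "\<exists>n. \<exists>P\<in>T. norm (A n P) > real (Suc i)" for i
    using unb by (metis not_le of_nat_0_le_iff)
  then obtain q where q: "\<And>i. \<exists>P\<in>T. norm (A (q i) P) > real (Suc i)" by metis
  have "\<exists>p\<in>T. \<forall>P\<in>T. norm (A (q i) P) \<le> norm (A (q i) p)" for i
    by (rule continuous_attains_sup[OF T]) (intro continuous_on_norm A)
  then obtain p where p: "\<And>i. p i \<in> T" "\<And>i P. P \<in> T \<Longrightarrow> norm (A (q i) P) \<le> norm (A (q i) (p i))" by metis
  \<comment> \<open>The maximum of the i-th chosen solution, attained at p(i). It exceeds i + 1 and
    so tends to infinity along every subsequence.\<close>
  define c where "c i = norm (A (q i) (p i))" for i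
  have c: "c i > real (Suc i)" for i
    using q[of i] p(2)[of _ i] unfolding c_def by fastforce
  have c0: "c i > 0" for i using c[of i] by linarith
  define a where "a i P = A (q i) P /\<^sub>R c i" for i P
  have ac: "continuous_on T (a i)" for i unfolding a_def by (intro continuous_intros A)
  have a1: "norm (a i P) \<le> 1" if "P \<in> T" for i P
    unfolding a_def using p(2)[OF that, of i] c0[of i] by (simp add: c_def[symmetric] field_simps)
  have ap: "norm (a i (p i)) = 1" for i
    unfolding a_def using c0[of i] by (simp add: c_def[symmetric])
  have aeq: "a i P = 2 *\<^sub>R ((LINT Y|MK. k P Y *\<^sub>R a i Y) + (g P + (LINT Y|MV. k P Y *\<^sub>R \<rho> (q i) Y)) /\<^sub>R c i)" if P: "P \<in> T" for i P
  proof -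
    have "(LINT Y|MK. k P Y *\<^sub>R a i Y) = (LINT Y|MK. inverse (c i) *\<^sub>R (k P Y *\<^sub>R A (q i) Y))"
      unfolding a_def by (simp add: mult.commute)
    also have "\<dots> = (LINT Y|MK. k P Y *\<^sub>R A (q i) Y) /\<^sub>R c i" by (rule integral_scaleR_right)
    finally have k: "(LINT Y|MK. k P Y *\<^sub>R a i Y) = (LINT Y|MK. k P Y *\<^sub>R A (q i) Y) /\<^sub>R c i" .
    have "A (q i) P = 2 *\<^sub>R ((LINT Y|MK. k P Y *\<^sub>R A (q i) Y) + (g P + (LINT Y|MV. k P Y *\<^sub>R \<rho> (q i) Y)))"
      using arg_cong[OF eq[OF P, of "q i"], of "\<lambda>x. 2 *\<^sub>R x"] by (simp add: add.assoc)
    then have "a i P = (2 *\<^sub>R ((LINT Y|MK. k P Y *\<^sub>R A (q i) Y) + (g P + (LINT Y|MV. k P Y *\<^sub>R \<rho> (q i) Y)))) /\<^sub>R c i"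
      unfolding a_def by simp
    then show ?thesis unfolding k by (simp add: scaleR_add_right mult.commute)
  qed
  obtain h r where h: "continuous_on T h" and r: "strict_mono (r :: nat \<Rightarrow> nat)"
    and hl: "\<forall>e>0. \<exists>N. \<forall>n P. n \<ge> N \<and> P \<in> T \<longrightarrow>
       norm ((LINT Y|MK. k P Y *\<^sub>R a (r n) Y) - h P) < e"
    using op_subsequence[of a 1 "\<lambda>_ _. 0" 0, OF ac a1] by auto
  define W where "W = \<bar>G\<bar> + R * V.total_const"
  have W0: "W \<ge> 0" unfolding W_def using R V.total_const_nonneg by simp
  have Wb: "norm (g P + (LINT Y|MV. k P Y *\<^sub>R \<rho> n Y)) \<le> W" if P: "P \<in> T" for n P
    unfolding W_def by (rule norm_triangle_mono[OF order_trans[OF g[OF P] abs_ge_self] V.op_bound[OF P \<rho> R]])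
  \<comment> \<open>The normalised equation reads a = 2 (K a + w) with w at most W/c. As K a tends
    to h uniformly, a tends to 2h.\<close>
  have al: "\<forall>e>0. \<exists>N. \<forall>n P. n \<ge> N \<and> P \<in> T \<longrightarrow> norm (a (r n) P - 2 *\<^sub>R h P) < e"
  proof (intro allI impI)
    fix e :: real assume e: "e > 0"
    obtain N1 where N1: "\<And>n P. n \<ge> N1 \<Longrightarrow> P \<in> T \<Longrightarrow> norm ((LINT Y|MK. k P Y *\<^sub>R a (r n) Y) - h P) < e / 4"
      using hl[rule_format, of "e / 4"] e by auto
    obtain N2 :: nat where N2: "4 * W / e < real N2" using reals_Archimedean2 by blast
    show "\<exists>N. \<forall>n P. n \<ge> N \<and> P \<in> T \<longrightarrow> norm (a (r n) P - 2 *\<^sub>R h P) < e"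
    proof (intro exI[of _ "max N1 N2"] allI impI)
      fix n P assume nP: "n \<ge> max N1 N2 \<and> P \<in> T"
      then have P: "P \<in> T" by blast
      let ?w = "(g P + (LINT Y|MV. k P Y *\<^sub>R \<rho> (q (r n)) Y)) /\<^sub>R c (r n)"
      have "real N2 \<le> c (r n)"
      proof -
        have "real N2 \<le> real n" using nP by simp
        also have "\<dots> \<le> real (Suc (r n))" using seq_suble[OF r, of n] by simp
        finally show ?thesis using c[of "r n"] by linarith
      qed
      then have "4 * W / e < c (r n)" using N2 by linarith
      then have wc: "W / c (r n) < e / 4" using c0[of "r n"] e by (simp add: field_simps)
      have "norm ?w = norm (g P + (LINT Y|MV. k P Y *\<^sub>R \<rho> (q (r n)) Y)) / c (r n)"
        using c0[of "r n"] by (simp add: divide_inverse mult.commute)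
      also have "\<dots> \<le> W / c (r n)" by (intro divide_right_mono Wb P) (use c0[of "r n"] in simp)
      finally have w: "norm ?w < e / 4" using wc by linarith
      have "a (r n) P - 2 *\<^sub>R h P = 2 *\<^sub>R (((LINT Y|MK. k P Y *\<^sub>R a (r n) Y) - h P) + ?w)"
        unfolding aeq[OF P, of "r n"] by (simp add: scaleR_diff_right scaleR_add_right)
      then have "norm (a (r n) P - 2 *\<^sub>R h P) = 2 * norm (((LINT Y|MK. k P Y *\<^sub>R a (r n) Y) - h P) + ?w)" by simp
      also have "\<dots> \<le> 2 * (norm ((LINT Y|MK. k P Y *\<^sub>R a (r n) Y) - h P) + norm ?w)"
        by (intro mult_left_mono norm_triangle_ineq) simp
      also have "\<dots> < e" using w N1[of n P] nP by simp
      finally show "norm (a (r n) P - 2 *\<^sub>R h P) < e" .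
    qed
  qed
  have h2: "continuous_on T (\<lambda>P. 2 *\<^sub>R h P)" by (intro continuous_intros h)
  have "2 *\<^sub>R h P = 0" if P: "P \<in> T" for P
  proof (rule homogeneous[OF h2 _ P])
    fix P assume P: "P \<in> T"
    have "(\<lambda>n. LINT Y|MK. k P Y *\<^sub>R a (r n) Y) \<longlonglongrightarrow> (LINT Y|MK. k P Y *\<^sub>R (2 *\<^sub>R h Y))"
      by (rule op_uniform_limit[OF ac h2 al P])
    moreover have "(\<lambda>n. LINT Y|MK. k P Y *\<^sub>R a (r n) Y) \<longlonglongrightarrow> h P"
    proof (rule LIMSEQ_I)
      fix e :: real assume "e > 0"
      then obtain N where "\<forall>n P. n \<ge> N \<and> P \<in> T \<longrightarrow>
         norm ((LINT Y|MK. k P Y *\<^sub>R a (r n) Y) - h P) < e" using hl by blast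
      then show "\<exists>no. \<forall>n\<ge>no. norm ((LINT Y|MK. k P Y *\<^sub>R a (r n) Y) - h P) < e" using P by (intro exI[of _ N]) simp
    qed
    ultimately have "h P = (LINT Y|MK. k P Y *\<^sub>R (2 *\<^sub>R h Y))" by (rule LIMSEQ_unique[rotated])
    then show "(1/2) *\<^sub>R 2 *\<^sub>R h P = (LINT Y|MK. k P Y *\<^sub>R (2 *\<^sub>R h Y))" by simp
  qed
  \<comment> \<open>At its maximum point each normalised function has norm 1, which excludes uniform
    convergence to 0.\<close>
  moreover obtain N where N: "\<And>n P. n \<ge> N \<Longrightarrow> P \<in> T \<Longrightarrow> norm (a (r n) P - 2 *\<^sub>R h P) < 1" using al zero_less_one by blast
  ultimately have "norm (a (r N) (p (r N))) < 1" using p(1) N[of N "p (r N)"] by simp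
  then show False using ap[of "r N"] by simp
qed

text \<open>The a priori bound makes the integral terms relatively compact, and the equation
  expresses each solution through them as 2 (K A + g + V \<rho>). The bound B is for the whole
  sequence.\<close>

lemma solutions_subsequence:
  fixes A \<rho> :: "nat \<Rightarrow> R3 \<Rightarrow> 'b" and g :: "R3 \<Rightarrow> 'b"
  assumes A: "\<And>n. continuous_on T (A n)"
    and eq: "\<And>n P. P \<in> T \<Longrightarrow> (1/2) *\<^sub>R A n P = (LINT Y|MK. k P Y *\<^sub>R A n Y) + g P + (LINT Y|MV. k P Y *\<^sub>R \<rho> n Y)"
    and g: "continuous_on T g"
    and \<rho>: "\<And>n. \<rho> n \<in> borel_measurable MV" "\<And>n Y. Y \<in> SV \<Longrightarrow> norm (\<rho> n Y) \<le> R" and R: "R \<ge> 0"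
  shows "\<exists>B a r. (\<forall>n. \<forall>P\<in>T. norm (A n P) \<le> B) \<and> continuous_on T a \<and> strict_mono (r :: nat \<Rightarrow> nat) \<and>
    (\<forall>e>0. \<exists>N. \<forall>n P. n \<ge> N \<and> P \<in> T \<longrightarrow> norm (A (r n) P - a P) < e)"
proof -
  obtain G where G: "\<forall>P\<in>T. norm (g P) \<le> G"
    using compact_imp_bounded[OF compact_continuous_image[OF g T(1)]] by (auto simp: bounded_iff)
  obtain B where B: "B \<ge> 0" "\<forall>n. \<forall>P\<in>T. norm (A n P) \<le> B"
    using solutions_bounded[where A=A and \<rho>=\<rho> and g=g and G=G and R=R, OF A eq _ \<rho>(2) R] G by blast
  obtain h r where h: "continuous_on T h" and r: "strict_mono (r :: nat \<Rightarrow> nat)"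
    and hl: "\<forall>e>0. \<exists>N. \<forall>n P. n \<ge> N \<and> P \<in> T \<longrightarrow>
       norm ((LINT Y|MK. k P Y *\<^sub>R A (r n) Y) + (LINT Y|MV. k P Y *\<^sub>R \<rho> (r n) Y) - h P) < e"
    using op_subsequence[where A=A and \<rho>=\<rho> and B=B and R=R, OF A _ B(1) \<rho> R] B(2) by blast
  have "\<forall>e>0. \<exists>N. \<forall>n P. n \<ge> N \<and> P \<in> T \<longrightarrow> norm (A (r n) P - 2 *\<^sub>R (h P + g P)) < e"
  proof (intro allI impI)
    fix e :: real assume "e > 0"
    then have "e / 2 > 0" by simp
    then obtain N where N: "\<And>n P. n \<ge> N \<and> P \<in> T \<Longrightarrow>
       norm ((LINT Y|MK. k P Y *\<^sub>R A (r n) Y) + (LINT Y|MV. k P Y *\<^sub>R \<rho> (r n) Y) - h P) < e / 2" using hl by blast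
    show "\<exists>N. \<forall>n P. n \<ge> N \<and> P \<in> T \<longrightarrow> norm (A (r n) P - 2 *\<^sub>R (h P + g P)) < e"
    proof (intro exI[of _ N] allI impI)
      fix n P assume nP: "n \<ge> N \<and> P \<in> T"
      then have P: "P \<in> T" by blast
      have "A (r n) P = 2 *\<^sub>R ((LINT Y|MK. k P Y *\<^sub>R A (r n) Y) + g P + (LINT Y|MV. k P Y *\<^sub>R \<rho> (r n) Y))"
        using arg_cong[OF eq[OF P, of "r n"], of "\<lambda>x. 2 *\<^sub>R x"] by simp
      then have "A (r n) P - 2 *\<^sub>R (h P + g P) = 2 *\<^sub>R ((LINT Y|MK. k P Y *\<^sub>R A (r n) Y) + (LINT Y|MV. k P Y *\<^sub>R \<rho> (r n) Y) - h P)"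
        by (simp add: scaleR_add_right scaleR_diff_right)
      then show "norm (A (r n) P - 2 *\<^sub>R (h P + g P)) < e" using N[OF nP] by simp
    qed
  qed
  moreover have "continuous_on T (\<lambda>P. 2 *\<^sub>R (h P + g P))" by (intro continuous_intros h g)
  ultimately show ?thesis using B(2) r by (intro exI[of _ B] exI[of _ "\<lambda>P. 2 *\<^sub>R (h P + g P)"] exI[of _ r]) blast
qed

end

section \<open>The boundary equation for \<open>A\<^sub>5\<close>\<close>

lemma newton_has_derivative:
  assumes "X \<noteq> 0"
  shows "(newton has_derivative (\<lambda>h. - (1 / (4 * pi * norm X ^ 3)) * (X \<bullet> h))) (at X)"
proof -
  have n: "norm X > 0" using assms by simp
  have nd: "(norm has_derivative (\<lambda>h. h \<bullet> sgn X)) (at X)" using has_derivative_norm[OF assms] by simp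
  have "((\<lambda>x. inverse (norm x)) has_derivative (\<lambda>h. - (inverse (norm X) * (h \<bullet> sgn X) * inverse (norm X)))) (at X)"
    by (rule Deriv.has_derivative_inverse[OF _ nd]) (use assms in simp)
  then have "((\<lambda>x. 1 / (4 * pi) * inverse (norm x)) has_derivative
      (\<lambda>h. 1 / (4 * pi) * - (inverse (norm X) * (h \<bullet> sgn X) * inverse (norm X)))) (at X)"
    by (rule has_derivative_mult_right)
  moreover have "1 / (4 * pi) * - (inverse (norm X) * (h \<bullet> sgn X) * inverse (norm X)) = - (1 / (4 * pi * norm X ^ 3)) * (X \<bullet> h)" for h
    using n by (simp add: sgn_div_norm inner_commute field_simps power3_eq_cube)
  moreover have "(\<lambda>x::R3. 1 / (4 * pi) * inverse (norm x)) = newton"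
    by (rule ext) (simp add: newton_def field_simps)
  ultimately show ?thesis by simp
qed

lemma grad_newton:
  assumes "X \<noteq> 0" shows "grad newton X = - (1 / (4 * pi * norm X ^ 3)) *\<^sub>R X"
proof -
  have "pd i newton X = - (1 / (4 * pi * norm X ^ 3)) * X $ i" for i
    using pd_eq[OF newton_has_derivative[OF assms], of i] by (simp add: inner_axis)
  then show ?thesis unfolding grad_def by (simp add: vec_eq_iff)
qed

lemma grad_newton_measurable [measurable]: "grad newton \<in> borel_measurable borel"
proof -
  \<comment> \<open>The value at the singularity is unspecified, but it concerns a single
    point.\<close>
  have "grad newton = (\<lambda>X. if X = 0 then grad newton 0 else - (1 / (4 * pi * norm X ^ 3)) *\<^sub>R X)"
    by (rule ext) (simp add: grad_newton)
  moreover have "(\<lambda>X::R3. if X = 0 then grad newton 0 else - (1 / (4 * pi * norm X ^ 3)) *\<^sub>R X) \<in> borel_measurable borel"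
    by measurable
  ultimately show ?thesis by simp
qed

text \<open>The kernel of the adjoint double layer potential: the normal is taken at the field point
  P, not at the integration point Y.\<close>

definition normal_kernel :: "R3 set \<Rightarrow> R3 \<Rightarrow> R3 \<Rightarrow> real" where
  "normal_kernel \<Omega> P Y = grad newton (P - Y) \<bullet> outer_normal \<Omega> P"

lemma normal_kernel_eq:
  "Y \<noteq> P \<Longrightarrow> normal_kernel \<Omega> P Y = - ((P - Y) \<bullet> outer_normal \<Omega> P) / (4 * pi * norm (P - Y) ^ 3)"
  unfolding normal_kernel_def by (subst grad_newton) simp_all

lemma normal_kernel_measurable: "normal_kernel \<Omega> P \<in> borel_measurable borel"
  unfolding normal_kernel_def[abs_def] by measurable

lemma normal_kernel_continuous:
  assumes n: "continuous_on T (outer_normal \<Omega>)" and P: "P \<in> T" and Y: "Y \<noteq> P"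
  shows "((\<lambda>P'. normal_kernel \<Omega> P' Y) \<longlongrightarrow> normal_kernel \<Omega> P Y) (at P within T)"
proof -
  have nl: "(outer_normal \<Omega> \<longlongrightarrow> outer_normal \<Omega> P) (at P within T)"
    using n P by (simp add: continuous_on_def)
  have "((\<lambda>P'. - ((P' - Y) \<bullet> outer_normal \<Omega> P') / (4 * pi * norm (P' - Y) ^ 3)) \<longlongrightarrow>
      - ((P - Y) \<bullet> outer_normal \<Omega> P) / (4 * pi * norm (P - Y) ^ 3)) (at P within T)"
    by (intro tendsto_intros nl) (use Y in auto)
  moreover have "\<forall>\<^sub>F P' in at P within T. - ((P' - Y) \<bullet> outer_normal \<Omega> P') / (4 * pi * norm (P' - Y) ^ 3) = normal_kernel \<Omega> P' Y"
  proof -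
    have "\<forall>\<^sub>F P' in at P within T. P' \<noteq> Y"
      by (rule tendsto_imp_eventually_ne[OF tendsto_ident_at]) (use Y in simp)
    then show ?thesis by (rule eventually_mono) (simp add: normal_kernel_eq)
  qed
  ultimately have "((\<lambda>P'. normal_kernel \<Omega> P' Y) \<longlongrightarrow> - ((P - Y) \<bullet> outer_normal \<Omega> P) / (4 * pi * norm (P - Y) ^ 3)) (at P within T)"
    by (rule Lim_transform_eventually)
  then show ?thesis using normal_kernel_eq[OF Y] by simp
qed

lemma power3_powr: "d > 0 \<Longrightarrow> d powr a / (c * d ^ 3) = 1 / c * d powr (a - 3)" for d :: real
  by (simp add: powr_diff)

locale convex_C1_domain =
  fixes \<Omega> :: "R3 set" and \<alpha> :: real
  assumes dom: "open \<Omega>" "\<Omega> \<noteq> {}" "bounded \<Omega>"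
    and bnd: "C1_alpha_boundary \<alpha> \<Omega>" "0 < \<alpha>" "\<alpha> \<le> 1" and cvx: "convex (closure \<Omega>)"
begin

lemmas domain_facts = dom(1) dom(3) bnd(1,2)

text \<open>On the boundary the numerator is of order |P - Y|^(1+\<alpha>), so the singularity has
  order 2 - \<alpha>, below the surface dimension 2.\<close>

lemma weakly_singular_surface:
  "\<exists>L. weakly_singular (surf \<Omega>) (frontier \<Omega>) (frontier \<Omega>) (normal_kernel \<Omega>) (24 * pi) L 2 (2 - \<alpha>)"
proof -
  obtain K where K: "K \<ge> 0" "\<forall>P\<in>frontier \<Omega>. \<forall>X\<in>frontier \<Omega>. \<bar>(P - X) \<bullet> outer_normal \<Omega> P\<bar> \<le> K * norm (P - X) powr (1 + \<alpha>)"
    using outer_normal_estimate[OF domain_facts] by blast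
  interpret finite_measure "surf \<Omega>" by (rule finite_measure_surf[OF domain_facts cvx dom(2)])
  have "weakly_singular (surf \<Omega>) (frontier \<Omega>) (frontier \<Omega>) (normal_kernel \<Omega>) (24 * pi) (K / (4 * pi)) 2 (2 - \<alpha>)"
  proof
    show "sets (surf \<Omega>) = sets (restrict_space borel (frontier \<Omega>))" by (rule sets_surf)
    show "emeasure (surf \<Omega>) (frontier \<Omega> \<inter> ball P r) \<le> ennreal (24 * pi * r powr 2)" if "r > 0" for P r
      using emeasure_surf_ball_le[OF domain_facts cvx dom(2) that] that by simp
    show "normal_kernel \<Omega> P \<in> borel_measurable (surf \<Omega>)" for P
      unfolding measurable_cong_sets[OF sets_surf refl] by (rule measurable_restrict_space1[OF normal_kernel_measurable])
    fix P Y assume P: "P \<in> frontier \<Omega>" and Y: "Y \<in> frontier \<Omega>" "Y \<noteq> P"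
    show "((\<lambda>P'. normal_kernel \<Omega> P' Y) \<longlongrightarrow> normal_kernel \<Omega> P Y) (at P within frontier \<Omega>)"
      by (rule normal_kernel_continuous[OF outer_normal_continuous_on[OF domain_facts] P Y(2)])
    have d: "norm (P - Y) > 0" using Y by simp
    have "\<bar>normal_kernel \<Omega> P Y\<bar> = \<bar>(P - Y) \<bullet> outer_normal \<Omega> P\<bar> / (4 * pi * norm (P - Y) ^ 3)"
      unfolding normal_kernel_eq[OF Y(2)] by simp
    also have "\<dots> \<le> K * norm (P - Y) powr (1 + \<alpha>) / (4 * pi * norm (P - Y) ^ 3)"
      using K P Y by (intro divide_right_mono) auto
    also have "\<dots> = K * (norm (P - Y) powr (1 + \<alpha>) / (4 * pi * norm (P - Y) ^ 3))" by simp
    also have "\<dots> = K / (4 * pi) * norm (P - Y) powr (- (2 - \<alpha>))"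
      unfolding power3_powr[OF d] by (simp add: algebra_simps)
    finally show "\<bar>normal_kernel \<Omega> P Y\<bar> \<le> K / (4 * pi) * norm (P - Y) powr (- (2 - \<alpha>))" .
  qed (use K bnd in auto)
  then show ?thesis by blast
qed

text \<open>Against volume, Cauchy-Schwarz alone gives order 2, below the dimension 3. The constant
  8 comes from the cube of edge 2r around a ball of radius r.\<close>

lemma weakly_singular_volume:
  "weakly_singular (restrict_space lborel \<Omega>) (frontier \<Omega>) \<Omega> (normal_kernel \<Omega>) 8 (1 / (4 * pi)) 3 2"
proof -
  have fin: "emeasure lborel \<Omega> < \<infinity>" by (rule emeasure_bounded_finite[OF dom(3)])
  interpret finite_measure "restrict_space lborel \<Omega>"
    by (rule finite_measureI) (use dom(1) fin in \<open>simp add: emeasure_restrict_space space_restrict_space\<close>)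
  show ?thesis
  proof
    show s: "sets (restrict_space lborel \<Omega>) = sets (restrict_space borel \<Omega>)"
      by (rule sets_restrict_space_cong) simp
    show "emeasure (restrict_space lborel \<Omega>) (\<Omega> \<inter> ball P r) \<le> ennreal (8 * r powr 3)" if "r > 0" for P r
    proof -
      have "emeasure (restrict_space lborel \<Omega>) (\<Omega> \<inter> ball P r) = emeasure lborel (\<Omega> \<inter> ball P r)"
        using dom(1) by (intro emeasure_restrict_space) auto
      also have "\<dots> \<le> emeasure lborel (cbox (P - (\<chi> i. r)) (P + (\<chi> i. r)))"
      proof (rule emeasure_mono)
        show "\<Omega> \<inter> ball P r \<subseteq> cbox (P - (\<chi> i. r)) (P + (\<chi> i. r))"
        proof
          fix Q assume "Q \<in> \<Omega> \<inter> ball P r"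
          then have "\<bar>Q $ i - P $ i\<bar> < r" for i
            using component_le_norm_cart[of "Q - P" i] by (simp add: dist_norm norm_minus_commute)
          then have "P $ i - r \<le> Q $ i" "Q $ i \<le> P $ i + r" for i
            by (smt (verit))+
          then show "Q \<in> cbox (P - (\<chi> i. r)) (P + (\<chi> i. r))" by (simp add: mem_box_cart)
        qed
      qed simp
      also have "\<dots> = ennreal (8 * r powr 3)"
      proof -
        have "emeasure lborel (cbox (P - (\<chi> i. r)) (P + (\<chi> i. r))) = ennreal (\<Prod>b\<in>Basis. ((P + (\<chi> i. r)) - (P - (\<chi> i. r))) \<bullet> b)"
          by (rule emeasure_lborel_cbox) (use that in \<open>auto simp: Basis_vec_def inner_axis\<close>)
        also have "(\<Prod>b\<in>(Basis :: R3 set). ((P + (\<chi> i. r)) - (P - (\<chi> i. r))) \<bullet> b) = (\<Prod>b\<in>(Basis :: R3 set). 2 * r)"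
          by (intro prod.cong refl) (auto simp: Basis_vec_def inner_axis)
        also have "\<dots> = 8 * r powr 3" using that by (simp add: power_mult_distrib)
        finally show ?thesis .
      qed
      finally show ?thesis .
    qed
    show "normal_kernel \<Omega> P \<in> borel_measurable (restrict_space lborel \<Omega>)" for P
      unfolding measurable_cong_sets[OF s refl] by (rule measurable_restrict_space1[OF normal_kernel_measurable])
    fix P Y assume P: "P \<in> frontier \<Omega>" and Y: "Y \<in> \<Omega>" "Y \<noteq> P"
    show "((\<lambda>P'. normal_kernel \<Omega> P' Y) \<longlongrightarrow> normal_kernel \<Omega> P Y) (at P within frontier \<Omega>)"
      by (rule normal_kernel_continuous[OF outer_normal_continuous_on[OF domain_facts] P Y(2)])
    have d: "norm (P - Y) > 0" using Y by simp
    have "\<bar>normal_kernel \<Omega> P Y\<bar> = \<bar>(P - Y) \<bullet> outer_normal \<Omega> P\<bar> / (4 * pi * norm (P - Y) ^ 3)"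
      unfolding normal_kernel_eq[OF Y(2)] by simp
    also have "\<dots> \<le> norm (P - Y) powr 1 / (4 * pi * norm (P - Y) ^ 3)"
      using Cauchy_Schwarz_ineq2[of "P - Y" "outer_normal \<Omega> P"] outer_normal_unit[OF domain_facts P] d
      by (intro divide_right_mono) simp_all
    also have "\<dots> = 1 / (4 * pi) * norm (P - Y) powr (- 2)"
      unfolding power3_powr[OF d] by simp
    finally show "\<bar>normal_kernel \<Omega> P Y\<bar> \<le> 1 / (4 * pi) * norm (P - Y) powr (- 2)" .
  qed auto
qed

lemma frontier_nonempty: "frontier \<Omega> \<noteq> {}"
  using dom by (metis frontier_not_empty not_bounded_UNIV)

end

section \<open>Nonlinear terms and the boundary equation for bounded Z\<close>

locale elliptic_setup = convex_C1_domain \<Omega> \<alpha>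
  for \<Omega> :: "R3 set" and \<alpha> :: real +
  fixes v :: "'m::finite enum10" and C :: "real^('m idx)^'m" and f :: "'m rhs"
    and g02 :: "R3 \<Rightarrow> real^'m" and A5 :: "'m Zfun \<Rightarrow> R3 \<Rightarrow> real^'m"
  assumes f: "continuous_on (UNIV \<times> closure \<Omega>) (\<lambda>(z, X). f z X)"
    and g02: "Ck_boundary 1 \<Omega> g02"
    and A5: "\<And>Z. Linf_fun (closure \<Omega>) Z \<Longrightarrow> solves_A5 \<Omega> v f g02 Z (A5 Z)"
    and A5_unique: "\<And>Z A P. Linf_fun (closure \<Omega>) Z \<Longrightarrow> solves_A5 \<Omega> v f g02 Z A \<Longrightarrow>
                      P \<in> frontier \<Omega> \<Longrightarrow> A P = A5 Z P"
begin

text \<open>One class for the continuous fixed points and for their almost everywhere limit, which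
  is merely measurable. Bounding at every point of the closure keeps the arguments of f in a fixed
  compact set.\<close>

definition bounded_class :: "real \<Rightarrow> 'm Zfun set" where
  "bounded_class M = {Z. Z \<in> borel_measurable (restrict_space lborel (closure \<Omega>)) \<and>
     (\<forall>X\<in>closure \<Omega>. \<forall>i. \<bar>Z X $ i\<bar> \<le> M)}"

lemma bounded_class_measurable: "Z \<in> bounded_class M \<Longrightarrow> Z \<in> borel_measurable (restrict_space lborel (closure \<Omega>))"
  and bounded_class_bound: "Z \<in> bounded_class M \<Longrightarrow> X \<in> closure \<Omega> \<Longrightarrow> \<bar>Z X $ i\<bar> \<le> M"
  unfolding bounded_class_def by blast+

lemma bounded_class_norm:
  assumes "Z \<in> bounded_class M" "X \<in> closure \<Omega>" shows "norm (Z X) \<le> real CARD('m idx) * M"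
proof -
  have "norm (Z X) \<le> (\<Sum>i\<in>UNIV. \<bar>Z X $ i\<bar>)" by (rule norm_le_l1_cart)
  also have "\<dots> \<le> (\<Sum>i\<in>(UNIV :: 'm idx set). M)" by (intro sum_mono bounded_class_bound[OF assms])
  finally show ?thesis by simp
qed

lemma bounded_class_Linf_norm:
  assumes "Z \<in> bounded_class M" shows "Linf_norm (closure \<Omega>) Z \<le> ereal M"
  by (rule Linf_norm_le[OF _ bounded_class_measurable[OF assms]]) (use bounded_class_bound[OF assms] in auto)

lemma bounded_class_Linf_fun:
  assumes "Z \<in> bounded_class M" shows "Linf_fun (closure \<Omega>) Z"
  unfolding Linf_fun_def
proof
  show "Z \<in> borel_measurable (restrict_space lborel (closure \<Omega>))" by (rule bounded_class_measurable[OF assms])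
  show "Linf_norm (closure \<Omega>) Z < \<infinity>"
    by (rule le_less_trans[OF bounded_class_Linf_norm[OF assms]]) simp
qed

lemma f_bounded:
  "\<exists>R\<ge>0. \<forall>Z\<in>bounded_class M. \<forall>X\<in>closure \<Omega>. norm (f (Z X) X) \<le> R"
proof -
  let ?K = "cball (0 :: real^'m idx) (real CARD('m idx) * M) \<times> closure \<Omega>"
  have "compact ?K" using dom(3) by (intro compact_Times) (auto simp: compact_closure)
  moreover have "continuous_on ?K (\<lambda>(z, X). f z X)" by (rule continuous_on_subset[OF f]) auto
  ultimately have "bounded ((\<lambda>(z, X). f z X) ` ?K)" by (intro compact_imp_bounded compact_continuous_image)
  then obtain R where R: "\<forall>y\<in>(\<lambda>(z, X). f z X) ` ?K. norm y \<le> R" unfolding bounded_iff by blast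
  have "norm (f (Z X) X) \<le> max R 0" if "Z \<in> bounded_class M" "X \<in> closure \<Omega>" for Z X
  proof -
    have "(Z X, X) \<in> ?K" using bounded_class_norm[OF that] that(2) by simp
    then have "f (Z X) X \<in> (\<lambda>(z, X). f z X) ` ?K" by (rule image_eqI[rotated]) simp
    then have "norm (f (Z X) X) \<le> R" using R by blast
    then show ?thesis by simp
  qed
  then show ?thesis by (intro exI[of _ "max R 0"]) auto
qed

lemma f_measurable:
  assumes Z: "Z \<in> borel_measurable (restrict_space lborel (closure \<Omega>))"
  shows "(\<lambda>X. f (Z X) X) \<in> borel_measurable (restrict_space lborel (closure \<Omega>))"
proof -
  have i: "(\<lambda>X. X) \<in> borel_measurable (restrict_space lborel (closure \<Omega>))"
    by (rule measurable_restrict_space1) simp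
  have "(\<lambda>X. (Z X, X)) \<in> borel_measurable (restrict_space lborel (closure \<Omega>))"
    by (rule borel_measurable_Pair[OF Z i])
  then have "(\<lambda>X. (Z X, X)) \<in> measurable (restrict_space lborel (closure \<Omega>)) (restrict_space borel (UNIV \<times> closure \<Omega>))"
    by (intro measurable_restrict_space2) (auto simp: space_restrict_space)
  from measurable_compose[OF this borel_measurable_continuous_on_restrict[OF f]]
  show ?thesis by simp
qed

lemma f_tendsto:
  assumes "\<And>n. X \<in> closure \<Omega>" "(\<lambda>n. Z n X) \<longlonglongrightarrow> Zs X"
  shows "(\<lambda>n. f (Z n X) X) \<longlonglongrightarrow> f (Zs X) X"
proof -
  have "(\<lambda>n. (Z n X, X)) \<longlonglongrightarrow> (Zs X, X)" by (intro tendsto_Pair tendsto_const assms)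
  from continuous_on_tendsto_compose[OF f this] show ?thesis using assms(1) by simp
qed

lemma comp_val_bounded:
  "\<exists>R\<ge>0. \<forall>Z\<in>bounded_class M. \<forall>X\<in>closure \<Omega>. \<forall>c. \<bar>comp_val v f Z X c\<bar> \<le> R"
proof -
  obtain R where R: "R \<ge> 0" "\<forall>Z\<in>bounded_class M. \<forall>X\<in>closure \<Omega>. norm (f (Z X) X) \<le> R" using f_bounded by blast
  have "\<bar>comp_val v f Z X c\<bar> \<le> max R M" if Z: "Z \<in> bounded_class M" "X \<in> closure \<Omega>" for Z X c
  proof (cases "inv v c")
    case (Inl j)
    have "\<bar>f (Z X) X $ j\<bar> \<le> norm (f (Z X) X)" by (rule component_le_norm_cart)
    then have "\<bar>f (Z X) X $ j\<bar> \<le> R" using R(2) Z by fastforce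
    then show ?thesis using Inl by (simp add: comp_val_def)
  next
    case (Inr k)
    then show ?thesis using bounded_class_bound[OF Z, of k] by (simp add: comp_val_def)
  qed
  then show ?thesis using R(1) by (intro exI[of _ "max R M"]) auto
qed

lemma comp_val_measurable:
  assumes Z: "Z \<in> borel_measurable (restrict_space lborel (closure \<Omega>))"
  shows "(\<lambda>X. comp_val v f Z X c) \<in> borel_measurable (restrict_space lborel (closure \<Omega>))"
proof (cases "inv v c")
  case (Inl j)
  have "(\<lambda>X. f (Z X) X $ j) \<in> borel_measurable (restrict_space lborel (closure \<Omega>))"
    by (rule measurable_compose[OF f_measurable[OF Z]]) (intro borel_measurable_continuous_onI continuous_intros)
  then show ?thesis using Inl by (simp add: comp_val_def)
next
  case (Inr k)
  have "(\<lambda>X. Z X $ k) \<in> borel_measurable (restrict_space lborel (closure \<Omega>))"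
    by (rule measurable_compose[OF Z]) (intro borel_measurable_continuous_onI continuous_intros)
  then show ?thesis using Inr by (simp add: comp_val_def)
qed

lemma comp_val_tendsto:
  assumes "X \<in> closure \<Omega>" "(\<lambda>n. Z n X) \<longlonglongrightarrow> Zs X"
  shows "(\<lambda>n. comp_val v f (Z n) X c) \<longlonglongrightarrow> comp_val v f Zs X c"
  using f_tendsto[of X Z Zs] assms by (cases "inv v c") (auto simp: comp_val_def intro: tendsto_vec_nth)

lemma restrict_closure_to_interior:
  fixes h :: "R3 \<Rightarrow> 'b::topological_space"
  assumes "h \<in> borel_measurable (restrict_space lborel (closure \<Omega>))"
  shows "h \<in> borel_measurable (restrict_space lborel \<Omega>)"
proof -
  have "h \<in> borel_measurable (restrict_space (restrict_space lborel (closure \<Omega>)) \<Omega>)"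
    by (rule measurable_restrict_space1[OF assms])
  moreover have "restrict_space (restrict_space lborel (closure \<Omega>)) \<Omega> = restrict_space lborel \<Omega>"
    using dom(1) closure_subset[of \<Omega>] by (subst restrict_restrict_space) (auto simp: inf_absorb2)
  ultimately show ?thesis by simp
qed

lemma psi1_bounded:
  "\<exists>R\<ge>0. \<forall>Z\<in>bounded_class M. \<forall>X\<in>closure \<Omega>. norm (psi1 v f Z X) \<le> R"
proof -
  obtain R where R: "R \<ge> 0" "\<forall>Z\<in>bounded_class M. \<forall>X\<in>closure \<Omega>. \<forall>c. \<bar>comp_val v f Z X c\<bar> \<le> R"
    using comp_val_bounded by blast
  have "norm (psi1 v f Z X) \<le> real CARD('m) * (3 * R)" if "Z \<in> bounded_class M" "X \<in> closure \<Omega>" for Z X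
  proof -
    have b: "\<bar>comp_val v f Z X c\<bar> \<le> R" for c using R(2) that by blast
    have "norm (psi1 v f Z X) \<le> (\<Sum>i\<in>UNIV. \<bar>psi1 v f Z X $ i\<bar>)" by (rule norm_le_l1_cart)
    also have "\<dots> \<le> (\<Sum>i\<in>(UNIV :: 'm set). 3 * R)"
    proof (rule sum_mono)
      fix i show "\<bar>psi1 v f Z X $ i\<bar> \<le> 3 * R"
        unfolding psi1_def using b[of "(Some Dxx, i)"] b[of "(Some Dyy, i)"] b[of "(Some Dzz, i)"]
        by simp
    qed
    finally show ?thesis by simp
  qed
  then show ?thesis using R(1) by (intro exI[of _ "real CARD('m) * (3 * R)"]) auto
qed

lemma psi1_measurable:
  assumes Z: "Z \<in> borel_measurable (restrict_space lborel (closure \<Omega>))"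
  shows "psi1 v f Z \<in> borel_measurable (restrict_space lborel \<Omega>)"
proof -
  have "psi1 v f Z \<in> borel_measurable (restrict_space lborel (closure \<Omega>))"
    unfolding psi1_def[abs_def]
  proof (subst borel_measurable_euclidean_space, intro ballI)
    fix b :: "real^'m" assume "b \<in> Basis"
    then obtain i where b: "b = axis i 1" by (auto simp: Basis_vec_def)
    have "(\<lambda>Y. - (comp_val v f Z Y (Some Dxx, i) + comp_val v f Z Y (Some Dyy, i) + comp_val v f Z Y (Some Dzz, i)))
        \<in> borel_measurable (restrict_space lborel (closure \<Omega>))"
      by (intro borel_measurable_uminus borel_measurable_add comp_val_measurable[OF Z])
    then show "(\<lambda>Y. (\<chi> i. - (comp_val v f Z Y (Some Dxx, i) + comp_val v f Z Y (Some Dyy, i) + comp_val v f Z Y (Some Dzz, i))) \<bullet> b)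
        \<in> borel_measurable (restrict_space lborel (closure \<Omega>))"
      unfolding b inner_axis by simp
  qed
  then show ?thesis by (rule restrict_closure_to_interior)
qed

lemma psi1_tendsto:
  assumes "X \<in> closure \<Omega>" "(\<lambda>n. Z n X) \<longlonglongrightarrow> Zs X"
  shows "(\<lambda>n. psi1 v f (Z n) X) \<longlonglongrightarrow> psi1 v f Zs X"
  unfolding psi1_def by (intro tendsto_vec_lambda tendsto_minus tendsto_add comp_val_tendsto[where Z=Z and Zs=Zs, OF assms])

lemma solves_A5_iff:
  "solves_A5 \<Omega> v f g02 Z A \<longleftrightarrow> continuous_on (frontier \<Omega>) A \<and>
     (\<forall>P\<in>frontier \<Omega>. (1/2) *\<^sub>R A P = (LINT Y|surf \<Omega>. normal_kernel \<Omega> P Y *\<^sub>R A Y) + g02 P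
        + (LINT Y|restrict_space lborel \<Omega>. normal_kernel \<Omega> P Y *\<^sub>R psi1 v f Z Y))"
proof -
  have "(LINT Y:\<Omega>|lborel. (grad newton (P - Y) \<bullet> outer_normal \<Omega> P) *\<^sub>R psi1 v f Z Y)
      = (LINT Y|restrict_space lborel \<Omega>. normal_kernel \<Omega> P Y *\<^sub>R psi1 v f Z Y)" for P
    unfolding normal_kernel_def using dom(1) by (subst integral_restrict_space) (simp_all add: set_lebesgue_integral_def)
  then show ?thesis unfolding solves_A5_def normal_kernel_def by simp
qed

lemma zero_Linf_fun: "Linf_fun (closure \<Omega>) (\<lambda>_. 0 :: real^'m idx)"
  by (rule bounded_class_Linf_fun[of _ 0]) (simp add: bounded_class_def)

text \<open>If a solves the homogeneous equation, then A_5(0) + a solves the full equation for Z =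
  0, and uniqueness there forces a = 0. The operator 1/2 - K is the same for every Z.\<close>

lemma homogeneous_A5:
  fixes a :: "R3 \<Rightarrow> real^'m"
  assumes a: "continuous_on (frontier \<Omega>) a"
    and eq: "\<And>P. P \<in> frontier \<Omega> \<Longrightarrow> (1/2) *\<^sub>R a P = (LINT Y|surf \<Omega>. normal_kernel \<Omega> P Y *\<^sub>R a Y)"
    and P: "P \<in> frontier \<Omega>"
  shows "a P = 0"
proof -
  obtain L where "weakly_singular (surf \<Omega>) (frontier \<Omega>) (frontier \<Omega>) (normal_kernel \<Omega>) (24 * pi) L 2 (2 - \<alpha>)"
    using weakly_singular_surface by blast
  then interpret W: weakly_singular "surf \<Omega>" "frontier \<Omega>" "frontier \<Omega>" "normal_kernel \<Omega>" "24 * pi" L 2 "2 - \<alpha>" .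
  let ?A = "A5 (\<lambda>_. 0)"
  have s: "solves_A5 \<Omega> v f g02 (\<lambda>_. 0) ?A" by (rule A5[OF zero_Linf_fun])
  then have Ac: "continuous_on (frontier \<Omega>) ?A" unfolding solves_A5_def by blast
  have int: "integrable (surf \<Omega>) (\<lambda>Y. normal_kernel \<Omega> P Y *\<^sub>R b Y)"
    if bc: "continuous_on (frontier \<Omega>) b" and bP: "P \<in> frontier \<Omega>" for b :: "R3 \<Rightarrow> real^'m" and P
  proof -
    have "b \<in> borel_measurable (surf \<Omega>)"
      unfolding measurable_cong_sets[OF sets_surf refl] by (rule borel_measurable_continuous_on_restrict[OF bc])
    moreover obtain B where "\<forall>Y\<in>frontier \<Omega>. norm (b Y) \<le> B"
      using compact_imp_bounded[OF compact_continuous_image[OF bc compact_frontier_Omega[OF domain_facts]]] by (auto simp: bounded_iff)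
    ultimately show ?thesis by (intro W.op_integrable[OF bP]) auto
  qed
  have "solves_A5 \<Omega> v f g02 (\<lambda>_. 0) (\<lambda>P. ?A P + a P)"
    unfolding solves_A5_iff
  proof (intro conjI ballI)
    show "continuous_on (frontier \<Omega>) (\<lambda>P. ?A P + a P)" by (intro continuous_intros Ac a)
    fix P assume P: "P \<in> frontier \<Omega>"
    have "(LINT Y|surf \<Omega>. normal_kernel \<Omega> P Y *\<^sub>R (?A Y + a Y))
        = (LINT Y|surf \<Omega>. normal_kernel \<Omega> P Y *\<^sub>R ?A Y) + (LINT Y|surf \<Omega>. normal_kernel \<Omega> P Y *\<^sub>R a Y)"
      unfolding scaleR_add_right by (rule Bochner_Integration.integral_add[OF int[OF Ac P] int[OF a P]])
    moreover have "(1/2) *\<^sub>R ?A P = (LINT Y|surf \<Omega>. normal_kernel \<Omega> P Y *\<^sub>R ?A Y) + g02 P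
        + (LINT Y|restrict_space lborel \<Omega>. normal_kernel \<Omega> P Y *\<^sub>R psi1 v f (\<lambda>_. 0) Y)"
      using s P unfolding solves_A5_iff by blast
    ultimately show "(1/2) *\<^sub>R (?A P + a P) = (LINT Y|surf \<Omega>. normal_kernel \<Omega> P Y *\<^sub>R (?A Y + a Y)) + g02 P
        + (LINT Y|restrict_space lborel \<Omega>. normal_kernel \<Omega> P Y *\<^sub>R psi1 v f (\<lambda>_. 0) Y)"
      unfolding scaleR_add_right eq[OF P] by simp
  qed
  from A5_unique[OF zero_Linf_fun this P] show ?thesis by simp
qed

lemma g02_continuous: "continuous_on (frontier \<Omega>) g02"
proof -
  obtain G U where G: "open U" "frontier \<Omega> \<subseteq> U" "Ck 1 U G" "\<forall>P\<in>frontier \<Omega>. G P = g02 P"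
    using g02 unfolding Ck_boundary_def Ck_extension_def by blast
  have "continuous_on U G"
    using G(3) by (auto intro!: continuous_at_imp_continuous_on differentiable_imp_continuous_within)
  then have "continuous_on (frontier \<Omega>) G" using G(2) continuous_on_subset by blast
  then show ?thesis by (rule continuous_on_cong[THEN iffD1, rotated -1]) (use G(4) in auto)
qed

lemma A5_continuous:
  assumes "Z \<in> bounded_class M" shows "continuous_on (frontier \<Omega>) (A5 Z)"
  using A5[OF bounded_class_Linf_fun[OF assms]] unfolding solves_A5_def by blast

text \<open>The sources \<open>psi1 v f (Z n)\<close> are uniformly bounded but may oscillate; the
  compactness comes from the weakly singular operators.\<close>

lemma A5_subsequence:
  assumes Z: "\<And>n. Z n \<in> bounded_class M"
  shows "\<exists>B a r. (\<forall>n. \<forall>P\<in>frontier \<Omega>. norm (A5 (Z n) P) \<le> B) \<and> continuous_on (frontier \<Omega>) a \<and> strict_mono (r :: nat \<Rightarrow> nat) \<and>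
    (\<forall>e>0. \<exists>N. \<forall>n P. n \<ge> N \<and> P \<in> frontier \<Omega> \<longrightarrow> norm (A5 (Z (r n)) P - a P) < e)"
proof -
  obtain L where "weakly_singular (surf \<Omega>) (frontier \<Omega>) (frontier \<Omega>) (normal_kernel \<Omega>) (24 * pi) L 2 (2 - \<alpha>)"
    using weakly_singular_surface by blast
  then interpret K: weakly_singular "surf \<Omega>" "frontier \<Omega>" "frontier \<Omega>" "normal_kernel \<Omega>" "24 * pi" L 2 "2 - \<alpha>" .
  interpret V: weakly_singular "restrict_space lborel \<Omega>" "frontier \<Omega>" \<Omega> "normal_kernel \<Omega>" 8 "1 / (4 * pi)" 3 2
    by (rule weakly_singular_volume)
  interpret boundary_equation "surf \<Omega>" "restrict_space lborel \<Omega>" "frontier \<Omega>" \<Omega> "normal_kernel \<Omega>" "24 * pi" L 2 "2 - \<alpha>" 8 "1 / (4 * pi)" 3 2 "undefined :: real^'m"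
    by unfold_locales (auto intro: compact_frontier_Omega[OF domain_facts] homogeneous_A5 simp: frontier_nonempty)
  obtain R where R: "R \<ge> 0" "\<forall>Z\<in>bounded_class M. \<forall>X\<in>closure \<Omega>. norm (psi1 v f Z X) \<le> R" using psi1_bounded by blast
  show ?thesis
  proof (rule solutions_subsequence[where A="\<lambda>n. A5 (Z n)" and \<rho>="\<lambda>n. psi1 v f (Z n)" and g=g02 and R=R])
    show "continuous_on (frontier \<Omega>) (A5 (Z n))" for n by (rule A5_continuous[OF Z])
    show "(1/2) *\<^sub>R A5 (Z n) P = (LINT Y|surf \<Omega>. normal_kernel \<Omega> P Y *\<^sub>R A5 (Z n) Y) + g02 P
        + (LINT Y|restrict_space lborel \<Omega>. normal_kernel \<Omega> P Y *\<^sub>R psi1 v f (Z n) Y)" if "P \<in> frontier \<Omega>" for n P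
      using A5[OF bounded_class_Linf_fun[OF Z, of n]] that unfolding solves_A5_iff by blast
    show "psi1 v f (Z n) \<in> borel_measurable (restrict_space lborel \<Omega>)" for n
      by (rule psi1_measurable[OF bounded_class_measurable[OF Z]])
    show "norm (psi1 v f (Z n) Y) \<le> R" if "Y \<in> \<Omega>" for n Y
      using R(2) Z that closure_subset by blast
  qed (rule g02_continuous R(1))+
qed

text \<open>Every term of the boundary equation passes to the limit, the volume term by dominated
  convergence with majorant R |k|. Uniqueness then identifies the limit.\<close>

lemma A5_limit:
  assumes Z: "\<And>n. Z n \<in> bounded_class M" and Zs: "Zs \<in> bounded_class M"
    and lim: "AE X in lborel. X \<in> closure \<Omega> \<longrightarrow> (\<lambda>n. Z n X) \<longlonglongrightarrow> Zs X"
    and a: "continuous_on (frontier \<Omega>) a"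
    and al: "\<forall>e>0. \<exists>N. \<forall>n P. n \<ge> N \<and> P \<in> frontier \<Omega> \<longrightarrow> norm (A5 (Z n) P - a P) < e"
    and P: "P \<in> frontier \<Omega>"
  shows "a P = A5 Zs P"
proof -
  obtain L where "weakly_singular (surf \<Omega>) (frontier \<Omega>) (frontier \<Omega>) (normal_kernel \<Omega>) (24 * pi) L 2 (2 - \<alpha>)"
    using weakly_singular_surface by blast
  then interpret K: weakly_singular "surf \<Omega>" "frontier \<Omega>" "frontier \<Omega>" "normal_kernel \<Omega>" "24 * pi" L 2 "2 - \<alpha>" .
  interpret V: weakly_singular "restrict_space lborel \<Omega>" "frontier \<Omega>" \<Omega> "normal_kernel \<Omega>" 8 "1 / (4 * pi)" 3 2
    by (rule weakly_singular_volume)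
  interpret boundary_equation "surf \<Omega>" "restrict_space lborel \<Omega>" "frontier \<Omega>" \<Omega> "normal_kernel \<Omega>" "24 * pi" L 2 "2 - \<alpha>" 8 "1 / (4 * pi)" 3 2 "undefined :: real^'m"
    by unfold_locales (auto intro: compact_frontier_Omega[OF domain_facts] homogeneous_A5 simp: frontier_nonempty)
  obtain R where R: "R \<ge> 0" "\<forall>Z\<in>bounded_class M. \<forall>X\<in>closure \<Omega>. norm (psi1 v f Z X) \<le> R" using psi1_bounded by blast
  have "solves_A5 \<Omega> v f g02 Zs a"
    unfolding solves_A5_iff
  proof (intro conjI ballI a)
    fix P assume P: "P \<in> frontier \<Omega>"
    have 1: "(\<lambda>n. LINT Y|surf \<Omega>. normal_kernel \<Omega> P Y *\<^sub>R A5 (Z n) Y) \<longlonglongrightarrow> (LINT Y|surf \<Omega>. normal_kernel \<Omega> P Y *\<^sub>R a Y)"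
      by (rule op_uniform_limit[OF A5_continuous[OF Z] a al P])
    have 2: "(\<lambda>n. LINT Y|restrict_space lborel \<Omega>. normal_kernel \<Omega> P Y *\<^sub>R psi1 v f (Z n) Y)
        \<longlonglongrightarrow> (LINT Y|restrict_space lborel \<Omega>. normal_kernel \<Omega> P Y *\<^sub>R psi1 v f Zs Y)"
    proof (rule integral_dominated_convergence[where w="\<lambda>Y. R * \<bar>normal_kernel \<Omega> P Y\<bar>"])
      show "(\<lambda>Y. normal_kernel \<Omega> P Y *\<^sub>R psi1 v f Zs Y) \<in> borel_measurable (restrict_space lborel \<Omega>)"
        by (intro borel_measurable_scaleR V.k_measurable[OF P] psi1_measurable[OF bounded_class_measurable[OF Zs]])
      show "(\<lambda>Y. normal_kernel \<Omega> P Y *\<^sub>R psi1 v f (Z n) Y) \<in> borel_measurable (restrict_space lborel \<Omega>)" for n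
        by (intro borel_measurable_scaleR V.k_measurable[OF P] psi1_measurable[OF bounded_class_measurable[OF Z]])
      show "integrable (restrict_space lborel \<Omega>) (\<lambda>Y. R * \<bar>normal_kernel \<Omega> P Y\<bar>)"
        by (intro integrable_mult_right integrable_abs V.kernel_integrable P)
      show "AE Y in restrict_space lborel \<Omega>. (\<lambda>n. normal_kernel \<Omega> P Y *\<^sub>R psi1 v f (Z n) Y) \<longlonglongrightarrow> normal_kernel \<Omega> P Y *\<^sub>R psi1 v f Zs Y"
      proof (subst AE_restrict_space_iff)
        show "AE Y in lborel. Y \<in> \<Omega> \<longrightarrow> (\<lambda>n. normal_kernel \<Omega> P Y *\<^sub>R psi1 v f (Z n) Y) \<longlonglongrightarrow> normal_kernel \<Omega> P Y *\<^sub>R psi1 v f Zs Y"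
          using lim
        proof eventually_elim
          case (elim Y)
          show ?case
          proof
            assume "Y \<in> \<Omega>"
            then have "Y \<in> closure \<Omega>" using closure_subset by blast
            then show "(\<lambda>n. normal_kernel \<Omega> P Y *\<^sub>R psi1 v f (Z n) Y) \<longlonglongrightarrow> normal_kernel \<Omega> P Y *\<^sub>R psi1 v f Zs Y"
              using elim by (intro tendsto_scaleR tendsto_const psi1_tendsto) auto
          qed
        qed
      qed (use dom(1) in simp)
      show "AE Y in restrict_space lborel \<Omega>. norm (normal_kernel \<Omega> P Y *\<^sub>R psi1 v f (Z n) Y) \<le> R * \<bar>normal_kernel \<Omega> P Y\<bar>" for n
      proof (rule AE_I2)
        fix Y assume "Y \<in> space (restrict_space lborel \<Omega>)"
        then have "Y \<in> closure \<Omega>" using closure_subset by (auto simp: space_restrict_space)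
        then have "norm (psi1 v f (Z n) Y) \<le> R" using R(2) Z by blast
        then show "norm (normal_kernel \<Omega> P Y *\<^sub>R psi1 v f (Z n) Y) \<le> R * \<bar>normal_kernel \<Omega> P Y\<bar>"
          using mult_right_mono[of "norm (psi1 v f (Z n) Y)" R "\<bar>normal_kernel \<Omega> P Y\<bar>"] by (simp add: mult.commute)
      qed
    qed
    have 3: "(\<lambda>n. A5 (Z n) P) \<longlonglongrightarrow> a P"
    proof (rule LIMSEQ_I)
      fix e :: real assume "e > 0"
      then obtain N where "\<forall>n P. n \<ge> N \<and> P \<in> frontier \<Omega> \<longrightarrow> norm (A5 (Z n) P - a P) < e" using al by blast
      then show "\<exists>no. \<forall>n\<ge>no. norm (A5 (Z n) P - a P) < e" using P by blast
    qed
    have e: "(1/2) *\<^sub>R A5 (Z n) P = (LINT Y|surf \<Omega>. normal_kernel \<Omega> P Y *\<^sub>R A5 (Z n) Y) + g02 P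
        + (LINT Y|restrict_space lborel \<Omega>. normal_kernel \<Omega> P Y *\<^sub>R psi1 v f (Z n) Y)" for n
      using A5[OF bounded_class_Linf_fun[OF Z, of n]] P unfolding solves_A5_iff by blast
    have "(\<lambda>n. (1/2) *\<^sub>R A5 (Z n) P) \<longlonglongrightarrow> (LINT Y|surf \<Omega>. normal_kernel \<Omega> P Y *\<^sub>R a Y) + g02 P
        + (LINT Y|restrict_space lborel \<Omega>. normal_kernel \<Omega> P Y *\<^sub>R psi1 v f Zs Y)"
      unfolding e by (intro tendsto_add tendsto_const 1 2)
    moreover have "(\<lambda>n. (1/2) *\<^sub>R A5 (Z n) P) \<longlonglongrightarrow> (1/2) *\<^sub>R a P" by (intro tendsto_scaleR tendsto_const 3)
    ultimately show "(1/2) *\<^sub>R a P = (LINT Y|surf \<Omega>. normal_kernel \<Omega> P Y *\<^sub>R a Y) + g02 P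
        + (LINT Y|restrict_space lborel \<Omega>. normal_kernel \<Omega> P Y *\<^sub>R psi1 v f Zs Y)" using LIMSEQ_unique by blast
  qed
  from A5_unique[OF bounded_class_Linf_fun[OF Zs] this P] show ?thesis .
qed

end

section \<open>Limits of mollified equations\<close>

lemma weight_pos: "0 < (1 + (norm (\<xi> :: R3))\<^sup>2) ^ N"
  by (intro zero_less_power add_pos_nonneg) simp_all

text \<open>Rests on (1 + cs/m)^m \<le> exp(cs), with b = max(1, m/c) bridging 1 + s and 1 + cs/m.
  The choice m = n + 1 avoids m = 0.\<close>

lemma power_exp_bounded:
  fixes c :: real
  assumes c: "c > 0" shows "\<exists>K\<ge>0. \<forall>s\<ge>0. (1 + s) ^ n * exp (- c * s) \<le> K"
proof -
  define m where "m = Suc n"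
  define b where "b = max 1 (real m / c)"
  have b: "b \<ge> 1" "b * (c / real m) \<ge> 1"
  proof -
    show "b \<ge> 1" unfolding b_def by simp
    have "real m / c * (c / real m) \<le> b * (c / real m)" unfolding b_def using c by (intro mult_right_mono) auto
    moreover have "real m / c * (c / real m) = 1" unfolding m_def using c by simp
    ultimately show "b * (c / real m) \<ge> 1" by simp
  qed
  have "(1 + s) ^ n * exp (- c * s) \<le> b ^ m" if s: "s \<ge> 0" for s
  proof -
    have "1 + s \<le> b * (1 + c * s / real m)"
      using b(1) mult_right_mono[OF b(2) s] by (simp add: algebra_simps)
    then have "(1 + s) ^ m \<le> (b * (1 + c * s / real m)) ^ m" using s by (intro power_mono) auto
    also have "\<dots> \<le> b ^ m * exp (c * s)"
      unfolding power_mult_distrib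
    proof (intro mult_left_mono)
      have "0 \<le> c * s" using c s by simp
      then show "(1 + c * s / real m) ^ m \<le> exp (c * s)"
        by (intro exp_ge_one_plus_x_over_n_power_n) (simp_all add: m_def)
    qed (use b(1) in simp)
    finally have "(1 + s) ^ m \<le> b ^ m * exp (c * s)" .
    moreover have "(1 + s) ^ n \<le> (1 + s) ^ m" unfolding m_def using s by (intro power_increasing) auto
    ultimately have "(1 + s) ^ n \<le> b ^ m * exp (c * s)" by linarith
    then have "(1 + s) ^ n * exp (- c * s) \<le> (b ^ m * exp (c * s)) * exp (- c * s)" by (intro mult_right_mono) auto
    also have "\<dots> = b ^ m * (exp (c * s) * exp (- c * s))" by (simp only: mult.assoc)
    also have "exp (c * s) * exp (- c * s) = 1" by (simp add: exp_minus)
    finally show ?thesis by simp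
  qed
  then show ?thesis using b(1) by (intro exI[of _ "b ^ m"]) simp
qed

lemma neg_norm_le:
  fixes T :: "'k::finite vdist"
  assumes c: "c \<ge> 0" and T: "\<And>\<phi> i. test_fun \<Omega> \<phi> \<Longrightarrow> cmod (T \<phi> $ i) \<le> c * sobolev_norm m \<Omega> \<phi>"
  shows "neg_norm m \<Omega> T \<le> ennreal c"
  unfolding neg_norm_def
proof (subst Max_le_iff)
  show "\<forall>x\<in>range (\<lambda>i. SUP \<phi>\<in>{\<phi>. test_fun \<Omega> \<phi> \<and> \<phi> \<noteq> (\<lambda>_. 0)}. ennreal (cmod (T \<phi> $ i) / sobolev_norm m \<Omega> \<phi>)). x \<le> ennreal c"
  proof (clarify, rule SUP_least, rule ennreal_leI)
    fix i \<phi> assume "\<phi> \<in> {\<phi>. test_fun \<Omega> \<phi> \<and> \<phi> \<noteq> (\<lambda>_. 0)}"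
    then have "cmod (T \<phi> $ i) \<le> c * sobolev_norm m \<Omega> \<phi>" using T by blast
    moreover have "sobolev_norm m \<Omega> \<phi> \<ge> 0"
      unfolding sobolev_norm_def set_lebesgue_integral_def by (intro real_sqrt_ge_zero integral_nonneg_AE AE_I2) (simp add: sum_nonneg)
    \<comment> \<open>Where the Sobolev norm vanishes, the quotient is 0 by convention.\<close>
    ultimately show "cmod (T \<phi> $ i) / sobolev_norm m \<Omega> \<phi> \<le> c"
      using c by (cases "sobolev_norm m \<Omega> \<phi> = 0") (simp_all add: divide_le_eq)
  qed
qed auto

text \<open>All components are packed into one vector-valued function, so that a single subsequence
  serves every index. The common bounded support provides the Lipschitz constant.\<close>

lemma fourier_subsequence:
  fixes w :: "nat \<Rightarrow> 'k::finite \<Rightarrow> R3 \<Rightarrow> complex"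
  assumes m: "\<And>n i. w n i \<in> borel_measurable borel" and K: "\<And>n i X. cmod (w n i X) \<le> K"
    and R: "\<And>n i X. w n i X \<noteq> 0 \<Longrightarrow> norm X \<le> R"
  shows "\<exists>r :: nat \<Rightarrow> nat. strict_mono r \<and> (\<forall>i \<xi>. convergent (\<lambda>n. fourier (w (r n) i) \<xi>))"
proof -
  have bi: "integrable lborel (\<lambda>X::R3. K * indicator (cball 0 R) X)"
    by (intro integrable_mult_right integrable_real_indicator emeasure_bounded_finite) auto
  have pb: "cmod (w n i X) \<le> K * indicator (cball 0 R) X" for n i X
    using K[of n i X] R[of n i X] by (cases "w n i X = 0") (auto split: split_indicator intro: order_trans[OF _ K])
  have wi: "integrable lborel (w n i)" for n i
  proof (rule Bochner_Integration.integrable_bound[OF bi])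
    show "AE X in lborel. norm (w n i X) \<le> norm (K * indicator (cball 0 R) X)"
      using pb by (intro AE_I2) (metis abs_ge_self order_trans real_norm_def)
  qed (use m in simp)
  define J where "J = (LINT X|lborel. K * indicator (cball (0::R3) R) X)"
  have L1: "(LINT X|lborel. cmod (w n i X)) \<le> J" for n i
    unfolding J_def by (intro integral_mono integrable_norm wi bi pb)
  have J0: "J \<ge> 0" using order_trans[OF integral_nonneg_AE L1] by simp
  define F where "F n \<xi> = (\<chi> i. fourier (w n i) \<xi>)" for n \<xi>
  have nv: "norm (x :: complex^'k) \<le> (\<Sum>i\<in>UNIV. cmod (x $ i))" for x
    by (simp add: norm_vec_def L2_set_le_sum)
  have "\<exists>r :: nat \<Rightarrow> nat. strict_mono r \<and> (\<forall>\<xi>. convergent (\<lambda>n. F (r n) \<xi>))"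
  proof (rule equi_Lipschitz_subsequence)
    fix n \<xi> \<eta>
    have "norm (F n \<xi>) \<le> (\<Sum>i\<in>UNIV. cmod (F n \<xi> $ i))" by (rule nv)
    also have "\<dots> \<le> (\<Sum>i\<in>(UNIV :: 'k set). J)"
      unfolding F_def by (intro sum_mono) (simp add: order_trans[OF cmod_fourier_le L1])
    finally show "norm (F n \<xi>) \<le> real CARD('k) * J" by simp
    have "norm (F n \<xi> - F n \<eta>) \<le> (\<Sum>i\<in>UNIV. cmod ((F n \<xi> - F n \<eta>) $ i))" by (rule nv)
    also have "\<dots> \<le> (\<Sum>i\<in>(UNIV :: 'k set). \<bar>R\<bar> * J * norm (\<xi> - \<eta>))"
    proof (rule sum_mono)
      fix i
      have "cmod (fourier (w n i) \<xi> - fourier (w n i) \<eta>) \<le> \<bar>R\<bar> * (LINT X|lborel. cmod (w n i X)) * norm (\<xi> - \<eta>)"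
        by (rule fourier_Lipschitz[OF wi]) (use R in force)
      also have "\<dots> \<le> \<bar>R\<bar> * J * norm (\<xi> - \<eta>)"
        by (intro mult_right_mono mult_left_mono L1) simp_all
      finally show "cmod ((F n \<xi> - F n \<eta>) $ i) \<le> \<bar>R\<bar> * J * norm (\<xi> - \<eta>)" unfolding F_def by simp
    qed
    finally show "norm (F n \<xi> - F n \<eta>) \<le> (real CARD('k) * (\<bar>R\<bar> * J)) * norm (\<xi> - \<eta>)" by simp
  qed
  then obtain r where r: "strict_mono (r :: nat \<Rightarrow> nat)" "\<And>\<xi>. convergent (\<lambda>n. F (r n) \<xi>)" by blast
  have "convergent (\<lambda>n. fourier (w (r n) i) \<xi>)" for i \<xi>
  proof -
    obtain l where "(\<lambda>n. F (r n) \<xi>) \<longlonglongrightarrow> l" using r(2) by (auto simp: convergent_def)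
    then have "(\<lambda>n. F (r n) \<xi> $ i) \<longlonglongrightarrow> l $ i" by (rule tendsto_vec_nth)
    then show ?thesis by (auto simp: F_def convergent_def)
  qed
  then show ?thesis using r(1) by blast
qed

lemma pairing_integrable:
  assumes t: "test_fun U \<phi>"
    and g: "integrable lborel (\<lambda>\<xi>. g \<xi> / of_real ((1 + (norm \<xi>)\<^sup>2) ^ k))"
  shows "integrable lborel (\<lambda>\<xi>. g \<xi> * inv_fourier \<phi> \<xi>)"
proof -
  obtain K where "\<forall>\<xi>. (1 + (norm \<xi>)\<^sup>2) ^ k * cmod (inv_fourier \<phi> \<xi>) \<le> K"
    using test_fun_inv_fourier_decay[OF t] by blast
  then show ?thesis
    by (intro integrable_mult_decay(1)[OF g]) (auto intro: inv_fourier_measurable test_fun_measurable[OF t])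
qed

text \<open>The factor \<open>p\<close> may grow faster than the weight \<open>(1 + |\<xi>|\<^sup>2)\<^sup>N\<close> allows, so that the pairing with \<open>p\<close> cannot be
  estimated by the Sobolev norm directly. As \<open>p\<close> does not depend on \<open>n\<close>, the limit of the
  mollified equations expresses this pairing through the well-behaved limits \<open>\<zeta>\<close> and \<open>q\<close>.\<close>

locale mollified_limit =
  fixes \<Omega> :: "R3 set" and N :: nat and p q \<zeta> :: "R3 \<Rightarrow> complex" and qs \<zeta>s :: "nat \<Rightarrow> R3 \<Rightarrow> complex"
    and W :: "R3 \<Rightarrow> real" and Kz :: real and \<epsilon> :: "nat \<Rightarrow> real"
  assumes \<Omega>: "open \<Omega>" "bounded \<Omega>" and N: "N \<ge> 3"
    and p: "integrable lborel (\<lambda>\<xi>. p \<xi> / of_real ((1 + (norm \<xi>)\<^sup>2) ^ Suc N))"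
    and W: "integrable lborel (\<lambda>\<xi>. W \<xi> / (1 + (norm \<xi>)\<^sup>2) ^ N)"
    and qs: "\<And>n. qs n \<in> borel_measurable borel" "\<And>n \<xi>. cmod (qs n \<xi>) \<le> W \<xi>" "\<And>\<xi>. (\<lambda>n. qs n \<xi>) \<longlonglongrightarrow> q \<xi>"
    and \<zeta>s: "\<And>n. \<zeta>s n \<in> borel_measurable borel" "\<And>n \<xi>. cmod (\<zeta>s n \<xi>) \<le> Kz" "\<And>\<xi>. (\<lambda>n. \<zeta>s n \<xi>) \<longlonglongrightarrow> \<zeta> \<xi>"
    and \<epsilon>: "\<And>n. \<epsilon> n > 0" "\<epsilon> \<longlonglongrightarrow> 0"
    and eq: "\<And>n \<phi>. test_fun \<Omega> \<phi> \<Longrightarrow> (LINT \<xi>|lborel. \<zeta>s n \<xi> * inv_fourier \<phi> \<xi>) =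
        (LINT \<xi>|lborel. of_real (exp (- \<epsilon> n * (norm \<xi>)\<^sup>2 / 4)) * ((p \<xi> + qs n \<xi>) * inv_fourier \<phi> \<xi>))"
begin

lemma q_measurable: "q \<in> borel_measurable borel" and \<zeta>_measurable: "\<zeta> \<in> borel_measurable borel"
  by (rule borel_measurable_LIMSEQ_metric[OF qs(1) qs(3)], rule borel_measurable_LIMSEQ_metric[OF \<zeta>s(1) \<zeta>s(3)])

lemma q_bound: "cmod (q \<xi>) \<le> W \<xi>" and \<zeta>_bound: "cmod (\<zeta> \<xi>) \<le> Kz"
  by (rule LIMSEQ_le_const2[OF tendsto_norm[OF qs(3)]], use qs(2) in blast)
     (rule LIMSEQ_le_const2[OF tendsto_norm[OF \<zeta>s(3)]], use \<zeta>s(2) in blast)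

lemma weighted_W:
  assumes "g \<in> borel_measurable borel" "\<And>\<xi>. cmod (g \<xi>) \<le> W \<xi>"
  shows "integrable lborel (\<lambda>\<xi>. g \<xi> / of_real ((1 + (norm \<xi>)\<^sup>2) ^ N))"
proof (rule Bochner_Integration.integrable_bound[OF W])
  show "AE \<xi> in lborel. norm (g \<xi> / of_real ((1 + (norm \<xi>)\<^sup>2) ^ N)) \<le> norm (W \<xi> / (1 + (norm \<xi>)\<^sup>2) ^ N)"
  proof (rule AE_I2)
    fix \<xi> :: R3
    have "norm (g \<xi> / of_real ((1 + (norm \<xi>)\<^sup>2) ^ N)) = cmod (g \<xi>) / (1 + (norm \<xi>)\<^sup>2) ^ N"
      unfolding norm_divide norm_of_real abs_of_pos[OF weight_pos] ..
    also have "\<dots> \<le> W \<xi> / (1 + (norm \<xi>)\<^sup>2) ^ N"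
      using assms(2) weight_pos[of \<xi> N] by (intro divide_right_mono) auto
    also have "\<dots> \<le> norm (W \<xi> / (1 + (norm \<xi>)\<^sup>2) ^ N)" by (simp only: real_norm_def abs_ge_self)
    finally show "norm (g \<xi> / of_real ((1 + (norm \<xi>)\<^sup>2) ^ N)) \<le> norm (W \<xi> / (1 + (norm \<xi>)\<^sup>2) ^ N)" .
  qed
qed (use assms(1) in simp)

lemma weighted_Kz:
  fixes g :: "R3 \<Rightarrow> complex"
  assumes "g \<in> borel_measurable borel" "\<And>\<xi>. cmod (g \<xi>) \<le> K"
  shows "integrable lborel (\<lambda>\<xi>. g \<xi> / of_real ((1 + (norm \<xi>)\<^sup>2) ^ N))"
proof -
  have i: "integrable lborel (\<lambda>\<xi>::R3. K * (1 / (1 + (norm \<xi>)\<^sup>2) ^ N))"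
    by (intro integrable_mult_right integrable_weight N)
  show ?thesis
  proof (rule Bochner_Integration.integrable_bound[OF i])
  show "AE \<xi> in lborel. norm (g \<xi> / of_real ((1 + (norm \<xi>)\<^sup>2) ^ N)) \<le> norm (K * (1 / (1 + (norm \<xi>)\<^sup>2) ^ N))"
  proof (rule AE_I2)
    fix \<xi> :: R3
    have "norm (g \<xi> / of_real ((1 + (norm \<xi>)\<^sup>2) ^ N)) = cmod (g \<xi>) / (1 + (norm \<xi>)\<^sup>2) ^ N"
      unfolding norm_divide norm_of_real abs_of_pos[OF weight_pos] ..
    also have "\<dots> \<le> K / (1 + (norm \<xi>)\<^sup>2) ^ N"
      using assms(2) weight_pos[of \<xi> N] by (intro divide_right_mono) auto
    also have "\<dots> \<le> norm (K * (1 / (1 + (norm \<xi>)\<^sup>2) ^ N))" by (simp only: real_norm_def times_divide_eq_right mult_1_right abs_ge_self)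
    finally show "norm (g \<xi> / of_real ((1 + (norm \<xi>)\<^sup>2) ^ N)) \<le> norm (K * (1 / (1 + (norm \<xi>)\<^sup>2) ^ N))" .
  qed
  qed (use assms(1) in simp)
qed

text \<open>The Gaussian factor is at most 1 and tends to 1. For one fixed \<phi> the decay of its
  transform also compensates the extra growth of p.\<close>

lemma mollified_pairing_tendsto:
  assumes t: "test_fun \<Omega> \<phi>"
    and p': "integrable lborel (\<lambda>\<xi>. p \<xi> * inv_fourier \<phi> \<xi>)"
  shows "(\<lambda>n. LINT \<xi>|lborel. of_real (exp (- \<epsilon> n * (norm \<xi>)\<^sup>2 / 4)) * ((p \<xi> + qs n \<xi>) * inv_fourier \<phi> \<xi>))
    \<longlonglongrightarrow> (LINT \<xi>|lborel. (p \<xi> + q \<xi>) * inv_fourier \<phi> \<xi>)"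
proof (rule integral_dominated_convergence[where w="\<lambda>\<xi>. cmod (p \<xi> * inv_fourier \<phi> \<xi>) + cmod (of_real (W \<xi>) * inv_fourier \<phi> \<xi>)"])
  have fm: "inv_fourier \<phi> \<in> borel_measurable borel" by (rule inv_fourier_measurable[OF test_fun_measurable[OF t]])
  have pm: "(\<lambda>\<xi>. p \<xi> * inv_fourier \<phi> \<xi>) \<in> borel_measurable lborel" by (rule borel_measurable_integrable[OF p'])
  have Wm: "integrable lborel (\<lambda>\<xi>. complex_of_real (W \<xi>) / of_real ((1 + (norm \<xi>)\<^sup>2) ^ N))"
    using integrable_of_real[OF W, where 'a=complex] by simp
  show "integrable lborel (\<lambda>\<xi>. cmod (p \<xi> * inv_fourier \<phi> \<xi>) + cmod (of_real (W \<xi>) * inv_fourier \<phi> \<xi>))"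
    by (intro Bochner_Integration.integrable_add integrable_norm p' pairing_integrable[OF t Wm])
  show "(\<lambda>\<xi>. (p \<xi> + q \<xi>) * inv_fourier \<phi> \<xi>) \<in> borel_measurable lborel"
    unfolding distrib_right using fm q_measurable by (intro borel_measurable_add pm borel_measurable_times) auto
  show "(\<lambda>\<xi>. of_real (exp (- \<epsilon> n * (norm \<xi>)\<^sup>2 / 4)) * ((p \<xi> + qs n \<xi>) * inv_fourier \<phi> \<xi>)) \<in> borel_measurable lborel" for n
    unfolding distrib_right using fm qs(1)[of n] by (intro borel_measurable_times borel_measurable_add pm) auto
  show "AE \<xi> in lborel. (\<lambda>n. of_real (exp (- \<epsilon> n * (norm \<xi>)\<^sup>2 / 4)) * ((p \<xi> + qs n \<xi>) * inv_fourier \<phi> \<xi>)) \<longlonglongrightarrow> (p \<xi> + q \<xi>) * inv_fourier \<phi> \<xi>"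
  proof (rule AE_I2)
    fix \<xi> :: R3
    have "(\<lambda>n. complex_of_real (exp (- \<epsilon> n * (norm \<xi>)\<^sup>2 / 4)) * ((p \<xi> + qs n \<xi>) * inv_fourier \<phi> \<xi>))
        \<longlonglongrightarrow> of_real (exp (- 0 * (norm \<xi>)\<^sup>2 / 4)) * ((p \<xi> + q \<xi>) * inv_fourier \<phi> \<xi>)"
      by (intro tendsto_intros \<epsilon>(2) qs(3)) simp
    then show "(\<lambda>n. complex_of_real (exp (- \<epsilon> n * (norm \<xi>)\<^sup>2 / 4)) * ((p \<xi> + qs n \<xi>) * inv_fourier \<phi> \<xi>)) \<longlonglongrightarrow> (p \<xi> + q \<xi>) * inv_fourier \<phi> \<xi>"
      by simp
  qed
  show "AE \<xi> in lborel. norm (of_real (exp (- \<epsilon> n * (norm \<xi>)\<^sup>2 / 4)) * ((p \<xi> + qs n \<xi>) * inv_fourier \<phi> \<xi>))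
      \<le> cmod (p \<xi> * inv_fourier \<phi> \<xi>) + cmod (of_real (W \<xi>) * inv_fourier \<phi> \<xi>)" for n
  proof (rule AE_I2)
    fix \<xi> :: R3
    have W0: "W \<xi> \<ge> 0" using order_trans[OF norm_ge_zero qs(2)] .
    have e1: "exp (- \<epsilon> n * (norm \<xi>)\<^sup>2 / 4) \<le> 1" using \<epsilon>(1)[of n] by simp
    have "norm (complex_of_real (exp (- \<epsilon> n * (norm \<xi>)\<^sup>2 / 4)) * ((p \<xi> + qs n \<xi>) * inv_fourier \<phi> \<xi>))
        = exp (- \<epsilon> n * (norm \<xi>)\<^sup>2 / 4) * cmod ((p \<xi> + qs n \<xi>) * inv_fourier \<phi> \<xi>)"
      by (simp only: norm_mult norm_of_real abs_exp_cancel)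
    also have "\<dots> \<le> 1 * cmod ((p \<xi> + qs n \<xi>) * inv_fourier \<phi> \<xi>)" by (intro mult_right_mono e1) simp
    also have "\<dots> \<le> cmod (p \<xi> * inv_fourier \<phi> \<xi>) + cmod (qs n \<xi> * inv_fourier \<phi> \<xi>)"
      unfolding distrib_right mult_1_left by (rule norm_triangle_ineq)
    also have "cmod (qs n \<xi> * inv_fourier \<phi> \<xi>) \<le> cmod (of_real (W \<xi>) * inv_fourier \<phi> \<xi>)"
      using qs(2)[of n \<xi>] W0 by (simp add: norm_mult mult_right_mono)
    finally show "norm (of_real (exp (- \<epsilon> n * (norm \<xi>)\<^sup>2 / 4)) * ((p \<xi> + qs n \<xi>) * inv_fourier \<phi> \<xi>))
      \<le> cmod (p \<xi> * inv_fourier \<phi> \<xi>) + cmod (of_real (W \<xi>) * inv_fourier \<phi> \<xi>)" by simp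
  qed
qed

lemma \<zeta>_pairing_tendsto:
  assumes t: "test_fun \<Omega> \<phi>"
  shows "(\<lambda>n. LINT \<xi>|lborel. \<zeta>s n \<xi> * inv_fourier \<phi> \<xi>) \<longlonglongrightarrow> (LINT \<xi>|lborel. \<zeta> \<xi> * inv_fourier \<phi> \<xi>)"
proof (rule integral_dominated_convergence[where w="\<lambda>\<xi>. Kz * cmod (inv_fourier \<phi> \<xi>)"])
  have fm: "inv_fourier \<phi> \<in> borel_measurable borel" by (rule inv_fourier_measurable[OF test_fun_measurable[OF t]])
  show "integrable lborel (\<lambda>\<xi>. Kz * cmod (inv_fourier \<phi> \<xi>))"
    by (intro integrable_mult_right integrable_norm integrable_inv_fourier[OF t])
  show "(\<lambda>\<xi>. \<zeta> \<xi> * inv_fourier \<phi> \<xi>) \<in> borel_measurable lborel" using fm \<zeta>_measurable by simp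
  show "(\<lambda>\<xi>. \<zeta>s n \<xi> * inv_fourier \<phi> \<xi>) \<in> borel_measurable lborel" for n using fm \<zeta>s(1) by simp
  show "AE \<xi> in lborel. (\<lambda>n. \<zeta>s n \<xi> * inv_fourier \<phi> \<xi>) \<longlonglongrightarrow> \<zeta> \<xi> * inv_fourier \<phi> \<xi>"
    by (intro AE_I2 tendsto_intros \<zeta>s(3))
  show "AE \<xi> in lborel. norm (\<zeta>s n \<xi> * inv_fourier \<phi> \<xi>) \<le> Kz * cmod (inv_fourier \<phi> \<xi>)" for n
    using \<zeta>s(2) by (intro AE_I2) (simp add: norm_mult mult_right_mono)
qed

lemma p_pairing_integrable: "test_fun \<Omega> \<phi> \<Longrightarrow> integrable lborel (\<lambda>\<xi>. p \<xi> * inv_fourier \<phi> \<xi>)"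
  by (rule pairing_integrable[OF _ p])

lemma limit_equation:
  assumes t: "test_fun \<Omega> \<phi>"
  shows "(LINT \<xi>|lborel. \<zeta> \<xi> * inv_fourier \<phi> \<xi>) = (LINT \<xi>|lborel. (p \<xi> + q \<xi>) * inv_fourier \<phi> \<xi>)"
  using LIMSEQ_unique[OF \<zeta>_pairing_tendsto[OF t]] mollified_pairing_tendsto[OF t p_pairing_integrable[OF t]]
  unfolding eq[OF t] by blast

text \<open>The distance to both limits in the weighted L^1 space. Through the decay of
  \<open>inv_fourier\<close> it bounds pairings uniformly over test functions of Sobolev norm
  1.\<close>

definition defect :: "nat \<Rightarrow> real" where
  "defect n = (LINT \<xi>|lborel. cmod ((\<zeta>s n \<xi> - \<zeta> \<xi>) / of_real ((1 + (norm \<xi>)\<^sup>2) ^ N)) + cmod ((qs n \<xi> - q \<xi>) / of_real ((1 + (norm \<xi>)\<^sup>2) ^ N)))"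

lemma \<zeta>_diff: "integrable lborel (\<lambda>\<xi>. (\<zeta>s n \<xi> - \<zeta> \<xi>) / of_real ((1 + (norm \<xi>)\<^sup>2) ^ N))"
  unfolding diff_divide_distrib
  by (intro Bochner_Integration.integrable_diff weighted_Kz[of _ Kz] \<zeta>s \<zeta>_measurable \<zeta>_bound)

lemma q_diff: "integrable lborel (\<lambda>\<xi>. (qs n \<xi> - q \<xi>) / of_real ((1 + (norm \<xi>)\<^sup>2) ^ N))"
  unfolding diff_divide_distrib
  by (intro Bochner_Integration.integrable_diff weighted_W qs q_measurable q_bound)

lemma defect_nonneg: "defect n \<ge> 0"
  unfolding defect_def by (intro integral_nonneg_AE AE_I2) simp

lemma defect_tendsto: "defect \<longlonglongrightarrow> 0"
proof -
  let ?w = "\<lambda>\<xi>::R3. (1 + (norm \<xi>)\<^sup>2) ^ N"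
  have "(\<lambda>n. LINT \<xi>|lborel. cmod ((\<zeta>s n \<xi> - \<zeta> \<xi>) / of_real (?w \<xi>)) + cmod ((qs n \<xi> - q \<xi>) / of_real (?w \<xi>)))
     \<longlonglongrightarrow> integral\<^sup>L (lborel :: R3 measure) (\<lambda>_. 0 :: real)"
  proof (rule integral_dominated_convergence[where w="\<lambda>\<xi>. 2 * Kz * (1 / ?w \<xi>) + 2 * (W \<xi> / ?w \<xi>)"])
    show "integrable lborel (\<lambda>\<xi>. 2 * Kz * (1 / ?w \<xi>) + 2 * (W \<xi> / ?w \<xi>))"
      by (intro Bochner_Integration.integrable_add integrable_mult_right integrable_weight N W)
    show "(\<lambda>\<xi>. cmod ((\<zeta>s n \<xi> - \<zeta> \<xi>) / of_real (?w \<xi>)) + cmod ((qs n \<xi> - q \<xi>) / of_real (?w \<xi>))) \<in> borel_measurable lborel" for n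
      by (intro borel_measurable_add borel_measurable_integrable[OF integrable_norm[OF \<zeta>_diff]] borel_measurable_integrable[OF integrable_norm[OF q_diff]])
    show "AE \<xi> in lborel. (\<lambda>n. cmod ((\<zeta>s n \<xi> - \<zeta> \<xi>) / of_real (?w \<xi>)) + cmod ((qs n \<xi> - q \<xi>) / of_real (?w \<xi>))) \<longlonglongrightarrow> 0"
    proof (rule AE_I2)
      fix \<xi> :: R3
      have "complex_of_real (?w \<xi>) \<noteq> 0" using weight_pos[of \<xi> N] by (metis less_irrefl of_real_eq_0_iff)
      then have "(\<lambda>n. cmod ((\<zeta>s n \<xi> - \<zeta> \<xi>) / of_real (?w \<xi>)) + cmod ((qs n \<xi> - q \<xi>) / of_real (?w \<xi>)))
         \<longlonglongrightarrow> cmod ((\<zeta> \<xi> - \<zeta> \<xi>) / of_real (?w \<xi>)) + cmod ((q \<xi> - q \<xi>) / of_real (?w \<xi>))"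
        by (intro tendsto_intros \<zeta>s(3) qs(3))
      then show "(\<lambda>n. cmod ((\<zeta>s n \<xi> - \<zeta> \<xi>) / of_real (?w \<xi>)) + cmod ((qs n \<xi> - q \<xi>) / of_real (?w \<xi>))) \<longlonglongrightarrow> 0" by simp
    qed
    show "AE \<xi> in lborel. norm (cmod ((\<zeta>s n \<xi> - \<zeta> \<xi>) / of_real (?w \<xi>)) + cmod ((qs n \<xi> - q \<xi>) / of_real (?w \<xi>))) \<le> 2 * Kz * (1 / ?w \<xi>) + 2 * (W \<xi> / ?w \<xi>)" for n
    proof (rule AE_I2)
      fix \<xi> :: R3
      have "cmod (\<zeta>s n \<xi> - \<zeta> \<xi>) \<le> 2 * Kz" using norm_triangle_ineq4[of "\<zeta>s n \<xi>" "\<zeta> \<xi>"] \<zeta>s(2)[of n \<xi>] \<zeta>_bound[of \<xi>] by linarith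
      then have 1: "cmod (\<zeta>s n \<xi> - \<zeta> \<xi>) / ?w \<xi> \<le> 2 * Kz / ?w \<xi>" using weight_pos[of \<xi> N] by (intro divide_right_mono) auto
      have "cmod (qs n \<xi> - q \<xi>) \<le> 2 * W \<xi>" using norm_triangle_ineq4[of "qs n \<xi>" "q \<xi>"] qs(2)[of n \<xi>] q_bound[of \<xi>] by linarith
      then have 2: "cmod (qs n \<xi> - q \<xi>) / ?w \<xi> \<le> 2 * W \<xi> / ?w \<xi>" using weight_pos[of \<xi> N] by (intro divide_right_mono) auto
      have "norm (cmod ((\<zeta>s n \<xi> - \<zeta> \<xi>) / of_real (?w \<xi>)) + cmod ((qs n \<xi> - q \<xi>) / of_real (?w \<xi>))) = cmod (\<zeta>s n \<xi> - \<zeta> \<xi>) / ?w \<xi> + cmod (qs n \<xi> - q \<xi>) / ?w \<xi>"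
        unfolding norm_divide norm_of_real abs_of_pos[OF weight_pos] real_norm_def
        by (intro abs_of_nonneg add_nonneg_nonneg divide_nonneg_pos weight_pos) simp_all
      then show "norm (cmod ((\<zeta>s n \<xi> - \<zeta> \<xi>) / of_real (?w \<xi>)) + cmod ((qs n \<xi> - q \<xi>) / of_real (?w \<xi>))) \<le> 2 * Kz * (1 / ?w \<xi>) + 2 * (W \<xi> / ?w \<xi>)"
        using 1 2 by simp
    qed
  qed simp
  then show ?thesis unfolding defect_def[abs_def] by simp
qed

lemma convergence_estimates:
  assumes K: "K \<ge> 0" "\<And>\<phi> \<xi>. test_fun \<Omega> \<phi> \<Longrightarrow> (1 + (norm \<xi>)\<^sup>2) ^ N * cmod (inv_fourier \<phi> \<xi>) \<le> K * sobolev_norm (2 * N) \<Omega> \<phi>"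
    and t: "test_fun \<Omega> \<phi>"
  shows "cmod ((LINT \<xi>|lborel. \<zeta>s n \<xi> * inv_fourier \<phi> \<xi>) - (LINT \<xi>|lborel. \<zeta> \<xi> * inv_fourier \<phi> \<xi>)) \<le> K * defect n * sobolev_norm (2 * N) \<Omega> \<phi>"
    and "cmod ((LINT \<xi>|lborel. \<zeta>s n \<xi> * inv_fourier \<phi> \<xi>) - (LINT \<xi>|lborel. (p \<xi> + qs n \<xi>) * inv_fourier \<phi> \<xi>)) \<le> K * defect n * sobolev_norm (2 * N) \<Omega> \<phi>"
proof -
  let ?f = "inv_fourier \<phi>" and ?s = "sobolev_norm (2 * N) \<Omega> \<phi>"
  have fm: "?f \<in> borel_measurable borel" by (rule inv_fourier_measurable[OF test_fun_measurable[OF t]])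
  note dec = K(2)[OF t]
  \<comment> \<open>The sign is read off from the decay estimate at \<xi> = 0, whose left side is
    nonnegative.\<close>
  have s0: "?s * K \<ge> 0" using dec[of 0] by (simp add: mult.commute) (meson norm_ge_zero order_trans)
  have z1: "integrable lborel (\<lambda>\<xi>. \<zeta>s n \<xi> * ?f \<xi>)" "integrable lborel (\<lambda>\<xi>. \<zeta> \<xi> * ?f \<xi>)"
    by (intro pairing_integrable[OF t, where k=N] weighted_Kz[of _ Kz] \<zeta>s \<zeta>_measurable \<zeta>_bound)+
  have q1: "integrable lborel (\<lambda>\<xi>. qs n \<xi> * ?f \<xi>)" "integrable lborel (\<lambda>\<xi>. q \<xi> * ?f \<xi>)"
    by (intro pairing_integrable[OF t, where k=N] weighted_W qs q_measurable q_bound)+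
  have p1: "integrable lborel (\<lambda>\<xi>. p \<xi> * ?f \<xi>)" by (rule p_pairing_integrable[OF t])
  let ?dz = "LINT \<xi>|lborel. cmod ((\<zeta>s n \<xi> - \<zeta> \<xi>) / of_real ((1 + (norm \<xi>)\<^sup>2) ^ N))"
  let ?dq = "LINT \<xi>|lborel. cmod ((qs n \<xi> - q \<xi>) / of_real ((1 + (norm \<xi>)\<^sup>2) ^ N))"
  have dsum: "defect n = ?dz + ?dq"
    unfolding defect_def by (rule Bochner_Integration.integral_add[OF integrable_norm[OF \<zeta>_diff] integrable_norm[OF q_diff]])
  have d0: "?dz \<ge> 0" "?dq \<ge> 0" by (intro integral_nonneg_AE AE_I2 norm_ge_zero)+
  have Z: "cmod (LINT \<xi>|lborel. (\<zeta>s n \<xi> - \<zeta> \<xi>) * ?f \<xi>) \<le> (K * ?s) * ?dz"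
    by (rule order_trans[OF integral_norm_bound integrable_mult_decay(2)[OF \<zeta>_diff fm dec]])
  have Q: "cmod (LINT \<xi>|lborel. (qs n \<xi> - q \<xi>) * ?f \<xi>) \<le> (K * ?s) * ?dq"
    by (rule order_trans[OF integral_norm_bound integrable_mult_decay(2)[OF q_diff fm dec]])
  have Ze: "(LINT \<xi>|lborel. (\<zeta>s n \<xi> - \<zeta> \<xi>) * ?f \<xi>) = (LINT \<xi>|lborel. \<zeta>s n \<xi> * ?f \<xi>) - (LINT \<xi>|lborel. \<zeta> \<xi> * ?f \<xi>)"
    unfolding left_diff_distrib by (rule Bochner_Integration.integral_diff[OF z1])
  have Qe: "(LINT \<xi>|lborel. (qs n \<xi> - q \<xi>) * ?f \<xi>) = (LINT \<xi>|lborel. qs n \<xi> * ?f \<xi>) - (LINT \<xi>|lborel. q \<xi> * ?f \<xi>)"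
    unfolding left_diff_distrib by (rule Bochner_Integration.integral_diff[OF q1])
  have "(K * ?s) * ?dz \<le> (K * ?s) * defect n"
    unfolding dsum using d0 s0 by (intro mult_left_mono) (auto simp: mult.commute)
  then show "cmod ((LINT \<xi>|lborel. \<zeta>s n \<xi> * ?f \<xi>) - (LINT \<xi>|lborel. \<zeta> \<xi> * ?f \<xi>)) \<le> K * defect n * ?s"
    using Z unfolding Ze by (simp add: mult_ac)
  have "(LINT \<xi>|lborel. (p \<xi> + qs n \<xi>) * ?f \<xi>) = (LINT \<xi>|lborel. p \<xi> * ?f \<xi>) + (LINT \<xi>|lborel. qs n \<xi> * ?f \<xi>)"
    unfolding distrib_right by (rule Bochner_Integration.integral_add[OF p1 q1(1)])
  moreover have "(LINT \<xi>|lborel. (p \<xi> + q \<xi>) * ?f \<xi>) = (LINT \<xi>|lborel. p \<xi> * ?f \<xi>) + (LINT \<xi>|lborel. q \<xi> * ?f \<xi>)"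
    unfolding distrib_right by (rule Bochner_Integration.integral_add[OF p1 q1(2)])
  \<comment> \<open>Subtracting the limit equation cancels the pairing with p and leaves differences
    controlled by the defect.\<close>
  ultimately have E: "(LINT \<xi>|lborel. \<zeta>s n \<xi> * ?f \<xi>) - (LINT \<xi>|lborel. (p \<xi> + qs n \<xi>) * ?f \<xi>)
      = (LINT \<xi>|lborel. (\<zeta>s n \<xi> - \<zeta> \<xi>) * ?f \<xi>) - (LINT \<xi>|lborel. (qs n \<xi> - q \<xi>) * ?f \<xi>)"
    using limit_equation[OF t] unfolding Ze Qe by simp
  have "cmod ((LINT \<xi>|lborel. \<zeta>s n \<xi> * ?f \<xi>) - (LINT \<xi>|lborel. (p \<xi> + qs n \<xi>) * ?f \<xi>)) \<le> (K * ?s) * ?dz + (K * ?s) * ?dq"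
    unfolding E by (rule order_trans[OF norm_triangle_ineq4 add_mono[OF Z Q]])
  also have "\<dots> = K * defect n * ?s" unfolding dsum by (simp add: algebra_simps)
  finally show "cmod ((LINT \<xi>|lborel. \<zeta>s n \<xi> * ?f \<xi>) - (LINT \<xi>|lborel. (p \<xi> + qs n \<xi>) * ?f \<xi>)) \<le> K * defect n * ?s" .
qed

end

section \<open>Symbols of the operators\<close>

text \<open>A factor growing like the j-th power of the weight raises the exponent by j: j = 1 for
  the Dirichlet part of the boundary term, j = 0 for bounded factors.\<close>

lemma weighted_mult:
  fixes g h :: "R3 \<Rightarrow> complex"
  assumes g: "integrable lborel (\<lambda>\<xi>. g \<xi> / of_real ((1 + (norm \<xi>)\<^sup>2) ^ N))"
    and h: "h \<in> borel_measurable borel" "\<And>\<xi>. cmod (h \<xi>) \<le> K * (1 + (norm \<xi>)\<^sup>2) ^ j"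
  shows "integrable lborel (\<lambda>\<xi>. g \<xi> * h \<xi> / of_real ((1 + (norm \<xi>)\<^sup>2) ^ (N + j)))"
proof -
  have "integrable lborel (\<lambda>\<xi>. g \<xi> * (h \<xi> / of_real ((1 + (norm \<xi>)\<^sup>2) ^ (N + j))))"
  proof (rule integrable_mult_decay(1)[OF g])
    show "(\<lambda>\<xi>. h \<xi> / of_real ((1 + (norm \<xi>)\<^sup>2) ^ (N + j))) \<in> borel_measurable borel" using h(1) by measurable
    fix \<xi> :: R3
    let ?w = "1 + (norm \<xi>)\<^sup>2"
    have "?w ^ N * cmod (h \<xi> / of_real (?w ^ (N + j))) = cmod (h \<xi>) / ?w ^ j"
      unfolding norm_divide norm_of_real abs_of_pos[OF weight_pos] unfolding power_add
    proof -
      have "x * (y / (x * z)) = y / z" if "x > 0" for x y z :: real using that by simp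
      then show "?w ^ N * (cmod (h \<xi>) / (?w ^ N * ?w ^ j)) = cmod (h \<xi>) / ?w ^ j" using weight_pos[of \<xi> N] by blast
    qed
    also have "\<dots> \<le> K" using h(2)[of \<xi>] weight_pos[of \<xi> j] by (simp add: pos_divide_le_eq)
    finally show "?w ^ N * cmod (h \<xi> / of_real (?w ^ (N + j))) \<le> K" .
  qed
  then show ?thesis by simp
qed

lemma weighted_measurable:
  fixes g :: "R3 \<Rightarrow> complex"
  assumes "integrable lborel (\<lambda>\<xi>. g \<xi> / of_real ((1 + (norm \<xi>)\<^sup>2) ^ N))"
  shows "g \<in> borel_measurable borel"
proof -
  have "(\<lambda>\<xi>. (g \<xi> / of_real ((1 + (norm \<xi>)\<^sup>2) ^ N)) * of_real ((1 + (norm \<xi>)\<^sup>2) ^ N)) \<in> borel_measurable lborel"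
    by (intro borel_measurable_times borel_measurable_integrable[OF assms]) measurable
  moreover have "(g \<xi> / of_real ((1 + (norm \<xi>)\<^sup>2) ^ N)) * of_real ((1 + (norm \<xi>)\<^sup>2) ^ N) = g \<xi>" for \<xi> :: R3
  proof -
    have "complex_of_real ((1 + (norm \<xi>)\<^sup>2) ^ N) \<noteq> 0"
      using weight_pos[of \<xi> N] by (metis less_irrefl of_real_eq_0_iff)
    moreover have "x / c * c = x" if "c \<noteq> 0" for x c :: complex using that by simp
    ultimately show ?thesis by blast
  qed
  ultimately show ?thesis by (simp only: measurable_lborel2)
qed

lemma fourier_tendsto_AE:
  assumes m: "\<And>n. w n \<in> borel_measurable borel" "ws \<in> borel_measurable borel" and K: "\<And>n X. cmod (w n X) \<le> K"
    and R: "\<And>n X. w n X \<noteq> 0 \<Longrightarrow> norm X \<le> R"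
    and lim: "AE X in lborel. (\<lambda>n. w n X) \<longlonglongrightarrow> ws X"
  shows "(\<lambda>n. fourier (w n) \<xi>) \<longlonglongrightarrow> fourier ws \<xi>"
  unfolding fourier_def
proof (rule integral_dominated_convergence[where w="\<lambda>X. K * indicator (cball 0 R) X"])
  show "integrable lborel (\<lambda>X::R3. K * indicator (cball 0 R) X)"
    by (intro integrable_mult_right integrable_real_indicator emeasure_bounded_finite) auto
  show "AE X in lborel. (\<lambda>n. w n X * exp (- \<i> * of_real (\<xi> \<bullet> X))) \<longlonglongrightarrow> ws X * exp (- \<i> * of_real (\<xi> \<bullet> X))"
    using lim by eventually_elim (intro tendsto_intros)
  show "AE X in lborel. norm (w n X * exp (- \<i> * of_real (\<xi> \<bullet> X))) \<le> K * indicator (cball 0 R) X" for n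
  proof (rule AE_I2)
    fix X
    show "norm (w n X * exp (- \<i> * of_real (\<xi> \<bullet> X))) \<le> K * indicator (cball 0 R) X"
    proof (cases "w n X = 0")
      case True
      have "K \<ge> 0" using order_trans[OF norm_ge_zero K] .
      then show ?thesis using True by simp
    next
      case False
      then show ?thesis using K[of n X] R[OF False] by (simp add: norm_mult)
    qed
  qed
  show "(\<lambda>X. ws X * exp (- \<i> * of_real (\<xi> \<bullet> X))) \<in> borel_measurable lborel" using m by measurable
  show "(\<lambda>X. w n X * exp (- \<i> * of_real (\<xi> \<bullet> X))) \<in> borel_measurable lborel" for n using m(1)[of n] by measurable
qed

lemma cut_measurable:
  fixes h :: "R3 \<Rightarrow> real"
  assumes S: "S \<in> sets borel" and h: "h \<in> borel_measurable (restrict_space lborel S)"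
  shows "(\<lambda>X. indicator S X * complex_of_real (h X)) \<in> borel_measurable borel"
proof -
  have "(\<lambda>X. indicator S X *\<^sub>R h X) \<in> borel_measurable lborel"
    using h S by (subst (asm) borel_measurable_restrict_space_iff) auto
  then have "(\<lambda>X. complex_of_real (indicator S X *\<^sub>R h X)) \<in> borel_measurable lborel"
    by (rule measurable_compose) (intro borel_measurable_continuous_onI continuous_intros)
  then have "(\<lambda>X. complex_of_real (indicator S X *\<^sub>R h X)) \<in> borel_measurable borel"
    by (simp only: measurable_lborel2)
  moreover have "complex_of_real (indicator S X *\<^sub>R h X) = indicator S X * complex_of_real (h X)" for X
    by (simp split: split_indicator)
  ultimately show ?thesis by (simp only:)
qed

section \<open>Boundary terms and their transforms\<close>

locale elliptic_problem = elliptic_setup \<Omega> \<alpha> v C f g02 A5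
  for \<Omega> :: "R3 set" and \<alpha> :: real and v :: "'m::finite enum10" and C :: "real^('m idx)^'m" and f :: "'m rhs"
    and g02 :: "R3 \<Rightarrow> real^'m" and A5 :: "'m Zfun \<Rightarrow> R3 \<Rightarrow> real^'m" +
  fixes A1 F :: "R3 \<Rightarrow> real^'m" and a :: nat
  assumes F: "Ck_extension 1 \<Omega> A1 F"
    and B1inv_weighted: "\<And>r k. integrable lborel (\<lambda>\<xi>. B1inv v C \<xi> $ r $ k / of_real ((1 + (norm \<xi>)\<^sup>2) ^ (a + 3)))"
    and B1invB2_weighted: "\<And>r l. integrable lborel (\<lambda>\<xi>. B1invB2 v C \<xi> $ r $ l / of_real ((1 + (norm \<xi>)\<^sup>2) ^ (a + 3)))"
begin

lemma finite_surf: "finite_measure (surf \<Omega>)"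
  by (rule finite_measure_surf[OF domain_facts cvx dom(2)])

lemma frontier_measurable:
  fixes b :: "R3 \<Rightarrow> 'b::topological_space"
  assumes "continuous_on (frontier \<Omega>) b" shows "b \<in> borel_measurable (surf \<Omega>)"
  unfolding measurable_cong_sets[OF sets_surf refl] by (rule borel_measurable_continuous_on_restrict[OF assms])

lemma frontier_bounded:
  fixes b :: "R3 \<Rightarrow> 'b::real_normed_vector"
  assumes "continuous_on (frontier \<Omega>) b" shows "\<exists>B\<ge>0. \<forall>P\<in>frontier \<Omega>. norm (b P) \<le> B"
proof -
  obtain B where "\<forall>P\<in>frontier \<Omega>. norm (b P) \<le> B"
    using compact_imp_bounded[OF compact_continuous_image[OF assms compact_frontier_Omega[OF domain_facts]]] by (auto simp: bounded_iff)
  then show ?thesis by (intro exI[of _ "max B 0"]) fastforce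
qed

lemma normal_continuous: "continuous_on (frontier \<Omega>) (outer_normal \<Omega>)"
  by (rule outer_normal_continuous_on[OF domain_facts])

lemma F_facts: "\<And>P. P \<in> frontier \<Omega> \<Longrightarrow> F differentiable (at P)"
  "continuous_on (frontier \<Omega>) A1" "\<And>j. continuous_on (frontier \<Omega>) (pd j F)"
proof -
  obtain U where U: "frontier \<Omega> \<subseteq> U" "\<forall>X\<in>U. F differentiable (at X)" "\<forall>i. continuous_on U (pd i F)"
    and eq: "\<forall>P\<in>frontier \<Omega>. F P = A1 P"
    using F unfolding Ck_extension_def by auto
  show "F differentiable (at P)" if "P \<in> frontier \<Omega>" for P using U that by blast
  show "continuous_on (frontier \<Omega>) (pd j F)" for j using U continuous_on_subset by blast
  have "continuous_on U F"
    using U(2) by (auto intro!: continuous_at_imp_continuous_on differentiable_imp_continuous_within)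
  then have "continuous_on (frontier \<Omega>) F" using U(1) continuous_on_subset by blast
  then show "continuous_on (frontier \<Omega>) A1" by (rule continuous_on_cong[THEN iffD1, rotated -1]) (use eq in auto)
qed

text \<open>In the definition the derivative of F at P is applied to a vector that itself moves with
  P. Expanded in partial derivatives, its continuity along the boundary becomes visible.\<close>

lemma bgrad_eq:
  assumes "P \<in> frontier \<Omega>"
  shows "bgrad \<Omega> F A j P = pd j F P + (outer_normal \<Omega> P $ j) *\<^sub>R (A P - (\<Sum>i\<in>UNIV. (outer_normal \<Omega> P $ i) *\<^sub>R pd i F P))"
proof -
  have lin: "linear (frechet_derivative F (at P))" using F_facts(1)[OF assms] by (rule linear_frechet_derivative)
  have "outer_normal \<Omega> P = (\<Sum>i\<in>UNIV. (outer_normal \<Omega> P $ i) *\<^sub>R axis i 1)"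
    using basis_expansion[of "outer_normal \<Omega> P"] by (simp add: scalar_mult_eq_scaleR)
  then have "frechet_derivative F (at P) (outer_normal \<Omega> P) = frechet_derivative F (at P) (\<Sum>i\<in>UNIV. (outer_normal \<Omega> P $ i) *\<^sub>R axis i 1)"
    by simp
  also have "\<dots> = (\<Sum>i\<in>UNIV. (outer_normal \<Omega> P $ i) *\<^sub>R pd i F P)"
    unfolding linear_sum[OF lin] linear_cmul[OF lin] pd_def ..
  finally show ?thesis unfolding bgrad_def by simp
qed

lemma bgrad_continuous:
  assumes "continuous_on (frontier \<Omega>) A" shows "continuous_on (frontier \<Omega>) (bgrad \<Omega> F A j)"
proof -
  have "continuous_on (frontier \<Omega>) (\<lambda>P. pd j F P + (outer_normal \<Omega> P $ j) *\<^sub>R (A P - (\<Sum>i\<in>UNIV. (outer_normal \<Omega> P $ i) *\<^sub>R pd i F P)))"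
    by (intro continuous_intros assms F_facts(3) normal_continuous)
  then show ?thesis by (rule continuous_on_cong[THEN iffD1, rotated -1]) (auto simp: bgrad_eq)
qed

text \<open>The dependence on A is affine, its linear part being A times a component of the unit
  normal; so one constant G serves all A and B.\<close>

lemma bgrad_bounded:
  "\<exists>G\<ge>0. \<forall>A B. \<forall>P\<in>frontier \<Omega>. norm (A P) \<le> B \<longrightarrow> norm (bgrad \<Omega> F A j P) \<le> G + B"
proof -
  obtain G where G: "G \<ge> 0" "\<forall>P\<in>frontier \<Omega>. norm (bgrad \<Omega> F (\<lambda>_. 0) j P) \<le> G"
    using frontier_bounded[OF bgrad_continuous[OF continuous_on_const]] by blast
  show ?thesis
  proof (intro exI[of _ G] conjI G(1) allI ballI impI)
    fix A :: "R3 \<Rightarrow> real^'m" and B P assume P: "P \<in> frontier \<Omega>" and A: "norm (A P) \<le> B"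
    have "bgrad \<Omega> F A j P = bgrad \<Omega> F (\<lambda>_. 0) j P + (outer_normal \<Omega> P $ j) *\<^sub>R A P"
      unfolding bgrad_def by (simp add: scaleR_diff_right)
    moreover have "norm ((outer_normal \<Omega> P $ j) *\<^sub>R A P) \<le> 1 * B"
      unfolding norm_scaleR using A component_le_norm_cart[of "outer_normal \<Omega> P" j] outer_normal_unit[OF domain_facts P]
      by (intro mult_mono) auto
    ultimately show "norm (bgrad \<Omega> F A j P) \<le> G + B"
      using G(2) P by (metis mult_1 norm_triangle_mono)
  qed
qed

lemma bfourier_measurable:
  assumes A: "continuous_on (frontier \<Omega>) A"
  shows "(\<lambda>\<xi>. bfourier \<Omega> A k \<xi> $ i) \<in> borel_measurable borel"
proof -
  interpret finite_measure "surf \<Omega>" by (rule finite_surf)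
  have h[measurable]: "(\<lambda>P. A P $ i * outer_normal \<Omega> P $ k) \<in> borel_measurable (surf \<Omega>)"
    by (rule frontier_measurable) (intro continuous_intros A normal_continuous)
  have [measurable]: "(\<lambda>P. P) \<in> borel_measurable (surf \<Omega>)" by (rule frontier_measurable) (rule continuous_on_id)
  have "(\<lambda>\<xi>. LINT P|surf \<Omega>. of_real (A P $ i * outer_normal \<Omega> P $ k) * exp (- \<i> * of_real (\<xi> \<bullet> P))) \<in> borel_measurable borel"
    by measurable
  then show ?thesis by (simp add: bfourier_def)
qed

lemma bfourier_integrand_bound:
  assumes "P \<in> frontier \<Omega>" "norm (A P) \<le> B"
  shows "cmod (of_real (A P $ i * outer_normal \<Omega> P $ k) * exp (- \<i> * of_real (\<xi> \<bullet> P))) \<le> B"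
proof -
  have "cmod (of_real (A P $ i * outer_normal \<Omega> P $ k) * exp (- \<i> * of_real (\<xi> \<bullet> P))) = \<bar>A P $ i\<bar> * \<bar>outer_normal \<Omega> P $ k\<bar>"
    by (simp add: norm_mult abs_mult)
  also have "\<dots> \<le> B * 1"
    using component_le_norm_cart[of "A P" i] component_le_norm_cart[of "outer_normal \<Omega> P" k] outer_normal_unit[OF domain_facts assms(1)] assms(2)
    by (intro mult_mono) auto
  finally show ?thesis by simp
qed

lemma bfourier_bound:
  assumes A: "\<And>P. P \<in> frontier \<Omega> \<Longrightarrow> norm (A P) \<le> B" and B: "B \<ge> 0"
  shows "cmod (bfourier \<Omega> A k \<xi> $ i) \<le> B * measure (surf \<Omega>) (frontier \<Omega>)"
proof -
  interpret finite_measure "surf \<Omega>" by (rule finite_surf)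
  let ?h = "\<lambda>P. of_real (A P $ i * outer_normal \<Omega> P $ k) * exp (- \<i> * of_real (\<xi> \<bullet> P))"
  have "cmod (LINT P|surf \<Omega>. ?h P) \<le> B * measure (surf \<Omega>) (frontier \<Omega>)"
  proof (cases "integrable (surf \<Omega>) ?h")
    case True
    have "cmod (LINT P|surf \<Omega>. ?h P) \<le> (LINT P|surf \<Omega>. B)"
    proof (rule Bochner_Integration.integral_norm_bound_integral[OF True])
      show "integrable (surf \<Omega>) (\<lambda>_. B)" by (rule integrable_const)
      show "cmod (?h P) \<le> B" if "P \<in> space (surf \<Omega>)" for P
        using that by (intro bfourier_integrand_bound A) simp_all
    qed
    then show ?thesis by (simp add: mult.commute)
  next
    case False
    then show ?thesis using B by (simp add: not_integrable_integral_eq del: of_real_mult)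
  qed
  then show ?thesis by (simp add: bfourier_def)
qed

lemma bfourier_tendsto:
  assumes A: "\<And>n. continuous_on (frontier \<Omega>) (A n)" "\<And>n P. P \<in> frontier \<Omega> \<Longrightarrow> norm (A n P) \<le> B"
    and As: "continuous_on (frontier \<Omega>) As" and lim: "\<And>P. P \<in> frontier \<Omega> \<Longrightarrow> (\<lambda>n. A n P) \<longlonglongrightarrow> As P"
  shows "(\<lambda>n. bfourier \<Omega> (A n) k \<xi> $ i) \<longlonglongrightarrow> bfourier \<Omega> As k \<xi> $ i"
proof -
  interpret finite_measure "surf \<Omega>" by (rule finite_surf)
  let ?h = "\<lambda>A P. of_real (A P $ i * outer_normal \<Omega> P $ k) * exp (- \<i> * of_real (\<xi> \<bullet> P))"
  have m: "?h A \<in> borel_measurable (surf \<Omega>)" if "continuous_on (frontier \<Omega>) A" for A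
    by (rule frontier_measurable) (intro continuous_intros that normal_continuous)
  have "(\<lambda>n. LINT P|surf \<Omega>. ?h (A n) P) \<longlonglongrightarrow> (LINT P|surf \<Omega>. ?h As P)"
  proof (rule integral_dominated_convergence[where w="\<lambda>_. B"])
    show "AE P in surf \<Omega>. (\<lambda>n. ?h (A n) P) \<longlonglongrightarrow> ?h As P"
      by (rule AE_I2) (intro tendsto_intros lim, simp)
    show "AE P in surf \<Omega>. norm (?h (A n) P) \<le> B" for n
      by (rule AE_I2) (intro bfourier_integrand_bound A(2), simp_all)
  qed (use m A(1) As in auto)
  then show ?thesis by (simp add: bfourier_def)
qed

text \<open>\<open>beta1\<close> splits into the part made of the transforms g_j of A_1, which is
  fixed and grows to first order through the factors i \<xi>_j, and the part \<open>b1\<close> made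
  of the g_jk, which is bounded but varies with A_5(Z).\<close>

definition b0 :: "R3 \<Rightarrow> 'm idx \<Rightarrow> complex" where
  "b0 \<xi> r = - (let g = (\<lambda>j. bfourier \<Omega> A1 j \<xi> $ snd r); z = i_xi \<xi> in case fst r of
      Dx \<Rightarrow> g 1 | Dy \<Rightarrow> g 2 | Dz \<Rightarrow> g 3 | Dxx \<Rightarrow> z$1 * g 1 | Dxy \<Rightarrow> z$1 * g 2 | Dxz \<Rightarrow> z$1 * g 3
    | Dyy \<Rightarrow> z$2 * g 2 | Dyz \<Rightarrow> z$2 * g 3 | Dzz \<Rightarrow> z$3 * g 3)"

definition b1 :: "(R3 \<Rightarrow> real^'m) \<Rightarrow> R3 \<Rightarrow> 'm idx \<Rightarrow> complex" where
  "b1 A \<xi> r = - (let gg = (\<lambda>j k. bfourier \<Omega> (bgrad \<Omega> F A j) k \<xi> $ snd r) in case fst r of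
      Dx \<Rightarrow> 0 | Dy \<Rightarrow> 0 | Dz \<Rightarrow> 0 | Dxx \<Rightarrow> gg 1 1 | Dxy \<Rightarrow> gg 2 1 | Dxz \<Rightarrow> gg 3 1
    | Dyy \<Rightarrow> gg 2 2 | Dyz \<Rightarrow> gg 3 2 | Dzz \<Rightarrow> gg 3 3)"

lemma beta1_split: "beta1 \<Omega> A1 F A \<xi> $ r = b0 \<xi> r + b1 A \<xi> r"
proof -
  obtain d i where r: "r = (d, i)" by (cases r)
  show ?thesis unfolding r beta1_def b0_def b1_def by (cases d) (simp_all add: Let_def)
qed

lemma b0_measurable: "(\<lambda>\<xi>. b0 \<xi> r) \<in> borel_measurable borel"
proof -
  have [measurable]: "(\<lambda>\<xi>. bfourier \<Omega> A1 j \<xi> $ i) \<in> borel_measurable borel" for j i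
    by (rule bfourier_measurable[OF F_facts(2)])
  have [measurable]: "(\<lambda>\<xi>. i_xi \<xi> $ j) \<in> borel_measurable borel" for j
    unfolding i_xi_def vec_lambda_beta by (intro borel_measurable_continuous_onI continuous_intros)
  show ?thesis unfolding b0_def Let_def by (cases "fst r") simp_all
qed

lemma b0_bound: "\<exists>K. \<forall>\<xi> r. cmod (b0 \<xi> r) \<le> K * (1 + (norm \<xi>)\<^sup>2) ^ 1"
proof -
  obtain B where B: "B \<ge> 0" "\<forall>P\<in>frontier \<Omega>. norm (A1 P) \<le> B" using frontier_bounded[OF F_facts(2)] by blast
  define K where "K = B * measure (surf \<Omega>) (frontier \<Omega>)"
  have K0: "K \<ge> 0" unfolding K_def using B by simp
  have g: "cmod (bfourier \<Omega> A1 j \<xi> $ i) \<le> K" for j \<xi> i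
    unfolding K_def using B by (intro bfourier_bound) auto
  have "cmod (b0 \<xi> r) \<le> K * (1 + (norm \<xi>)\<^sup>2)" for \<xi> r
  proof -
    have z: "cmod (i_xi \<xi> $ j) \<le> 1 + (norm \<xi>)\<^sup>2" for j
    proof -
      have "cmod (i_xi \<xi> $ j) \<le> norm \<xi>" using component_le_norm_cart[of \<xi> j] by (simp add: i_xi_def norm_mult)
      also have "norm \<xi> \<le> 1 + (norm \<xi>)\<^sup>2"
      proof -
        have "0 \<le> (norm \<xi> - 1)\<^sup>2" by simp
        also have "\<dots> = (norm \<xi>)\<^sup>2 + 1 - 2 * norm \<xi>" by (simp add: power2_diff)
        finally show ?thesis using norm_ge_zero[of \<xi>] by linarith
      qed
      finally show ?thesis .
    qed
    have 1: "cmod (bfourier \<Omega> A1 j \<xi> $ i) \<le> K * (1 + (norm \<xi>)\<^sup>2)" for j i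
      using mult_mono[OF g[of j \<xi> i] _ K0, of 1 "1 + (norm \<xi>)\<^sup>2"] by simp
    have 2: "cmod (i_xi \<xi> $ l * bfourier \<Omega> A1 j \<xi> $ i) \<le> K * (1 + (norm \<xi>)\<^sup>2)" for j i l
      unfolding norm_mult using mult_mono[OF g[of j \<xi> i] z[of l] K0] by (simp add: mult.commute)
    show ?thesis unfolding b0_def Let_def norm_minus_cancel by (cases "fst r") (simp_all only: pder.case 1 2)
  qed
  then show ?thesis by (intro exI[of _ K]) simp
qed

lemma b1_measurable: "continuous_on (frontier \<Omega>) A \<Longrightarrow> (\<lambda>\<xi>. b1 A \<xi> r) \<in> borel_measurable borel"
  unfolding b1_def Let_def by (cases "fst r") (simp_all add: bfourier_measurable bgrad_continuous)

text \<open>The constant depends on A only through its bound on the boundary, so it is common to all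
  A_5(Z_n).\<close>

lemma b1_bound: "\<exists>K\<ge>0. \<forall>A \<xi> r. (\<forall>P\<in>frontier \<Omega>. norm (A P) \<le> B) \<longrightarrow> cmod (b1 A \<xi> r) \<le> K"
proof -
  obtain G where G: "\<And>j. G j \<ge> 0" "\<And>j A B P. P \<in> frontier \<Omega> \<Longrightarrow> norm (A P) \<le> B \<Longrightarrow> norm (bgrad \<Omega> F A j P) \<le> G j + B"
    using bgrad_bounded by metis
  define G' where "G' = (\<Sum>j\<in>UNIV. G j) + \<bar>B\<bar>"
  define K where "K = G' * measure (surf \<Omega>) (frontier \<Omega>)"
  have G0: "G' \<ge> 0" unfolding G'_def using G(1) by (intro add_nonneg_nonneg sum_nonneg) auto
  then have K0: "K \<ge> 0" unfolding K_def by simp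
  have Gj: "G j + B \<le> G'" for j
    unfolding G'_def using G(1) member_le_sum[of j UNIV G] by (simp add: add_mono)
  show ?thesis
  proof (intro exI[of _ K] conjI K0 allI impI)
    fix A :: "R3 \<Rightarrow> real^'m" and \<xi> and r :: "'m idx" assume A: "\<forall>P\<in>frontier \<Omega>. norm (A P) \<le> B"
    have gg: "cmod (bfourier \<Omega> (bgrad \<Omega> F A j) k \<xi> $ i) \<le> K" for j k i
      unfolding K_def by (rule bfourier_bound[OF _ G0]) (use G(2) A Gj order_trans in blast)
    show "cmod (b1 A \<xi> r) \<le> K"
      unfolding b1_def Let_def norm_minus_cancel using K0 by (cases "fst r") (simp_all add: gg)
  qed
qed

lemma b1_tendsto:
  assumes A: "\<And>n. continuous_on (frontier \<Omega>) (A n)" "\<And>n P. P \<in> frontier \<Omega> \<Longrightarrow> norm (A n P) \<le> B"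
    and As: "continuous_on (frontier \<Omega>) As" and lim: "\<And>P. P \<in> frontier \<Omega> \<Longrightarrow> (\<lambda>n. A n P) \<longlonglongrightarrow> As P"
  shows "(\<lambda>n. b1 (A n) \<xi> r) \<longlonglongrightarrow> b1 As \<xi> r"
proof -
  have gg: "(\<lambda>n. bfourier \<Omega> (bgrad \<Omega> F (A n) j) k \<xi> $ i) \<longlonglongrightarrow> bfourier \<Omega> (bgrad \<Omega> F As j) k \<xi> $ i" for j k i
  proof -
    obtain G where G: "\<forall>A B. \<forall>P\<in>frontier \<Omega>. norm (A P) \<le> B \<longrightarrow> norm (bgrad \<Omega> F A j P) \<le> G + B"
      using bgrad_bounded by blast
    show ?thesis
    proof (rule bfourier_tendsto[where B="G + B"])
      show "norm (bgrad \<Omega> F (A n) j P) \<le> G + B" if "P \<in> frontier \<Omega>" for n P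
        using G A(2)[OF that] that by blast
      show "(\<lambda>n. bgrad \<Omega> F (A n) j P) \<longlonglongrightarrow> bgrad \<Omega> F As j P" if "P \<in> frontier \<Omega>" for P
        unfolding bgrad_def by (intro tendsto_intros lim that)
    qed (intro bgrad_continuous A(1) As)+
  qed
  show ?thesis unfolding b1_def Let_def by (cases "fst r") (simp_all add: tendsto_minus gg)
qed

end

lemma component_measurable:
  fixes Z :: "R3 \<Rightarrow> real^'k"
  assumes "Z \<in> borel_measurable N" shows "(\<lambda>X. Z X $ k) \<in> borel_measurable N"
  by (rule measurable_compose[OF assms]) (intro borel_measurable_continuous_onI continuous_intros)

lemma weighted_mult_bounded:
  fixes g h :: "R3 \<Rightarrow> complex"
  assumes "integrable lborel (\<lambda>\<xi>. g \<xi> / of_real ((1 + (norm \<xi>)\<^sup>2) ^ N))"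
    and "h \<in> borel_measurable borel" "\<And>\<xi>. cmod (h \<xi>) \<le> K"
  shows "integrable lborel (\<lambda>\<xi>. g \<xi> * h \<xi> / of_real ((1 + (norm \<xi>)\<^sup>2) ^ N))"
  using weighted_mult[OF assms(1,2), of K 0] assms(3) by simp

lemma integrable_mult_contraction:
  fixes e g :: "R3 \<Rightarrow> complex"
  assumes g: "integrable lborel g" and e: "e \<in> borel_measurable borel" "\<And>\<xi>. cmod (e \<xi>) \<le> 1"
  shows "integrable lborel (\<lambda>\<xi>. e \<xi> * g \<xi>)"
proof (rule Bochner_Integration.integrable_bound[OF g])
  show "(\<lambda>\<xi>. e \<xi> * g \<xi>) \<in> borel_measurable lborel"
    using e(1) borel_measurable_integrable[OF g] by (intro borel_measurable_times) auto
  show "AE \<xi> in lborel. norm (e \<xi> * g \<xi>) \<le> norm (g \<xi>)"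
    using e(2) by (intro AE_I2) (simp add: norm_mult mult_left_le_one_le)
qed

text \<open>The transform of the Gaussian decays faster than every power, so it makes each weighted
  symbol integrable and the inverse transforms in \<open>T0_eps\<close> convergent
  integrals.\<close>

lemma gauss_multiplier_integrable:
  assumes "\<epsilon> > 0" and g: "integrable lborel (\<lambda>\<xi>. g \<xi> / of_real ((1 + (norm \<xi>)\<^sup>2) ^ N))"
  shows "integrable lborel (\<lambda>\<xi>. fourier (gauss \<epsilon>) \<xi> * g \<xi>)"
proof -
  obtain K where K: "\<forall>s\<ge>0. (1 + s) ^ N * exp (- (\<epsilon> / 4) * s) \<le> K"
    using power_exp_bounded[of "\<epsilon> / 4" N] assms(1) by auto
  have "integrable lborel (\<lambda>\<xi>. g \<xi> * fourier (gauss \<epsilon>) \<xi>)"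
  proof (rule integrable_mult_decay(1)[OF g])
    show "fourier (gauss \<epsilon>) \<in> borel_measurable borel"
      using borel_measurable_integrable[OF integrable_gauss[OF assms(1)]] by (intro fourier_measurable) simp
    show "(1 + (norm \<xi>)\<^sup>2) ^ N * cmod (fourier (gauss \<epsilon>) \<xi>) \<le> K" for \<xi>
      using K[rule_format, of "(norm \<xi>)\<^sup>2"] unfolding fourier_gauss[OF assms(1)] norm_of_real abs_exp_cancel by simp
  qed
  then show ?thesis by (simp only: mult.commute)
qed

lemma inv_fourier_mult_integrable:
  assumes G: "integrable lborel G" and t: "test_fun U \<phi>"
  shows "integrable lborel (\<lambda>X. inv_fourier G X * \<phi> X)"
proof (rule Bochner_Integration.integrable_bound)
  show "integrable lborel (\<lambda>X. (LINT X|lborel. cmod (G X)) * cmod (\<phi> X))"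
    by (intro integrable_mult_right integrable_norm test_fun_integrable[OF t])
  have "G \<in> borel_measurable borel" using borel_measurable_integrable[OF G] by simp
  then show "(\<lambda>X. inv_fourier G X * \<phi> X) \<in> borel_measurable lborel"
    using inv_fourier_measurable test_fun_measurable[OF t] by (intro borel_measurable_times) auto
  show "AE X in lborel. norm (inv_fourier G X * \<phi> X) \<le> norm ((LINT X|lborel. cmod (G X)) * cmod (\<phi> X))"
    using cmod_inv_fourier_le[of G]
    by (intro AE_I2) (simp add: norm_mult abs_mult mult_right_mono order_trans[OF _ abs_ge_self])
qed

section \<open>The operators expressed through symbols\<close>

context elliptic_problem
begin

definition cut :: "(R3 \<Rightarrow> real) \<Rightarrow> R3 \<Rightarrow> complex" where
  "cut h X = indicator (closure \<Omega>) X * complex_of_real (h X)"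

lemma cut_support: "\<exists>R. \<forall>h X. cut h X \<noteq> 0 \<longrightarrow> norm X \<le> R"
proof -
  obtain R where "\<forall>X\<in>closure \<Omega>. norm X \<le> R" using bounded_closure[OF dom(3)] by (auto simp: bounded_iff)
  then show ?thesis by (intro exI[of _ R]) (auto simp: cut_def split: split_indicator_asm)
qed

lemma cut_bound:
  assumes "\<And>X. X \<in> closure \<Omega> \<Longrightarrow> \<bar>h X\<bar> \<le> K" "K \<ge> 0" shows "cmod (cut h X) \<le> K"
  using assms by (cases "X \<in> closure \<Omega>") (simp_all add: cut_def)

lemma measurable_cut: "h \<in> borel_measurable (restrict_space lborel (closure \<Omega>)) \<Longrightarrow> cut h \<in> borel_measurable borel"
  unfolding cut_def[abs_def] by (rule cut_measurable) auto

lemma cut_tendsto: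
  assumes "\<And>X. X \<in> closure \<Omega> \<Longrightarrow> P X \<Longrightarrow> (\<lambda>n. h n X) \<longlonglongrightarrow> hs X" and "X \<in> closure \<Omega> \<longrightarrow> P X"
  shows "(\<lambda>n. cut (h n) X) \<longlonglongrightarrow> cut hs X"
proof (cases "X \<in> closure \<Omega>")
  case True
  then show ?thesis unfolding cut_def using assms by (intro tendsto_intros) blast
qed (simp add: cut_def)

lemma cut_integrable:
  assumes m: "h \<in> borel_measurable (restrict_space lborel (closure \<Omega>))"
    and K: "\<And>X. X \<in> closure \<Omega> \<Longrightarrow> \<bar>h X\<bar> \<le> K" "K \<ge> 0"
  shows "integrable lborel (cut h)"
    "(LINT X|lborel. cmod (cut h X)) \<le> K * measure lborel (closure \<Omega>)"
proof -
  have fin: "emeasure lborel (closure \<Omega>) < \<infinity>"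
    by (rule emeasure_bounded_finite[OF bounded_closure[OF dom(3)]])
  have bi: "integrable lborel (\<lambda>X. K * indicator (closure \<Omega>) X :: real)"
    using fin by (intro integrable_mult_right integrable_real_indicator) auto
  have pb: "cmod (cut h X) \<le> K * indicator (closure \<Omega>) X" for X
    using K by (cases "X \<in> closure \<Omega>") (simp_all add: cut_def)
  show i: "integrable lborel (cut h)"
  proof (rule Bochner_Integration.integrable_bound[OF bi])
    show "AE X in lborel. norm (cut h X) \<le> norm (K * indicator (closure \<Omega>) X :: real)"
      using pb by (intro AE_I2) (metis abs_ge_self order_trans real_norm_def)
  qed (use measurable_cut[OF m] in simp)
  have "(LINT X|lborel. cmod (cut h X)) \<le> (LINT X|lborel. K * indicator (closure \<Omega>) X)"
    by (intro integral_mono integrable_norm i bi pb)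
  also have "\<dots> = K * measure lborel (closure \<Omega>)" by simp
  finally show "(LINT X|lborel. cmod (cut h X)) \<le> K * measure lborel (closure \<Omega>)" .
qed

lemma psi_cut_eq: "psi_cut \<Omega> f C Z l = cut (\<lambda>X. psi f C Z X $ l)"
  by (rule ext) (simp add: psi_cut_def cut_def)

lemma psi_measurable:
  assumes "Z \<in> bounded_class M"
  shows "(\<lambda>X. psi f C Z X $ l) \<in> borel_measurable (restrict_space lborel (closure \<Omega>))"
proof -
  note Z = bounded_class_measurable[OF assms]
  have "(\<lambda>X. C *v Z X) \<in> borel_measurable (restrict_space lborel (closure \<Omega>))"
    by (rule measurable_compose[OF Z])
       (intro borel_measurable_continuous_onI linear_continuous_on matrix_vector_mul_bounded_linear)
  then have "(\<lambda>X. f (Z X) X $ l - (C *v Z X) $ l) \<in> borel_measurable (restrict_space lborel (closure \<Omega>))"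
    by (intro borel_measurable_diff component_measurable f_measurable[OF Z])
  then show ?thesis by (simp add: psi_def)
qed

lemma psi_bounded: "\<exists>K\<ge>0. \<forall>Z\<in>bounded_class M. \<forall>X\<in>closure \<Omega>. \<forall>l. \<bar>psi f C Z X $ l\<bar> \<le> K"
proof -
  obtain R where R: "R \<ge> 0" "\<forall>Z\<in>bounded_class M. \<forall>X\<in>closure \<Omega>. norm (f (Z X) X) \<le> R" using f_bounded by blast
  have bl: "bounded_linear ((*v) C)" by (rule matrix_vector_mul_bounded_linear)
  define K where "K = R + onorm ((*v) C) * (real CARD('m idx) * \<bar>M\<bar>)"
  have K0: "K \<ge> 0" unfolding K_def using R(1) onorm_pos_le[OF bl] by simp
  have "\<bar>psi f C Z X $ l\<bar> \<le> K" if Z: "Z \<in> bounded_class M" "X \<in> closure \<Omega>" for Z X l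
  proof -
    have "norm (Z X) \<le> real CARD('m idx) * \<bar>M\<bar>"
      by (rule order_trans[OF bounded_class_norm[OF Z]]) (simp add: mult_left_mono)
    then have "onorm ((*v) C) * norm (Z X) \<le> onorm ((*v) C) * (real CARD('m idx) * \<bar>M\<bar>)"
      by (intro mult_left_mono onorm_pos_le bl)
    then have "norm (C *v Z X) \<le> onorm ((*v) C) * (real CARD('m idx) * \<bar>M\<bar>)"
      using onorm[OF bl, of "Z X"] by linarith
    moreover have "norm (f (Z X) X) \<le> R" using R(2) Z by blast
    ultimately have "norm (psi f C Z X) \<le> K"
      unfolding psi_def K_def using norm_triangle_ineq4[of "f (Z X) X" "C *v Z X"] by linarith
    then show ?thesis using component_le_norm_cart[of "psi f C Z X" l] by linarith
  qed
  then show ?thesis using K0 by blast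
qed

lemma psi_tendsto:
  assumes "X \<in> closure \<Omega>" "(\<lambda>n. Z n X) \<longlonglongrightarrow> Zs X"
  shows "(\<lambda>n. psi f C (Z n) X $ l) \<longlonglongrightarrow> psi f C Zs X $ l"
proof -
  have "(\<lambda>n. C *v Z n X) \<longlonglongrightarrow> C *v Zs X"
    by (rule bounded_linear.tendsto[OF matrix_vector_mul_bounded_linear assms(2)])
  then show ?thesis unfolding psi_def by (intro tendsto_intros f_tendsto assms)
qed

lemma psi_cut_integrable: "Z \<in> bounded_class M \<Longrightarrow> integrable lborel (psi_cut \<Omega> f C Z l)"
  unfolding psi_cut_eq using psi_bounded[of M] by (blast intro: cut_integrable(1) psi_measurable)

text \<open>This is p of the overview, the same for every Z; the next definition is q(Z).\<close>

definition boundary_symbol :: "'m idx \<Rightarrow> R3 \<Rightarrow> complex" where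
  "boundary_symbol r \<xi> = (\<Sum>k\<in>UNIV. B1inv v C \<xi> $ r $ k * b0 \<xi> k)"

definition solution_symbol :: "'m Zfun \<Rightarrow> 'm idx \<Rightarrow> R3 \<Rightarrow> complex" where
  "solution_symbol Z r \<xi> = (\<Sum>k\<in>UNIV. B1inv v C \<xi> $ r $ k * b1 (A5 Z) \<xi> k)
     + (\<Sum>l\<in>UNIV. B1invB2 v C \<xi> $ r $ l * fourier (psi_cut \<Omega> f C Z l) \<xi>)"

text \<open>The exponent is one above a + 3 because \<open>b0\<close> is controlled by a multiple of
  1 + |\<xi>|^2 rather than by a constant.\<close>

lemma boundary_symbol_weighted:
  "integrable lborel (\<lambda>\<xi>. boundary_symbol r \<xi> / of_real ((1 + (norm \<xi>)\<^sup>2) ^ Suc (a + 3)))"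
proof -
  obtain K where K: "\<And>\<xi> r. cmod (b0 \<xi> r) \<le> K * (1 + (norm \<xi>)\<^sup>2) ^ 1" using b0_bound by blast
  have "integrable lborel (\<lambda>\<xi>. \<Sum>k\<in>UNIV. B1inv v C \<xi> $ r $ k * b0 \<xi> k / of_real ((1 + (norm \<xi>)\<^sup>2) ^ (a + 3 + 1)))"
    by (intro Bochner_Integration.integrable_sum weighted_mult[OF B1inv_weighted b0_measurable K])
  then show ?thesis unfolding boundary_symbol_def sum_divide_distrib Suc_eq_plus1 .
qed

lemma b1_A5:
  assumes Z: "Z \<in> bounded_class M"
  shows "(\<lambda>\<xi>. b1 (A5 Z) \<xi> k) \<in> borel_measurable borel" "\<exists>K. \<forall>\<xi> k. cmod (b1 (A5 Z) \<xi> k) \<le> K"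
proof -
  note c = A5_continuous[OF Z]
  show "(\<lambda>\<xi>. b1 (A5 Z) \<xi> k) \<in> borel_measurable borel" by (rule b1_measurable[OF c])
  obtain B where "\<forall>P\<in>frontier \<Omega>. norm (A5 Z P) \<le> B" using frontier_bounded[OF c] by blast
  then show "\<exists>K. \<forall>\<xi> k. cmod (b1 (A5 Z) \<xi> k) \<le> K" using b1_bound[of B] by blast
qed

lemma fourier_psi_measurable:
  assumes Z: "Z \<in> bounded_class M" shows "fourier (psi_cut \<Omega> f C Z l) \<in> borel_measurable borel"
  unfolding psi_cut_eq by (intro fourier_measurable measurable_cut psi_measurable[OF Z])

lemma fourier_psi_bounded: "\<exists>K. \<forall>Z\<in>bounded_class M. \<forall>\<xi> l. cmod (fourier (psi_cut \<Omega> f C Z l) \<xi>) \<le> K"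
proof -
  obtain K where K: "K \<ge> 0" "\<forall>Z\<in>bounded_class M. \<forall>X\<in>closure \<Omega>. \<forall>l. \<bar>psi f C Z X $ l\<bar> \<le> K" using psi_bounded by blast
  have "cmod (fourier (psi_cut \<Omega> f C Z l) \<xi>) \<le> K * measure lborel (closure \<Omega>)" if Z: "Z \<in> bounded_class M" for Z l \<xi>
    unfolding psi_cut_eq
    by (rule order_trans[OF cmod_fourier_le cut_integrable(2)[OF psi_measurable[OF Z]]]) (use K Z in auto)
  then show ?thesis by blast
qed

lemma solution_symbol_measurable:
  assumes Z: "Z \<in> bounded_class M" shows "solution_symbol Z r \<in> borel_measurable borel"
  unfolding solution_symbol_def[abs_def]
  by (intro borel_measurable_add borel_measurable_sum borel_measurable_times
      weighted_measurable[OF B1inv_weighted] weighted_measurable[OF B1invB2_weighted] b1_A5(1)[OF Z] fourier_psi_measurable[OF Z])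

lemma B1inv_beta1:
  "(B1inv v C \<xi> *v beta1 \<Omega> A1 F A \<xi>) $ r = boundary_symbol r \<xi> + (\<Sum>k\<in>UNIV. B1inv v C \<xi> $ r $ k * b1 A \<xi> k)"
  unfolding matrix_vector_mult_def boundary_symbol_def vec_lambda_beta beta1_split distrib_left sum.distrib ..

lemma B1inv_beta1_weighted:
  assumes Z: "Z \<in> bounded_class M"
  shows "integrable lborel (\<lambda>\<xi>. (B1inv v C \<xi> *v beta1 \<Omega> A1 F (A5 Z) \<xi>) $ r / of_real ((1 + (norm \<xi>)\<^sup>2) ^ Suc (a + 3)))"
proof -
  obtain K where K: "\<And>\<xi> k. cmod (b1 (A5 Z) \<xi> k) \<le> K" using b1_A5(2)[OF Z] by blast
  have K': "cmod (b1 (A5 Z) \<xi> k) \<le> K * (1 + (norm \<xi>)\<^sup>2) ^ 1" for \<xi> k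
  proof -
    have "0 \<le> K" using order_trans[OF norm_ge_zero K] .
    then have "K * 1 \<le> K * (1 + (norm \<xi>)\<^sup>2) ^ 1" by (intro mult_left_mono) auto
    then show ?thesis using K[of \<xi> k] by linarith
  qed
  have "integrable lborel (\<lambda>\<xi>. \<Sum>k\<in>UNIV. B1inv v C \<xi> $ r $ k * b1 (A5 Z) \<xi> k / of_real ((1 + (norm \<xi>)\<^sup>2) ^ (a + 3 + 1)))"
    by (intro Bochner_Integration.integrable_sum weighted_mult[OF B1inv_weighted b1_A5(1)[OF Z] K'])
  then show ?thesis
    unfolding B1inv_beta1 add_divide_distrib sum_divide_distrib
    by (intro Bochner_Integration.integrable_add boundary_symbol_weighted) (simp only: Suc_eq_plus1)
qed

lemma B1invB2_psi_weighted:
  assumes Z: "Z \<in> bounded_class M"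
  shows "integrable lborel (\<lambda>\<xi>. B1invB2 v C \<xi> $ r $ l * fourier (psi_cut \<Omega> f C Z l) \<xi> / of_real ((1 + (norm \<xi>)\<^sup>2) ^ (a + 3)))"
proof -
  obtain K where K: "\<And>\<xi> l. cmod (fourier (psi_cut \<Omega> f C Z l) \<xi>) \<le> K" using fourier_psi_bounded Z by blast
  show ?thesis by (rule weighted_mult_bounded[OF B1invB2_weighted fourier_psi_measurable[OF Z] K])
qed

text \<open>The common form of both operators: e = 1 yields \<open>T0\<close>, and e equal to the
  transform of the Gaussian yields \<open>T0_eps\<close>.\<close>

lemma symbol_pairing:
  assumes Z: "Z \<in> bounded_class M" and t: "test_fun \<Omega> \<phi>"
    and e: "e \<in> borel_measurable borel" "\<And>\<xi>. cmod (e \<xi>) \<le> 1"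
  shows "(LINT \<xi>|lborel. e \<xi> * ((B1inv v C \<xi> *v beta1 \<Omega> A1 F (A5 Z) \<xi>) $ r * inv_fourier \<phi> \<xi>))
      + (\<Sum>l\<in>UNIV. LINT \<xi>|lborel. e \<xi> * (B1invB2 v C \<xi> $ r $ l * fourier (psi_cut \<Omega> f C Z l) \<xi> * inv_fourier \<phi> \<xi>))
    = (LINT \<xi>|lborel. e \<xi> * ((boundary_symbol r \<xi> + solution_symbol Z r \<xi>) * inv_fourier \<phi> \<xi>))"
proof -
  have 1: "integrable lborel (\<lambda>\<xi>. e \<xi> * ((B1inv v C \<xi> *v beta1 \<Omega> A1 F (A5 Z) \<xi>) $ r * inv_fourier \<phi> \<xi>))"
    by (intro integrable_mult_contraction pairing_integrable[OF t B1inv_beta1_weighted[OF Z]] e)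
  have 2: "integrable lborel (\<lambda>\<xi>. e \<xi> * (B1invB2 v C \<xi> $ r $ l * fourier (psi_cut \<Omega> f C Z l) \<xi> * inv_fourier \<phi> \<xi>))" for l
    by (intro integrable_mult_contraction pairing_integrable[OF t B1invB2_psi_weighted[OF Z]] e)
  have "e \<xi> * ((boundary_symbol r \<xi> + solution_symbol Z r \<xi>) * inv_fourier \<phi> \<xi>)
      = e \<xi> * ((B1inv v C \<xi> *v beta1 \<Omega> A1 F (A5 Z) \<xi>) $ r * inv_fourier \<phi> \<xi>)
      + (\<Sum>l\<in>UNIV. e \<xi> * (B1invB2 v C \<xi> $ r $ l * fourier (psi_cut \<Omega> f C Z l) \<xi> * inv_fourier \<phi> \<xi>))" for \<xi>
    unfolding B1inv_beta1 solution_symbol_def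
    by (simp add: distrib_left distrib_right sum_distrib_left sum_distrib_right)
  then have "(LINT \<xi>|lborel. e \<xi> * ((boundary_symbol r \<xi> + solution_symbol Z r \<xi>) * inv_fourier \<phi> \<xi>))
      = (LINT \<xi>|lborel. e \<xi> * ((B1inv v C \<xi> *v beta1 \<Omega> A1 F (A5 Z) \<xi>) $ r * inv_fourier \<phi> \<xi>)
        + (\<Sum>l\<in>UNIV. e \<xi> * (B1invB2 v C \<xi> $ r $ l * fourier (psi_cut \<Omega> f C Z l) \<xi> * inv_fourier \<phi> \<xi>)))"
    by (simp only:)
  also have "\<dots> = (LINT \<xi>|lborel. e \<xi> * ((B1inv v C \<xi> *v beta1 \<Omega> A1 F (A5 Z) \<xi>) $ r * inv_fourier \<phi> \<xi>))
        + (LINT \<xi>|lborel. (\<Sum>l\<in>UNIV. e \<xi> * (B1invB2 v C \<xi> $ r $ l * fourier (psi_cut \<Omega> f C Z l) \<xi> * inv_fourier \<phi> \<xi>)))"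
    by (intro Bochner_Integration.integral_add 1 Bochner_Integration.integrable_sum 2)
  also have "(LINT \<xi>|lborel. (\<Sum>l\<in>UNIV. e \<xi> * (B1invB2 v C \<xi> $ r $ l * fourier (psi_cut \<Omega> f C Z l) \<xi> * inv_fourier \<phi> \<xi>)))
      = (\<Sum>l\<in>UNIV. LINT \<xi>|lborel. e \<xi> * (B1invB2 v C \<xi> $ r $ l * fourier (psi_cut \<Omega> f C Z l) \<xi> * inv_fourier \<phi> \<xi>))"
    by (intro Bochner_Integration.integral_sum 2)
  finally show ?thesis ..
qed

lemma T0_eq:
  assumes Z: "Z \<in> bounded_class M" and t: "test_fun \<Omega> \<phi>"
  shows "T0 \<Omega> v C f A1 F A5 Z \<phi> $ r = (LINT \<xi>|lborel. (boundary_symbol r \<xi> + solution_symbol Z r \<xi>) * inv_fourier \<phi> \<xi>)"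
proof -
  have t': "test_fun UNIV \<phi>" using t by (rule test_fun_mono) simp
  have "T0 \<Omega> v C f A1 F A5 Z \<phi> $ r =
      (LINT \<xi>|lborel. 1 * ((B1inv v C \<xi> *v beta1 \<Omega> A1 F (A5 Z) \<xi>) $ r * inv_fourier \<phi> \<xi>))
      + (\<Sum>l\<in>UNIV. LINT \<xi>|lborel. 1 * (B1invB2 v C \<xi> $ r $ l * fourier (psi_cut \<Omega> f C Z l) \<xi> * inv_fourier \<phi> \<xi>))"
    unfolding T0_def vec_lambda_beta inv_fourier_dist_def conv_dist_def fun_dist_def
      inv_fourier_correlation[OF psi_cut_integrable[OF Z] t'] by (simp only: mult_1_left mult.assoc)
  also have "\<dots> = (LINT \<xi>|lborel. 1 * ((boundary_symbol r \<xi> + solution_symbol Z r \<xi>) * inv_fourier \<phi> \<xi>))"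
    by (rule symbol_pairing[OF Z t]) simp_all
  finally show ?thesis by (simp only: mult_1_left)
qed

text \<open>The fixed point equation holds pointwise on the closure. The convolutions become
  products of transforms, and pairing with \<phi> moves the equation to the Fourier side.\<close>

lemma fixed_point_pairing:
  assumes \<epsilon>: "\<epsilon> > 0" and fp: "fixed_T0_eps \<Omega> v C f A1 F A5 \<epsilon> Z"
    and Z: "Z \<in> bounded_class M" and t: "test_fun \<Omega> \<phi>"
  shows "vfun_dist \<Omega> Z \<phi> $ r = (LINT \<xi>|lborel. of_real (exp (- \<epsilon> * (norm \<xi>)\<^sup>2 / 4)) *
      ((boundary_symbol r \<xi> + solution_symbol Z r \<xi>) * inv_fourier \<phi> \<xi>))"
proof -
  let ?e = "\<lambda>\<xi>. fourier (gauss \<epsilon>) \<xi>"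
  define G where "G \<xi> = ?e \<xi> * (B1inv v C \<xi> *v beta1 \<Omega> A1 F (A5 Z) \<xi>) $ r" for \<xi>
  define H where "H l \<xi> = ?e \<xi> * B1invB2 v C \<xi> $ r $ l" for l \<xi>
  define H' where "H' l \<xi> = H l \<xi> * fourier (psi_cut \<Omega> f C Z l) \<xi>" for l \<xi>
  have G: "integrable lborel G"
    unfolding G_def by (rule gauss_multiplier_integrable[OF \<epsilon> B1inv_beta1_weighted[OF Z]])
  have H: "integrable lborel (H l)" for l
    unfolding H_def by (rule gauss_multiplier_integrable[OF \<epsilon> B1invB2_weighted])
  have H': "integrable lborel (H' l)" for l
    unfolding H'_def H_def mult.assoc by (rule gauss_multiplier_integrable[OF \<epsilon> B1invB2_psi_weighted[OF Z]])
  have \<phi>: "integrable lborel \<phi>" by (rule test_fun_integrable[OF t])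
  have pw: "indicator \<Omega> X *\<^sub>R (of_real (Z X $ r) * \<phi> X) = inv_fourier G X * \<phi> X + (\<Sum>l\<in>UNIV. inv_fourier (H' l) X * \<phi> X)" for X
  proof (cases "X \<in> \<Omega>")
    case True
    then have X: "X \<in> closure \<Omega>" using closure_subset by blast
    have "of_real (Z X $ r) = T0_eps \<Omega> v C f A1 F A5 \<epsilon> Z X $ r"
      using fp X unfolding fixed_T0_eps_def by blast
    also have "\<dots> = inv_fourier G X + (\<Sum>l\<in>UNIV. LINT Y|lborel. inv_fourier (H l) (X - Y) * psi_cut \<Omega> f C Z l Y)"
      unfolding T0_eps_def vec_lambda_beta G_def[abs_def] H_def[abs_def] ..
    also have "\<dots> = inv_fourier G X + (\<Sum>l\<in>UNIV. inv_fourier (H' l) X)"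
      unfolding conv_inv_fourier[OF H psi_cut_integrable[OF Z]] H'_def[abs_def] ..
    finally show ?thesis using True by (simp add: distrib_right sum_distrib_right)
  next
    case False
    then show ?thesis using test_fun_eq_0[OF t False] by simp
  qed
  have "vfun_dist \<Omega> Z \<phi> $ r = (LINT X|lborel. inv_fourier G X * \<phi> X + (\<Sum>l\<in>UNIV. inv_fourier (H' l) X * \<phi> X))"
    unfolding vfun_dist_def vec_lambda_beta set_lebesgue_integral_def pw ..
  also have "\<dots> = (LINT X|lborel. inv_fourier G X * \<phi> X) + (LINT X|lborel. (\<Sum>l\<in>UNIV. inv_fourier (H' l) X * \<phi> X))"
    by (intro Bochner_Integration.integral_add Bochner_Integration.integrable_sum inv_fourier_mult_integrable[OF _ t] G H')
  also have "(LINT X|lborel. (\<Sum>l\<in>UNIV. inv_fourier (H' l) X * \<phi> X)) = (\<Sum>l\<in>UNIV. LINT X|lborel. inv_fourier (H' l) X * \<phi> X)"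
    by (intro Bochner_Integration.integral_sum inv_fourier_mult_integrable[OF _ t] H')
  also have "(LINT X|lborel. inv_fourier G X * \<phi> X) + (\<Sum>l\<in>UNIV. LINT X|lborel. inv_fourier (H' l) X * \<phi> X)
     = (LINT \<xi>|lborel. ?e \<xi> * ((B1inv v C \<xi> *v beta1 \<Omega> A1 F (A5 Z) \<xi>) $ r * inv_fourier \<phi> \<xi>))
      + (\<Sum>l\<in>UNIV. LINT \<xi>|lborel. ?e \<xi> * (B1invB2 v C \<xi> $ r $ l * fourier (psi_cut \<Omega> f C Z l) \<xi> * inv_fourier \<phi> \<xi>))"
    unfolding inv_fourier_pairing[OF G \<phi>] inv_fourier_pairing[OF H' \<phi>] by (simp only: G_def H'_def H_def mult.assoc)
  also have "\<dots> = (LINT \<xi>|lborel. ?e \<xi> * ((boundary_symbol r \<xi> + solution_symbol Z r \<xi>) * inv_fourier \<phi> \<xi>))"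
  proof (rule symbol_pairing[OF Z t])
    show "?e \<in> borel_measurable borel"
      using borel_measurable_integrable[OF integrable_gauss[OF \<epsilon>]] by (intro fourier_measurable) simp
    show "cmod (?e \<xi>) \<le> 1" for \<xi>
      unfolding fourier_gauss[OF \<epsilon>] norm_of_real abs_exp_cancel using \<epsilon> by simp
  qed
  finally show ?thesis unfolding fourier_gauss[OF \<epsilon>] .
qed

text \<open>The pairing runs over \<Omega> and the cut-off is at its closure; both agree because
  \<phi> vanishes outside \<Omega>.\<close>

lemma vfun_pairing:
  assumes Z: "Z \<in> bounded_class M" and t: "test_fun \<Omega> \<phi>"
  shows "vfun_dist \<Omega> Z \<phi> $ r = (LINT \<xi>|lborel. fourier (cut (\<lambda>X. Z X $ r)) \<xi> * inv_fourier \<phi> \<xi>)"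
proof -
  have t': "test_fun UNIV \<phi>" using t by (rule test_fun_mono) simp
  have pw: "indicator \<Omega> X *\<^sub>R (of_real (Z X $ r) * \<phi> X) = cut (\<lambda>X. Z X $ r) X * \<phi> X" for X
    using closure_subset[of \<Omega>] test_fun_eq_0[OF t, of X] by (cases "X \<in> \<Omega>") (auto simp: cut_def)
  have i: "integrable lborel (cut (\<lambda>X. Z X $ r))"
  proof (rule cut_integrable(1))
    show "(\<lambda>X. Z X $ r) \<in> borel_measurable (restrict_space lborel (closure \<Omega>))"
      by (rule component_measurable[OF bounded_class_measurable[OF Z]])
    show "\<bar>Z X $ r\<bar> \<le> \<bar>M\<bar>" if "X \<in> closure \<Omega>" for X using bounded_class_bound[OF Z that, of r] by linarith
  qed simp
  show ?thesis
    unfolding vfun_dist_def vec_lambda_beta set_lebesgue_integral_def pw by (rule test_fun_pairing_fourier[OF i t'])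
qed

lemma Omega_ball_subset: "Omega_ball \<Omega> M \<subseteq> bounded_class M"
proof
  fix Z :: "'m Zfun" assume "Z \<in> Omega_ball \<Omega> M"
  then have c: "continuous_on (closure \<Omega>) Z" and n: "max_norm \<Omega> Z < M" unfolding Omega_ball_def by auto
  have "\<bar>Z X $ i\<bar> \<le> M" if X: "X \<in> closure \<Omega>" for X i
  proof -
    have "compact ((\<lambda>X. \<bar>Z X $ i\<bar>) ` closure \<Omega>)"
      using dom(3) by (intro compact_continuous_image continuous_intros c) (simp add: compact_closure)
    then have "\<bar>Z X $ i\<bar> \<le> (SUP X\<in>closure \<Omega>. \<bar>Z X $ i\<bar>)"
      by (intro cSUP_upper X bounded_imp_bdd_above compact_imp_bounded)
    also have "\<dots> \<le> max_norm \<Omega> Z" unfolding max_norm_def by (intro Max_ge) auto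
    finally show ?thesis using n by simp
  qed
  moreover have "Z \<in> borel_measurable (restrict_space lborel (closure \<Omega>))"
  proof -
    have "Z \<in> borel_measurable (restrict_space borel (closure \<Omega>))" by (rule borel_measurable_continuous_on_restrict[OF c])
    moreover have "sets (restrict_space borel (closure \<Omega>)) = sets (restrict_space lborel (closure \<Omega>))"
      by (rule sets_restrict_space_cong) simp
    ultimately show ?thesis using measurable_cong_sets[OF _ refl] by blast
  qed
  ultimately show "Z \<in> bounded_class M" unfolding bounded_class_def by blast
qed

end

section \<open>Convergence of the fixed points\<close>

text \<open>D is a multiple of the defect, and E bounds the limit functional, which places it in the
  negative Sobolev space. The existential form allows each component its own rates.\<close>

lemma (in mollified_limit) convergence_rate:
  "\<exists>D E. D \<longlonglongrightarrow> 0 \<and> (\<forall>n. 0 \<le> D n) \<and> 0 \<le> E \<and> (\<forall>\<phi>. test_fun \<Omega> \<phi> \<longrightarrow>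
     (\<forall>n. cmod ((LINT \<xi>|lborel. \<zeta>s n \<xi> * inv_fourier \<phi> \<xi>) - (LINT \<xi>|lborel. \<zeta> \<xi> * inv_fourier \<phi> \<xi>)) \<le> D n * sobolev_norm (2 * N) \<Omega> \<phi>
       \<and> cmod ((LINT \<xi>|lborel. \<zeta>s n \<xi> * inv_fourier \<phi> \<xi>) - (LINT \<xi>|lborel. (p \<xi> + qs n \<xi>) * inv_fourier \<phi> \<xi>)) \<le> D n * sobolev_norm (2 * N) \<Omega> \<phi>)
     \<and> cmod (LINT \<xi>|lborel. \<zeta> \<xi> * inv_fourier \<phi> \<xi>) \<le> E * sobolev_norm (2 * N) \<Omega> \<phi>)"
proof -
  obtain K where K: "K \<ge> 0" "\<And>\<phi> \<xi>. test_fun \<Omega> \<phi> \<Longrightarrow> (1 + (norm \<xi>)\<^sup>2) ^ N * cmod (inv_fourier \<phi> \<xi>) \<le> K * sobolev_norm (2 * N) \<Omega> \<phi>"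
    using inv_fourier_decay[OF \<Omega>] by blast
  define J where "J = (LINT \<xi>|lborel. cmod (\<zeta> \<xi> / of_real ((1 + (norm \<xi>)\<^sup>2) ^ N)))"
  have J: "J \<ge> 0" unfolding J_def by (intro integral_nonneg_AE AE_I2) simp
  have "cmod (LINT \<xi>|lborel. \<zeta> \<xi> * inv_fourier \<phi> \<xi>) \<le> K * J * sobolev_norm (2 * N) \<Omega> \<phi>" if t: "test_fun \<Omega> \<phi>" for \<phi>
  proof -
    have "cmod (LINT \<xi>|lborel. \<zeta> \<xi> * inv_fourier \<phi> \<xi>) \<le> (K * sobolev_norm (2 * N) \<Omega> \<phi>) * J"
      unfolding J_def
      by (rule order_trans[OF integral_norm_bound integrable_mult_decay(2)[OF weighted_Kz[OF \<zeta>_measurable \<zeta>_bound]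
            inv_fourier_measurable[OF test_fun_measurable[OF t]] K(2)[OF t]]])
    then show ?thesis by (simp add: mult_ac)
  qed
  moreover have "(\<lambda>n. K * defect n) \<longlonglongrightarrow> 0" using tendsto_mult_left[OF defect_tendsto, of K] by simp
  moreover note convergence_estimates[OF K]
  ultimately show ?thesis
    using K(1) J by (intro exI[of _ "\<lambda>n. K * defect n"] exI[of _ "K * J"]) (simp add: defect_nonneg)
qed

lemma inv_fourier_add:
  assumes "integrable lborel \<phi>" "integrable lborel \<eta>"
  shows "inv_fourier (\<lambda>X. \<phi> X + \<eta> X) \<xi> = inv_fourier \<phi> \<xi> + inv_fourier \<eta> \<xi>"
proof -
  have "integrable lborel (\<lambda>X. exp (\<i> * of_real (X \<bullet> \<xi>)) * g X)" if "integrable lborel g" for g :: "R3 \<Rightarrow> complex"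
    by (rule integrable_mult_contraction[OF that]) simp_all
  then have "integrable lborel (\<lambda>X. \<phi> X * exp (\<i> * of_real (X \<bullet> \<xi>)))" "integrable lborel (\<lambda>X. \<eta> X * exp (\<i> * of_real (X \<bullet> \<xi>)))"
    using assms by (simp_all only: mult.commute)
  then show ?thesis unfolding inv_fourier_def distrib_right
    by (subst Bochner_Integration.integral_add) (simp_all only: distrib_left)
qed

lemma inv_fourier_cmult: "inv_fourier (\<lambda>X. c * \<phi> X) \<xi> = c * inv_fourier \<phi> \<xi>"
  unfolding inv_fourier_def mult.assoc integral_mult_right_zero by (rule mult.left_commute)

lemma neg_norm_tendsto_zero:
  assumes "c \<longlonglongrightarrow> 0" "\<And>n. 0 \<le> c n"
    and "\<And>n \<phi> i. test_fun \<Omega> \<phi> \<Longrightarrow> cmod (T n \<phi> $ i) \<le> c n * sobolev_norm m \<Omega> \<phi>"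
  shows "(\<lambda>n. neg_norm m \<Omega> (T n)) \<longlonglongrightarrow> 0"
proof (rule tendsto_sandwich[where f="\<lambda>_. 0"])
  show "(\<lambda>n. ennreal (c n)) \<longlonglongrightarrow> 0" using tendsto_ennrealI[OF assms(1)] by simp
  show "\<forall>\<^sub>F n in sequentially. neg_norm m \<Omega> (T n) \<le> ennreal (c n)"
    by (intro always_eventually allI neg_norm_le assms)
qed (auto intro: always_eventually)

context elliptic_problem
begin

text \<open>All constants depend on Z only through M and B, so one majorant serves the entire
  sequence.\<close>

lemma solution_symbol_dominated:
  "\<exists>W. (\<forall>r. integrable lborel (\<lambda>\<xi>. W r \<xi> / (1 + (norm \<xi>)\<^sup>2) ^ (a + 3))) \<and>
     (\<forall>Z\<in>bounded_class M. (\<forall>P\<in>frontier \<Omega>. norm (A5 Z P) \<le> B) \<longrightarrow> (\<forall>r \<xi>. cmod (solution_symbol Z r \<xi>) \<le> W r \<xi>))"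
proof -
  obtain Kb where Kb: "\<And>A \<xi> r. (\<forall>P\<in>frontier \<Omega>. norm (A P) \<le> B) \<Longrightarrow> cmod (b1 A \<xi> r) \<le> Kb" using b1_bound[of B] by blast
  obtain Kp where Kp: "\<And>Z \<xi> l. Z \<in> bounded_class M \<Longrightarrow> cmod (fourier (psi_cut \<Omega> f C Z l) \<xi>) \<le> Kp"
    using fourier_psi_bounded by blast
  define W where "W r \<xi> = (\<Sum>k\<in>UNIV. Kb * cmod (B1inv v C \<xi> $ r $ k)) + (\<Sum>l\<in>UNIV. Kp * cmod (B1invB2 v C \<xi> $ r $ l))" for r \<xi>
  have n: "integrable lborel (\<lambda>\<xi>. K * cmod (g \<xi>) / (1 + (norm \<xi>)\<^sup>2) ^ (a + 3))"
    if "integrable lborel (\<lambda>\<xi>. g \<xi> / of_real ((1 + (norm \<xi>)\<^sup>2) ^ (a + 3)))" for g :: "R3 \<Rightarrow> complex" and K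
    using integrable_mult_right[OF integrable_norm[OF that], of K]
    unfolding norm_divide norm_of_real abs_of_pos[OF weight_pos] by simp
  have "integrable lborel (\<lambda>\<xi>. W r \<xi> / (1 + (norm \<xi>)\<^sup>2) ^ (a + 3))" for r
    unfolding W_def add_divide_distrib sum_divide_distrib
    by (intro Bochner_Integration.integrable_add Bochner_Integration.integrable_sum n B1inv_weighted B1invB2_weighted)
  moreover have "cmod (solution_symbol Z r \<xi>) \<le> W r \<xi>"
    if Z: "Z \<in> bounded_class M" "\<forall>P\<in>frontier \<Omega>. norm (A5 Z P) \<le> B" for Z r \<xi>
    unfolding solution_symbol_def W_def
    by (intro norm_triangle_mono sum_norm_le)
       (simp_all add: norm_mult mult.commute[of "cmod (_ $ _ $ _)"] mult_right_mono Kb[OF Z(2)] Kp[OF Z(1)])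
  ultimately show ?thesis by (intro exI[of _ W]) blast
qed

text \<open>The limits g are left arbitrary: under weak convergence of Z_n they need not be
  transforms of \<psi> of the limit.\<close>

lemma solution_symbol_tendsto:
  assumes Z: "\<And>n. Z n \<in> bounded_class M" and B: "\<And>n P. P \<in> frontier \<Omega> \<Longrightarrow> norm (A5 (Z n) P) \<le> B"
    and c: "continuous_on (frontier \<Omega>) c" "\<And>P. P \<in> frontier \<Omega> \<Longrightarrow> (\<lambda>n. A5 (Z n) P) \<longlonglongrightarrow> c P"
    and g: "\<And>l. (\<lambda>n. fourier (psi_cut \<Omega> f C (Z n) l) \<xi>) \<longlonglongrightarrow> g l"
  shows "(\<lambda>n. solution_symbol (Z n) r \<xi>) \<longlonglongrightarrow>
    (\<Sum>k\<in>UNIV. B1inv v C \<xi> $ r $ k * b1 c \<xi> k) + (\<Sum>l\<in>UNIV. B1invB2 v C \<xi> $ r $ l * g l)"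
  unfolding solution_symbol_def
  by (intro tendsto_intros g b1_tendsto[where B=B] A5_continuous[OF Z] B c)

lemma component_cut:
  assumes Z: "Z \<in> bounded_class M"
  shows "cut (\<lambda>X. Z X $ r) \<in> borel_measurable borel" "cmod (cut (\<lambda>X. Z X $ r) X) \<le> \<bar>M\<bar>"
    "cmod (fourier (cut (\<lambda>X. Z X $ r)) \<xi>) \<le> \<bar>M\<bar> * measure lborel (closure \<Omega>)"
proof -
  have m: "(\<lambda>X. Z X $ r) \<in> borel_measurable (restrict_space lborel (closure \<Omega>))"
    by (rule component_measurable[OF bounded_class_measurable[OF Z]])
  have b: "\<bar>Z X $ r\<bar> \<le> \<bar>M\<bar>" if "X \<in> closure \<Omega>" for X using bounded_class_bound[OF Z that, of r] by linarith
  show "cut (\<lambda>X. Z X $ r) \<in> borel_measurable borel" by (rule measurable_cut[OF m])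
  show "cmod (cut (\<lambda>X. Z X $ r) X) \<le> \<bar>M\<bar>" by (rule cut_bound[OF b]) simp_all
  show "cmod (fourier (cut (\<lambda>X. Z X $ r)) \<xi>) \<le> \<bar>M\<bar> * measure lborel (closure \<Omega>)"
    by (rule order_trans[OF cmod_fourier_le cut_integrable(2)[OF m b]]) simp_all
qed

lemma fixed_points_mollified_limit:
  assumes \<epsilon>: "\<And>n. \<epsilon> n > 0" "\<epsilon> \<longlonglongrightarrow> 0"
    and Z: "\<And>n. Z n \<in> bounded_class M" "\<And>n. fixed_T0_eps \<Omega> v C f A1 F A5 (\<epsilon> n) (Z n)"
    and B: "\<And>n P. P \<in> frontier \<Omega> \<Longrightarrow> norm (A5 (Z n) P) \<le> B"
    and q: "\<And>r \<xi>. (\<lambda>n. solution_symbol (Z n) r \<xi>) \<longlonglongrightarrow> q r \<xi>"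
    and \<zeta>: "\<And>r \<xi>. (\<lambda>n. fourier (cut (\<lambda>X. Z n X $ r)) \<xi>) \<longlonglongrightarrow> \<zeta> r \<xi>"
  shows "\<exists>W. \<forall>r. mollified_limit \<Omega> (a + 3) (boundary_symbol r) (q r) (\<zeta> r) (\<lambda>n. solution_symbol (Z n) r)
    (\<lambda>n. fourier (cut (\<lambda>X. Z n X $ r))) (W r) (\<bar>M\<bar> * measure lborel (closure \<Omega>)) \<epsilon>"
proof -
  obtain W where W: "\<And>r. integrable lborel (\<lambda>\<xi>. W r \<xi> / (1 + (norm \<xi>)\<^sup>2) ^ (a + 3))"
    "\<And>Z r \<xi>. Z \<in> bounded_class M \<Longrightarrow> (\<forall>P\<in>frontier \<Omega>. norm (A5 Z P) \<le> B) \<Longrightarrow> cmod (solution_symbol Z r \<xi>) \<le> W r \<xi>"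
    using solution_symbol_dominated[of M B] by blast
  have "mollified_limit \<Omega> (a + 3) (boundary_symbol r) (q r) (\<zeta> r) (\<lambda>n. solution_symbol (Z n) r)
    (\<lambda>n. fourier (cut (\<lambda>X. Z n X $ r))) (W r) (\<bar>M\<bar> * measure lborel (closure \<Omega>)) \<epsilon>" for r
  proof unfold_locales
    show "open \<Omega>" "bounded \<Omega>" by (rule dom)+
    show "3 \<le> a + 3" by simp
    show "integrable lborel (\<lambda>\<xi>. boundary_symbol r \<xi> / of_real ((1 + (norm \<xi>)\<^sup>2) ^ Suc (a + 3)))"
      by (rule boundary_symbol_weighted)
    show "cmod (solution_symbol (Z n) r \<xi>) \<le> W r \<xi>" for n \<xi> using W(2)[OF Z(1)] B by blast
    show "cmod (fourier (cut (\<lambda>X. Z n X $ r)) \<xi>) \<le> \<bar>M\<bar> * measure lborel (closure \<Omega>)" for n \<xi>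
      by (rule component_cut(3)[OF Z(1)])
    show "(LINT \<xi>|lborel. fourier (cut (\<lambda>X. Z n X $ r)) \<xi> * inv_fourier \<phi> \<xi>) =
        (LINT \<xi>|lborel. of_real (exp (- \<epsilon> n * (norm \<xi>)\<^sup>2 / 4)) * ((boundary_symbol r \<xi> + solution_symbol (Z n) r \<xi>) * inv_fourier \<phi> \<xi>))"
      if "test_fun \<Omega> \<phi>" for n \<phi>
      unfolding vfun_pairing[OF Z(1) that, symmetric] by (rule fixed_point_pairing[OF \<epsilon>(1) Z(2,1) that])
  qed (intro W(1) solution_symbol_measurable[OF Z(1)] q fourier_measurable component_cut(1)[OF Z(1)] \<zeta> \<epsilon>)+
  then show ?thesis by blast
qed

lemma vfun_dist_bound:
  assumes Z: "Z \<in> bounded_class M" and M: "M \<ge> 0" and t: "test_fun \<Omega> \<phi>"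
  shows "cmod (vfun_dist \<Omega> Z \<phi> $ i) \<le> M * (LINT X:\<Omega>|lborel. cmod (\<phi> X))"
proof -
  have \<phi>: "integrable lborel (\<lambda>X. M * (indicator \<Omega> X *\<^sub>R cmod (\<phi> X)))"
    using integrable_mult_indicator[OF _ integrable_norm[OF test_fun_integrable[OF t]], of \<Omega>] dom(1)
    by (intro integrable_mult_right) simp
  have "cmod (vfun_dist \<Omega> Z \<phi> $ i) \<le> (LINT X|lborel. cmod (indicator \<Omega> X *\<^sub>R (of_real (Z X $ i) * \<phi> X)))"
    unfolding vfun_dist_def vec_lambda_beta set_lebesgue_integral_def by (rule integral_norm_bound)
  also have "\<dots> \<le> (LINT X|lborel. M * (indicator \<Omega> X *\<^sub>R cmod (\<phi> X)))"
  proof (rule integral_mono'[OF \<phi>])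
    show "cmod (indicator \<Omega> X *\<^sub>R (of_real (Z X $ i) * \<phi> X)) \<le> M * (indicator \<Omega> X *\<^sub>R cmod (\<phi> X))" for X
    proof (cases "X \<in> \<Omega>")
      case True
      then have "X \<in> closure \<Omega>" using closure_subset by blast
      then have "\<bar>Z X $ i\<bar> * cmod (\<phi> X) \<le> M * cmod (\<phi> X)" by (intro mult_right_mono bounded_class_bound[OF Z]) auto
      then show ?thesis using True by (simp add: norm_mult)
    qed simp
    show "0 \<le> M * (indicator \<Omega> X *\<^sub>R cmod (\<phi> X))" for X using M by simp
  qed
  also have "\<dots> = M * (LINT X:\<Omega>|lborel. cmod (\<phi> X))"
    unfolding set_lebesgue_integral_def by (rule integral_mult_right_zero)
  finally show ?thesis .
qed

end

section \<open>The strong solution and the bounded solution\<close>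

context elliptic_problem
begin

text \<open>Three successive subsequences, for A_5(Z_n), for the transforms of Z_n and for those of
  \<psi>(Z_n). The limit distribution is defined on the Fourier side, and the bound by M passes to
  it through the pairings with test functions.\<close>

lemma strong_solution:
  assumes \<epsilon>: "\<And>k. \<epsilon> k > 0" "\<epsilon> \<longlonglongrightarrow> 0" and M: "M > 0"
    and Z: "\<And>k. Z k \<in> Omega_ball \<Omega> M" "\<And>k. fixed_T0_eps \<Omega> v C f A1 F A5 (\<epsilon> k) (Z k)"
  shows "\<exists>(n :: nat \<Rightarrow> nat) Zs. strict_mono n \<and> in_neg_sobolev (2 * (a + 3)) \<Omega> Zs \<and>
    (\<lambda>k. neg_norm (2 * (a + 3)) \<Omega> (\<lambda>\<phi>. vfun_dist \<Omega> (Z (n k)) \<phi> - Zs \<phi>)) \<longlonglongrightarrow> 0 \<and>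
    (\<lambda>k. neg_norm (2 * (a + 3)) \<Omega> (\<lambda>\<phi>. vfun_dist \<Omega> (Z (n k)) \<phi> - T0 \<Omega> v C f A1 F A5 (Z (n k)) \<phi>)) \<longlonglongrightarrow> 0 \<and>
    (\<forall>g. loc_integrable \<Omega> g \<and> (\<forall>\<phi>. test_fun \<Omega> \<phi> \<longrightarrow> Zs \<phi> = vfun_dist \<Omega> g \<phi>) \<longrightarrow> Linf_norm \<Omega> g \<le> ereal M)"
proof -
  have Zb: "Z k \<in> bounded_class M" for k using Z(1) Omega_ball_subset by blast
  obtain B c r1 where B: "\<And>n P. P \<in> frontier \<Omega> \<Longrightarrow> norm (A5 (Z n) P) \<le> B" and c: "continuous_on (frontier \<Omega>) c"
    and r1: "strict_mono (r1 :: nat \<Rightarrow> nat)"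
    and u: "\<forall>e>0. \<exists>N. \<forall>n P. n \<ge> N \<and> P \<in> frontier \<Omega> \<longrightarrow> norm (A5 (Z (r1 n)) P - c P) < e"
    using A5_subsequence[of Z M] Zb by blast
  obtain R where R: "\<And>h X. cut h X \<noteq> 0 \<Longrightarrow> norm X \<le> R" using cut_support by blast
  obtain r2 where r2: "strict_mono (r2 :: nat \<Rightarrow> nat)"
    "\<And>i \<xi>. convergent (\<lambda>n. fourier (cut (\<lambda>X. Z (r1 (r2 n)) X $ i)) \<xi>)"
    using fourier_subsequence[of "\<lambda>n i. cut (\<lambda>X. Z (r1 n) X $ i)" "\<bar>M\<bar>" R] component_cut(1,2)[OF Zb] R by blast
  obtain K where K: "K \<ge> 0" "\<And>Z X l. Z \<in> bounded_class M \<Longrightarrow> X \<in> closure \<Omega> \<Longrightarrow> \<bar>psi f C Z X $ l\<bar> \<le> K"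
    using psi_bounded by blast
  have psi_m: "cut (\<lambda>X. psi f C (Z k) X $ l) \<in> borel_measurable borel" for k l by (intro measurable_cut psi_measurable[OF Zb])
  have psi_b: "cmod (cut (\<lambda>X. psi f C (Z k) X $ l) X) \<le> K" for k l X by (rule cut_bound[OF K(2)[OF Zb] K(1)])
  obtain r3 where r3: "strict_mono (r3 :: nat \<Rightarrow> nat)"
    "\<And>l \<xi>. convergent (\<lambda>n. fourier (cut (\<lambda>X. psi f C (Z (r1 (r2 (r3 n)))) X $ l)) \<xi>)"
    using fourier_subsequence[of "\<lambda>n l. cut (\<lambda>X. psi f C (Z (r1 (r2 n))) X $ l)" K R] psi_m psi_b R by blast
  define n where "n k = r1 (r2 (r3 k))" for k
  have n: "strict_mono n" using r1 r2(1) r3(1) unfolding n_def[abs_def] strict_mono_def by blast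
  define \<zeta> where "\<zeta> r \<xi> = lim (\<lambda>k. fourier (cut (\<lambda>X. Z (n k) X $ r)) \<xi>)" for r \<xi>
  define g where "g l \<xi> = lim (\<lambda>k. fourier (psi_cut \<Omega> f C (Z (n k)) l) \<xi>)" for l \<xi>
  define q where "q r \<xi> = (\<Sum>k\<in>UNIV. B1inv v C \<xi> $ r $ k * b1 c \<xi> k) + (\<Sum>l\<in>UNIV. B1invB2 v C \<xi> $ r $ l * g l \<xi>)" for r \<xi>
  have \<zeta>l: "(\<lambda>k. fourier (cut (\<lambda>X. Z (n k) X $ r)) \<xi>) \<longlonglongrightarrow> \<zeta> r \<xi>" for r \<xi>
    unfolding \<zeta>_def convergent_LIMSEQ_iff[symmetric] n_def
    using convergent_subseq_convergent[OF r2(2) r3(1)] by (simp add: o_def)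
  have gl: "(\<lambda>k. fourier (psi_cut \<Omega> f C (Z (n k)) l) \<xi>) \<longlonglongrightarrow> g l \<xi>" for l \<xi>
    unfolding g_def convergent_LIMSEQ_iff[symmetric] n_def psi_cut_eq by (rule r3(2))
  have cl: "(\<lambda>k. A5 (Z (n k)) P) \<longlonglongrightarrow> c P" if "P \<in> frontier \<Omega>" for P
  proof -
    have "(\<lambda>k. A5 (Z (r1 k)) P) \<longlonglongrightarrow> c P" unfolding LIMSEQ_iff using u that by blast
    moreover have "strict_mono (\<lambda>k. r2 (r3 k))" using r2(1) r3(1) unfolding strict_mono_def by blast
    ultimately show ?thesis unfolding n_def using LIMSEQ_subseq_LIMSEQ[of "\<lambda>k. A5 (Z (r1 k)) P" "c P" "\<lambda>k. r2 (r3 k)"] by (simp add: o_def)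
  qed
  have ql: "(\<lambda>k. solution_symbol (Z (n k)) r \<xi>) \<longlonglongrightarrow> q r \<xi>" for r \<xi>
    unfolding q_def by (rule solution_symbol_tendsto[OF Zb B c cl gl])
  have \<epsilon>n: "(\<lambda>k. \<epsilon> (n k)) \<longlonglongrightarrow> 0" using LIMSEQ_subseq_LIMSEQ[OF \<epsilon>(2) n] by (simp add: o_def)
  obtain W where L: "\<And>r. mollified_limit \<Omega> (a + 3) (boundary_symbol r) (q r) (\<zeta> r) (\<lambda>k. solution_symbol (Z (n k)) r)
      (\<lambda>k. fourier (cut (\<lambda>X. Z (n k) X $ r))) (W r) (\<bar>M\<bar> * measure lborel (closure \<Omega>)) (\<lambda>k. \<epsilon> (n k))"
    using fixed_points_mollified_limit[OF \<epsilon>(1) \<epsilon>n Zb Z(2) B ql \<zeta>l] by blast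
  let ?m = "2 * (a + 3)"
  let ?Q = "\<lambda>r D E. D \<longlonglongrightarrow> 0 \<and> (\<forall>k. 0 \<le> D k) \<and> 0 \<le> E \<and> (\<forall>\<phi>. test_fun \<Omega> \<phi> \<longrightarrow>
     (\<forall>k. cmod (vfun_dist \<Omega> (Z (n k)) \<phi> $ r - (LINT \<xi>|lborel. \<zeta> r \<xi> * inv_fourier \<phi> \<xi>)) \<le> D k * sobolev_norm ?m \<Omega> \<phi>
       \<and> cmod (vfun_dist \<Omega> (Z (n k)) \<phi> $ r - T0 \<Omega> v C f A1 F A5 (Z (n k)) \<phi> $ r) \<le> D k * sobolev_norm ?m \<Omega> \<phi>)
     \<and> cmod (LINT \<xi>|lborel. \<zeta> r \<xi> * inv_fourier \<phi> \<xi>) \<le> E * sobolev_norm ?m \<Omega> \<phi>)"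
  have "\<exists>D E. ?Q r D E" for r
    using mollified_limit.convergence_rate[OF L[of r]] by (simp only: vfun_pairing[OF Zb] T0_eq[OF Zb] cong: imp_cong)
  \<comment> \<open>The rates depend on the component r; choice collects them into functions of r,
    and the sum \<open>d\<close> below dominates all of them.\<close>
  then have "\<forall>r. \<exists>D E. ?Q r D E" by (rule allI)
  from choice[OF this] obtain D where "\<forall>r. \<exists>E. ?Q r (D r) E" by (rule exE)
  from choice[OF this] obtain E where DE: "\<forall>r. ?Q r (D r) (E r)" by (rule exE)
  have D: "\<And>r. D r \<longlonglongrightarrow> 0" "\<And>r k. 0 \<le> D r k" and E: "\<And>r. 0 \<le> E r"
    using DE by blast+
  have D1: "\<And>\<phi> r k. test_fun \<Omega> \<phi> \<Longrightarrow>
      cmod (vfun_dist \<Omega> (Z (n k)) \<phi> $ r - (LINT \<xi>|lborel. \<zeta> r \<xi> * inv_fourier \<phi> \<xi>)) \<le> D r k * sobolev_norm ?m \<Omega> \<phi>"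
    and D2: "\<And>\<phi> r k. test_fun \<Omega> \<phi> \<Longrightarrow>
      cmod (vfun_dist \<Omega> (Z (n k)) \<phi> $ r - T0 \<Omega> v C f A1 F A5 (Z (n k)) \<phi> $ r) \<le> D r k * sobolev_norm ?m \<Omega> \<phi>"
    and E1: "\<And>\<phi> r. test_fun \<Omega> \<phi> \<Longrightarrow> cmod (LINT \<xi>|lborel. \<zeta> r \<xi> * inv_fourier \<phi> \<xi>) \<le> E r * sobolev_norm ?m \<Omega> \<phi>"
    using DE by blast+
  have s0: "sobolev_norm ?m \<Omega> \<phi> \<ge> 0" for \<phi>
    unfolding sobolev_norm_def set_lebesgue_integral_def by (intro real_sqrt_ge_zero integral_nonneg_AE AE_I2) (simp add: sum_nonneg)
  define d where "d k = (\<Sum>r\<in>UNIV. D r k)" for k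
  have d: "d \<longlonglongrightarrow> 0" "\<And>k. 0 \<le> d k"
    unfolding d_def[abs_def] using D by (auto intro!: tendsto_null_sum sum_nonneg)
  have Dd: "D r k * sobolev_norm ?m \<Omega> \<phi> \<le> d k * sobolev_norm ?m \<Omega> \<phi>" for r k \<phi>
    unfolding d_def by (intro mult_right_mono s0 member_le_sum) (simp_all add: D(2))
  define Zs :: "'m idx vdist" where "Zs \<phi> = (\<chi> r. LINT \<xi>|lborel. \<zeta> r \<xi> * inv_fourier \<phi> \<xi>)" for \<phi>
  have \<zeta>i: "integrable lborel (\<lambda>\<xi>. \<zeta> r \<xi> * inv_fourier \<phi> \<xi>)" if "test_fun \<Omega> \<phi>" for r \<phi>
    by (rule pairing_integrable[OF that mollified_limit.weighted_Kz[OF L[of r] mollified_limit.\<zeta>_measurable[OF L[of r]] mollified_limit.\<zeta>_bound[OF L[of r]]]])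
  have "in_neg_sobolev ?m \<Omega> Zs"
    unfolding in_neg_sobolev_def
  proof (intro conjI allI impI)
    fix \<phi> \<eta> assume t: "test_fun \<Omega> \<phi> \<and> test_fun \<Omega> \<eta>"
    have "(LINT \<xi>|lborel. \<zeta> r \<xi> * inv_fourier (\<lambda>X. \<phi> X + \<eta> X) \<xi>)
       = (LINT \<xi>|lborel. \<zeta> r \<xi> * inv_fourier \<phi> \<xi>) + (LINT \<xi>|lborel. \<zeta> r \<xi> * inv_fourier \<eta> \<xi>)" for r
      unfolding inv_fourier_add[OF test_fun_integrable test_fun_integrable, OF conjunct1[OF t] conjunct2[OF t]] distrib_left
      by (intro Bochner_Integration.integral_add \<zeta>i conjunct1[OF t] conjunct2[OF t])
    then show "Zs (\<lambda>X. \<phi> X + \<eta> X) = Zs \<phi> + Zs \<eta>" unfolding Zs_def by (simp add: vec_eq_iff)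
  next
    fix k \<phi>
    show "Zs (\<lambda>X. k * \<phi> X) = k *s Zs \<phi>"
      unfolding Zs_def inv_fourier_cmult mult.left_commute[of _ k] integral_mult_right_zero by (simp add: vec_eq_iff)
  next
    have "neg_norm ?m \<Omega> Zs \<le> ennreal (\<Sum>r\<in>UNIV. E r)"
    proof (rule neg_norm_le)
      show "0 \<le> (\<Sum>r\<in>UNIV. E r)" by (intro sum_nonneg E)
      fix \<phi> r assume t: "test_fun \<Omega> \<phi>"
      have "cmod (Zs \<phi> $ r) \<le> E r * sobolev_norm ?m \<Omega> \<phi>" unfolding Zs_def vec_lambda_beta by (rule E1[OF t])
      also have "\<dots> \<le> (\<Sum>r\<in>UNIV. E r) * sobolev_norm ?m \<Omega> \<phi>"
        by (intro mult_right_mono s0 member_le_sum) (simp_all add: E)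
      finally show "cmod (Zs \<phi> $ r) \<le> (\<Sum>r\<in>UNIV. E r) * sobolev_norm ?m \<Omega> \<phi>" .
    qed
    then show "neg_norm ?m \<Omega> Zs < \<infinity>" by (rule le_less_trans) simp
  qed
  moreover have "(\<lambda>k. neg_norm ?m \<Omega> (\<lambda>\<phi>. vfun_dist \<Omega> (Z (n k)) \<phi> - Zs \<phi>)) \<longlonglongrightarrow> 0"
  proof (rule neg_norm_tendsto_zero[OF d])
    show "cmod ((vfun_dist \<Omega> (Z (n k)) \<phi> - Zs \<phi>) $ r) \<le> d k * sobolev_norm ?m \<Omega> \<phi>" if "test_fun \<Omega> \<phi>" for k \<phi> r
      unfolding vector_minus_component Zs_def vec_lambda_beta by (rule order_trans[OF D1[OF that] Dd])
  qed
  moreover have "(\<lambda>k. neg_norm ?m \<Omega> (\<lambda>\<phi>. vfun_dist \<Omega> (Z (n k)) \<phi> - T0 \<Omega> v C f A1 F A5 (Z (n k)) \<phi>)) \<longlonglongrightarrow> 0"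
  proof (rule neg_norm_tendsto_zero[OF d])
    show "cmod ((vfun_dist \<Omega> (Z (n k)) \<phi> - T0 \<Omega> v C f A1 F A5 (Z (n k)) \<phi>) $ r) \<le> d k * sobolev_norm ?m \<Omega> \<phi>" if "test_fun \<Omega> \<phi>" for k \<phi> r
      unfolding vector_minus_component by (rule order_trans[OF D2[OF that] Dd])
  qed
  moreover have "Linf_norm \<Omega> h \<le> ereal M"
    if h: "loc_integrable \<Omega> h" "\<And>\<phi>. test_fun \<Omega> \<phi> \<Longrightarrow> Zs \<phi> = vfun_dist \<Omega> h \<phi>" for h
  proof (rule Linf_norm_le_of_tests[OF dom(1) h(1)])
    fix \<phi> i assume t: "test_fun \<Omega> \<phi>"
    have "(\<lambda>k. vfun_dist \<Omega> (Z (n k)) \<phi> $ i) \<longlonglongrightarrow> Zs \<phi> $ i"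
      unfolding vfun_pairing[OF Zb t] Zs_def vec_lambda_beta by (rule mollified_limit.\<zeta>_pairing_tendsto[OF L t])
    then have "cmod (Zs \<phi> $ i) \<le> M * (LINT X:\<Omega>|lborel. cmod (\<phi> X))"
      by (rule LIMSEQ_le_const2[OF tendsto_norm]) (use vfun_dist_bound[OF Zb less_imp_le[OF M] t] in blast)
    then show "cmod (vfun_dist \<Omega> h \<phi> $ i) \<le> M * (LINT X:\<Omega>|lborel. cmod (\<phi> X))" unfolding h(2)[OF t] .
  qed
  ultimately show ?thesis using n by blast
qed

text \<open>Convergence almost everywhere identifies every limit with its value at the limit
  function: A_5 through uniqueness of the boundary equation, both transforms through dominated
  convergence. The subsequence is taken for A_5 alone.\<close>

lemma Linf_solution:
  assumes \<epsilon>: "\<And>k. \<epsilon> k > 0" "\<epsilon> \<longlonglongrightarrow> 0" and M: "M > 0"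
    and Z: "\<And>k. Z k \<in> Omega_ball \<Omega> M" "\<And>k. fixed_T0_eps \<Omega> v C f A1 F A5 (\<epsilon> k) (Z k)"
    and conv: "AE X in lborel. X \<in> closure \<Omega> \<longrightarrow> convergent (\<lambda>k. Z k X)"
  shows "\<exists>Zs\<in>bounded_class M. \<forall>\<phi>. test_fun \<Omega> \<phi> \<longrightarrow> vfun_dist \<Omega> Zs \<phi> = T0 \<Omega> v C f A1 F A5 Zs \<phi>"
proof -
  have Zb: "Z k \<in> bounded_class M" for k using Z(1) Omega_ball_subset by blast
  let ?N = "restrict_space lborel (closure \<Omega>)"
  \<comment> \<open>The default 0 off the set of convergence makes the limit measurable and bounded
    by M at every point of the closure, as \<open>bounded_class\<close> demands.\<close>
  define Zs where "Zs X = (if Cauchy (\<lambda>k. Z k X) then lim (\<lambda>k. Z k X) else 0)" for X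
  have Zl: "(\<lambda>k. Z k X) \<longlonglongrightarrow> Zs X" if "convergent (\<lambda>k. Z k X)" for X
    using that convergent_Cauchy[OF that] unfolding Zs_def convergent_LIMSEQ_iff by simp
  have Zs: "Zs \<in> bounded_class M"
    unfolding bounded_class_def
  proof (intro CollectI conjI ballI allI)
    note m = bounded_class_measurable[OF Zb]
    show "Zs \<in> borel_measurable ?N"
      unfolding Zs_def[abs_def] by (intro measurable_If borel_measurable_lim_metric sets_Collect_Cauchy m) simp_all
    fix X i assume X: "X \<in> closure \<Omega>"
    show "\<bar>Zs X $ i\<bar> \<le> M"
    proof (cases "Cauchy (\<lambda>k. Z k X)")
      case True
      then have "(\<lambda>k. \<bar>Z k X $ i\<bar>) \<longlonglongrightarrow> \<bar>Zs X $ i\<bar>"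
        by (intro tendsto_intros Zl) (simp add: Cauchy_convergent_iff)
      then show ?thesis by (rule LIMSEQ_le_const2) (use bounded_class_bound[OF Zb X] in blast)
    next
      case False
      then show ?thesis using M by (simp add: Zs_def)
    qed
  qed
  obtain B c r where B: "\<And>n P. P \<in> frontier \<Omega> \<Longrightarrow> norm (A5 (Z n) P) \<le> B" and c: "continuous_on (frontier \<Omega>) c"
    and r: "strict_mono (r :: nat \<Rightarrow> nat)"
    and u: "\<forall>e>0. \<exists>N. \<forall>n P. n \<ge> N \<and> P \<in> frontier \<Omega> \<longrightarrow> norm (A5 (Z (r n)) P - c P) < e"
    using A5_subsequence[of Z M] Zb by blast
  have lim: "AE X in lborel. X \<in> closure \<Omega> \<longrightarrow> (\<lambda>n. Z (r n) X) \<longlonglongrightarrow> Zs X"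
    using conv
  proof eventually_elim
    fix X assume "X \<in> closure \<Omega> \<longrightarrow> convergent (\<lambda>k. Z k X)"
    then show "X \<in> closure \<Omega> \<longrightarrow> (\<lambda>n. Z (r n) X) \<longlonglongrightarrow> Zs X"
      using LIMSEQ_subseq_LIMSEQ[OF Zl r] by (simp add: o_def)
  qed
  have A5l: "(\<lambda>n. A5 (Z (r n)) P) \<longlonglongrightarrow> A5 Zs P" if P: "P \<in> frontier \<Omega>" for P
  proof -
    have "(\<lambda>n. A5 (Z (r n)) P) \<longlonglongrightarrow> c P" unfolding LIMSEQ_iff using u P by blast
    then show ?thesis using A5_limit[OF Zb Zs lim c u P] by simp
  qed
  obtain R where R: "\<And>h X. cut h X \<noteq> 0 \<Longrightarrow> norm X \<le> R" using cut_support by blast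
  have cut_AE: "AE X in lborel. (\<lambda>n. cut (h (Z (r n))) X) \<longlonglongrightarrow> cut (h Zs) X"
    if h: "\<And>X. X \<in> closure \<Omega> \<Longrightarrow> (\<lambda>n. Z (r n) X) \<longlonglongrightarrow> Zs X \<Longrightarrow> (\<lambda>n. h (Z (r n)) X) \<longlonglongrightarrow> h Zs X" for h :: "'m Zfun \<Rightarrow> R3 \<Rightarrow> real"
    using lim by eventually_elim (rule cut_tendsto[OF h])
  have \<zeta>l: "(\<lambda>n. fourier (cut (\<lambda>X. Z (r n) X $ i)) \<xi>) \<longlonglongrightarrow> fourier (cut (\<lambda>X. Zs X $ i)) \<xi>" for i \<xi>
    by (rule fourier_tendsto_AE[OF component_cut(1)[OF Zb] component_cut(1)[OF Zs] component_cut(2)[OF Zb] R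
          cut_AE[of "\<lambda>Z X. Z X $ i"]]) (auto intro: tendsto_vec_nth)
  obtain K where K: "K \<ge> 0" "\<And>Z X l. Z \<in> bounded_class M \<Longrightarrow> X \<in> closure \<Omega> \<Longrightarrow> \<bar>psi f C Z X $ l\<bar> \<le> K"
    using psi_bounded by blast
  have gl: "(\<lambda>n. fourier (psi_cut \<Omega> f C (Z (r n)) l) \<xi>) \<longlonglongrightarrow> fourier (psi_cut \<Omega> f C Zs l) \<xi>" for l \<xi>
    unfolding psi_cut_eq
    by (rule fourier_tendsto_AE[OF measurable_cut[OF psi_measurable[OF Zb]] measurable_cut[OF psi_measurable[OF Zs]]
          cut_bound[OF K(2)[OF Zb] K(1)] R cut_AE[of "\<lambda>Z X. psi f C Z X $ l"]]) (auto intro: psi_tendsto)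
  have ql: "(\<lambda>n. solution_symbol (Z (r n)) i \<xi>) \<longlonglongrightarrow> solution_symbol Zs i \<xi>" for i \<xi>
    unfolding solution_symbol_def[of Zs]
    by (rule solution_symbol_tendsto[OF Zb B A5_continuous[OF Zs] A5l gl])
  have \<epsilon>r: "(\<lambda>n. \<epsilon> (r n)) \<longlonglongrightarrow> 0" using LIMSEQ_subseq_LIMSEQ[OF \<epsilon>(2) r] by (simp add: o_def)
  obtain W where L: "\<And>i. mollified_limit \<Omega> (a + 3) (boundary_symbol i) (solution_symbol Zs i) (fourier (cut (\<lambda>X. Zs X $ i)))
      (\<lambda>n. solution_symbol (Z (r n)) i) (\<lambda>n. fourier (cut (\<lambda>X. Z (r n) X $ i))) (W i) (\<bar>M\<bar> * measure lborel (closure \<Omega>)) (\<lambda>n. \<epsilon> (r n))"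
    using fixed_points_mollified_limit[OF \<epsilon>(1) \<epsilon>r Zb Z(2) B ql \<zeta>l] by blast
  have "vfun_dist \<Omega> Zs \<phi> $ i = T0 \<Omega> v C f A1 F A5 Zs \<phi> $ i" if t: "test_fun \<Omega> \<phi>" for \<phi> i
    unfolding vfun_pairing[OF Zs t] T0_eq[OF Zs t] by (rule mollified_limit.limit_equation[OF L t])
  then show ?thesis using Zs by (intro bexI[of _ Zs]) (simp_all add: vec_eq_iff)
qed

end

theorem theorem4p2:
  fixes \<Omega> :: "R3 set" and \<alpha> M :: real
    and v :: "'m::finite enum10" and C :: "real^('m idx)^'m" and f :: "'m rhs"
    and A1 F g02 :: "R3 \<Rightarrow> real^'m" and A5 :: "'m Zfun \<Rightarrow> R3 \<Rightarrow> real^'m"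
    and a1 :: poly3 and Np :: "poly3^('m idx)^('m idx)" and Lp :: "poly3^'m^('m idx)"
    and a m1 :: nat
  assumes domain: "open \<Omega>" "connected \<Omega>" "\<Omega> \<noteq> {}" "bounded \<Omega>"
    and boundary: "0 < \<alpha>" "\<alpha> \<le> 1" "C1_alpha_boundary \<alpha> \<Omega>"
    and convex: "convex (closure \<Omega>)"
    and v: "bij v"
    and f: "continuous_on (UNIV \<times> closure \<Omega>) (\<lambda>(z, X). f z X)"
    and C: "admissible v C a1 Np Lp"
    and a: "a = max_degree Np Lp" and m1: "m1 = 6 + 2 * a"
    and A1: "Ck_boundary 2 \<Omega> A1"
    and F: "Ck_extension 1 \<Omega> A1 F"
    and g02: "is_g02 \<Omega> A1 g02" "Ck_boundary 1 \<Omega> g02"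
    and A5: "\<And>Z. Linf_fun (closure \<Omega>) Z \<Longrightarrow> solves_A5 \<Omega> v f g02 Z (A5 Z)"
    and A5_unique: "\<And>Z A P. Linf_fun (closure \<Omega>) Z \<Longrightarrow> solves_A5 \<Omega> v f g02 Z A \<Longrightarrow>
                      P \<in> frontier \<Omega> \<Longrightarrow> A P = A5 Z P"
    and M: "M > 0"
  shows
    "(\<forall>\<epsilon> Z. (\<forall>k::nat. \<epsilon> k > 0) \<and> \<epsilon> \<longlonglongrightarrow> 0 \<and> (\<forall>k. Z k \<in> Omega_ball \<Omega> M) \<and>
         (\<forall>k. fixed_T0_eps \<Omega> v C f A1 F A5 (\<epsilon> k) (Z k)) \<longrightarrow>
       (\<exists>(n :: nat \<Rightarrow> nat) Zs. strict_mono n \<and> in_neg_sobolev m1 \<Omega> Zs \<and>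
          (\<lambda>k. neg_norm m1 \<Omega> (\<lambda>\<phi>. vfun_dist \<Omega> (Z (n k)) \<phi> - Zs \<phi>)) \<longlonglongrightarrow> 0 \<and>
          (\<lambda>k. neg_norm m1 \<Omega>
                 (\<lambda>\<phi>. vfun_dist \<Omega> (Z (n k)) \<phi> - T0 \<Omega> v C f A1 F A5 (Z (n k)) \<phi>)) \<longlonglongrightarrow> 0 \<and>
          (\<forall>g. loc_integrable \<Omega> g \<and> (\<forall>\<phi>. test_fun \<Omega> \<phi> \<longrightarrow> Zs \<phi> = vfun_dist \<Omega> g \<phi>) \<longrightarrow>
               Linf_norm \<Omega> g \<le> ereal M)))
     \<and>
     ((\<exists>\<epsilon> Z. (\<forall>k::nat. \<epsilon> k > 0) \<and> (\<forall>k. Z k \<in> Omega_ball \<Omega> M) \<and>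
         (\<forall>k. fixed_T0_eps \<Omega> v C f A1 F A5 (\<epsilon> k) (Z k)) \<and> \<epsilon> \<longlonglongrightarrow> 0 \<and>
         (AE X in lborel. X \<in> closure \<Omega> \<longrightarrow> convergent (\<lambda>k. Z k X))) \<longrightarrow>
       (\<exists>Zs. Linf_fun (closure \<Omega>) Zs \<and> Linf_norm (closure \<Omega>) Zs \<le> ereal M \<and>
          (\<forall>\<phi>. test_fun \<Omega> \<phi> \<longrightarrow> vfun_dist \<Omega> Zs \<phi> = T0 \<Omega> v C f A1 F A5 Zs \<phi>)))"
proof -
  interpret elliptic_problem \<Omega> \<alpha> v C f g02 A5 A1 F a
    by unfold_locales
      (use domain boundary convex f g02 A5 A5_unique F C a in \<open>auto simp: admissible_def Let_def\<close>)
  \<comment> \<open>Twice the weight exponent a + 3, as in the decay estimate for test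
    functions.\<close>
  have m: "m1 = 2 * (a + 3)" using m1 by simp
  show ?thesis
  proof (intro conjI allI impI)
    fix \<epsilon> :: "nat \<Rightarrow> real" and Z :: "nat \<Rightarrow> 'm Zfun"
    assume h: "(\<forall>k. \<epsilon> k > 0) \<and> \<epsilon> \<longlonglongrightarrow> 0 \<and> (\<forall>k. Z k \<in> Omega_ball \<Omega> M) \<and>
      (\<forall>k. fixed_T0_eps \<Omega> v C f A1 F A5 (\<epsilon> k) (Z k))"
    show "\<exists>(n :: nat \<Rightarrow> nat) Zs. strict_mono n \<and> in_neg_sobolev m1 \<Omega> Zs \<and>
          (\<lambda>k. neg_norm m1 \<Omega> (\<lambda>\<phi>. vfun_dist \<Omega> (Z (n k)) \<phi> - Zs \<phi>)) \<longlonglongrightarrow> 0 \<and>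
          (\<lambda>k. neg_norm m1 \<Omega>
                 (\<lambda>\<phi>. vfun_dist \<Omega> (Z (n k)) \<phi> - T0 \<Omega> v C f A1 F A5 (Z (n k)) \<phi>)) \<longlonglongrightarrow> 0 \<and>
          (\<forall>g. loc_integrable \<Omega> g \<and> (\<forall>\<phi>. test_fun \<Omega> \<phi> \<longrightarrow> Zs \<phi> = vfun_dist \<Omega> g \<phi>) \<longrightarrow>
               Linf_norm \<Omega> g \<le> ereal M)"
      unfolding m by (rule strong_solution[of \<epsilon> M Z]) (use h M in auto)
  next
    assume "\<exists>\<epsilon> Z. (\<forall>k::nat. \<epsilon> k > 0) \<and> (\<forall>k. Z k \<in> Omega_ball \<Omega> M) \<and>
         (\<forall>k. fixed_T0_eps \<Omega> v C f A1 F A5 (\<epsilon> k) (Z k)) \<and> \<epsilon> \<longlonglongrightarrow> 0 \<and>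
         (AE X in lborel. X \<in> closure \<Omega> \<longrightarrow> convergent (\<lambda>k. Z k X))"
    then obtain \<epsilon> Z where h: "\<And>k::nat. \<epsilon> k > 0" "\<And>k. Z k \<in> Omega_ball \<Omega> M"
      "\<And>k. fixed_T0_eps \<Omega> v C f A1 F A5 (\<epsilon> k) (Z k)" "\<epsilon> \<longlonglongrightarrow> 0"
      "AE X in lborel. X \<in> closure \<Omega> \<longrightarrow> convergent (\<lambda>k. Z k X)"
      by blast
    from Linf_solution[OF h(1,4) M h(2,3,5)]
    obtain Zs where "Zs \<in> bounded_class M" "\<forall>\<phi>. test_fun \<Omega> \<phi> \<longrightarrow> vfun_dist \<Omega> Zs \<phi> = T0 \<Omega> v C f A1 F A5 Zs \<phi>"
      by blast
    then show "\<exists>Zs. Linf_fun (closure \<Omega>) Zs \<and> Linf_norm (closure \<Omega>) Zs \<le> ereal M \<and>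
          (\<forall>\<phi>. test_fun \<Omega> \<phi> \<longrightarrow> vfun_dist \<Omega> Zs \<phi> = T0 \<Omega> v C f A1 F A5 Zs \<phi>)"
      using bounded_class_Linf_fun bounded_class_Linf_norm by blast
  qed
qed

end
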